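(* Let $F$ be a number field with absolute discriminant $\Delta_F$, and let $\Lambda$ be a rank $n$ semi-stable $\mathcal O_F$-lattice. (i) If $\deg(\Lambda)\le-[F:\mathbb Q]\cdot\frac{n\log n}{2}$, then $$h^0(F,\Lambda)\le\frac{3^{n[F:\mathbb Q]}}{1-\frac{\log3}{\pi}}\cdot\exp\Big(-\pi[F:\mathbb Q]\cdot e^{-\frac{2\deg(\Lambda)}{n[F:\mathbb Q]}}\Big).$$ (ii) If $\deg(\Lambda)\ge[F:\mathbb Q]\cdot\frac{n\log n}{2}+n\log\Delta_F$, then $$h^1(F,\Lambda)\le\frac{3^{n[F:\mathbb Q]}}{1-\frac{\log3}{\pi}}\cdot\exp\Big(-\pi[F:\mathbb Q]\cdot\Delta_F^{-\frac{2}{[F:\mathbb Q]}}\cdot e^{\frac{2\deg(\Lambda)}{n[F:\mathbb Q]}}\Big).$$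
   Context: An $\mathcal O_F$-lattice of rank $n$ is a projective $\mathcal O_F$-module $\Lambda$ of rank $n$ together with, for every infinite place $v$ of $F$, a positive definite inner product $\langle\cdot,\cdot\rangle_v$ (Hermitian for $v$ complex) on $\Lambda\otimes_{\mathcal O_F}F_v$. Let $N_v=[F_v:\mathbb R]$, $V_\Lambda=\prod_{v\mid\infty}\Lambda\otimes_{\mathcal O_F}F_v$, and $\|x\|_\Lambda^2=\sum_{v\mid\infty}N_v\langle x_v,x_v\rangle_v$ for $x\in V_\Lambda$. $H^0(F,\Lambda)=\Lambda$ and $H^1(F,\Lambda)=V_\Lambda/\Lambda$. Degree: for any $e_1,\dots,e_n\in\Lambda$ linearly independent over $F$, $\deg(\Lambda)=\log\#\big(\Lambda/\sum_i\mathcal O_Fe_i\big)-\frac12\sum_{v\mid\infty}N_v\log\det(\langle e_i,e_j\rangle_v)_{i,j}$ (independent of the choice). $\Delta_F$ is the absolute value of the discriminant of $F$. $\Lambda$ is semi-stable if for every nonzero $\mathcal O_F$-sublattice $\Lambda'\subset\Lambda$ (an $\mathcal O_F$-submodule with the induced metrics), $\deg(\Lambda')/\mathrm{rank}(\Lambda')\le\deg(\Lambda)/\mathrm{rank}(\Lambda)$. $\Lambda^\vee=\mathrm{Hom}_{\mathcal O_F}(\Lambda,\mathcal O_F)$ with dual metrics; $\omega_F$ is the inverse different $\{x\in F:\mathrm{Tr}_{F/\mathbb Q}(x\mathcal O_F)\subset\mathbb Z\}$ with the standard metric (usual absolute value on each $F_v$). The trace pairing identifies $\omega_F\otimes\Lambda^\vee=\mathrm{Hom}_{\mathcal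 O_F}(\Lambda,\omega_F)$ with the Pontrjagin dual of $V_\Lambda/\Lambda$: $\xi$ gives the character $z\mapsto\langle z,\xi\rangle=\exp\big(2\pi\sqrt{-1}\sum_{v\mid\infty}\mathrm{Tr}_{F_v/\mathbb R}(\xi_v(z_v))\big)$. Numerical cohomology: $$h^0(F,\Lambda)=\log\sum_{x\in\Lambda}e^{-\pi\|x\|_\Lambda^2},\qquad h^1(F,\Lambda)=\log\int_{V_\Lambda/\Lambda}\Big|\sum_{\xi\in\omega_F\otimes\Lambda^\vee}\langle z,\xi\rangle^{-1}e^{-\frac{\pi}{2}\|\xi\|_{\omega_F\otimes\Lambda^\vee}^2}\Big|^2dz,$$ where $dz$ is the Haar measure of total mass $1$ on $V_\Lambda/\Lambda$. *)

theory Defs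
  imports
    "HOL-Algebra.Algebra"
    "Jordan_Normal_Form.Determinant"
    "HOL-Analysis.Analysis"
begin

section \<open>Modules, base change and projectivity\<close>

text \<open>In all modules built below the ring fields \<^term>\<open>mult\<close> and \<^term>\<open>one\<close> of the
  record are irrelevant (the locale \<^locale>\<open>Module.module\<close> only uses the additive part).\<close>

definition linear_maps ::
    "'r ring \<Rightarrow> ('r, 'm) module \<Rightarrow> ('r, 'n) module \<Rightarrow> ('m \<Rightarrow> 'n) set" where
  "linear_maps R M N = {f \<in> carrier M \<rightarrow>\<^sub>E carrier N.
     (\<forall>x\<in>carrier M. \<forall>y\<in>carrier M. f (x \<oplus>\<^bsub>M\<^esub> y) = f x \<oplus>\<^bsub>N\<^esub> f y) \<and>
     (\<forall>r\<in>carrier R. \<forall>x\<in>carrier M. f (r \<odot>\<^bsub>M\<^esub> x) = r \<odot>\<^bsub>N\<^esub> f x)}"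

definition free_module :: "'r ring \<Rightarrow> nat \<Rightarrow> ('r, nat \<Rightarrow> 'r) module" where
  "free_module R k = \<lparr>carrier = {..<k} \<rightarrow>\<^sub>E carrier R, monoid.mult = undefined, one = undefined,
     ring.zero = (\<lambda>i\<in>{..<k}. \<zero>\<^bsub>R\<^esub>), ring.add = (\<lambda>f g. \<lambda>i\<in>{..<k}. f i \<oplus>\<^bsub>R\<^esub> g i),
     module.smult = (\<lambda>r f. \<lambda>i\<in>{..<k}. r \<otimes>\<^bsub>R\<^esub> f i)\<rparr>"

text \<open>Finitely generated projective, as a direct summand of some \<open>R\<^sup>k\<close>: the inclusion \<open>s\<close>
  and the projection \<open>p\<close> of the summand satisfy \<open>p \<circ> s = id\<close>.\<close>

definition fg_projective :: "'r ring \<Rightarrow> ('r, 'm) module \<Rightarrow> bool" where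
  "fg_projective R M \<longleftrightarrow> Module.module R M \<and>
     (\<exists>k. \<exists>s\<in>linear_maps R M (free_module R k). \<exists>p\<in>linear_maps R (free_module R k) M.
        \<forall>x\<in>carrier M. p (s x) = x)"

definition lin_indep :: "'r ring \<Rightarrow> ('r, 'm) module \<Rightarrow> 'm list \<Rightarrow> bool" where
  "lin_indep R M es \<longleftrightarrow>
     (\<forall>c\<in>{..<length es} \<rightarrow> carrier R.
        (\<Oplus>\<^bsub>M\<^esub>i\<in>{..<length es}. c i \<odot>\<^bsub>M\<^esub> es ! i) = \<zero>\<^bsub>M\<^esub> \<longrightarrow> (\<forall>i<length es. c i = \<zero>\<^bsub>R\<^esub>))"

definition lin_span :: "'r ring \<Rightarrow> ('r, 'm) module \<Rightarrow> 'm list \<Rightarrow> 'm set" where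
  "lin_span R M es =
     {(\<Oplus>\<^bsub>M\<^esub>i\<in>{..<length es}. c i \<odot>\<^bsub>M\<^esub> es ! i) | c. c \<in> {..<length es} \<rightarrow> carrier R}"

text \<open>The tensor product \<open>M \<otimes>\<^sub>R S\<close>, for \<open>S\<close> an \<open>R\<close>-algebra through \<open>\<phi>\<close>, is the free abelian
  group on \<open>M \<times> S\<close> modulo the usual relations; its elements are cosets of formal sums.\<close>

type_synonym ('m, 's) tensor = "(('m \<times> 's) \<Rightarrow>\<^sub>0 int) set"

definition tensor_relations ::
    "'r ring \<Rightarrow> 's ring \<Rightarrow> ('r \<Rightarrow> 's) \<Rightarrow> ('r, 'm) module \<Rightarrow> (('m \<times> 's) \<Rightarrow>\<^sub>0 int) set" where
  "tensor_relations R S \<phi> M =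
     {frag_of (x \<oplus>\<^bsub>M\<^esub> y, a) - frag_of (x, a) - frag_of (y, a) | x y a.
        x \<in> carrier M \<and> y \<in> carrier M \<and> a \<in> carrier S} \<union>
     {frag_of (x, a \<oplus>\<^bsub>S\<^esub> b) - frag_of (x, a) - frag_of (x, b) | x a b.
        x \<in> carrier M \<and> a \<in> carrier S \<and> b \<in> carrier S} \<union>
     {frag_of (r \<odot>\<^bsub>M\<^esub> x, a) - frag_of (x, \<phi> r \<otimes>\<^bsub>S\<^esub> a) | r x a.
        r \<in> carrier R \<and> x \<in> carrier M \<and> a \<in> carrier S}"

definition formal_tensors :: "'s ring \<Rightarrow> ('r, 'm) module \<Rightarrow> (('m \<times> 's) \<Rightarrow>\<^sub>0 int) monoid" where
  "formal_tensors S M = free_Abelian_group (carrier M \<times> carrier S)"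

definition tensor_kernel ::
    "'r ring \<Rightarrow> 's ring \<Rightarrow> ('r \<Rightarrow> 's) \<Rightarrow> ('r, 'm) module \<Rightarrow> ('m, 's) tensor" where
  "tensor_kernel R S \<phi> M = generate (formal_tensors S M) (tensor_relations R S \<phi> M)"

definition tensor_class ::
    "'r ring \<Rightarrow> 's ring \<Rightarrow> ('r \<Rightarrow> 's) \<Rightarrow> ('r, 'm) module \<Rightarrow> (('m \<times> 's) \<Rightarrow>\<^sub>0 int) \<Rightarrow> ('m, 's) tensor"
  where "tensor_class R S \<phi> M t = tensor_kernel R S \<phi> M #>\<^bsub>formal_tensors S M\<^esub> t"

definition pure_tensor ::
    "'r ring \<Rightarrow> 's ring \<Rightarrow> ('r \<Rightarrow> 's) \<Rightarrow> ('r, 'm) module \<Rightarrow> 'm \<Rightarrow> 's \<Rightarrow> ('m, 's) tensor" where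
  "pure_tensor R S \<phi> M x a = tensor_class R S \<phi> M (frag_of (x, a))"

text \<open>In the scalar multiplication \<open>s \<cdot> (x \<otimes> a) = x \<otimes> s a\<close> all members of the union below are
  the same coset.\<close>

definition base_change ::
    "'r ring \<Rightarrow> 's ring \<Rightarrow> ('r \<Rightarrow> 's) \<Rightarrow> ('r, 'm) module \<Rightarrow> ('s, ('m, 's) tensor) module" where
  "base_change R S \<phi> M =
     (let Q = formal_tensors S M Mod tensor_kernel R S \<phi> M in
      \<lparr>carrier = carrier Q, monoid.mult = undefined, one = undefined,
       ring.zero = \<one>\<^bsub>Q\<^esub>, ring.add = (\<otimes>\<^bsub>Q\<^esub>),
       module.smult = (\<lambda>s T. \<Union>t\<in>T.
          tensor_class R S \<phi> M (frag_extend (\<lambda>(x, a). frag_of (x, s \<otimes>\<^bsub>S\<^esub> a)) t))\<rparr>)"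


section \<open>Number fields\<close>

class number_field = field_char_0 +
  assumes finite_degree_over_rat:
    "\<exists>B. finite B \<and> (\<forall>x. \<exists>c :: 'a \<Rightarrow> rat. x = (\<Sum>b\<in>B. of_rat (c b) * b))"

definition rat_scale :: "rat \<Rightarrow> 'f::number_field \<Rightarrow> 'f" where
  "rat_scale q x = of_rat q * x"

definition field_degree :: "'f::number_field itself \<Rightarrow> nat" where
  "field_degree _ = vector_space.dim rat_scale (UNIV :: 'f set)"

text \<open>\<open>Tr\<^bsub>F/\<rat>\<^esub>(x)\<close> is the trace of the \<open>\<rat>\<close>-linear map \<open>y \<mapsto> x y\<close>, computed in some basis.\<close>

definition field_trace :: "'f::number_field \<Rightarrow> rat" where
  "field_trace x =
     (let B = (SOME B :: 'f set. \<not> Modules.module.dependent rat_scale B \<and>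
                 Modules.module.span rat_scale B = UNIV)
      in \<Sum>b\<in>B. Modules.module.representation rat_scale B (x * b) b)"

definition number_ring :: "'f::number_field ring" where
  "number_ring = \<lparr>carrier = UNIV, monoid.mult = (*), one = 1, ring.zero = 0, ring.add = (+)\<rparr>"

definition ring_of_integers :: "'f::number_field ring" where
  "ring_of_integers = number_ring\<lparr>carrier := {x. algebraic_int x}\<rparr>"

definition integral_basis :: "'f::number_field list \<Rightarrow> bool" where
  "integral_basis bs \<longleftrightarrow> set bs \<subseteq> carrier ring_of_integers \<and>
     (\<forall>x\<in>carrier ring_of_integers. \<exists>!c :: int list. length c = length bs \<and>
        x = (\<Sum>i<length bs. of_int (c ! i) * bs ! i))"

definition abs_discriminant :: "'f::number_field itself \<Rightarrow> real" where
  "abs_discriminant _ =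
     (let bs = (SOME bs :: 'f list. integral_basis bs); d = length bs
      in \<bar>real_of_rat (Determinant.det (Matrix.mat d d (\<lambda>(i, j). field_trace (bs ! i * bs ! j))))\<bar>)"

definition inverse_different :: "('f::number_field, 'f) module" where
  "inverse_different =
     \<lparr>carrier = {x. \<forall>y\<in>carrier ring_of_integers. field_trace (x * y) \<in> \<int>},
      monoid.mult = undefined, one = undefined, ring.zero = 0, ring.add = (+), module.smult = (*)\<rparr>"

text \<open>An infinite place is a pair of conjugate embeddings into \<open>\<complex>\<close> (a single one if it is real).
  For each place one of its embeddings is selected; it identifies the completion \<open>F\<^sub>v\<close> with \<open>\<real>\<close> or
  \<open>\<complex>\<close>, where \<open>\<real>\<close> is realised as a subset of the type \<^typ>\<open>complex\<close>.\<close>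

type_synonym 'f place = "('f \<Rightarrow> complex) set"

definition complex_embeddings :: "('f::number_field \<Rightarrow> complex) set" where
  "complex_embeddings =
     {\<sigma>. \<sigma> 1 = 1 \<and> (\<forall>x y. \<sigma> (x + y) = \<sigma> x + \<sigma> y) \<and> (\<forall>x y. \<sigma> (x * y) = \<sigma> x * \<sigma> y)}"

definition infinite_places :: "'f::number_field place set" where
  "infinite_places = (\<lambda>\<sigma>. {\<sigma>, cnj \<circ> \<sigma>}) ` complex_embeddings"

definition place_embedding :: "'f::number_field place \<Rightarrow> 'f \<Rightarrow> complex" where
  "place_embedding v = (SOME \<sigma>. \<sigma> \<in> v)"

definition real_place :: "'f::number_field place \<Rightarrow> bool" where
  "real_place v \<longleftrightarrow> range (place_embedding v) \<subseteq> \<real>"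

definition completion_ring :: "'f::number_field place \<Rightarrow> complex ring" where
  "completion_ring v = \<lparr>carrier = (if real_place v then \<real> else UNIV),
     monoid.mult = (*), one = 1, ring.zero = 0, ring.add = (+)\<rparr>"

definition local_degree :: "'f::number_field place \<Rightarrow> real" where
  "local_degree v = (if real_place v then 1 else 2)"

definition local_trace :: "'f::number_field place \<Rightarrow> complex \<Rightarrow> real" where
  "local_trace v a = (if real_place v then Re a else Re (a + cnj a))"


section \<open>Lattices over the ring of integers\<close>

type_synonym ('f, 'm) metrics = "'f place \<Rightarrow> ('m, complex) tensor \<Rightarrow> ('m, complex) tensor \<Rightarrow> complex"

text \<open>\<open>\<Lambda> \<otimes> F\<close> and \<open>\<Lambda> \<otimes> F\<^sub>v\<close>, with the canonical maps from \<open>\<Lambda>\<close>.\<close>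

definition generic_fibre :: "('f::number_field, 'm) module \<Rightarrow> ('f, ('m, 'f) tensor) module" where
  "generic_fibre \<Lambda> = base_change ring_of_integers number_ring id \<Lambda>"

definition to_generic_fibre :: "('f::number_field, 'm) module \<Rightarrow> 'm \<Rightarrow> ('m, 'f) tensor" where
  "to_generic_fibre \<Lambda> x = pure_tensor ring_of_integers number_ring id \<Lambda> x 1"

definition place_fibre ::
    "('f::number_field, 'm) module \<Rightarrow> 'f place \<Rightarrow> (complex, ('m, complex) tensor) module" where
  "place_fibre \<Lambda> v = base_change ring_of_integers (completion_ring v) (place_embedding v) \<Lambda>"

definition to_place_fibre ::
    "('f::number_field, 'm) module \<Rightarrow> 'f place \<Rightarrow> 'm \<Rightarrow> ('m, complex) tensor" where
  "to_place_fibre \<Lambda> v x =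
     pure_tensor ring_of_integers (completion_ring v) (place_embedding v) \<Lambda> x 1"

definition lin_indep_over_field ::
    "('f::number_field, 'm) module \<Rightarrow> 'm list \<Rightarrow> bool" where
  "lin_indep_over_field \<Lambda> es \<longleftrightarrow>
     lin_indep number_ring (generic_fibre \<Lambda>) (map (to_generic_fibre \<Lambda>) es)"

text \<open>Rank and degree are defined for submodules \<open>N\<close> of \<open>\<Lambda>\<close>, which carry the metrics induced
  from \<open>\<Lambda>\<close>; \<^term>\<open>N = carrier \<Lambda>\<close> gives \<open>\<Lambda>\<close> itself.\<close>

definition lattice_rank :: "('f::number_field, 'm) module \<Rightarrow> 'm set \<Rightarrow> nat" where
  "lattice_rank \<Lambda> N = Max {length es | es. set es \<subseteq> N \<and> lin_indep_over_field \<Lambda> es}"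

definition inner_product_on ::
    "complex ring \<Rightarrow> (complex, 'v) module \<Rightarrow> ('v \<Rightarrow> 'v \<Rightarrow> complex) \<Rightarrow> bool" where
  "inner_product_on K V g \<longleftrightarrow>
     (\<forall>x\<in>carrier V. \<forall>y\<in>carrier V. g x y \<in> carrier K) \<and>
     (\<forall>x\<in>carrier V. \<forall>y\<in>carrier V. \<forall>z\<in>carrier V. g (x \<oplus>\<^bsub>V\<^esub> y) z = g x z + g y z) \<and>
     (\<forall>a\<in>carrier K. \<forall>x\<in>carrier V. \<forall>y\<in>carrier V. g (a \<odot>\<^bsub>V\<^esub> x) y = a * g x y) \<and>
     (\<forall>x\<in>carrier V. \<forall>y\<in>carrier V. g y x = cnj (g x y)) \<and>
     (\<forall>x\<in>carrier V. x \<noteq> \<zero>\<^bsub>V\<^esub> \<longrightarrow> Re (g x x) > 0)"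

definition is_lattice :: "('f::number_field, 'm) module \<Rightarrow> ('f, 'm) metrics \<Rightarrow> bool" where
  "is_lattice \<Lambda> h \<longleftrightarrow> fg_projective ring_of_integers \<Lambda> \<and>
     (\<forall>v\<in>infinite_places. inner_product_on (completion_ring v) (place_fibre \<Lambda> v) (h v))"

definition degree_wrt ::
    "('f::number_field, 'm) module \<Rightarrow> ('f, 'm) metrics \<Rightarrow> 'm set \<Rightarrow> 'm list \<Rightarrow> real" where
  "degree_wrt \<Lambda> h N es =
     (let r = length es in
      ln (real (card (rcosets\<^bsub>add_monoid (\<Lambda>\<lparr>carrier := N\<rparr>)\<^esub> (lin_span ring_of_integers \<Lambda> es)))) -
      1 / 2 * (\<Sum>v\<in>infinite_places. local_degree v *
        ln (Re (Determinant.det (Matrix.mat r r (\<lambda>(i, j).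
          h v (to_place_fibre \<Lambda> v (es ! i)) (to_place_fibre \<Lambda> v (es ! j))))))))"

definition lattice_degree ::
    "('f::number_field, 'm) module \<Rightarrow> ('f, 'm) metrics \<Rightarrow> 'm set \<Rightarrow> real" where
  "lattice_degree \<Lambda> h N = degree_wrt \<Lambda> h N
     (SOME es. set es \<subseteq> N \<and> length es = lattice_rank \<Lambda> N \<and> lin_indep_over_field \<Lambda> es)"

definition semistable :: "('f::number_field, 'm) module \<Rightarrow> ('f, 'm) metrics \<Rightarrow> bool" where
  "semistable \<Lambda> h \<longleftrightarrow>
     (\<forall>N. Module.submodule N ring_of_integers \<Lambda> \<and> N \<noteq> {\<zero>\<^bsub>\<Lambda>\<^esub>} \<longrightarrow>
        lattice_degree \<Lambda> h N / lattice_rank \<Lambda> N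
          \<le> lattice_degree \<Lambda> h (carrier \<Lambda>) / lattice_rank \<Lambda> (carrier \<Lambda>))"


section \<open>The space \<open>V\<^sub>\<Lambda>\<close> and its quotient by \<open>\<Lambda>\<close>\<close>

definition lattice_space ::
    "('f::number_field, 'm) module \<Rightarrow> ('f place \<Rightarrow> ('m, complex) tensor) monoid" where
  "lattice_space \<Lambda> = product_group infinite_places (\<lambda>v. add_monoid (place_fibre \<Lambda> v))"

definition to_lattice_space ::
    "('f::number_field, 'm) module \<Rightarrow> 'm \<Rightarrow> 'f place \<Rightarrow> ('m, complex) tensor" where
  "to_lattice_space \<Lambda> x = (\<lambda>v\<in>infinite_places. to_place_fibre \<Lambda> v x)"

definition norm_sq ::
    "('f::number_field, 'm) metrics \<Rightarrow> ('f place \<Rightarrow> ('m, complex) tensor) \<Rightarrow> real" where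
  "norm_sq h x = (\<Sum>v\<in>infinite_places. local_degree v * Re (h v (x v) (x v)))"

definition lattice_space_topology ::
    "('f::number_field, 'm) module \<Rightarrow> ('f, 'm) metrics \<Rightarrow>
      ('f place \<Rightarrow> ('m, complex) tensor) topology" where
  "lattice_space_topology \<Lambda> h = Metric_space.mtopology (carrier (lattice_space \<Lambda>))
     (\<lambda>x y. sqrt (norm_sq h (x \<otimes>\<^bsub>lattice_space \<Lambda>\<^esub> inv\<^bsub>lattice_space \<Lambda>\<^esub> y)))"

definition quotient_space ::
    "('f::number_field, 'm) module \<Rightarrow> ('f place \<Rightarrow> ('m, complex) tensor) set monoid" where
  "quotient_space \<Lambda> = lattice_space \<Lambda> Mod (to_lattice_space \<Lambda> ` carrier \<Lambda>)"

text \<open>Points of the quotient are cosets, so \<open>\<Union>U\<close> is the preimage of \<open>U\<close> in \<open>V\<^sub>\<Lambda>\<close>.\<close>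

definition quotient_topology ::
    "('f::number_field, 'm) module \<Rightarrow> ('f, 'm) metrics \<Rightarrow>
      ('f place \<Rightarrow> ('m, complex) tensor) set topology" where
  "quotient_topology \<Lambda> h = topology (\<lambda>U. U \<subseteq> carrier (quotient_space \<Lambda>) \<and>
     openin (lattice_space_topology \<Lambda> h) (\<Union>U))"

definition haar_probability :: "'g monoid \<Rightarrow> 'g topology \<Rightarrow> 'g measure \<Rightarrow> bool" where
  "haar_probability G T \<mu> \<longleftrightarrow>
     space \<mu> = carrier G \<and>
     sets \<mu> = sigma_sets (carrier G) {U. openin T U} \<and>
     emeasure \<mu> (space \<mu>) = 1 \<and>
     (\<forall>g\<in>carrier G. \<forall>A\<in>sets \<mu>. emeasure \<mu> (g <#\<^bsub>G\<^esub> A) = emeasure \<mu> A)"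


section \<open>Duality\<close>

definition dual_lattice :: "('f::number_field, 'm) module \<Rightarrow> ('m \<Rightarrow> 'f) set" where
  "dual_lattice \<Lambda> = linear_maps ring_of_integers \<Lambda> inverse_different"

text \<open>The \<open>F\<^sub>v\<close>-linear extension \<open>\<xi>\<^sub>v\<close> of \<open>\<xi>\<close>, given by \<open>\<xi>\<^sub>v(x \<otimes> a) = \<xi>(x) a\<close>. A formal sum
  representing the tensor is chosen; the value does not depend on it.\<close>

definition extend_functional ::
    "'f::number_field place \<Rightarrow> ('m \<Rightarrow> 'f) \<Rightarrow> ('m, complex) tensor \<Rightarrow> complex" where
  "extend_functional v \<xi> T =
     (let t = (SOME t. t \<in> T)
      in \<Sum>(x, a)\<in>Poly_Mapping.keys t.
           of_int (Poly_Mapping.lookup t (x, a)) * (place_embedding v (\<xi> x) * a))"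

text \<open>Dual metric: \<open>\<xi>\<^sub>v = \<langle>\<cdot>, w\<rangle>\<^sub>v\<close> has the length of the vector \<open>w\<close>. Since \<open>\<omega>\<^sub>F\<close> carries the
  standard metric, this is also the metric of \<open>\<omega>\<^sub>F \<otimes> \<Lambda>\<^sup>\<or>\<close> at \<open>v\<close>.\<close>

definition riesz_vector ::
    "('f::number_field, 'm) module \<Rightarrow> ('f, 'm) metrics \<Rightarrow> 'f place \<Rightarrow> ('m \<Rightarrow> 'f) \<Rightarrow>
      ('m, complex) tensor" where
  "riesz_vector \<Lambda> h v \<xi> = (THE w. w \<in> carrier (place_fibre \<Lambda> v) \<and>
     (\<forall>x\<in>carrier (place_fibre \<Lambda> v). extend_functional v \<xi> x = h v x w))"

definition dual_norm_sq ::
    "('f::number_field, 'm) module \<Rightarrow> ('f, 'm) metrics \<Rightarrow> ('m \<Rightarrow> 'f) \<Rightarrow> real" where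
  "dual_norm_sq \<Lambda> h \<xi> = (\<Sum>v\<in>infinite_places.
     local_degree v * Re (h v (riesz_vector \<Lambda> h v \<xi>) (riesz_vector \<Lambda> h v \<xi>)))"

text \<open>The pairing of a coset \<open>Z \<in> V\<^sub>\<Lambda>/\<Lambda>\<close> with \<open>\<xi>\<close>, evaluated at any representative.\<close>

definition pairing ::
    "('f::number_field place \<Rightarrow> ('m, complex) tensor) set \<Rightarrow> ('m \<Rightarrow> 'f) \<Rightarrow> complex" where
  "pairing Z \<xi> =
     (let z = (SOME z. z \<in> Z)
      in exp (2 * of_real pi * \<i> * of_real (\<Sum>v\<in>infinite_places.
           local_trace v (extend_functional v \<xi> (z v)))))"


section \<open>Numerical cohomology\<close>

definition h0 :: "('f::number_field, 'm) module \<Rightarrow> ('f, 'm) metrics \<Rightarrow> real" where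
  "h0 \<Lambda> h = ln (\<Sum>\<^sub>\<infinity>x\<in>carrier \<Lambda>. exp (- pi * norm_sq h (to_lattice_space \<Lambda> x)))"

text \<open>The last argument is the normalised Haar measure of \<^term>\<open>quotient_space \<Lambda>\<close>.\<close>

definition h1 ::
    "('f::number_field, 'm) module \<Rightarrow> ('f, 'm) metrics \<Rightarrow>
      ('f place \<Rightarrow> ('m, complex) tensor) set measure \<Rightarrow> real" where
  "h1 \<Lambda> h dz = ln (LINT Z|dz.
     (cmod (\<Sum>\<^sub>\<infinity>\<xi>\<in>dual_lattice \<Lambda>.
        inverse (pairing Z \<xi>) * of_real (exp (- (pi / 2) * dual_norm_sq \<Lambda> h \<xi>))))\<^sup>2)"

end

theory Submission
  imports Defs "Jordan_Normal_Form.Char_Poly" "HOL-Computational_Algebra.Field_as_Ring" "HOL-Library.Function_Algebras"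
begin

text \<open>The first minimum of a semi-stable \<open>\<Lambda>\<close> is bounded below by comparing degrees: the line \<open>\<O> x\<close> has
  degree \<open>-\<Sum>\<^sub>v N\<^sub>v log \<parallel>x\<parallel>\<^sub>v\<close>, so semi-stability and AM--GM give
  \<open>\<parallel>x\<parallel>\<^sup>2 \<ge> d exp (- 2 deg \<Lambda> / (n d))\<close>. Applied to \<open>ker \<xi>\<close>, semi-stability bounds the dual norm of
  \<open>\<xi> \<in> Hom(\<Lambda>, \<omega>)\<close> in the same way; the discriminant enters as the index of \<open>\<O>\<close> in \<open>\<omega>\<close>. A packing argument
  bounds the number of lattice vectors of norm \<open>\<le> r\<close> by \<open>(1 + 2 r / \<lambda>)\<^sup>D\<close> with \<open>D = n d\<close>, and integrating against the
  Gaussian gives \<open>3\<^sup>D e\<^bsup>-\<pi>\<lambda>\<^sup>2\<^esup> \<pi> / (\<pi> - 1/2)\<close> as soon as \<open>\<lambda>\<^sup>2 \<ge> D\<close>, which is what the hypothesis on the degree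
  ensures. For \<open>h\<^sup>1\<close> one first applies Parseval on \<open>V/\<Lambda>\<close>.\<close>

section \<open>Embeddings of a number field\<close>

text \<open>The 3 comes from 1 + 2 r / \<lambda> \<le> 3 r / \<lambda> for r \<ge> \<lambda>. As D
  \<le> \<lambda>^2, the remaining growth (r / \<lambda>)^D is at most exp ((r^2 - \<lambda>^2) /
  2), which costs 1/2 in the exponent \<pi> and produces \<pi> / (\<pi> - 1/2); ln 3 \<ge> 1/2 then
  gives the stated constant. The zero vector contributes 1 to a theta series, and ln (1 + B) \<le>
  B. The terms of the series in \<open>h1\<close> have \<pi>/2 in the exponent, so after squaring
  both parts need the same estimate.

  The obstacle is that \<open>lattice_degree\<close> is computed from an arbitrary maximal
  independent family. One formula, \<open>degree_split\<close>, serves twice: with a coordinate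
  functional it shows that exchanging one vector preserves the degree of \<Lambda>, and with \<xi>
  it compares \<Lambda> with ker \<xi>, where the family chosen for the kernel is extended by one
  vector. Fibres are quotients of groups of formal sums; they are handled through coordinates, and
  tensors are told apart by extended functionals.\<close>

interpretation ratvs: vector_space "rat_scale :: rat \<Rightarrow> 'f::number_field \<Rightarrow> 'f"
  by unfold_locales (simp_all add: rat_scale_def algebra_simps of_rat_add of_rat_mult)

lemma ratvs_finite_span:
  obtains B :: "'f::number_field set" where "finite B" "ratvs.span B = UNIV"
proof -
  obtain B :: "'f set" where B: "finite B" "\<forall>x. \<exists>c. x = (\<Sum>b\<in>B. of_rat (c b) * b)"
    using finite_degree_over_rat by blast
  have "x \<in> ratvs.span B" for x
  proof -
    obtain c where "x = (\<Sum>b\<in>B. of_rat (c b) * b)" using B by blast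
    also have "\<dots> = (\<Sum>b\<in>B. rat_scale (c b) b)" by (simp add: rat_scale_def)
    also have "\<dots> \<in> ratvs.span B"
      by (intro ratvs.span_sum ratvs.span_scale ratvs.span_base)
    finally show ?thesis .
  qed
  then show ?thesis using B that by blast
qed

lemma ratvs_finite_independent: "\<not> ratvs.dependent B \<Longrightarrow> finite (B :: 'f::number_field set)"
proof -
  obtain C :: "'f set" where C: "finite C" "ratvs.span C = UNIV" using ratvs_finite_span .
  assume "\<not> ratvs.dependent B"
  then show "finite B" using ratvs.independent_span_bound[OF C(1), of B] C by auto
qed

text \<open>\<open>field_trace\<close> makes the same choice, so its value is the trace computed in
  this basis by unfolding alone.\<close>

definition rat_basis :: "'f::number_field set" where
  "rat_basis = (SOME B. \<not> ratvs.dependent B \<and> ratvs.span B = UNIV)"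

lemma rat_basis: "\<not> ratvs.dependent (rat_basis :: 'f::number_field set)"
  "ratvs.span (rat_basis :: 'f set) = UNIV"
proof -
  have "\<exists>B :: 'f set. \<not> ratvs.dependent B \<and> ratvs.span B = UNIV"
    using ratvs.maximal_independent_subset[of UNIV] by (metis top.extremum_unique)
  then show "\<not> ratvs.dependent (rat_basis :: 'f set)" "ratvs.span (rat_basis :: 'f set) = UNIV"
    unfolding rat_basis_def by (metis (mono_tags, lifting) someI_ex)+
qed

lemma finite_rat_basis: "finite (rat_basis :: 'f::number_field set)"
  by (rule ratvs_finite_independent[OF rat_basis(1)])

lemma card_rat_basis: "card (rat_basis :: 'f::number_field set) = field_degree TYPE('f)"
  unfolding field_degree_def by (rule ratvs.basis_card_eq_dim) (auto simp: rat_basis)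

interpretation ratvs: finite_dimensional_vector_space
  "rat_scale :: rat \<Rightarrow> 'f::number_field \<Rightarrow> 'f" rat_basis
  by unfold_locales (auto simp: rat_basis finite_rat_basis)

text \<open>The complex vector space of \<rat>-linear maps from F to \<complex>. The embeddings turn
  out to be a basis of it, which yields both their number and the trace formula.\<close>

definition qlinear :: "('f::number_field \<Rightarrow> complex) \<Rightarrow> bool" where
  "qlinear f \<longleftrightarrow> (\<forall>x y. f (x + y) = f x + f y) \<and> (\<forall>q x. f (of_rat q * x) = of_rat q * f x)"

lemma qlinearD: "qlinear f \<Longrightarrow> f (x + y) = f x + f y" "qlinear f \<Longrightarrow> f (of_rat q * x) = of_rat q * f x"
  by (auto simp: qlinear_def)

lemma qlinear_0: "qlinear f \<Longrightarrow> f 0 = 0"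
  using qlinearD(2)[of f 0 0] by simp

lemma qlinear_sum: "qlinear f \<Longrightarrow> f (sum g A) = (\<Sum>a\<in>A. f (g a))"
  by (induction A rule: infinite_finite_induct) (auto simp: qlinear_0 qlinearD)

text \<open>The operator \<open>\<Prod>(b - r)\<close> over the roots \<open>r\<close> in a list, acting on functions by \<open>(b f)(y) = f (b y)\<close>.\<close>

primrec root_op :: "'f::number_field \<Rightarrow> complex list \<Rightarrow> ('f \<Rightarrow> complex) \<Rightarrow> 'f \<Rightarrow> complex" where
  "root_op b [] f = f"
| "root_op b (r # rs) f = root_op b rs (\<lambda>y. f (b * y) - r * f y)"

text \<open>Translates between operators and polynomials: if the product of the linear factors is
  proportional to a rational polynomial vanishing at b, then the operator kills every \<rat>-linear
  f.\<close>

lemma root_op_eq: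
  "root_op b rs f y = (\<Sum>i\<le>length rs. poly.coeff (\<Prod>r\<leftarrow>rs. [:-r, 1:]) i * f (b ^ i * y))"
proof (induction rs arbitrary: f)
  case (Cons r rs)
  define P where "P = (\<Prod>r\<leftarrow>rs. [:-r, 1:])"
  define n where "n = length rs"
  have deg: "Polynomial.degree P \<le> n"
    unfolding P_def n_def by (induction rs) (auto intro!: order_trans[OF degree_mult_le] simp del: mult_pCons_left)
  have c: "poly.coeff ([:-r, 1:] * P) i = (case i of 0 \<Rightarrow> 0 | Suc j \<Rightarrow> poly.coeff P j) - r * poly.coeff P i" for i
    by (cases i) auto
  have top: "poly.coeff P (Suc n) = 0" using deg by (intro coeff_eq_0) auto
  have "root_op b (r # rs) f y = (\<Sum>i\<le>n. poly.coeff P i * (f (b * (b ^ i * y)) - r * f (b ^ i * y)))"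
    by (simp add: Cons.IH P_def n_def)
  also have "\<dots> = (\<Sum>i\<le>n. poly.coeff P i * f (b ^ Suc i * y)) - (\<Sum>i\<le>n. r * poly.coeff P i * f (b ^ i * y))"
    by (simp add: algebra_simps sum_subtractf)
  also have "(\<Sum>i\<le>n. poly.coeff P i * f (b ^ Suc i * y))
      = (\<Sum>i\<le>Suc n. (case i of 0 \<Rightarrow> 0 | Suc j \<Rightarrow> poly.coeff P j) * f (b ^ i * y))"
    by (subst sum.atMost_Suc_shift) simp
  also have "(\<Sum>i\<le>n. r * poly.coeff P i * f (b ^ i * y)) = (\<Sum>i\<le>Suc n. r * poly.coeff P i * f (b ^ i * y))"
    by (simp add: top)
  finally have "root_op b (r # rs) f y = (\<Sum>i\<le>Suc n. poly.coeff ([:-r, 1:] * P) i * f (b ^ i * y))"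
    unfolding c by (simp only: left_diff_distrib sum_subtractf)
  then show ?case by (simp only: P_def n_def list.simps prod_list.Cons list.size) simp
qed simp

text \<open>Induction on the roots: f (b y) - r f y is killed by the remaining factors, so it splits
  into eigenparts for the roots s \<noteq> r, from which those of f are recovered. The clause on a
  and s records that an eigenvalue equation of f for another multiplier passes to its parts; it lets
  several multipliers be diagonalised one after the other.\<close>

lemma eigen_split:
  assumes "qlinear f" "distinct rs" "\<And>y. root_op b rs f y = 0"
  shows "\<exists>g. (\<forall>r\<in>set rs. qlinear (g r) \<and> (\<forall>y. g r (b * y) = r * g r y) \<and>
      (\<forall>a s. (\<forall>y. f (a * y) = s * f y) \<longrightarrow> (\<forall>y. g r (a * y) = s * g r y))) \<and> (\<forall>y. f y = (\<Sum>r\<in>set rs. g r y))"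
  using assms
proof (induction rs arbitrary: f)
  case (Cons r rs)
  have ql: "qlinear (\<lambda>y. f (b * y) - r * f y)"
    using Cons.prems(1) by (auto simp: qlinear_def algebra_simps) (metis mult.assoc mult.commute)
  have kill: "root_op b rs (\<lambda>y. f (b * y) - r * f y) y = 0" for y using Cons.prems(3)[of y] by simp
  have dist: "distinct rs" using Cons.prems(2) by simp
  obtain g where g0: "\<forall>s\<in>set rs. qlinear (g s) \<and> (\<forall>y. g s (b * y) = s * g s y) \<and>
      (\<forall>a t. (\<forall>y. f (b * (a * y)) - r * f (a * y) = t * (f (b * y) - r * f y)) \<longrightarrow> (\<forall>y. g s (a * y) = t * g s y))"
    "\<forall>y. f (b * y) - r * f y = (\<Sum>s\<in>set rs. g s y)"
    using Cons.IH[OF ql dist kill] by blast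
  have g: "\<And>s. s \<in> set rs \<Longrightarrow> qlinear (g s)" "\<And>s y. s \<in> set rs \<Longrightarrow> g s (b * y) = s * g s y"
    "\<And>y. f (b * y) - r * f y = (\<Sum>s\<in>set rs. g s y)"
    "\<And>s a t. s \<in> set rs \<Longrightarrow> \<forall>y. f (b * (a * y)) - r * f (a * y) = t * (f (b * y) - r * f y)
        \<Longrightarrow> \<forall>y. g s (a * y) = t * g s y"
    using g0 by blast+
  have g5: "g s (a * y) = t * g s y" if "s \<in> set rs" "\<And>y. f (a * y) = t * f y" for s a t y
    using g(4)[OF that(1), of a t] that(2) by (simp add: mult.left_commute[of b] right_diff_distrib)
  have ne: "s \<noteq> r" if "s \<in> set rs" for s using that Cons.prems(2) by auto
  \<comment> \<open>Since b - r acts on the s-part as s - r, the s-part of f is g s / (s - r); what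
    remains of f is killed by b - r and is the r-part.\<close>
  define G where "G = (\<lambda>s y. if s = r then f y - (\<Sum>t\<in>set rs. g t y / (t - r)) else g s y / (s - r))"
  have "qlinear (G s) \<and> (\<forall>y. G s (b * y) = s * G s y) \<and>
      (\<forall>a t. (\<forall>y. f (a * y) = t * f y) \<longrightarrow> (\<forall>y. G s (a * y) = t * G s y))" if s: "s \<in> set (r # rs)" for s
  proof (cases "s = r")
    case True
    have "qlinear (G s)"
      using Cons.prems(1) g(1) unfolding G_def True qlinear_def
      by (simp add: algebra_simps sum.distrib add_divide_distrib sum_distrib_left)
    moreover have "G s (b * y) = s * G s y" for y
    proof -
      have "f (b * y) = r * f y + (\<Sum>t\<in>set rs. g t y)" using g(3)[of y] by (simp add: algebra_simps)
      moreover have "(\<Sum>t\<in>set rs. t * g t y / (t - r)) = (\<Sum>t\<in>set rs. g t y) + (\<Sum>t\<in>set rs. r * g t y / (t - r))"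
        unfolding sum.distrib[symmetric] using ne by (intro sum.cong) (auto simp: field_simps)
      ultimately show ?thesis
        by (simp add: G_def True g(2) algebra_simps sum_distrib_left)
    qed
    moreover have "G s (a * y) = t * G s y" if "\<forall>y. f (a * y) = t * f y" for a t y
    proof -
      have "(\<Sum>u\<in>set rs. g u (a * y) / (u - r)) = t * (\<Sum>u\<in>set rs. g u y / (u - r))"
        unfolding sum_distrib_left using that by (intro sum.cong refl) (simp add: g5[of _ a t])
      then show ?thesis using that by (simp add: G_def True right_diff_distrib)
    qed
    ultimately show ?thesis by blast
  next
    case False
    then have "s \<in> set rs" using s by auto
    then show ?thesis using g(1,2) g5 False by (auto simp: G_def qlinear_def add_divide_distrib)
  qed
  moreover have "f y = (\<Sum>s\<in>set (r # rs). G s y)" for y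
  proof -
    have "(\<Sum>s\<in>set (r # rs). G s y) = G r y + (\<Sum>s\<in>set rs. G s y)" using Cons.prems(2) by simp
    also have "(\<Sum>s\<in>set rs. G s y) = (\<Sum>s\<in>set rs. g s y / (s - r))"
      by (intro sum.cong) (auto simp: G_def dest: ne)
    finally show ?thesis by (simp add: G_def)
  qed
  ultimately show ?case by (intro exI[of _ G] conjI ballI allI) simp_all
qed simp

section \<open>Rational polynomials vanishing at an element\<close>

interpretation of_rat_poly_hom: map_poly_comm_ring_hom "of_rat :: rat \<Rightarrow> 'f::field_char_0" ..

abbreviation rpoly :: "rat poly \<Rightarrow> 'f::field_char_0 poly" where "rpoly \<equiv> map_poly of_rat"

text \<open>The powers of b lie in a finite dimensional space. A repeated power is treated
  separately because linear dependence is a property of the set of powers, not of the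
  family.\<close>

lemma exists_rat_poly:
  fixes b :: "'f::number_field"
  shows "\<exists>p. p \<noteq> 0 \<and> poly (rpoly p) b = 0"
proof (cases "inj (\<lambda>i::nat. b ^ i)")
  case False
  then obtain i j :: nat where ij: "b ^ i = b ^ j" "i \<noteq> j" by (auto simp: inj_def)
  let ?p = "Polynomial.monom 1 i + Polynomial.monom (- 1) j :: rat poly"
  have "poly.coeff ?p i = 1" using ij by simp
  then have "?p \<noteq> 0" by (metis coeff_0 zero_neq_one)
  moreover have "poly (rpoly ?p) b = 0"
    using ij by (simp add: hom_distribs poly_monom)
  ultimately show ?thesis by blast
next
  case True
  have "infinite (range (\<lambda>i::nat. b ^ i))" using True by (simp add: finite_image_iff)
  then have "ratvs.dependent (range (\<lambda>i::nat. b ^ i))" using ratvs_finite_independent by blast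
  then obtain S u where S: "finite S" "S \<subseteq> range (\<lambda>i::nat. b ^ i)" "(\<Sum>v\<in>S. rat_scale (u v) v) = 0" "\<exists>v\<in>S. u v \<noteq> 0"
    unfolding ratvs.dependent_explicit by blast
  obtain I where I: "S = (\<lambda>i. b ^ i) ` I" using S(2) by (meson subset_image_iff)
  have inj: "inj_on (\<lambda>i. b ^ i) I" using True by (rule inj_on_subset) simp
  have finI: "finite I" using S(1) I inj by (simp add: finite_image_iff)
  define p where "p = (\<Sum>i\<in>I. Polynomial.monom (u (b ^ i)) i)"
  obtain k where k: "k \<in> I" "u (b ^ k) \<noteq> 0" using S(4) I by auto
  have "poly.coeff p k = u (b ^ k)"
    unfolding p_def using finI k by (simp add: coeff_sum)
  then have "p \<noteq> 0" using k by auto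
  moreover have "poly (rpoly p) b = (\<Sum>i\<in>I. of_rat (u (b ^ i)) * b ^ i)"
    unfolding p_def by (simp add: hom_distribs poly_sum poly_monom)
  moreover have "\<dots> = 0" using S(3) unfolding I by (simp add: sum.reindex[OF inj] rat_scale_def)
  ultimately show ?thesis by auto
qed

lemma poly_rpoly_add: "poly (rpoly (p + q)) x = poly (rpoly p) x + poly (rpoly q) x"
  by (simp add: hom_distribs)

lemma poly_rpoly_mult: "poly (rpoly (p * q)) x = poly (rpoly p) x * poly (rpoly q) x"
  by (simp add: hom_distribs)

text \<open>Take p of least degree among the nonzero rational polynomials with root b. A multiple
  complex root would make the gcd of p and its derivative a nonconstant proper divisor, and b would
  be a root of it or of the cofactor, both of smaller degree.\<close>

lemma exists_squarefree_rat_poly: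
  fixes b :: "'f::number_field"
  shows "\<exists>p. p \<noteq> 0 \<and> poly (rpoly p) b = 0 \<and> rsquarefree (rpoly p :: complex poly)"
proof -
  define P where "P = (\<lambda>p. p \<noteq> 0 \<and> poly (rpoly p) b = 0)"
  obtain p where p: "P p" and least: "\<And>q. P q \<Longrightarrow> Polynomial.degree p \<le> Polynomial.degree q"
    using exists_rat_poly[of b] ex_has_least_nat[of P _ Polynomial.degree] unfolding P_def by blast
  have "rsquarefree (rpoly p :: complex poly)"
  proof (rule ccontr)
    assume "\<not> rsquarefree (rpoly p :: complex poly)"
    then obtain a :: complex where a: "poly (rpoly p) a = 0" "poly (pderiv (rpoly p)) a = 0"
      unfolding rsquarefree_roots by blast
    define g where "g = gcd p (pderiv p)"
    obtain u v where uv: "u * p + v * pderiv p = g"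
      unfolding g_def by (metis bezout_coefficients_fst_snd)
    have pd: "pderiv (rpoly p :: complex poly) = rpoly (pderiv p)"
      by (simp add: of_rat_hom.map_poly_pderiv)
    have ga: "poly (rpoly g) a = 0"
      unfolding uv[symmetric] poly_rpoly_add poly_rpoly_mult using a by (simp add: pd)
    have p0: "p \<noteq> 0" using p by (simp add: P_def)
    have g0: "g \<noteq> 0" unfolding g_def using p0 by simp
    have nconst: "Polynomial.degree q > 0" if "q \<noteq> 0" "poly (rpoly q) a = 0" for q
    proof (rule ccontr)
      assume "\<not> Polynomial.degree q > 0"
      then obtain c where "q = [:c:]" by (metis degree_eq_zeroE gr0I)
      then show False using that by simp
    qed
    have dg: "Polynomial.degree g > 0" by (rule nconst[OF g0 ga])
    have dp: "Polynomial.degree p > 0" by (rule nconst[OF p0 a(1)])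
    obtain q where q: "p = g * q" unfolding g_def by (meson dvd_def gcd_dvd1)
    have q0: "q \<noteq> 0" using q p0 by auto
    have dq: "Polynomial.degree q < Polynomial.degree p"
      using q g0 q0 dg by (simp add: degree_mult_eq)
    have pd0: "pderiv p \<noteq> 0" using dp by (simp add: pderiv_eq_0_iff)
    have "Polynomial.degree g \<le> Polynomial.degree (pderiv p)"
      unfolding g_def by (intro dvd_imp_degree_le pd0) simp
    also have "\<dots> < Polynomial.degree p" using dp by (simp add: degree_pderiv)
    finally have dg': "Polynomial.degree g < Polynomial.degree p" .
    have "poly (rpoly g) b * poly (rpoly q) b = 0"
      using p unfolding P_def q poly_rpoly_mult by simp
    then have "P g \<or> P q" using g0 q0 by (auto simp: P_def)
    then show False using least dg' dq by fastforce
  qed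
  then show ?thesis using p by (auto simp: P_def)
qed

text \<open>The distinct roots required by \<open>eigen_split\<close> are the complex roots of a
  squarefree rational polynomial vanishing at b. Up to its leading coefficient this polynomial is
  the product of the linear factors, so the operator kills f.\<close>

lemma eigen_split_list:
  fixes b :: "'f::number_field"
  assumes "qlinear f"
  shows "\<exists>gs. (\<forall>g\<in>set gs. qlinear g \<and> (\<exists>r. \<forall>y. g (b * y) = r * g y) \<and>
      (\<forall>a s. (\<forall>y. f (a * y) = s * f y) \<longrightarrow> (\<forall>y. g (a * y) = s * g y))) \<and> (\<forall>y. f y = (\<Sum>g\<leftarrow>gs. g y))"
proof -
  obtain p where p: "p \<noteq> 0" "poly (rpoly p) b = 0" "rsquarefree (rpoly p :: complex poly)"
    using exists_squarefree_rat_poly by blast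
  define P where "P = (rpoly p :: complex poly)"
  have P0: "P \<noteq> 0" using p(1) by (simp add: P_def)
  obtain rs where rs: "set rs = {z. poly P z = 0}" "distinct rs"
    using finite_distinct_list[OF poly_roots_finite[OF P0]] by blast
  define Q where "Q = (\<Prod>r\<leftarrow>rs. [:-r, 1:])"
  have "(\<Prod>z\<in>set rs. [:- z, 1:]) = Q" by (simp add: Q_def prod.distinct_set_conv_list[OF rs(2)])
  then have PQ: "P = smult (lead_coeff P) Q"
    using complex_poly_decompose_rsquarefree[of P] p(3) by (simp add: P_def rs(1))
  have degQ: "Polynomial.degree Q = length rs"
    unfolding Q_def by (subst degree_prod_list_eq) (auto simp: o_def sum_list_triv)
  have degP: "Polynomial.degree P = length rs"
    using PQ P0 degQ by (metis degree_smult_eq leading_coeff_0_iff)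
  have kill: "root_op b rs f y = 0" for y
  proof -
    have "lead_coeff P * root_op b rs f y = (\<Sum>i\<le>length rs. poly.coeff (smult (lead_coeff P) Q) i * f (b ^ i * y))"
      by (simp add: root_op_eq Q_def sum_distrib_left mult.assoc)
    also have "\<dots> = (\<Sum>i\<le>length rs. of_rat (poly.coeff p i) * f (b ^ i * y))"
      unfolding PQ[symmetric] by (simp add: P_def)
    also have "\<dots> = f (\<Sum>i\<le>length rs. of_rat (poly.coeff p i) * (b ^ i * y))"
      by (simp add: qlinear_sum[OF assms] qlinearD(2)[OF assms])
    also have "(\<Sum>i\<le>length rs. of_rat (poly.coeff p i) * (b ^ i * y)) = poly (rpoly p) b * y"
      using degP by (simp add: poly_altdef P_def sum_distrib_right mult.assoc)
    finally show ?thesis using P0 qlinear_0[OF assms] p(2) by simp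
  qed
  obtain g where g: "\<forall>r\<in>set rs. qlinear (g r) \<and> (\<forall>y. g r (b * y) = r * g r y) \<and>
      (\<forall>a s. (\<forall>y. f (a * y) = s * f y) \<longrightarrow> (\<forall>y. g r (a * y) = s * g r y))"
    "\<forall>y. f y = (\<Sum>r\<in>set rs. g r y)"
    using eigen_split[OF assms rs(2) kill] by blast
  have "\<forall>y. f y = (\<Sum>g\<leftarrow>map g rs. g y)"
    using g(2) rs(2) by (simp add: sum.distinct_set_conv_list o_def)
  then show ?thesis using g(1) by (intro exI[of _ "map g rs"]) auto
qed

text \<open>Split by one multiplier at a time; the eigenvalue equations for the multipliers already
  treated survive each refinement.\<close>

lemma simultaneous_eigen_split:
  assumes "qlinear f"
  shows "\<exists>gs. (\<forall>g\<in>set gs. qlinear g \<and> (\<forall>b\<in>set bs. \<exists>r. \<forall>y. g (b * y) = r * g y)) \<and>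
    (\<forall>y. f y = (\<Sum>g\<leftarrow>gs. g y))"
proof (induction bs)
  case Nil
  show ?case using assms by (intro exI[of _ "[f]"]) auto
next
  case (Cons b bs)
  then obtain gs where gs: "\<forall>g\<in>set gs. qlinear g \<and> (\<forall>b\<in>set bs. \<exists>r. \<forall>y. g (b * y) = r * g y)"
    "\<And>y. f y = (\<Sum>g\<leftarrow>gs. g y)" by blast
  have "\<forall>g\<in>set gs. \<exists>hs. (\<forall>h\<in>set hs. qlinear h \<and> (\<exists>r. \<forall>y. h (b * y) = r * h y) \<and>
      (\<forall>a s. (\<forall>y. g (a * y) = s * g y) \<longrightarrow> (\<forall>y. h (a * y) = s * h y))) \<and> (\<forall>y. g y = (\<Sum>h\<leftarrow>hs. h y))"
    using gs(1) eigen_split_list by blast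
  then obtain H where H: "\<forall>g\<in>set gs. (\<forall>h\<in>set (H g). qlinear h \<and> (\<exists>r. \<forall>y. h (b * y) = r * h y) \<and>
      (\<forall>a s. (\<forall>y. g (a * y) = s * g y) \<longrightarrow> (\<forall>y. h (a * y) = s * h y))) \<and> (\<forall>y. g y = (\<Sum>h\<leftarrow>H g. h y))"
    by metis
  have "(\<Sum>g\<leftarrow>gs. g y) = (\<Sum>h\<leftarrow>concat (map H gs). h y)" for y
    using H by (induction gs) auto
  moreover have "\<forall>h\<in>set (concat (map H gs)). qlinear h \<and> (\<forall>c\<in>set (b # bs). \<exists>r. \<forall>y. h (c * y) = r * h y)"
  proof
    fix h assume "h \<in> set (concat (map H gs))"
    then obtain g where g: "g \<in> set gs" "h \<in> set (H g)" by auto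
    note Hg = H[rule_format, OF g(1), THEN conjunct1, rule_format, OF g(2)]
    have "\<exists>r. \<forall>y. h (c * y) = r * h y" if "c \<in> set (b # bs)" for c
    proof (cases "c = b")
      case False
      then have "c \<in> set bs" using that by simp
      then obtain r where "\<forall>y. g (c * y) = r * g y" using gs(1) g(1) by blast
      then show ?thesis using Hg by blast
    qed (use Hg in blast)
    then show "qlinear h \<and> (\<forall>c\<in>set (b # bs). \<exists>r. \<forall>y. h (c * y) = r * h y)" using Hg by blast
  qed
  ultimately show ?case using gs(2) by (intro exI[of _ "concat (map H gs)"]) auto
qed

section \<open>The embeddings as a basis of the rational-linear maps\<close>

interpretation cfun: vector_space "\<lambda>(c::complex) (f :: 'f::number_field \<Rightarrow> complex). (\<lambda>x. c * f x)"
  by unfold_locales (auto simp: fun_eq_iff algebra_simps)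

text \<open>A common eigenvector g of the multiplications by a rational basis is one of
  multiplication by every x, with eigenvalue \<sigma> x. From g (x y) = \<sigma> x g y with g
  \<noteq> 0 it follows that \<sigma> is an embedding and that g is g 1 times \<sigma>.\<close>

lemma qlinear_in_span_embeddings:
  fixes f :: "'f::number_field \<Rightarrow> complex"
  assumes "qlinear f"
  shows "f \<in> cfun.span complex_embeddings"
proof -
  obtain bs where bs: "set bs = (rat_basis :: 'f set)"
    using finite_list[OF finite_rat_basis] by blast
  obtain gs where gs: "\<forall>g\<in>set gs. qlinear g \<and> (\<forall>b\<in>set bs. \<exists>r. \<forall>y. g (b * y) = r * g y)"
    "\<And>y. f y = (\<Sum>g\<leftarrow>gs. g y)" using simultaneous_eigen_split[OF assms, of bs] by blast
  have "g \<in> cfun.span complex_embeddings" if g: "g \<in> set gs" for g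
  proof (cases "g = (\<lambda>_. 0)")
    case True
    then show ?thesis using cfun.span_zero[of complex_embeddings] by (simp add: zero_fun_def)
  next
    case False
    have ql: "qlinear g" using gs(1) g by blast
    have "\<exists>r. \<forall>y. g (x * y) = r * g y" for x
    proof -
      have "x \<in> ratvs.span (rat_basis :: 'f set)" by (simp add: rat_basis)
      then show ?thesis
      proof (induction rule: ratvs.span_induct_alt)
        case base
        then show ?case using qlinear_0[OF ql] by (intro exI[of _ 0]) simp
      next
        case (step c x y)
        obtain r s where "\<forall>z. g (x * z) = r * g z" "\<forall>z. g (y * z) = s * g z"
          using gs(1) g step bs by blast
        then have "\<forall>z. g ((rat_scale c x + y) * z) = (of_rat c * r + s) * g z"
          by (simp add: rat_scale_def distrib_right mult.assoc qlinearD[OF ql])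
        then show ?case by blast
      qed
    qed
    then obtain \<sigma> where \<sigma>: "\<And>x y. g (x * y) = \<sigma> x * g y" by metis
    have gx: "g x = g 1 * \<sigma> x" for x using \<sigma>[of x 1] by simp
    have g1: "g 1 \<noteq> 0"
    proof
      assume "g 1 = 0"
      then have "g x = 0" for x using gx[of x] by simp
      then show False using False by auto
    qed
    have "g 1 * \<sigma> 1 = g 1 * 1" by (simp flip: gx)
    then have "\<sigma> 1 = 1" using g1 by (simp only: mult_cancel_left) simp
    moreover have "\<sigma> (x + y) = \<sigma> x + \<sigma> y" for x y
    proof -
      have "g 1 * \<sigma> (x + y) = g 1 * (\<sigma> x + \<sigma> y)"
        by (simp add: distrib_left qlinearD(1)[OF ql] flip: gx)
      then show ?thesis using g1 by (simp only: mult_cancel_left) simp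
    qed
    moreover have "\<sigma> (x * y) = \<sigma> x * \<sigma> y" for x y
    proof -
      have "g 1 * \<sigma> (x * y) = \<sigma> x * (g 1 * \<sigma> y)"
        by (simp add: \<sigma> flip: gx)
      then have "g 1 * \<sigma> (x * y) = g 1 * (\<sigma> x * \<sigma> y)" by (simp only: mult.left_commute)
      then show ?thesis using g1 by (simp only: mult_cancel_left) simp
    qed
    ultimately have "\<sigma> \<in> complex_embeddings" by (simp add: complex_embeddings_def)
    then have "(\<lambda>x. g 1 * \<sigma> x) \<in> cfun.span complex_embeddings"
      by (intro cfun.span_scale cfun.span_base)
    moreover have "(\<lambda>x. g 1 * \<sigma> x) = g" by (rule ext) (rule gx[symmetric])
    ultimately show ?thesis by simp
  qed
  then have "(\<Sum>g\<leftarrow>gs. g) \<in> cfun.span complex_embeddings"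
    by (induction gs) (auto simp: cfun.span_zero intro: cfun.span_add)
  moreover have "(\<Sum>g\<leftarrow>gs. g) = f"
  proof
    fix y
    have "(\<Sum>g\<leftarrow>gs. g) y = (\<Sum>g\<leftarrow>gs. g y)" by (induction gs) auto
    then show "(\<Sum>g\<leftarrow>gs. g) y = f y" using gs(2) by simp
  qed
  ultimately show ?thesis by simp
qed

text \<open>Artin's independence of characters: replacing x by y x and subtracting \<rho> y times
  the relation removes \<rho> from it, and every other \<sigma> differs from \<rho> at some
  y.\<close>

lemma embeddings_sum_eq_0:
  assumes "finite S" "S \<subseteq> complex_embeddings" "\<And>x. (\<Sum>\<sigma>\<in>S. c \<sigma> * \<sigma> x) = 0" "\<tau> \<in> S"
  shows "c \<tau> = (0::complex)"
  using assms
proof (induction S arbitrary: c \<tau> rule: finite_induct)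
  case (insert \<rho> S)
  have mult: "\<sigma> (x * y) = \<sigma> x * \<sigma> y" if "\<sigma> \<in> insert \<rho> S" for \<sigma> x y
    using insert.prems(1) that by (auto simp: complex_embeddings_def)
  have eq: "(\<Sum>\<sigma>\<in>S. (c \<sigma> * (\<sigma> y - \<rho> y)) * \<sigma> x) = 0" for x y
  proof -
    have "(\<Sum>\<sigma>\<in>S. (c \<sigma> * (\<sigma> y - \<rho> y)) * \<sigma> x) =
      (\<Sum>\<sigma>\<in>insert \<rho> S. c \<sigma> * \<sigma> (y * x)) - \<rho> y * (\<Sum>\<sigma>\<in>insert \<rho> S. c \<sigma> * \<sigma> x)"
      using insert.hyps by (simp add: mult algebra_simps sum_subtractf sum_distrib_left)
    also have "\<dots> = 0" using insert.prems(2)[of "y * x"] insert.prems(2)[of x] by simp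
    finally show ?thesis .
  qed
  have S0: "c \<sigma> = 0" if \<sigma>: "\<sigma> \<in> S" for \<sigma>
  proof -
    have "\<sigma> \<noteq> \<rho>" using \<sigma> insert.hyps by auto
    then obtain y where y: "\<sigma> y \<noteq> \<rho> y" by auto
    have "c \<sigma> * (\<sigma> y - \<rho> y) = 0"
      by (rule insert.IH[of "\<lambda>\<sigma>. c \<sigma> * (\<sigma> y - \<rho> y)" \<sigma>]) (use eq insert.prems \<sigma> in auto)
    then show ?thesis using y by simp
  qed
  have "c \<rho> * \<rho> 1 = 0" using insert.prems(2)[of 1] insert.hyps S0 by simp
  then have "c \<rho> = 0" using insert.prems(1) by (simp add: complex_embeddings_def)
  then show ?case using insert.prems(3) S0 by auto
qed simp

lemma embeddings_independent: "\<not> cfun.dependent (complex_embeddings :: ('f::number_field \<Rightarrow> complex) set)"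
proof
  assume "cfun.dependent (complex_embeddings :: ('f \<Rightarrow> complex) set)"
  then obtain S u where S: "finite S" "S \<subseteq> complex_embeddings" "(\<Sum>v\<in>S. (\<lambda>x::'f. u v * v x)) = 0" "\<exists>v\<in>S. u v \<noteq> 0"
    unfolding cfun.dependent_explicit by blast
  have "(\<Sum>v\<in>S. (\<lambda>x::'f. u v * v x)) x = (\<Sum>v\<in>S. u v * v x)" for x
    using S(1) by (induction S rule: finite_induct) auto
  then have "(\<Sum>v\<in>S. u v * v x) = 0" for x using S(3) by simp
  then show False using embeddings_sum_eq_0[OF S(1,2), of u] S(4) by blast
qed

lemma embeddingD:
  assumes "\<sigma> \<in> complex_embeddings"
  shows "\<sigma> 1 = 1" "\<sigma> (x + y) = \<sigma> x + \<sigma> y" "\<sigma> (x * y) = \<sigma> x * \<sigma> y" "\<sigma> 0 = 0" "\<sigma> (- x) = - \<sigma> x"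
    "\<sigma> (x - y) = \<sigma> x - \<sigma> y" "\<sigma> (of_nat n) = of_nat n" "\<sigma> (of_int i) = of_int i" "\<sigma> (of_rat q) = of_rat q"
    "\<sigma> x = 0 \<longleftrightarrow> x = 0" "\<sigma> (inverse x) = inverse (\<sigma> x)" "\<sigma> (sum g A) = (\<Sum>a\<in>A. \<sigma> (g a))"
    "\<sigma> (x / y) = \<sigma> x / \<sigma> y"
proof -
  interpret field_hom \<sigma>
    using assms by unfold_locales (auto simp: complex_embeddings_def, metis add_cancel_right_right)
  interpret field_char_0_hom \<sigma> ..
  have rat: "\<sigma> (of_rat q) = of_rat q"
    by (cases q) (simp add: of_rat_rat hom_distribs)
  show "\<sigma> 1 = 1" "\<sigma> (x + y) = \<sigma> x + \<sigma> y" "\<sigma> (x * y) = \<sigma> x * \<sigma> y" "\<sigma> 0 = 0" "\<sigma> (- x) = - \<sigma> x"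
    "\<sigma> (x - y) = \<sigma> x - \<sigma> y" "\<sigma> (of_nat n) = of_nat n" "\<sigma> (of_int i) = of_int i" "\<sigma> (of_rat q) = of_rat q"
    "\<sigma> x = 0 \<longleftrightarrow> x = 0" "\<sigma> (inverse x) = inverse (\<sigma> x)" "\<sigma> (sum g A) = (\<Sum>a\<in>A. \<sigma> (g a))"
    "\<sigma> (x / y) = \<sigma> x / \<sigma> y"
    by (simp_all add: hom_distribs rat)
qed

lemma qlinear_embedding: "\<sigma> \<in> complex_embeddings \<Longrightarrow> qlinear \<sigma>"
  by (simp add: qlinear_def embeddingD)

section \<open>Rational coordinates and the trace\<close>

definition rat_coord :: "'f::number_field \<Rightarrow> 'f \<Rightarrow> rat" where
  "rat_coord b x = ratvs.representation rat_basis x b"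

lemma rat_coord_sum: "(\<Sum>b\<in>rat_basis. of_rat (rat_coord b x) * b) = x"
  using ratvs.sum_representation_eq[OF rat_basis(1) _ finite_rat_basis subset_refl, of x]
  by (simp add: rat_coord_def rat_basis rat_scale_def)

lemma rat_coord_linear: "rat_coord b (x + y) = rat_coord b x + rat_coord b y"
  "rat_coord b (of_rat q * x) = q * rat_coord b x"
  unfolding rat_coord_def
  using ratvs.representation_add[OF rat_basis(1), of y x] ratvs.representation_scale[OF rat_basis(1), of x q]
  by (simp_all add: rat_basis rat_scale_def)

lemma rat_coord_basis: "b \<in> rat_basis \<Longrightarrow> c \<in> rat_basis \<Longrightarrow> rat_coord b c = (if b = c then 1 else 0)"
  unfolding rat_coord_def using ratvs.representation_basis[OF rat_basis(1), of c] by auto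

lemma qlinear_rat_coord: "qlinear (\<lambda>x. of_rat (rat_coord b x))"
  by (simp add: qlinear_def rat_coord_linear of_rat_add of_rat_mult)

lemma qlinear_expand:
  assumes "qlinear f"
  shows "f x = (\<Sum>b\<in>rat_basis. f b * of_rat (rat_coord b x))"
proof -
  have "f x = f (\<Sum>b\<in>rat_basis. of_rat (rat_coord b x) * b)" by (simp add: rat_coord_sum)
  also have "\<dots> = (\<Sum>b\<in>rat_basis. f b * of_rat (rat_coord b x))"
    by (simp add: qlinear_sum[OF assms] qlinearD[OF assms]) (simp add: mult.commute)
  finally show ?thesis .
qed

lemma sum_fun_apply: "(\<Sum>a\<in>A. g a) x = (\<Sum>a\<in>A. g a x :: 'b::comm_monoid_add)"
  by (induction A rule: infinite_finite_induct) auto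

text \<open>The embeddings and the coordinate functions \<delta> b of the rational basis are two
  independent families, each contained in the span of the other.\<close>

lemma finite_card_embeddings:
  "finite (complex_embeddings :: ('f::number_field \<Rightarrow> complex) set)"
  "card (complex_embeddings :: ('f \<Rightarrow> complex) set) = field_degree TYPE('f)"
proof -
  define \<delta> :: "'f \<Rightarrow> 'f \<Rightarrow> complex" where "\<delta> = (\<lambda>b x. of_rat (rat_coord b x))"
  have span: "f \<in> cfun.span (\<delta> ` rat_basis)" if "qlinear f" for f
  proof -
    have "f = (\<Sum>b\<in>rat_basis. (\<lambda>x. f b * \<delta> b x))"
      by (rule ext) (subst qlinear_expand[OF that], simp add: \<delta>_def sum_fun_apply)
    moreover have "\<dots> \<in> cfun.span (\<delta> ` rat_basis)"
      by (intro cfun.span_sum cfun.span_scale cfun.span_base) auto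
    ultimately show ?thesis by simp
  qed
  have "(complex_embeddings :: ('f \<Rightarrow> complex) set) \<subseteq> cfun.span (\<delta> ` rat_basis)"
    using span qlinear_embedding by blast
  with cfun.independent_span_bound[of "\<delta> ` rat_basis", OF _ embeddings_independent]
  have fin: "finite (complex_embeddings :: ('f \<Rightarrow> complex) set)"
    and le: "card (complex_embeddings :: ('f \<Rightarrow> complex) set) \<le> card (\<delta> ` rat_basis)"
    by (auto simp: finite_rat_basis)
  have \<delta>b: "\<delta> b c = (if b = c then 1 else 0)" if "b \<in> rat_basis" "c \<in> rat_basis" for b c
    using that by (simp add: \<delta>_def rat_coord_basis)
  have inj: "inj_on \<delta> rat_basis"
    by (rule inj_onI) (metis \<delta>b zero_neq_one)
  have card\<delta>: "card (\<delta> ` rat_basis) = field_degree TYPE('f)"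
    using inj by (simp add: card_image card_rat_basis)
  have ind: "\<not> cfun.dependent (\<delta> ` rat_basis)"
  proof
    assume "cfun.dependent (\<delta> ` rat_basis)"
    then obtain u v where uv: "(\<Sum>v\<in>\<delta> ` rat_basis. (\<lambda>x. u v * v x)) = 0" "v \<in> \<delta> ` rat_basis" "u v \<noteq> 0"
      unfolding cfun.dependent_finite[OF finite_imageI[OF finite_rat_basis]] by blast
    obtain b where b: "b \<in> rat_basis" "v = \<delta> b" using uv(2) by blast
    have "(\<Sum>v\<in>\<delta> ` rat_basis. (\<lambda>x. u v * v x)) b = (\<Sum>c\<in>rat_basis. u (\<delta> c) * \<delta> c b)"
      by (simp add: sum_fun_apply sum.reindex[OF inj])
    also have "\<dots> = (\<Sum>c\<in>rat_basis. if c = b then u (\<delta> c) else 0)"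
      using b by (intro sum.cong) (auto simp: \<delta>b)
    also have "\<dots> = u v" using b by (simp add: finite_rat_basis)
    finally show False using uv by simp
  qed
  have "\<delta> ` rat_basis \<subseteq> cfun.span complex_embeddings"
    using qlinear_in_span_embeddings qlinear_rat_coord unfolding \<delta>_def by blast
  with cfun.independent_span_bound[OF fin ind]
  have "card (\<delta> ` rat_basis) \<le> card (complex_embeddings :: ('f \<Rightarrow> complex) set)" by blast
  then show "card (complex_embeddings :: ('f \<Rightarrow> complex) set) = field_degree TYPE('f)"
    using le card\<delta> by simp
  show "finite (complex_embeddings :: ('f \<Rightarrow> complex) set)" by (rule fin)
qed

lemma qlinear_combination:
  fixes f :: "'f::number_field \<Rightarrow> complex"
  assumes "qlinear f"
  obtains c where "\<And>x. f x = (\<Sum>\<sigma>\<in>complex_embeddings. c \<sigma> * \<sigma> x)"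
proof -
  have "f \<in> cfun.span complex_embeddings" by (rule qlinear_in_span_embeddings[OF assms])
  then obtain c where "f = (\<Sum>\<sigma>\<in>complex_embeddings. (\<lambda>x. c \<sigma> * \<sigma> x))"
    unfolding cfun.span_finite[OF finite_card_embeddings(1)] by blast
  then show ?thesis using that by (simp add: sum_fun_apply)
qed

text \<open>Let R express the coordinate functions through the embeddings. The matrices (\<tau> b)
  and R are inverse to each other by independence of the embeddings, so conjugation turns the matrix
  of multiplication by x into the diagonal matrix of the \<sigma> x.\<close>

lemma of_rat_field_trace:
  fixes x :: "'f::number_field"
  shows "complex_of_rat (field_trace x) = (\<Sum>\<sigma>\<in>complex_embeddings. \<sigma> x)"
proof -
  have "\<exists>c. \<forall>x. complex_of_rat (rat_coord b x) = (\<Sum>\<sigma>\<in>complex_embeddings. c \<sigma> * \<sigma> x)" for b :: 'f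
    using qlinear_combination[OF qlinear_rat_coord[of b]] by metis
  then obtain R where R: "\<And>b x. complex_of_rat (rat_coord b x) = (\<Sum>\<sigma>\<in>complex_embeddings. R b \<sigma> * \<sigma> (x::'f))"
    by metis
  have dual: "(\<Sum>b\<in>rat_basis. \<tau> b * R b \<sigma>) = (if \<sigma> = \<tau> then 1 else 0)"
    if \<tau>: "\<tau> \<in> complex_embeddings" and \<sigma>: "\<sigma> \<in> complex_embeddings" for \<sigma> \<tau>
  proof -
    have "(\<Sum>\<sigma>\<in>complex_embeddings. ((\<Sum>b\<in>rat_basis. \<tau> b * R b \<sigma>) - (if \<sigma> = \<tau> then 1 else 0)) * \<sigma> x) = 0" for x
    proof -
      have "\<tau> x = (\<Sum>b\<in>rat_basis. \<tau> b * (\<Sum>\<sigma>\<in>complex_embeddings. R b \<sigma> * \<sigma> x))"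
        using qlinear_expand[OF qlinear_embedding[OF \<tau>], of x] by (simp add: R)
      also have "\<dots> = (\<Sum>\<sigma>\<in>complex_embeddings. (\<Sum>b\<in>rat_basis. \<tau> b * R b \<sigma>) * \<sigma> x)"
        unfolding sum_distrib_left sum_distrib_right by (subst sum.swap) (simp add: mult.assoc)
      finally have *: "\<tau> x = (\<Sum>\<sigma>\<in>complex_embeddings. (\<Sum>b\<in>rat_basis. \<tau> b * R b \<sigma>) * \<sigma> x)" .
      have "(\<Sum>\<sigma>\<in>complex_embeddings. (if \<sigma> = \<tau> then 1 else 0) * \<sigma> x) = (\<Sum>\<sigma>\<in>complex_embeddings. if \<sigma> = \<tau> then \<sigma> x else 0)"
        by (intro sum.cong) auto
      also have "\<dots> = \<tau> x" using \<tau> by (simp add: finite_card_embeddings)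
      finally show ?thesis using * by (simp add: left_diff_distrib sum_subtractf)
    qed
    from embeddings_sum_eq_0[OF finite_card_embeddings(1) subset_refl this \<sigma>]
    show ?thesis by simp
  qed
  have "field_trace x = (\<Sum>b\<in>rat_basis. rat_coord b (x * b))"
    unfolding field_trace_def rat_coord_def rat_basis_def Let_def by (rule refl)
  then have "complex_of_rat (field_trace x) = (\<Sum>b\<in>rat_basis. \<Sum>\<sigma>\<in>complex_embeddings. R b \<sigma> * (\<sigma> x * \<sigma> b))"
    by (simp add: of_rat_sum R embeddingD)
  also have "\<dots> = (\<Sum>\<sigma>\<in>complex_embeddings. \<sigma> x * (\<Sum>b\<in>rat_basis. \<sigma> b * R b \<sigma>))"
    by (subst sum.swap) (simp add: sum_distrib_left mult_ac)
  also have "\<dots> = (\<Sum>\<sigma>\<in>complex_embeddings. \<sigma> x)" by (simp add: dual)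
  finally show ?thesis .
qed

section \<open>Algebraic integers\<close>

text \<open>The subgroup generated by a family. It is a family and not a set because values may
  repeat among the powers of an element and in lists.\<close>

definition int_combs :: "('i \<Rightarrow> 'a::field_char_0) \<Rightarrow> 'i set \<Rightarrow> 'a set" where
  "int_combs w I = {(\<Sum>i\<in>I. of_int (c i) * w i) | c. True}"

lemma int_combsI: "(\<Sum>i\<in>I. of_int (c i) * w i) \<in> int_combs w I"
  by (auto simp: int_combs_def)

lemma int_combs_base: "finite I \<Longrightarrow> i \<in> I \<Longrightarrow> w i \<in> int_combs w I"
proof -
  assume "finite I" "i \<in> I"
  then have "w i = (\<Sum>j\<in>I. of_int (if j = i then 1 else 0) * w j)"
    by (simp add: if_distrib[of "\<lambda>x. of_int x * _"] cong: if_cong)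
  then show ?thesis by (simp only: int_combsI)
qed

lemma int_combs_add: "x \<in> int_combs w I \<Longrightarrow> y \<in> int_combs w I \<Longrightarrow> x + y \<in> int_combs w I"
proof -
  assume "x \<in> int_combs w I" "y \<in> int_combs w I"
  then obtain c d where "x = (\<Sum>i\<in>I. of_int (c i) * w i)" "y = (\<Sum>i\<in>I. of_int (d i) * w i)"
    unfolding int_combs_def by blast
  then have "x + y = (\<Sum>i\<in>I. of_int (c i + d i) * w i)" by (simp add: distrib_right sum.distrib)
  then show ?thesis by (simp only: int_combsI)
qed

lemma int_combs_scale: "x \<in> int_combs w I \<Longrightarrow> of_int a * x \<in> int_combs w I"
proof -
  assume "x \<in> int_combs w I"
  then obtain c where "x = (\<Sum>i\<in>I. of_int (c i) * w i)" unfolding int_combs_def by blast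
  then have "of_int a * x = (\<Sum>i\<in>I. of_int (a * c i) * w i)" by (simp add: sum_distrib_left mult.assoc)
  then show ?thesis by (simp only: int_combsI)
qed

lemma int_combs_sum:
  "(\<And>a. a \<in> A \<Longrightarrow> g a \<in> int_combs w I) \<Longrightarrow> (\<Sum>a\<in>A. g a) \<in> int_combs w I"
proof (induction A rule: infinite_finite_induct)
  case (insert x F)
  then show ?case by (simp add: int_combs_add)
qed (auto simp: int_combs_def intro!: exI[of _ "\<lambda>_. 0"])

lemma int_combs_mult:
  assumes "\<And>i. i \<in> I \<Longrightarrow> x * w i \<in> int_combs w I" "y \<in> int_combs w I"
  shows "x * y \<in> int_combs w I"
proof -
  obtain c where "y = (\<Sum>i\<in>I. of_int (c i) * w i)" using assms(2) unfolding int_combs_def by blast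
  then have "x * y = (\<Sum>i\<in>I. of_int (c i) * (x * w i))" by (simp add: sum_distrib_left mult.left_commute)
  then show ?thesis using assms(1) by (simp add: int_combs_sum int_combs_scale)
qed

text \<open>Integrality criterion: \<open>x\<close> is an eigenvalue of an integer matrix.\<close>

lemma algebraic_int_if_stable:
  fixes x :: "'a::field_char_0"
  assumes "finite I" "k \<in> I" "w k \<noteq> 0" and stable: "\<And>i. i \<in> I \<Longrightarrow> x * w i \<in> int_combs w I"
  shows "algebraic_int x"
proof -
  define N where "N = card I"
  obtain f where f: "bij_betw f {0..<N} I" using ex_bij_betw_nat_finite[OF assms(1)] N_def by blast
  have "\<forall>i\<in>I. \<exists>c. x * w i = (\<Sum>j\<in>I. of_int (c j) * w j)" using stable unfolding int_combs_def by blast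
  then obtain A where A: "\<And>i. i \<in> I \<Longrightarrow> x * w i = (\<Sum>j\<in>I. of_int (A i j) * w j)" by metis
  define B :: "int mat" where "B = Matrix.mat N N (\<lambda>(i, j). A (f i) (f j))"
  define M where "M = map_mat (of_int :: int \<Rightarrow> 'a) B"
  define v where "v = Matrix.vec N (\<lambda>i. w (f i))"
  have fI: "f i \<in> I" if "i < N" for i using f that by (auto simp: bij_betw_def)
  have M: "M \<in> carrier_mat N N" by (simp add: M_def B_def)
  have "M *\<^sub>v v = x \<cdot>\<^sub>v v"
  proof (rule eq_vecI)
    fix i assume "i < dim_vec (x \<cdot>\<^sub>v v)"
    then have i: "i < N" by (simp add: v_def)
    have "(M *\<^sub>v v) $ i = (\<Sum>j = 0..<N. of_int (A (f i) (f j)) * w (f j))"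
      using i by (simp add: M_def B_def v_def scalar_prod_def)
    also have "\<dots> = (\<Sum>j\<in>I. of_int (A (f i) j) * w j)" by (rule sum.reindex_bij_betw[OF f])
    finally show "(M *\<^sub>v v) $ i = (x \<cdot>\<^sub>v v) $ i" using i fI A by (simp add: v_def)
  qed (simp add: M_def B_def v_def)
  moreover have "v \<noteq> 0\<^sub>v N"
  proof
    assume "v = 0\<^sub>v N"
    moreover obtain i where "i < N" "f i = k" using f assms(2) by (auto simp: bij_betw_def)
    ultimately have "v $ i = 0" by simp
    then show False using assms(3) \<open>i < N\<close> \<open>f i = k\<close> by (simp add: v_def)
  qed
  ultimately have "eigenvalue M x"
    unfolding eigenvalue_def eigenvector_def using M by (intro exI[of _ v]) (auto simp: v_def)
  then have "poly (char_poly M) x = 0" using eigenvalue_root_char_poly[OF M] by simp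
  moreover have "char_poly M = map_poly of_int (char_poly B)"
    unfolding M_def by (rule of_int_hom.char_poly_hom[of B N]) (simp add: B_def)
  moreover have "lead_coeff (char_poly M) = 1"
    using degree_monic_char_poly[OF M] by simp
  ultimately show ?thesis
    by (intro algebraic_int.intros[of "char_poly M"]) (auto simp: coeff_map_poly)
qed

lemma algebraic_int_relation:
  assumes "algebraic_int (x::'a::field_char_0)"
  obtains m where "m > 0" "x ^ m \<in> int_combs (\<lambda>i. x ^ i) {..<m}"
proof -
  obtain p where p: "lead_coeff p = 1" "\<And>i. poly.coeff p i \<in> \<int>" "poly p x = 0"
    using assms by (auto simp: algebraic_int.simps)
  define m where "m = Polynomial.degree p"
  have "\<forall>i. \<exists>k. poly.coeff p i = of_int k" using p(2) by (auto simp: Ints_def)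
  then obtain c where c: "\<And>i. poly.coeff p i = of_int (c i)" by metis
  have "0 = (\<Sum>i\<le>m. poly.coeff p i * x ^ i)" using p(3) by (simp add: poly_altdef m_def)
  also have "\<dots> = (\<Sum>i<m. of_int (c i) * x ^ i) + x ^ m"
    using p(1) by (simp add: lessThan_Suc_atMost[symmetric] m_def c)
  finally have "x ^ m = (\<Sum>i<m. of_int (- c i) * x ^ i)" by (simp add: sum_negf eq_neg_iff_add_eq_0 add.commute)
  then have "x ^ m \<in> int_combs (\<lambda>i. x ^ i) {..<m}" by (simp only: int_combsI)
  moreover have "m > 0"
  proof (rule ccontr)
    assume "\<not> m > 0"
    then show False using \<open>0 = (\<Sum>i\<le>m. poly.coeff p i * x ^ i)\<close> p(1) by (simp add: m_def)
  qed
  ultimately show ?thesis using that by blast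
qed

text \<open>The span of the monomials x^i y^j with i < m and j < n is stable under x and under y by
  the two integral relations, hence under x + y and x y.\<close>

lemma algebraic_int_closed:
  fixes x y :: "'a::field_char_0"
  assumes "algebraic_int x" "algebraic_int y"
  shows algebraic_int_add: "algebraic_int (x + y)" and algebraic_int_mult: "algebraic_int (x * y)"
proof -
  obtain m where m: "m > 0" "x ^ m \<in> int_combs (\<lambda>i. x ^ i) {..<m}" using algebraic_int_relation[OF assms(1)] .
  obtain n where n: "n > 0" "y ^ n \<in> int_combs (\<lambda>i. y ^ i) {..<n}" using algebraic_int_relation[OF assms(2)] .
  define I where "I = {..<m} \<times> {..<n}"
  define w where "w = (\<lambda>(i, j). x ^ i * y ^ j)"
  have fin: "finite I" by (simp add: I_def)
  have x: "x * w k \<in> int_combs w I" if "k \<in> I" for k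
  proof -
    obtain i j where k: "k = (i, j)" "i < m" "j < n" using \<open>k \<in> I\<close> by (auto simp: I_def)
    show ?thesis
    proof (cases "Suc i < m")
      case True
      then have "w (Suc i, j) \<in> int_combs w I" using k by (intro int_combs_base fin) (auto simp: I_def)
      then show ?thesis by (simp add: w_def k mult.assoc)
    next
      case False
      then have "Suc i = m" using k by simp
      obtain c where c: "x ^ m = (\<Sum>i<m. of_int (c i) * x ^ i)" using m(2) unfolding int_combs_def by blast
      have "x * w k = x ^ m * y ^ j" using \<open>Suc i = m\<close> by (auto simp: w_def k)
      also have "\<dots> = (\<Sum>i<m. of_int (c i) * w (i, j))" by (simp add: c w_def sum_distrib_right mult.assoc)
      also have "\<dots> \<in> int_combs w I"
        using k by (intro int_combs_sum int_combs_scale int_combs_base fin) (auto simp: I_def)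
      finally show ?thesis .
    qed
  qed
  have y: "y * w k \<in> int_combs w I" if "k \<in> I" for k
  proof -
    obtain i j where k: "k = (i, j)" "i < m" "j < n" using \<open>k \<in> I\<close> by (auto simp: I_def)
    show ?thesis
    proof (cases "Suc j < n")
      case True
      then have "w (i, Suc j) \<in> int_combs w I" using k by (intro int_combs_base fin) (auto simp: I_def)
      then show ?thesis by (simp add: w_def k mult.left_commute)
    next
      case False
      then have "Suc j = n" using k by simp
      obtain c where c: "y ^ n = (\<Sum>i<n. of_int (c i) * y ^ i)" using n(2) unfolding int_combs_def by blast
      have "y * w k = x ^ i * y ^ n" using \<open>Suc j = n\<close> by (auto simp: w_def k)
      also have "\<dots> = (\<Sum>j<n. of_int (c j) * w (i, j))" by (simp add: c w_def sum_distrib_left mult.left_commute)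
      also have "\<dots> \<in> int_combs w I"
        using k by (intro int_combs_sum int_combs_scale int_combs_base fin) (auto simp: I_def)
      finally show ?thesis .
    qed
  qed
  have k: "(0, 0) \<in> I" "w (0, 0) \<noteq> 0" using m n by (auto simp: I_def w_def)
  show "algebraic_int (x + y)"
    by (rule algebraic_int_if_stable[where w=w, OF fin k]) (simp add: distrib_right int_combs_add x y)
  show "algebraic_int (x * y)"
    by (rule algebraic_int_if_stable[where w=w, OF fin k]) (simp add: mult.assoc int_combs_mult x y)
qed

lemma algebraic_int_diff: "algebraic_int x \<Longrightarrow> algebraic_int y \<Longrightarrow> algebraic_int (x - y :: 'a::field_char_0)"
  using algebraic_int_add[of x "- y"] by auto

lemma algebraic_int_sum: "(\<And>a. a \<in> A \<Longrightarrow> algebraic_int (g a)) \<Longrightarrow> algebraic_int (\<Sum>a\<in>A. g a :: 'a::field_char_0)"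
  by (induction A rule: infinite_finite_induct) (auto intro: algebraic_int_add)

lemma algebraic_int_of_int: "algebraic_int (of_int m :: 'a::field_char_0)"
  by (auto intro: int_imp_algebraic_int)

text \<open>Let c be the leading coefficient of an integer polynomial of degree m with root x. Then
  c x^m is an integer combination of lower powers, so the span of 1, ..., x^(m-1) is stable under c
  x.\<close>

lemma algebraic_int_multiple:
  fixes x :: "'f::number_field"
  obtains m :: nat where "m > 0" "algebraic_int (of_nat m * x)"
proof -
  obtain q where q: "q \<noteq> 0" "poly (rpoly q) x = 0" using exists_rat_poly by blast
  have "algebraic x"
    by (rule algebraicI'[of "rpoly q"]) (use q in \<open>auto simp: coeff_map_poly map_poly_eq_0_iff\<close>)
  then obtain p where p: "\<And>i. poly.coeff p i \<in> \<int>" "p \<noteq> 0" "poly p x = 0" unfolding algebraic_def by blast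
  define m where "m = Polynomial.degree p"
  have "\<forall>i. \<exists>k. poly.coeff p i = of_int k" using p(1) by (auto simp: Ints_def)
  then obtain c where c: "\<And>i. poly.coeff p i = of_int (c i)" by metis
  have p0: "0 = (\<Sum>i\<le>m. poly.coeff p i * x ^ i)" using p(3) by (simp add: poly_altdef m_def)
  have cm: "c m \<noteq> 0" using p(2) c[of m] by (auto simp: m_def)
  have "0 = (\<Sum>i<m. of_int (c i) * x ^ i) + of_int (c m) * x ^ m"
    using p0 by (simp add: lessThan_Suc_atMost[symmetric] c)
  then have eq: "of_int (c m) * x ^ m = (\<Sum>i<m. of_int (- c i) * x ^ i)"
    by (simp add: sum_negf eq_neg_iff_add_eq_0 add.commute)
  have m: "m > 0"
  proof (rule ccontr)
    assume "\<not> m > 0"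
    then show False using p0 cm by (simp add: c)
  qed
  have "algebraic_int (of_int (c m) * x)"
  proof (rule algebraic_int_if_stable[of "{..<m}" 0 "\<lambda>i. x ^ i"])
    fix i assume i: "i \<in> {..<m}"
    show "of_int (c m) * x * x ^ i \<in> int_combs (\<lambda>i. x ^ i) {..<m}"
    proof (cases "Suc i = m")
      case True
      then have "of_int (c m) * x * x ^ i = (\<Sum>i<m. of_int (- c i) * x ^ i)" using eq by (auto simp: mult.assoc)
      then show ?thesis by (simp only: int_combsI)
    next
      case False
      then have "x ^ Suc i \<in> int_combs (\<lambda>i. x ^ i) {..<m}" using i by (intro int_combs_base) auto
      then show ?thesis using int_combs_scale[of "x ^ Suc i" _ _ "c m"] by (simp add: mult.assoc)
    qed
  qed (use m in auto)
  then have "algebraic_int (of_nat (nat \<bar>c m\<bar>) * x)"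
    by (cases "c m \<ge> 0") (auto simp: of_nat_nat)
  then show ?thesis using that[of "nat \<bar>c m\<bar>"] cm by simp
qed

lemma algebraic_int_common_multiple:
  fixes f :: "'i \<Rightarrow> 'f::number_field"
  assumes "finite I"
  obtains m :: nat where "m > 0" "\<And>i. i \<in> I \<Longrightarrow> algebraic_int (of_nat m * f i)"
  using assms
proof (induction I arbitrary: thesis rule: finite_induct)
  case empty
  show ?case by (rule empty(1)[of 1]) auto
next
  case (insert i I)
  obtain m :: nat where m: "m > 0" "\<And>i. i \<in> I \<Longrightarrow> algebraic_int (of_nat m * f i)" using insert.IH by blast
  obtain k :: nat where k: "k > 0" "algebraic_int (of_nat k * f i)" using algebraic_int_multiple .
  have "algebraic_int (of_nat (m * k) * f j)" if "j \<in> insert i I" for j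
  proof (cases "j = i")
    case True
    then show ?thesis using algebraic_int_mult[OF algebraic_int_of_int[of "int m"] k(2)] by (simp add: mult.assoc)
  next
    case False
    then have "algebraic_int (of_nat m * f j)" using that m by auto
    from algebraic_int_mult[OF algebraic_int_of_int[of "int k"] this]
    show ?thesis by (simp add: mult_ac)
  qed
  then show ?case using insert.prems[of "m * k"] m k by simp
qed

lemma algebraic_int_embedding:
  fixes x :: "'f::number_field"
  assumes "\<sigma> \<in> complex_embeddings" "algebraic_int x"
  shows "algebraic_int (\<sigma> x)"
proof -
  obtain m where m: "m > 0" "x ^ m \<in> int_combs (\<lambda>i. x ^ i) {..<m}" using algebraic_int_relation[OF assms(2)] .
  obtain c where c: "x ^ m = (\<Sum>i<m. of_int (c i) * x ^ i)" using m(2) unfolding int_combs_def by blast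
  have pow: "\<sigma> (x ^ i) = \<sigma> x ^ i" for i by (induction i) (simp_all add: embeddingD[OF assms(1)])
  have eq: "\<sigma> x ^ m = (\<Sum>i<m. of_int (c i) * \<sigma> x ^ i)"
    using arg_cong[OF c, of \<sigma>] by (simp add: embeddingD[OF assms(1)] pow)
  show ?thesis
  proof (rule algebraic_int_if_stable[of "{..<m}" 0 "\<lambda>i. \<sigma> x ^ i"])
    fix i assume i: "i \<in> {..<m}"
    show "\<sigma> x * \<sigma> x ^ i \<in> int_combs (\<lambda>i. \<sigma> x ^ i) {..<m}"
    proof (cases "Suc i = m")
      case True
      then have "\<sigma> x * \<sigma> x ^ i = (\<Sum>i<m. of_int (c i) * \<sigma> x ^ i)" using eq by auto
      then show ?thesis by (simp only: int_combsI)
    next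
      case False
      then have "\<sigma> x ^ Suc i \<in> int_combs (\<lambda>i. \<sigma> x ^ i) {..<m}" using i by (intro int_combs_base) auto
      then show ?thesis by simp
    qed
  qed (use m in auto)
qed

text \<open>As a sum of conjugates the trace is an algebraic integer, and a rational algebraic
  integer is an integer.\<close>

lemma field_trace_int:
  assumes "algebraic_int (x::'f::number_field)"
  shows "field_trace x \<in> \<int>"
proof -
  have "algebraic_int (complex_of_rat (field_trace x))"
    unfolding of_rat_field_trace by (intro algebraic_int_sum algebraic_int_embedding assms)
  then have "complex_of_rat (field_trace x) \<in> \<int>"
    by (intro rational_algebraic_int_is_int) auto
  then obtain k where "complex_of_rat (field_trace x) = of_int k" by (auto elim: Ints_cases)
  then have "complex_of_rat (field_trace x) = complex_of_rat (of_int k)" by simp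
  then show ?thesis by (metis Ints_of_int of_rat_eq_iff)
qed

lemma field_trace_linear: "field_trace (x + y) = field_trace x + field_trace y"
  "field_trace (of_rat q * x) = q * field_trace (x :: 'f::number_field)"
proof -
  have "complex_of_rat (field_trace (x + y)) = complex_of_rat (field_trace x + field_trace y)"
    by (simp add: of_rat_field_trace of_rat_add embeddingD sum.distrib)
  then show "field_trace (x + y) = field_trace x + field_trace y" by (simp only: of_rat_eq_iff)
  have "complex_of_rat (field_trace (of_rat q * x)) = complex_of_rat (q * field_trace x)"
    by (simp add: of_rat_field_trace of_rat_mult embeddingD sum_distrib_left)
  then show "field_trace (of_rat q * x) = q * field_trace x" by (simp only: of_rat_eq_iff)
qed

lemma field_trace_sum: "field_trace (\<Sum>a\<in>A. g a) = (\<Sum>a\<in>A. field_trace (g a :: 'f::number_field))"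
  using field_trace_linear(2)[of 0 "0::'f"]
  by (induction A rule: infinite_finite_induct) (auto simp: field_trace_linear)

lemma field_trace_one: "field_trace (1::'f::number_field) = of_nat (field_degree TYPE('f))"
proof -
  have "complex_of_rat (field_trace (1::'f)) = complex_of_rat (of_nat (field_degree TYPE('f)))"
    by (simp add: of_rat_field_trace embeddingD finite_card_embeddings)
  then show ?thesis by (simp only: of_rat_eq_iff)
qed

lemma field_degree_pos: "field_degree TYPE('f::number_field) > 0"
proof -
  have "(rat_basis :: 'f set) \<noteq> {}"
  proof
    assume "(rat_basis :: 'f set) = {}"
    then have "(UNIV :: 'f set) = {0}" using rat_basis(2) ratvs.span_empty by metis
    then show False by (metis UNIV_I singletonD zero_neq_one)
  qed
  then show ?thesis using finite_rat_basis[where 'f='f] by (simp add: card_rat_basis[symmetric] card_gt_0_iff)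
qed

section \<open>Indices of subgroups\<close>

definition add_subgroup :: "'a::ab_group_add set \<Rightarrow> bool" where
  "add_subgroup A \<longleftrightarrow> 0 \<in> A \<and> (\<forall>x\<in>A. \<forall>y\<in>A. x - y \<in> A)"

lemma add_subgroupD:
  assumes "add_subgroup A"
  shows "0 \<in> A" "x \<in> A \<Longrightarrow> y \<in> A \<Longrightarrow> x - y \<in> A" "x \<in> A \<Longrightarrow> - x \<in> A" "x \<in> A \<Longrightarrow> y \<in> A \<Longrightarrow> x + y \<in> A"
proof -
  show 0: "0 \<in> A" and d: "x \<in> A \<Longrightarrow> y \<in> A \<Longrightarrow> x - y \<in> A" for x y using assms by (auto simp: add_subgroup_def)
  show m: "x \<in> A \<Longrightarrow> - x \<in> A" for x using d[OF 0, of x] by simp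
  show "x \<in> A \<Longrightarrow> y \<in> A \<Longrightarrow> x + y \<in> A" using d[of x "- y"] m[of y] by simp
qed

lemma add_subgroup_sum: "add_subgroup A \<Longrightarrow> (\<And>i. i \<in> I \<Longrightarrow> g i \<in> A) \<Longrightarrow> (\<Sum>i\<in>I. g i) \<in> A"
  by (induction I rule: infinite_finite_induct) (auto dest: add_subgroupD)

text \<open>The index [A : B]. Being the \<open>card\<close> of a possibly infinite set it is 0 for
  infinite index, so positivity has to be proved before logarithms are taken.\<close>

definition idx :: "'a::ab_group_add set \<Rightarrow> 'a set \<Rightarrow> nat" where
  "idx A B = card ((\<lambda>x. (+) x ` B) ` A)"

lemma coset_eq_iff:
  assumes "add_subgroup B"
  shows "(+) x ` B = (+) y ` B \<longleftrightarrow> x - y \<in> B"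
proof
  assume "(+) x ` B = (+) y ` B"
  then have "x + 0 \<in> (+) y ` B" using add_subgroupD(1)[OF assms] by blast
  then show "x - y \<in> B" by auto
next
  assume *: "x - y \<in> B"
  have "(+) x ` B \<subseteq> (+) y ` B" if "x - y \<in> B" for x y
  proof
    fix z assume "z \<in> (+) x ` B"
    then obtain b where "b \<in> B" "z = x + b" by auto
    then have "z = y + ((x - y) + b)" "(x - y) + b \<in> B" using that add_subgroupD(4)[OF assms] by auto
    then show "z \<in> (+) y ` B" by blast
  qed
  moreover have "y - x \<in> B" using add_subgroupD(3)[OF assms *] by simp
  ultimately show "(+) x ` B = (+) y ` B" using * by blast
qed

definition transversal :: "'a::ab_group_add set \<Rightarrow> 'a set \<Rightarrow> 'a set \<Rightarrow> bool" where
  "transversal T A B \<longleftrightarrow> T \<subseteq> A \<and> (\<forall>x\<in>A. \<exists>!t. t \<in> T \<and> x - t \<in> B)"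

lemma transversal_exists:
  assumes "add_subgroup B"
  obtains T where "transversal T A B"
proof -
  define T where "T = (\<lambda>c. SOME x. x \<in> A \<and> c = (+) x ` B) ` ((\<lambda>x. (+) x ` B) ` A)"
  have s: "(SOME z. z \<in> A \<and> (+) x ` B = (+) z ` B) \<in> A \<and> (+) x ` B = (+) (SOME z. z \<in> A \<and> (+) x ` B = (+) z ` B) ` B"
    if "x \<in> A" for x
    by (rule someI[of _ x]) (use that in auto)
  have "transversal T A B"
    unfolding transversal_def
  proof (intro conjI ballI)
    show "T \<subseteq> A" unfolding T_def using s by auto
    fix x assume x: "x \<in> A"
    define t where "t = (SOME z. z \<in> A \<and> (+) x ` B = (+) z ` B)"
    have t: "t \<in> T" "x - t \<in> B"
      using x s[OF x] coset_eq_iff[OF assms, of x t] unfolding T_def t_def by auto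
    have "u = t" if "u \<in> T" "x - u \<in> B" for u
    proof -
      obtain y where y: "y \<in> A" "u = (SOME z. z \<in> A \<and> (+) y ` B = (+) z ` B)" using \<open>u \<in> T\<close> unfolding T_def by auto
      have "(+) y ` B = (+) u ` B" using s[OF y(1)] y(2) by blast
      also have "\<dots> = (+) x ` B" using that(2) coset_eq_iff[OF assms, of x u] by simp
      finally show ?thesis using y(2) by (simp add: t_def)
    qed
    then show "\<exists>!t. t \<in> T \<and> x - t \<in> B" using t by blast
  qed
  then show ?thesis using that by blast
qed

lemma idx_transversal:
  assumes "add_subgroup B" "transversal T A B"
  shows "idx A B = card T"
proof -
  have TA: "T \<subseteq> A" and ex: "\<And>x. x \<in> A \<Longrightarrow> \<exists>!t. t \<in> T \<and> x - t \<in> B" using assms(2) by (auto simp: transversal_def)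
  have "(\<lambda>x. (+) x ` B) ` A = (\<lambda>x. (+) x ` B) ` T"
  proof
    show "(\<lambda>x. (+) x ` B) ` A \<subseteq> (\<lambda>x. (+) x ` B) ` T"
    proof
      fix c assume "c \<in> (\<lambda>x. (+) x ` B) ` A"
      then obtain x where "x \<in> A" "c = (+) x ` B" by auto
      moreover obtain t where "t \<in> T" "x - t \<in> B" using ex[OF \<open>x \<in> A\<close>] by blast
      ultimately show "c \<in> (\<lambda>x. (+) x ` B) ` T" using coset_eq_iff[OF assms(1), of x t] by auto
    qed
  qed (use TA in auto)
  moreover have "inj_on (\<lambda>x. (+) x ` B) T"
  proof (rule inj_onI)
    fix x y assume xy: "x \<in> T" "y \<in> T" "(+) x ` B = (+) y ` B"
    then have "x - y \<in> B" "x - x \<in> B" using coset_eq_iff[OF assms(1)] add_subgroupD(1)[OF assms(1)] by auto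
    then show "x = y" using ex[of x] xy TA by blast
  qed
  ultimately show ?thesis by (simp add: idx_def card_image)
qed

text \<open>Representatives of the kernels plus lifts of representatives of the images form a system
  of representatives of A modulo B. Counting pairs is compatible with \<open>card\<close> being 0 on
  infinite sets. Additivity of f is asked only on A, so that f may be the transport of a map known
  on a lattice alone.\<close>

lemma idx_exact:
  assumes A: "add_subgroup A" and B: "add_subgroup B" and BA: "B \<subseteq> A"
    and f: "\<And>x y. x \<in> A \<Longrightarrow> y \<in> A \<Longrightarrow> f (x + y) = f x + (f y :: 'b::ab_group_add)"
  shows "idx A B = idx {x \<in> A. f x = 0} {x \<in> B. f x = 0} * idx (f ` A) (f ` B)"
proof -
  have f0: "f 0 = 0" using f[of 0 0] add_subgroupD(1)[OF A] by simp
  have fd: "f (x - y) = f x - f y" if "x \<in> A" "y \<in> A" for x y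
    using f[of "x - y" y] add_subgroupD(2)[OF A that] that by (simp add: eq_diff_eq)
  have KB: "add_subgroup {x \<in> B. f x = 0}"
    using B BA f0 fd by (auto simp: add_subgroup_def subset_iff)
  have fB: "add_subgroup (f ` B)"
    unfolding add_subgroup_def
  proof (intro conjI ballI)
    show "0 \<in> f ` B" using f0 add_subgroupD(1)[OF B] by force
    fix u v assume "u \<in> f ` B" "v \<in> f ` B"
    then obtain x y where "x \<in> B" "y \<in> B" "u = f x" "v = f y" by auto
    then show "u - v \<in> f ` B" using fd[of x y] BA add_subgroupD(2)[OF B, of x y] by (metis image_eqI subsetD)
  qed
  obtain S where S: "transversal S {x \<in> A. f x = 0} {x \<in> B. f x = 0}" using transversal_exists[OF KB] .
  obtain U where U: "transversal U (f ` A) (f ` B)" using transversal_exists[OF fB] .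
  have SA: "\<And>s. s \<in> S \<Longrightarrow> s \<in> A \<and> f s = 0" and S1: "\<And>x. x \<in> A \<Longrightarrow> f x = 0 \<Longrightarrow> \<exists>!t. t \<in> S \<and> x - t \<in> {x \<in> B. f x = 0}"
    using S by (auto simp: transversal_def)
  have U1: "\<And>x. x \<in> A \<Longrightarrow> \<exists>!t. t \<in> U \<and> f x - t \<in> f ` B" and UA: "U \<subseteq> f ` A"
    using U by (auto simp: transversal_def)
  have "\<forall>u\<in>U. \<exists>x. x \<in> A \<and> f x = u" using UA by auto
  then obtain g where g: "\<And>u. u \<in> U \<Longrightarrow> g u \<in> A \<and> f (g u) = u" by metis
  define h where "h = (\<lambda>(s, u). s + g u)"
  have fh: "f (h (s, u)) = u" "h (s, u) \<in> A" if "s \<in> S" "u \<in> U" for s u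
    using SA[OF that(1)] g[OF that(2)] f add_subgroupD(4)[OF A] by (auto simp: h_def)
  have uniq: "p = q" if p: "p \<in> S \<times> U" and q: "q \<in> S \<times> U" and d: "h p - h q \<in> B" for p q
  proof -
    obtain s u s' u' where pq: "p = (s, u)" "q = (s', u')" "s \<in> S" "s' \<in> S" "u \<in> U" "u' \<in> U" using p q by auto
    have "f (h p) - f (h q) \<in> f ` B" using fd[of "h p" "h q"] fh pq d by (metis image_eqI)
    then have "u - u' \<in> f ` B" using fh pq by simp
    moreover have "u - u \<in> f ` B" using add_subgroupD(1)[OF fB] by simp
    ultimately have "u = u'" using U1[of "g u"] g pq by metis
    then have "s - s' \<in> B" using d by (simp add: pq h_def)
    then have "s = s'"
      using S1[of s] SA[OF pq(3)] SA[OF pq(4)] pq add_subgroupD(1)[OF B] f0 fd[of s s'] by fastforce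
    then show ?thesis using pq \<open>u = u'\<close> by simp
  qed
  have "transversal (h ` (S \<times> U)) A B"
    unfolding transversal_def
  proof (intro conjI ballI)
    show "h ` (S \<times> U) \<subseteq> A" using fh by auto
    fix x assume x: "x \<in> A"
    obtain u where u: "u \<in> U" "f x - u \<in> f ` B" using U1[OF x] by blast
    then obtain b where b: "b \<in> B" "f x - u = f b" by auto
    define k where "k = x - g u - b"
    have kA: "x - g u \<in> A" "b \<in> A" "k \<in> A" unfolding k_def using x g[OF u(1)] b BA add_subgroupD[OF A] by auto
    have fk: "f k = 0" unfolding k_def using fd[OF kA(1,2)] fd[OF x, of "g u"] g[OF u(1)] b by simp
    obtain s where s: "s \<in> S" "k - s \<in> B" using S1[OF kA(3) fk] by blast
    have "x - h (s, u) = b + (k - s)" by (simp add: h_def k_def)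
    then have xB: "x - h (s, u) \<in> B" using b s add_subgroupD(4)[OF B] by metis
    show "\<exists>!t. t \<in> h ` (S \<times> U) \<and> x - t \<in> B"
    proof (rule ex1I[of _ "h (s, u)"])
      show "h (s, u) \<in> h ` (S \<times> U) \<and> x - h (s, u) \<in> B" using s u xB by auto
      fix t assume t: "t \<in> h ` (S \<times> U) \<and> x - t \<in> B"
      then obtain q where q: "q \<in> S \<times> U" "t = h q" by auto
      have "h (s, u) - h q = (x - t) - (x - h (s, u))" using q by simp
      then have "h (s, u) - h q \<in> B" using t xB add_subgroupD(2)[OF B] by metis
      then show "t = h (s, u)" using uniq[of "(s, u)" q] s u q by auto
    qed
  qed
  then have "idx A B = card (h ` (S \<times> U))" by (rule idx_transversal[OF B])
  also have "\<dots> = card (S \<times> U)"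
    by (rule card_image, rule inj_onI, rule uniq) (use add_subgroupD(1)[OF B] in auto)
  also have "\<dots> = idx {x \<in> A. f x = 0} {x \<in> B. f x = 0} * idx (f ` A) (f ` B)"
    by (simp add: card_cartesian_product idx_transversal[OF KB S] idx_transversal[OF fB U])
  finally show ?thesis .
qed

lemma idx_same: "add_subgroup A \<Longrightarrow> idx A A = 1"
proof -
  assume A: "add_subgroup A"
  have "transversal {0} A A" using add_subgroupD[OF A] by (auto simp: transversal_def)
  from idx_transversal[OF A this] show ?thesis by simp
qed

lemma idx_image:
  assumes B: "add_subgroup B" and BA: "B \<subseteq> A" and A: "add_subgroup A"
    and inj: "inj_on f A" and f: "\<And>x y. x \<in> A \<Longrightarrow> y \<in> A \<Longrightarrow> f (x + y) = f x + (f y :: 'b::ab_group_add)"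
  shows "idx (f ` A) (f ` B) = idx A B"
proof -
  have f0: "f 0 = 0" using f[of 0 0] add_subgroupD(1)[OF A] by simp
  have "{x \<in> A. f x = 0} = {0}" "{x \<in> B. f x = 0} = {0}"
    using inj f0 BA add_subgroupD(1)[OF A] add_subgroupD(1)[OF B] by (auto dest: inj_onD[of f A _ 0])
  moreover have "idx {0 :: 'a} {0} = 1" by (rule idx_same) (simp add: add_subgroup_def)
  ultimately show ?thesis using idx_exact[OF A B BA f] by simp
qed

text \<open>\<open>s a g\<close> stands for the a-fold multiple of the generator indexed by g. If m
  times each generator lies in B, coefficients matter only modulo m, which leaves at most m ^ card G
  cosets.\<close>

lemma idx_pos:
  assumes A: "add_subgroup A" and B: "add_subgroup B" and m: "m > 0" and G: "finite G"
    and gen: "\<And>x. x \<in> A \<Longrightarrow> \<exists>c. x = (\<Sum>g\<in>G. s (c g :: int) g)"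
    and s: "\<And>a b g. s (a + b) g = s a g + s b g"
    and mB: "\<And>a g. g \<in> G \<Longrightarrow> s (int m * a) g \<in> B"
  shows "idx A B > 0" "finite ((\<lambda>x. (+) x ` B) ` A)"
proof -
  define F where "F = (\<lambda>c. (+) (\<Sum>g\<in>G. s (c g) g) ` B) ` (G \<rightarrow>\<^sub>E {0..<int m})"
  have "(\<lambda>x. (+) x ` B) ` A \<subseteq> F"
  proof
    fix C assume "C \<in> (\<lambda>x. (+) x ` B) ` A"
    then obtain x where x: "x \<in> A" "C = (+) x ` B" by auto
    obtain c where c: "x = (\<Sum>g\<in>G. s (c g) g)" using gen[OF x(1)] by blast
    define r where "r = (\<lambda>g\<in>G. c g mod int m)"
    have "x = (\<Sum>g\<in>G. s (int m * (c g div int m)) g) + (\<Sum>g\<in>G. s (r g) g)"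
      unfolding c sum.distrib[symmetric] by (intro sum.cong) (auto simp: r_def s[symmetric])
    then have "x - (\<Sum>g\<in>G. s (r g) g) \<in> B" by (simp add: add_subgroup_sum[OF B] mB)
    then have "C = (+) (\<Sum>g\<in>G. s (r g) g) ` B" using x(2) coset_eq_iff[OF B] by simp
    moreover have "r \<in> G \<rightarrow>\<^sub>E {0..<int m}" using m by (auto simp: r_def)
    ultimately show "C \<in> F" unfolding F_def by blast
  qed
  moreover have "finite F" unfolding F_def using G by (intro finite_imageI finite_PiE) auto
  ultimately show fin: "finite ((\<lambda>x. (+) x ` B) ` A)" by (rule finite_subset)
  show "idx A B > 0" unfolding idx_def using fin add_subgroupD(1)[OF A] by (auto simp: card_gt_0_iff)
qed

section \<open>Lattices in a number field\<close>

definition emb_list :: "('f::number_field \<Rightarrow> complex) list" where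
  "emb_list = (SOME es. distinct es \<and> set es = complex_embeddings)"

lemma emb_list: "distinct (emb_list :: ('f::number_field \<Rightarrow> complex) list)"
  "set (emb_list :: ('f \<Rightarrow> complex) list) = complex_embeddings"
  "length (emb_list :: ('f \<Rightarrow> complex) list) = field_degree TYPE('f)"
proof -
  have "\<exists>es. distinct es \<and> set es = (complex_embeddings :: ('f \<Rightarrow> complex) set)"
    using finite_distinct_list[OF finite_card_embeddings(1)] by blast
  from someI_ex[OF this] show *: "distinct (emb_list :: ('f \<Rightarrow> complex) list)"
    "set (emb_list :: ('f \<Rightarrow> complex) list) = complex_embeddings" by (auto simp: emb_list_def)
  then show "length (emb_list :: ('f \<Rightarrow> complex) list) = field_degree TYPE('f)"
    using distinct_card[OF *(1)] by (simp add: finite_card_embeddings)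
qed

lemma emb_list_nth: "i < field_degree TYPE('f::number_field) \<Longrightarrow> (emb_list ! i :: 'f \<Rightarrow> complex) \<in> complex_embeddings"
  using emb_list(2,3) nth_mem by metis

lemma sum_emb_list:
  "(\<Sum>i<field_degree TYPE('f). g (emb_list ! i)) = (\<Sum>\<sigma>\<in>(complex_embeddings :: ('f::number_field \<Rightarrow> complex) set). g \<sigma>)"
  using sum.reindex_bij_betw[OF bij_betw_nth[OF emb_list(1) _ emb_list(2)[symmetric]], of "{..<field_degree TYPE('f)}" g]
  by (simp add: emb_list)

lemma prod_emb_list:
  "(\<Prod>i<field_degree TYPE('f). g (emb_list ! i)) = (\<Prod>\<sigma>\<in>(complex_embeddings :: ('f::number_field \<Rightarrow> complex) set). g \<sigma>)"
  using prod.reindex_bij_betw[OF bij_betw_nth[OF emb_list(1) _ emb_list(2)[symmetric]], of "{..<field_degree TYPE('f)}" g]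
  by (simp add: emb_list)

definition embmat :: "'f::number_field list \<Rightarrow> complex mat" where
  "embmat bs = Matrix.mat (field_degree TYPE('f)) (field_degree TYPE('f)) (\<lambda>(i, j). (emb_list ! i) (bs ! j))"

lemma embmat_carrier [simp]:
  "embmat (bs :: 'f::number_field list) \<in> carrier_mat (field_degree TYPE('f)) (field_degree TYPE('f))"
  "dim_row (embmat bs) = field_degree TYPE('f)" "dim_col (embmat bs) = field_degree TYPE('f)"
  by (auto simp: embmat_def)

text \<open>Up to a power of two, the covolume of the lattice spanned by \<open>bs\<close> in \<open>\<Prod>\<^sub>v F\<^sub>v\<close>.\<close>

definition vol :: "'f::number_field list \<Rightarrow> real" where
  "vol bs = (if length bs = field_degree TYPE('f) then cmod (Determinant.det (embmat bs)) else 0)"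

lemma embmat_combination:
  fixes bs cs :: "'f::number_field list"
  assumes "\<And>j. j < field_degree TYPE('f) \<Longrightarrow> cs ! j = (\<Sum>k<field_degree TYPE('f). of_rat (q k j) * bs ! k)"
  shows "embmat cs = embmat bs * Matrix.mat (field_degree TYPE('f)) (field_degree TYPE('f)) (\<lambda>(k, j). of_rat (q k j))"
  by (rule eq_matI) (auto simp: embmat_def scalar_prod_def assms emb_list_nth embeddingD lessThan_atLeast0 mult.commute
      intro!: sum.cong)

lemma det_rat_mat:
  "Determinant.det (Matrix.mat n n (\<lambda>(k, j). of_rat (q k j)) :: complex mat)
    = of_rat (Determinant.det (Matrix.mat n n (\<lambda>(k, j). q k j)))"
proof -
  have "Matrix.mat n n (\<lambda>(k, j). complex_of_rat (q k j)) = map_mat of_rat (Matrix.mat n n (\<lambda>(k, j). q k j))"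
    by (rule eq_matI) auto
  then show ?thesis by (simp only: of_rat_hom.hom_det)
qed

lemma det_int_mat:
  "Determinant.det (Matrix.mat n n (\<lambda>(k, j). of_int (q k j)) :: 'a::comm_ring_1 mat)
    = of_int (Determinant.det (Matrix.mat n n (\<lambda>(k, j). q k j)))"
proof -
  have "Matrix.mat n n (\<lambda>(k, j). of_int (q k j) :: 'a) = map_mat of_int (Matrix.mat n n (\<lambda>(k, j). q k j))"
    by (rule eq_matI) auto
  then show ?thesis by (simp only: of_int_hom.hom_det)
qed

abbreviation zspan :: "'a::field_char_0 list \<Rightarrow> 'a set" where
  "zspan bs \<equiv> int_combs ((!) bs) {..<length bs}"

lemma zspan_eq: "zspan bs = {(\<Sum>i<length bs. of_int (c i) * bs ! i) | c. True}"
  by (simp add: int_combs_def)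

lemma add_subgroup_int_combs: "add_subgroup (int_combs w I)"
proof -
  have "(\<Sum>i\<in>I. of_int 0 * w i) \<in> int_combs w I" by (rule int_combsI)
  moreover have "x - y \<in> int_combs w I" if "x \<in> int_combs w I" "y \<in> int_combs w I" for x y
    using int_combs_add[OF that(1) int_combs_scale[OF that(2), of "-1"]] by simp
  ultimately show ?thesis by (simp add: add_subgroup_def)
qed

text \<open>What a triangular change of basis needs to know of \<open>vol\<close>. The tail
  \<open>vs\<close> is arbitrary so that an induction over initial segments can keep the later
  vectors fixed.\<close>

definition volume_like :: "('a::field_char_0 list \<Rightarrow> real) \<Rightarrow> bool" where
  "volume_like V \<longleftrightarrow> (\<forall>us b vs c u. u \<in> zspan us \<longrightarrow> V (us @ (of_int c * b + u) # vs) = \<bar>of_int c\<bar> * V (us @ b # vs))"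

lemma volume_like_vol: "volume_like (vol :: 'f::number_field list \<Rightarrow> real)"
  unfolding volume_like_def
proof (intro allI impI)
  fix us vs :: "'f list" and b u :: 'f and c :: int
  assume "u \<in> zspan us"
  then obtain a where a: "u = (\<Sum>i<length us. of_int (a i) * us ! i)" unfolding zspan_eq by blast
  let ?n = "field_degree TYPE('f)" and ?cs = "us @ (of_int c * b + u) # vs" and ?bs = "us @ b # vs"
  show "vol ?cs = \<bar>of_int c\<bar> * vol ?bs"
  proof (cases "length ?bs = ?n")
    case True
    define j where "j = length us"
    have j: "j < ?n" using True by (simp add: j_def)
    \<comment> \<open>The change of basis is the identity except in column j, which has the
      coefficients of u above the diagonal and c on it; its determinant is c.\<close>
    define q where "q = (\<lambda>k l. if l = j then (if k < j then a k else if k = j then c else 0) else if k = l then 1 else 0 :: int)"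
    have "?cs ! l = (\<Sum>k<?n. of_rat (of_int (q k l)) * ?bs ! k)" if l: "l < ?n" for l
    proof (cases "l = j")
      case False
      have "(\<Sum>k<?n. of_rat (of_int (q k l)) * ?bs ! k) = (\<Sum>k<?n. if k = l then ?bs ! k else 0)"
        using False by (intro sum.cong) (auto simp: q_def)
      also have "\<dots> = ?bs ! l" using l by simp
      also have "\<dots> = ?cs ! l" using False by (auto simp: nth_append nth_Cons j_def split: nat.split)
      finally show ?thesis by simp
    next
      case True
      have "(\<Sum>k<?n. of_rat (of_int (q k l)) * ?bs ! k) = (\<Sum>k<Suc j. of_rat (of_int (q k l)) * ?bs ! k)"
        using j by (intro sum.mono_neutral_right) (auto simp: q_def True)
      also have "\<dots> = (\<Sum>k<j. of_int (a k) * us ! k) + of_int c * b"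
        by (simp add: q_def True nth_append j_def)
      finally show ?thesis using True by (simp add: a j_def)
    qed
    from embmat_combination[of ?cs "\<lambda>k l. of_int (q k l)" ?bs, OF this]
    have "embmat ?cs = embmat ?bs * Matrix.mat ?n ?n (\<lambda>(k, l). of_int (q k l))" by simp
    then have "Determinant.det (embmat ?cs) = Determinant.det (embmat ?bs) *
        of_int (Determinant.det (Matrix.mat ?n ?n (\<lambda>(k, l). q k l)))"
      by (simp add: det_mult[of _ ?n] det_int_mat)
    also have "Determinant.det (Matrix.mat ?n ?n (\<lambda>(k, l). q k l)) = (\<Prod>i = 0..<?n. q i i)"
      by (subst det_upper_triangular[of _ ?n]) (auto simp: prod_list_diag_prod q_def)
    also have "\<dots> = (\<Prod>i = 0..<?n. if i = j then c else 1)" by (intro prod.cong) (auto simp: q_def)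
    also have "\<dots> = c" using j by simp
    finally show ?thesis using True by (simp add: vol_def norm_mult)
  qed (simp add: vol_def)
qed

definition zindep :: "'a::field_char_0 list \<Rightarrow> bool" where
  "zindep bs \<longleftrightarrow> (\<forall>c. (\<Sum>i<length bs. of_int (c i) * bs ! i) = 0 \<longrightarrow> (\<forall>i<length bs. c i = 0))"

lemma zspan_snoc: "zspan (bs @ [b]) = {u + of_int k * b | u k. u \<in> zspan bs}"
proof -
  have *: "(\<Sum>i<length (bs @ [b]). of_int (c i) * (bs @ [b]) ! i) = (\<Sum>i<length bs. of_int (c i) * bs ! i) + of_int (c (length bs)) * b" for c
    by (simp add: nth_append)
  show ?thesis
  proof (intro equalityI subsetI)
    fix x assume "x \<in> zspan (bs @ [b])"
    then obtain c where "x = (\<Sum>i<length (bs @ [b]). of_int (c i) * (bs @ [b]) ! i)" unfolding zspan_eq by blast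
    then show "x \<in> {u + of_int k * b | u k. u \<in> zspan bs}" unfolding * using int_combsI by blast
  next
    fix x assume "x \<in> {u + of_int k * b | u k. u \<in> zspan bs}"
    then obtain c k where x: "x = (\<Sum>i<length bs. of_int (c i) * bs ! i) + of_int k * b" unfolding zspan_eq by blast
    have "x = (\<Sum>i<length (bs @ [b]). of_int ((c(length bs := k)) i) * (bs @ [b]) ! i)"
      unfolding * x by simp
    then show "x \<in> zspan (bs @ [b])" by (simp only: int_combsI)
  qed
qed

lemma zspan_snocI: "u \<in> zspan bs \<Longrightarrow> u + of_int k * b \<in> zspan (bs @ [b])"
  unfolding zspan_snoc by blast

lemma zspan_snocE:
  assumes "x \<in> zspan (bs @ [b])"
  obtains u k where "u \<in> zspan bs" "x = u + of_int k * b"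
  using assms unfolding zspan_snoc by blast

lemma zspanE:
  assumes "x \<in> zspan bs"
  obtains c where "x = (\<Sum>i<length bs. of_int (c i) * bs ! i)"
  using assms unfolding int_combs_def by blast

lemma add_subgroup_scale:
  assumes "add_subgroup M" "w \<in> M"
  shows "of_int k * w \<in> (M :: 'a::ring_1 set)"
proof -
  have n: "of_nat j * w \<in> M" for j :: nat
    by (induction j) (simp_all add: distrib_right add_subgroupD(1)[OF assms(1)] add_subgroupD(4)[OF assms(1) assms(2)])
  show ?thesis
  proof (cases "k \<ge> 0")
    case True
    then show ?thesis using n[of "nat k"] by (simp add: of_nat_nat)
  next
    case False
    then show ?thesis using add_subgroupD(3)[OF assms(1) n[of "nat (- k)"]] by (simp add: of_nat_nat)
  qed
qed

lemma zindep_snoc: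
  assumes "zindep (bs @ [b])"
  shows "zindep bs" "u \<in> zspan bs \<Longrightarrow> u' \<in> zspan bs \<Longrightarrow> u + of_int k * b = u' + of_int k' * b \<Longrightarrow> k = k' \<and> u = u'"
proof -
  have *: "(\<Sum>i<length (bs @ [b]). of_int ((c(length bs := k)) i) * (bs @ [b]) ! i) = (\<Sum>i<length bs. of_int (c i) * bs ! i) + of_int k * b" for c k
    by (simp add: nth_append)
  have D: "(\<forall>i<length bs. c i = 0) \<and> k = 0" if "(\<Sum>i<length bs. of_int (c i) * bs ! i) + of_int k * b = 0" for c k
  proof -
    have "\<forall>i<length (bs @ [b]). (c(length bs := k)) i = 0"
      using assms that unfolding zindep_def *[symmetric] by blast
    then have h: "(c(length bs := k)) i = 0" if "i < Suc (length bs)" for i using that by simp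
    have "c i = 0" if "i < length bs" for i using h[of i] that by simp
    then show ?thesis using h[of "length bs"] by simp
  qed
  show "zindep bs" unfolding zindep_def using D[of _ 0] by auto
  assume u: "u \<in> zspan bs" "u' \<in> zspan bs" and eq: "u + of_int k * b = u' + of_int k' * b"
  have "u - u' \<in> zspan bs" using add_subgroupD(2)[OF add_subgroup_int_combs u] .
  then obtain c where c: "u - u' = (\<Sum>i<length bs. of_int (c i) * bs ! i)" unfolding zspan_eq by blast
  have "(\<Sum>i<length bs. of_int (c i) * bs ! i) + of_int (k - k') * b = 0"
    unfolding c[symmetric] using eq by (simp add: algebra_simps)
  from D[OF this] show "k = k' \<and> u = u'" using c by simp
qed

lemma int_subgroup:
  assumes "add_subgroup (S :: int set)" "m \<in> S" "m > 0"
  obtains c where "c > 0" "S = range ((*) c)" "idx UNIV S = nat c"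
proof -
  define c where "c = int (LEAST k. k > 0 \<and> int k \<in> S)"
  have "\<exists>k. k > 0 \<and> int k \<in> S" using assms(2,3) by (intro exI[of _ "nat m"]) auto
  from LeastI_ex[OF this] have c: "c > 0" "c \<in> S" by (auto simp: c_def)
  have least: "c \<le> k" if "k \<in> S" "k > 0" for k
    unfolding c_def using Least_le[of "\<lambda>k. k > 0 \<and> int k \<in> S" "nat k"] that by simp
  have mult: "of_nat k * c \<in> S" for k :: nat
    by (induction k) (auto simp: distrib_right add_subgroupD[OF assms(1)] c)
  have mult': "c * k \<in> S" for k
    using mult[of "nat k"] add_subgroupD(3)[OF assms(1) mult[of "nat (- k)"]] by (cases "k \<ge> 0") (auto simp: mult.commute)
  have "k \<in> range ((*) c)" if k: "k \<in> S" for k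
  proof -
    have "k mod c \<in> S" using add_subgroupD(2)[OF assms(1) k mult'[of "k div c"]] by (simp add: minus_mult_div_eq_mod)
    moreover have "k mod c < c" "k mod c \<ge> 0" using c by auto
    ultimately have "k mod c = 0" using least[of "k mod c"] by linarith
    then show ?thesis by (metis mult_div_mod_eq add.right_neutral rangeI)
  qed
  then have S: "S = range ((*) c)" using mult' by auto
  have "transversal {0..<c} UNIV S"
    unfolding transversal_def S
  proof (intro conjI ballI subset_UNIV)
    fix x :: int
    show "\<exists>!t. t \<in> {0..<c} \<and> x - t \<in> range ((*) c)"
    proof (rule ex1I[of _ "x mod c"])
      show "x mod c \<in> {0..<c} \<and> x - x mod c \<in> range ((*) c)"
        using c(1) by (auto simp: minus_mod_eq_mult_div)
      fix t assume t: "t \<in> {0..<c} \<and> x - t \<in> range ((*) c)"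
      then obtain k where "x = t + c * k" by (auto simp: algebra_simps)
      then show "t = x mod c" using t by simp
    qed
  qed
  from idx_transversal[OF assms(1) this] have "idx UNIV S = nat c" by simp
  then show ?thesis using that c S by blast
qed

text \<open>The new basis is triangular with respect to the old one, so the index is the product of the
  diagonal entries.\<close>

lemma sublattice_basis_aux:
  fixes bs :: "'a::field_char_0 list"
  assumes V: "volume_like V"
  shows "zindep bs \<Longrightarrow> add_subgroup M \<Longrightarrow> M \<subseteq> zspan bs \<Longrightarrow> m > 0 \<Longrightarrow> (\<And>x. x \<in> zspan bs \<Longrightarrow> of_nat m * x \<in> M) \<Longrightarrow>
    \<exists>cs. length cs = length bs \<and> zspan cs = M \<and> idx (zspan bs) M > 0 \<and>
      (\<forall>vs. V (cs @ vs) = real (idx (zspan bs) M) * V (bs @ vs))"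
proof (induction bs arbitrary: M rule: rev_induct)
  case Nil
  have "zspan [] = ({0} :: 'a set)" by (simp add: int_combs_def)
  then have "M = {0}" using Nil(3) add_subgroupD(1)[OF Nil(2)] by auto
  then show ?case using idx_same[OF Nil(2)] by (intro exI[of _ "[]"]) (auto simp: int_combs_def)
next
  case (snoc b bs)
  let ?L = "zspan (bs @ [b])"
  note ind = zindep_snoc[OF snoc.prems(1)]
  \<comment> \<open>\<rho> reads off the coefficient of b, which is well defined by independence.
    Its kernel in M is a sublattice of the span of bs, covered by the induction hypothesis; its
    image is a subgroup of the integers.\<close>
  define \<rho> where "\<rho> = (\<lambda>x. THE k. \<exists>u\<in>zspan bs. x = u + of_int k * b)"
  have \<rho>: "\<rho> (u + of_int k * b) = k" if "u \<in> zspan bs" for u k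
    unfolding \<rho>_def by (rule the_equality) (use that ind(2) in blast)+
  have L: "\<And>x. x \<in> ?L \<Longrightarrow> \<exists>u k. u \<in> zspan bs \<and> x = u + of_int k * b" unfolding zspan_snoc by blast
  have Lsub: "add_subgroup ?L" by (rule add_subgroup_int_combs)
  have add: "\<rho> (x + y) = \<rho> x + \<rho> y" if xy: "x \<in> ?L" "y \<in> ?L" for x y
  proof -
    obtain u k u' k' where *: "u \<in> zspan bs" "x = u + of_int k * b" "u' \<in> zspan bs" "y = u' + of_int k' * b"
      using L[OF xy(1)] L[OF xy(2)] by blast
    then have "x + y = (u + u') + of_int (k + k') * b" by (simp add: algebra_simps)
    then have "\<rho> (x + y) = k + k'" using \<rho>[OF int_combs_add[OF *(1,3)], of "k + k'"] by metis
    then show ?thesis using * \<rho> by simp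
  qed
  have ker: "x \<in> zspan bs" if "x \<in> ?L" "\<rho> x = 0" for x
    using L[OF that(1)] that(2) \<rho> by force
  have ker': "\<rho> x = 0" "x \<in> ?L" if "x \<in> zspan bs" for x
    using \<rho>[OF that, of 0] zspan_snocI[OF that, of 0 b] by simp_all
  have b: "of_int k * b \<in> ?L" for k
    using zspan_snocI[OF add_subgroupD(1)[OF add_subgroup_int_combs], of k b bs] by simp
  have \<rho>L: "\<rho> ` ?L = UNIV"
  proof -
    have "k \<in> \<rho> ` ?L" for k
      using \<rho>[OF add_subgroupD(1)[OF add_subgroup_int_combs], of k] b[of k] by (metis add_0 image_eqI)
    then show ?thesis by blast
  qed
  define M' where "M' = {x \<in> M. \<rho> x = 0}"
  have M: "add_subgroup M" "M \<subseteq> ?L" by fact+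
  have d: "\<rho> (x - y) = \<rho> x - \<rho> y" if "x \<in> ?L" "y \<in> ?L" for x y
    using add[of "x - y" y] add_subgroupD(2)[OF Lsub that] that by (simp add: eq_diff_eq)
  have M': "add_subgroup M'" "M' \<subseteq> zspan bs"
    using M d ker add_subgroupD(1)[OF M(1)] ker'(1)[OF add_subgroupD(1)[OF add_subgroup_int_combs]]
    by (auto simp: M'_def add_subgroup_def subset_iff)
  have "of_nat m * x \<in> M'" if "x \<in> zspan bs" for x
    unfolding M'_def
    using that snoc.prems(5)[OF ker'(2)[OF that]] ker'(1)[of "of_nat m * x"] int_combs_scale[OF that, of "int m"] by simp
  from snoc.IH[OF ind(1) M' snoc.prems(4) this]
  obtain cs where cs: "length cs = length bs" "zspan cs = M'" "idx (zspan bs) M' > 0"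
    "\<And>vs. V (cs @ vs) = real (idx (zspan bs) M') * V (bs @ vs)" by blast
  have S: "add_subgroup (\<rho> ` M)"
    unfolding add_subgroup_def
  proof (intro conjI ballI)
    show "0 \<in> \<rho> ` M" using add_subgroupD(1)[OF M'(1)] by (force simp: M'_def)
    fix k l assume "k \<in> \<rho> ` M" "l \<in> \<rho> ` M"
    then obtain x y where "x \<in> M" "y \<in> M" "k = \<rho> x" "l = \<rho> y" by auto
    then show "k - l \<in> \<rho> ` M" using d[of x y] M add_subgroupD(2)[OF M(1), of x y] by (metis image_eqI subsetD)
  qed
  have "of_nat m * b \<in> M" using snoc.prems(5)[of b] b[of 1] by simp
  moreover have "\<rho> (of_nat m * b) = int m" using \<rho>[OF add_subgroupD(1)[OF add_subgroup_int_combs], of "int m"] by simp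
  ultimately have "int m \<in> \<rho> ` M" by (metis image_eqI)
  then obtain c where c: "c > 0" "\<rho> ` M = range ((*) c)" "idx UNIV (\<rho> ` M) = nat c"
    using int_subgroup[OF S, of "int m"] snoc.prems(4) by auto
  \<comment> \<open>A preimage w of the generator c of the image completes the basis. Its
    coefficient at b is c, so the volume and the index both acquire the factor c.\<close>
  have "c \<in> \<rho> ` M" unfolding c(2) using image_iff by fastforce
  then obtain w where w: "w \<in> M" "\<rho> w = c" by auto
  obtain u where u: "u \<in> zspan bs" "w = of_int c * b + u"
    using L[of w] M(2) w \<rho> by (metis add.commute subsetD)
  have idx: "idx ?L M = idx (zspan bs) M' * nat c"
  proof -
    have "{x \<in> ?L. \<rho> x = 0} = zspan bs" using ker ker' by auto
    moreover have "idx ?L M = idx {x \<in> ?L. \<rho> x = 0} M' * idx (\<rho> ` ?L) (\<rho> ` M)"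
      unfolding M'_def by (rule idx_exact[OF Lsub M]) (rule add)
    ultimately show ?thesis by (simp only: \<rho>L c(3))
  qed
  have "zspan (cs @ [w]) = M"
  proof (intro equalityI subsetI)
    fix x assume "x \<in> zspan (cs @ [w])"
    then obtain y k where "y \<in> M'" "x = y + of_int k * w" unfolding cs(2)[symmetric] by (rule zspan_snocE)
    then show "x \<in> M" using add_subgroupD(4)[OF M(1) _ add_subgroup_scale[OF M(1) w(1)]] by (simp add: M'_def)
  next
    fix x assume x: "x \<in> M"
    then have "\<rho> x \<in> range ((*) c)" unfolding c(2)[symmetric] by (rule imageI)
    then obtain k where k: "\<rho> x = c * k" by (rule imageE)
    have kw: "of_int k * w \<in> M" by (rule add_subgroup_scale[OF M(1) w(1)])
    have "of_int k * w = of_int k * u + of_int (c * k) * b" by (simp add: u algebra_simps)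
    then have "\<rho> (of_int k * w) = c * k" using \<rho>[OF int_combs_scale[OF u(1)], of k "c * k"] by metis
    then have "\<rho> (x - of_int k * w) = 0" using d[OF subsetD[OF M(2) x] subsetD[OF M(2) kw]] k by simp
    then have "x - of_int k * w \<in> M'" unfolding M'_def using add_subgroupD(2)[OF M(1) x kw] by simp
    then show "x \<in> zspan (cs @ [w])" using zspan_snocI[of "x - of_int k * w" cs k w] by (simp add: cs(2))
  qed
  moreover have "V ((cs @ [w]) @ vs) = real (idx ?L M) * V ((bs @ [b]) @ vs)" for vs
  proof -
    have "V ((cs @ [w]) @ vs) = real (idx (zspan bs) M') * V (bs @ w # vs)" using cs(4)[of "w # vs"] by simp
    also have "V (bs @ w # vs) = \<bar>of_int c\<bar> * V (bs @ b # vs)"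
      using V u unfolding volume_like_def by blast
    finally show ?thesis using c(1) unfolding idx by simp
  qed
  moreover have "idx ?L M > 0" unfolding idx using cs(3) c(1) by simp
  ultimately show ?case using cs(1) by (intro exI[of _ "cs @ [w]"]) simp
qed

lemma vol_nonzero_indep:
  fixes bs :: "'f::number_field list"
  assumes "vol bs \<noteq> 0" "(\<Sum>k<length bs. of_rat (q k) * bs ! k) = 0" "k < length bs"
  shows "q k = 0"
proof (rule ccontr)
  assume qk: "q k \<noteq> 0"
  let ?n = "field_degree TYPE('f)"
  have len: "length bs = ?n" and det: "Determinant.det (embmat bs) \<noteq> 0"
    using assms(1) by (auto simp: vol_def split: if_splits)
  define v where "v = Matrix.vec ?n (\<lambda>k. complex_of_rat (q k))"
  have "embmat bs *\<^sub>v v = 0\<^sub>v ?n"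
  proof (rule eq_vecI)
    fix i assume "i < dim_vec (0\<^sub>v ?n :: complex Matrix.vec)"
    then have i: "i < ?n" by simp
    have "(embmat bs *\<^sub>v v) $ i = (\<Sum>k<?n. (emb_list ! i) (bs ! k) * of_rat (q k))"
      using i by (simp add: embmat_def v_def scalar_prod_def lessThan_atLeast0)
    also have "\<dots> = (emb_list ! i) (\<Sum>k<?n. of_rat (q k) * bs ! k)"
      using i by (simp add: embeddingD emb_list_nth mult.commute)
    also have "\<dots> = 0" using assms(2) i by (simp add: len embeddingD emb_list_nth)
    finally show "(embmat bs *\<^sub>v v) $ i = 0\<^sub>v ?n $ i" using i by simp
  qed (simp add: embmat_def)
  moreover have "v \<noteq> 0\<^sub>v ?n"
  proof
    assume "v = 0\<^sub>v ?n"
    then have "v $ k = 0" using assms(3) len by simp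
    then show False using qk assms(3) len by (simp add: v_def)
  qed
  moreover have "v \<in> carrier_vec ?n" by (simp add: v_def)
  ultimately have "Determinant.det (embmat bs) = 0"
    using det_0_iff_vec_prod_zero[of "embmat bs" ?n] embmat_carrier(1)[of bs] by blast
  then show False using det by simp
qed

lemma vol_nonzero_zindep: "vol bs \<noteq> 0 \<Longrightarrow> zindep bs"
  unfolding zindep_def
proof (intro allI impI)
  fix c i assume *: "vol bs \<noteq> 0" "(\<Sum>i<length bs. of_int (c i) * bs ! i) = 0" "i < length bs"
  show "c i = 0" using vol_nonzero_indep[OF *(1), of "\<lambda>i. of_int (c i)" i] * by simp
qed

text \<open>A vector in the left kernel of \<open>embmat bs\<close> is a linear relation between the
  embeddings that holds on bs, hence on the whole rational span, against independence.\<close>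

lemma vol_nonzero_if_spanning:
  fixes bs :: "'f::number_field list"
  assumes len: "length bs = field_degree TYPE('f)" and span: "\<And>x. \<exists>q. x = (\<Sum>k<length bs. of_rat (q k) * bs ! k)"
  shows "vol bs \<noteq> 0"
proof
  let ?n = "field_degree TYPE('f)"
  assume "vol bs = 0"
  then have "Determinant.det (transpose_mat (embmat bs)) = 0"
    using len by (simp add: vol_def Determinant.det_transpose[OF embmat_carrier(1)])
  then obtain v where v: "v \<in> carrier_vec ?n" "v \<noteq> 0\<^sub>v ?n" "transpose_mat (embmat bs) *\<^sub>v v = 0\<^sub>v ?n"
    using det_0_iff_vec_prod_zero[of "transpose_mat (embmat bs)" ?n] by auto
  have b: "(\<Sum>i<?n. v $ i * (emb_list ! i) (bs ! j)) = 0" if "j < ?n" for j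
  proof -
    have "(\<Sum>i<?n. v $ i * (emb_list ! i) (bs ! j)) = (transpose_mat (embmat bs) *\<^sub>v v) $ j"
      using that v(1) by (simp add: embmat_def scalar_prod_def lessThan_atLeast0 mult.commute)
    then show ?thesis using v(3) that by simp
  qed
  have all: "(\<Sum>i<?n. v $ i * (emb_list ! i) x) = 0" for x :: 'f
  proof -
    obtain q where q: "x = (\<Sum>k<?n. of_rat (q k) * bs ! k)" using span[of x] len by auto
    have "(\<Sum>i<?n. v $ i * (emb_list ! i) x) = (\<Sum>i<?n. \<Sum>k<?n. of_rat (q k) * (v $ i * (emb_list ! i) (bs ! k)))"
      by (intro sum.cong refl) (simp add: q embeddingD emb_list_nth sum_distrib_left mult.left_commute)
    also have "\<dots> = (\<Sum>k<?n. of_rat (q k) * (\<Sum>i<?n. v $ i * (emb_list ! i) (bs ! k)))"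
      by (subst sum.swap) (simp add: sum_distrib_left)
    also have "\<dots> = 0" by (simp add: b)
    finally show ?thesis .
  qed
  define c where "c = (\<lambda>\<sigma>::'f \<Rightarrow> complex. v $ (THE i. i < ?n \<and> emb_list ! i = \<sigma>))"
  have ci: "c (emb_list ! i) = v $ i" if "i < ?n" for i
  proof -
    have "(THE j. j < ?n \<and> emb_list ! j = (emb_list ! i :: 'f \<Rightarrow> complex)) = i"
      using that emb_list(1,3)[where 'f='f] by (intro the_equality) (auto simp: nth_eq_iff_index_eq)
    then show ?thesis by (simp add: c_def)
  qed
  have "(\<Sum>\<sigma>\<in>complex_embeddings. c \<sigma> * \<sigma> x) = 0" for x
    unfolding sum_emb_list[symmetric] using all[of x] by (simp add: ci)
  then have "c \<sigma> = 0" if "\<sigma> \<in> complex_embeddings" for \<sigma>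
    using embeddings_sum_eq_0[OF finite_card_embeddings(1) subset_refl] that by blast
  then have "v $ i = 0" if "i < ?n" for i using ci[OF that] emb_list_nth[OF that] by auto
  then have "v = 0\<^sub>v ?n" using v(1) by (intro eq_vecI) auto
  then show False using v(2) by simp
qed

text \<open>Nonzero volume makes bs independent, and there are as many vectors as the degree. The
  dimension argument counts a set, so bs is first seen to be distinct.\<close>

lemma spanning_if_vol_nonzero:
  fixes bs :: "'f::number_field list"
  assumes "vol bs \<noteq> 0"
  shows "\<exists>q. x = (\<Sum>k<length bs. of_rat (q k) * bs ! k)"
proof -
  have len: "length bs = field_degree TYPE('f)" using assms by (auto simp: vol_def split: if_splits)
  have dist: "distinct bs"
  proof (rule ccontr)
    assume "\<not> distinct bs"
    then obtain i j where ij: "i < length bs" "j < length bs" "i \<noteq> j" "bs ! i = bs ! j" by (auto simp: distinct_conv_nth)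
    define q where "q = (\<lambda>k. (if k = i then 1 else 0) - (if k = j then 1 else 0) :: rat)"
    have "(\<Sum>k<length bs. of_rat (q k) * bs ! k) = (\<Sum>k<length bs. if k = i then bs ! k else 0) - (\<Sum>k<length bs. if k = j then bs ! k else 0)"
      unfolding sum_subtractf[symmetric] by (intro sum.cong) (auto simp: q_def)
    then have "(\<Sum>k<length bs. of_rat (q k) * bs ! k) = 0" using ij by simp
    from vol_nonzero_indep[OF assms this ij(1)] show False using ij by (simp add: q_def)
  qed
  have bij: "bij_betw ((!) bs) {..<length bs} (set bs)" using dist by (intro bij_betw_nth) auto
  have sum: "(\<Sum>v\<in>set bs. rat_scale (u v) v) = (\<Sum>k<length bs. of_rat (u (bs ! k)) * bs ! k)" for u
    using sum.reindex_bij_betw[OF bij, of "\<lambda>v. rat_scale (u v) v"] by (simp add: rat_scale_def)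
  have "\<not> ratvs.dependent (set bs)"
  proof
    assume "ratvs.dependent (set bs)"
    then obtain u v where u: "v \<in> set bs" "u v \<noteq> 0" "(\<Sum>v\<in>set bs. rat_scale (u v) v) = 0"
      unfolding ratvs.dependent_finite[OF finite_set] by blast
    obtain k where "k < length bs" "bs ! k = v" using u(1) by (auto simp: in_set_conv_nth)
    then show False using vol_nonzero_indep[OF assms, of "\<lambda>k. u (bs ! k)" k] u sum[of u] by simp
  qed
  moreover have "card (set bs) = ratvs.dim (UNIV :: 'f set)"
    using dist len by (simp add: distinct_card field_degree_def)
  ultimately have "x \<in> ratvs.span (set bs)"
    using ratvs.card_eq_dim[of "set bs" UNIV] by auto
  then obtain u where "x = (\<Sum>v\<in>set bs. rat_scale (u v) v)"
    unfolding ratvs.span_finite[OF finite_set] by blast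
  then show ?thesis unfolding sum by (rule exI[of _ "\<lambda>k. u (bs ! k)"])
qed

text \<open>Lattices contained in each other have integer transition matrices, so each volume is an
  integer multiple of the other; as the volumes are nonzero, both factors are at least 1 in absolute
  value.\<close>

lemma vol_unique:
  fixes bs cs :: "'f::number_field list"
  assumes "vol bs \<noteq> 0" "length cs = length bs" "zspan bs = zspan cs"
  shows "vol cs = vol bs"
proof -
  let ?n = "field_degree TYPE('f)"
  have len: "length bs = ?n" "length cs = ?n" using assms by (auto simp: vol_def split: if_splits)
  have le: "\<exists>k::int. vol as = \<bar>of_int k\<bar> * vol bs" if "zspan as \<subseteq> zspan bs" "length as = ?n" "length bs = ?n"
    for as bs :: "'f list"
  proof -
    have "\<forall>j\<in>{..<?n}. \<exists>c. as ! j = (\<Sum>k<?n. of_int (c k) * bs ! k)"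
    proof
      fix j assume "j \<in> {..<?n}"
      then have "as ! j \<in> zspan as" using that(2) by (intro int_combs_base) auto
      then show "\<exists>c. as ! j = (\<Sum>k<?n. of_int (c k) * bs ! k)" using that(1,3) unfolding zspan_eq by auto
    qed
    then obtain A where A: "\<And>j. j < ?n \<Longrightarrow> as ! j = (\<Sum>k<?n. of_int (A j k) * bs ! k)" by (metis lessThan_iff)
    have "embmat as = embmat bs * Matrix.mat ?n ?n (\<lambda>(k, j). of_rat (of_int (A j k)))"
      by (rule embmat_combination) (simp add: A)
    then have "Determinant.det (embmat as) = Determinant.det (embmat bs) * of_int (Determinant.det (Matrix.mat ?n ?n (\<lambda>(k, j). A j k)))"
      by (simp add: det_mult[of _ ?n] det_int_mat)
    then show ?thesis using that by (intro exI[of _ "Determinant.det (Matrix.mat ?n ?n (\<lambda>(k, j). A j k))"]) (simp add: vol_def norm_mult)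
  qed
  obtain k where k: "vol bs = \<bar>of_int k\<bar> * vol cs" using le[of bs cs] assms(3) len by auto
  obtain l where l: "vol cs = \<bar>of_int l\<bar> * vol bs" using le[of cs bs] assms(3) len by auto
  have nn: "vol bs \<ge> 0" "vol cs \<ge> 0" by (auto simp: vol_def)
  have kl: "k \<noteq> 0" "l \<noteq> 0" using k l assms(1) by auto
  then have "\<bar>of_int k\<bar> \<ge> (1::real)" "\<bar>of_int l\<bar> \<ge> (1::real)" by linarith+
  then have "1 * vol cs \<le> \<bar>of_int k\<bar> * vol cs" "1 * vol bs \<le> \<bar>of_int l\<bar> * vol bs"
    using nn by (intro mult_right_mono; simp)+
  then show ?thesis unfolding k[symmetric] l[symmetric] by simp
qed

lemma sublattice_basis:
  fixes bs :: "'f::number_field list"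
  assumes "vol bs \<noteq> 0" "add_subgroup M" "M \<subseteq> zspan bs" "m > 0" "\<forall>x\<in>zspan bs. of_nat m * x \<in> M"
  shows "\<exists>cs. length cs = length bs \<and> zspan cs = M \<and> idx (zspan bs) M > 0 \<and> vol cs = real (idx (zspan bs) M) * vol bs"
proof -
  obtain cs where cs: "length cs = length bs" "zspan cs = M" "idx (zspan bs) M > 0"
      "\<forall>vs. vol (cs @ vs) = real (idx (zspan bs) M) * vol (bs @ vs)"
    using sublattice_basis_aux[OF volume_like_vol vol_nonzero_zindep[OF assms(1)] assms(2-4)] assms(5) by blast
  then show ?thesis using cs(4)[rule_format, of "[]"] by (intro exI[of _ cs]) simp
qed

lemma trace_matrix:
  fixes as bs :: "'f::number_field list"
  defines "n \<equiv> field_degree TYPE('f)"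
  shows "Matrix.mat n n (\<lambda>(i, j). complex_of_rat (field_trace (as ! i * bs ! j))) = transpose_mat (embmat as) * embmat bs"
  by (rule eq_matI)
    (auto simp: embmat_def n_def scalar_prod_def of_rat_field_trace sum_emb_list[symmetric] lessThan_atLeast0
      emb_list_nth embeddingD)

lemma cmod_of_rat: "cmod (of_rat r) = \<bar>real_of_rat r\<bar>"
  by (cases r) (simp add: of_rat_rat norm_divide)

lemma det_trace_matrix:
  fixes as bs :: "'f::number_field list"
  defines "n \<equiv> field_degree TYPE('f)"
  assumes "length as = n" "length bs = n"
  shows "\<bar>real_of_rat (Determinant.det (Matrix.mat n n (\<lambda>(i, j). field_trace (as ! i * bs ! j))))\<bar> = vol as * vol bs"
proof -
  have "complex_of_rat (Determinant.det (Matrix.mat n n (\<lambda>(i, j). field_trace (as ! i * bs ! j)))) =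
      Determinant.det (transpose_mat (embmat as) * embmat bs)"
    by (simp add: det_rat_mat[symmetric] trace_matrix[symmetric] n_def)
  also have "\<dots> = Determinant.det (embmat as) * Determinant.det (embmat bs)"
    by (subst det_mult[of _ n]) (auto simp: n_def Determinant.det_transpose[OF embmat_carrier(1)])
  finally have "cmod (complex_of_rat (Determinant.det (Matrix.mat n n (\<lambda>(i, j). field_trace (as ! i * bs ! j))))) = vol as * vol bs"
    using assms by (simp add: vol_def norm_mult)
  then show ?thesis by (simp add: cmod_of_rat)
qed

text \<open>\<Phi> is injective by nondegeneracy of the trace form: if all traces of y b_j vanish
  and y \<noteq> 0, expanding 1/y in bs gives trace 0 for 1, whereas this trace is the degree. As an
  endomorphism of a finite dimensional space \<Phi> is surjective, and ds are the preimages of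
  bs.\<close>

lemma trace_dual_basis:
  fixes bs :: "'f::number_field list"
  assumes "vol bs \<noteq> 0"
  obtains ds where "length ds = length bs"
    "\<And>i j. i < length bs \<Longrightarrow> j < length bs \<Longrightarrow> field_trace (ds ! i * bs ! j) = (if i = j then 1 else 0)"
    "\<And>x. x = (\<Sum>j<length bs. of_rat (field_trace (x * bs ! j)) * ds ! j)"
proof -
  define \<Phi> where "\<Phi> = (\<lambda>y. \<Sum>j<length bs. of_rat (field_trace (y * bs ! j)) * bs ! j)"
  have add: "\<Phi> (x + y) = \<Phi> x + \<Phi> y" for x y
    by (simp add: \<Phi>_def distrib_right field_trace_linear of_rat_add sum.distrib)
  have scale: "\<Phi> (of_rat q * x) = of_rat q * \<Phi> x" for q x
    by (simp add: \<Phi>_def mult.assoc field_trace_linear of_rat_mult sum_distrib_left)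
  have lin: "Vector_Spaces.linear rat_scale rat_scale \<Phi>"
    by unfold_locales (simp_all add: add scale rat_scale_def)
  have tr0: "y = 0" if "\<And>j. j < length bs \<Longrightarrow> field_trace (y * bs ! j) = 0" for y
  proof (rule ccontr)
    assume y: "y \<noteq> 0"
    obtain q where q: "inverse y = (\<Sum>k<length bs. of_rat (q k) * bs ! k)" using spanning_if_vol_nonzero[OF assms] by blast
    have "1 = (\<Sum>k<length bs. of_rat (q k) * (y * bs ! k))"
      using y q by (simp add: sum_distrib_left[symmetric] mult.left_commute[of _ y] flip: q)
    then have "field_trace (1::'f) = field_trace (\<Sum>k<length bs. of_rat (q k) * (y * bs ! k))"
      by (rule arg_cong)
    also have "\<dots> = (\<Sum>k<length bs. q k * field_trace (y * bs ! k))"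
      by (simp add: field_trace_sum field_trace_linear)
    finally have "field_trace (1::'f) = (\<Sum>k<length bs. q k * field_trace (y * bs ! k))" .
    then show False using that field_degree_pos[where 'f='f] by (simp add: field_trace_one)
  qed
  have d: "\<Phi> (x - y) = \<Phi> x - \<Phi> y" for x y using add[of "x - y" y] by simp
  have ker: "y = 0" if "\<Phi> y = 0" for y
  proof (rule tr0)
    fix j assume j: "j < length bs"
    have "(\<Sum>j<length bs. of_rat (field_trace (y * bs ! j)) * bs ! j) = 0" using that by (simp add: \<Phi>_def)
    then show "field_trace (y * bs ! j) = 0" using j by (rule vol_nonzero_indep[OF assms])
  qed
  have inj: "inj \<Phi>"
  proof (rule injI)
    fix x y assume "\<Phi> x = \<Phi> y"
    then show "x = y" using ker[of "x - y"] d[of x y] by simp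
  qed
  have surj: "surj \<Phi>" by (rule ratvs.linear_inj_imp_surj[OF lin inj])
  define ds where "ds = map (\<lambda>j. inv_into UNIV \<Phi> (bs ! j)) [0..<length bs]"
  have ds: "\<Phi> (ds ! j) = bs ! j" if "j < length bs" for j
    using that surj by (simp add: ds_def surj_f_inv_f)
  have dual: "field_trace (ds ! i * bs ! j) = (if i = j then 1 else 0)" if ij: "i < length bs" "j < length bs" for i j
  proof -
    have "(\<Sum>k<length bs. of_rat (field_trace (ds ! i * bs ! k) - (if k = i then 1 else 0)) * bs ! k)
       = \<Phi> (ds ! i) - (\<Sum>k<length bs. if k = i then bs ! k else 0)"
      unfolding \<Phi>_def sum_subtractf[symmetric] by (intro sum.cong) (auto simp: of_rat_diff algebra_simps)
    also have "\<dots> = 0" using ij ds by simp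
    finally have "field_trace (ds ! i * bs ! j) - (if j = i then 1 else 0) = 0"
      by (rule vol_nonzero_indep[OF assms]) (rule ij)
    then show ?thesis by auto
  qed
  have "x = (\<Sum>j<length bs. of_rat (field_trace (x * bs ! j)) * ds ! j)" for x
  proof -
    have "x - (\<Sum>j<length bs. of_rat (field_trace (x * bs ! j)) * ds ! j) = 0"
    proof (rule tr0)
      fix k assume k: "k < length bs"
      have "field_trace ((\<Sum>j<length bs. of_rat (field_trace (x * bs ! j)) * ds ! j) * bs ! k)
          = (\<Sum>j<length bs. field_trace (x * bs ! j) * field_trace (ds ! j * bs ! k))"
        by (simp add: sum_distrib_right field_trace_sum field_trace_linear mult.assoc)
      also have "\<dots> = (\<Sum>j<length bs. if j = k then field_trace (x * bs ! j) else 0)"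
        using k by (intro sum.cong) (auto simp: dual)
      also have "\<dots> = field_trace (x * bs ! k)" using k by simp
      finally have *: "field_trace ((\<Sum>j<length bs. of_rat (field_trace (x * bs ! j)) * ds ! j) * bs ! k) = field_trace (x * bs ! k)" .
      have "field_trace (u * bs ! k) = field_trace ((u - v) * bs ! k) + field_trace (v * bs ! k)" for u v
        by (simp flip: field_trace_linear(1) distrib_right)
      from this[of x "\<Sum>j<length bs. of_rat (field_trace (x * bs ! j)) * ds ! j"] *
      show "field_trace ((x - (\<Sum>j<length bs. of_rat (field_trace (x * bs ! j)) * ds ! j)) * bs ! k) = 0" by simp
    qed
    then show ?thesis by simp
  qed
  then show ?thesis using that[of ds] dual by (simp add: ds_def)
qed

lemma vol_dual:
  fixes bs ds :: "'f::number_field list"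
  assumes "length bs = field_degree TYPE('f)" "length ds = length bs"
    and dual: "\<And>i j. i < length bs \<Longrightarrow> j < length bs \<Longrightarrow> field_trace (ds ! i * bs ! j) = (if i = j then 1 else 0)"
  shows "vol ds * vol bs = 1"
proof -
  let ?n = "field_degree TYPE('f)"
  have "Matrix.mat ?n ?n (\<lambda>(i, j). field_trace (ds ! i * bs ! j)) = 1\<^sub>m ?n"
    by (rule eq_matI) (auto simp: dual assms(1))
  then show ?thesis using det_trace_matrix[of ds bs] assms(1,2) by simp
qed

section \<open>Integral bases and the discriminant\<close>

definition int_elems :: "'f::number_field set" where
  "int_elems = {x. algebraic_int x}"

lemma int_elems_closed:
  fixes x y :: "'f::number_field"
  shows "(0::'f) \<in> int_elems" "(1::'f) \<in> int_elems" "(of_int k :: 'f) \<in> int_elems" "(of_nat m :: 'f) \<in> int_elems"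
  "x \<in> int_elems \<Longrightarrow> y \<in> int_elems \<Longrightarrow> x + y \<in> int_elems"
  "x \<in> int_elems \<Longrightarrow> y \<in> int_elems \<Longrightarrow> x * y \<in> int_elems"
  "x \<in> int_elems \<Longrightarrow> y \<in> int_elems \<Longrightarrow> x - y \<in> int_elems"
  "x \<in> int_elems \<Longrightarrow> - x \<in> int_elems"
  using algebraic_int_of_int[of 1, where 'a='f] algebraic_int_of_int[of "int m", where 'a='f]
  by (auto simp: int_elems_def algebraic_int_of_int intro: algebraic_int_add algebraic_int_mult algebraic_int_diff)

lemma add_subgroup_int_elems: "add_subgroup int_elems"
  by (auto simp: add_subgroup_def int_elems_closed)

lemma int_elems_multiples:
  fixes f :: "'i \<Rightarrow> 'f::number_field"
  assumes "finite I"
  shows "\<exists>m::nat. m > 0 \<and> (\<forall>i\<in>I. of_nat m * f i \<in> int_elems)"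
proof (rule algebraic_int_common_multiple[OF assms, of f])
  fix m :: nat assume "m > 0" "\<And>i. i \<in> I \<Longrightarrow> algebraic_int (of_nat m * f i)"
  then show ?thesis by (intro exI[of _ m]) (simp add: int_elems_def)
qed

lemma int_elems_multiple:
  obtains m :: nat where "m > 0" "of_nat m * (x :: 'f::number_field) \<in> int_elems"
proof (rule algebraic_int_multiple[of x])
  fix m :: nat assume "m > 0" "algebraic_int (of_nat m * x)"
  then show thesis using that[of m] by (simp add: int_elems_def)
qed

lemma map_scale_spanning:
  fixes bs :: "'f::number_field list"
  assumes "vol bs \<noteq> 0" "a \<noteq> 0"
  shows "vol (map ((*) a) bs) \<noteq> 0"
proof (rule vol_nonzero_if_spanning)
  show len: "length (map ((*) a) bs) = field_degree TYPE('f)" using assms(1) by (auto simp: vol_def split: if_splits)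
  fix x
  obtain q where q: "x / a = (\<Sum>k<length bs. of_rat (q k) * bs ! k)" using spanning_if_vol_nonzero[OF assms(1)] by blast
  have "x = a * (x / a)" using assms(2) by simp
  also have "\<dots> = (\<Sum>k<length (map ((*) a) bs). of_rat (q k) * map ((*) a) bs ! k)"
    unfolding q by (simp add: sum_distrib_left mult.left_commute)
  finally show "\<exists>q. x = (\<Sum>k<length (map ((*) a) bs). of_rat (q k) * map ((*) a) bs ! k)" by blast
qed

lemma zspan_map_scale: "zspan (map ((*) a) bs) = (*) a ` zspan (bs :: 'a::field_char_0 list)"
proof -
  have *: "(\<Sum>i<length bs. of_int (c i) * map ((*) a) bs ! i) = a * (\<Sum>i<length bs. of_int (c i) * bs ! i)" for c
    by (simp add: sum_distrib_left mult.left_commute)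
  show ?thesis unfolding int_combs_def length_map * by auto
qed

text \<open>Start from a rational basis bs consisting of algebraic integers. The trace of x b_j is
  an integer for integral x, so the ring of integers lies in the span of the trace dual basis ds;
  some multiple of ds is integral, so it is a sublattice of finite index there and inherits a
  basis.\<close>

lemma exists_int_basis:
  obtains bs :: "'f::number_field list" where "vol bs \<noteq> 0" "zspan bs = int_elems"
proof -
  obtain as :: "'f list" where as: "set as = rat_basis" "distinct as"
    using finite_distinct_list[OF finite_rat_basis] by blast
  have len: "length as = field_degree TYPE('f)" using as distinct_card card_rat_basis by metis
  have vas: "vol as \<noteq> 0"
  proof (rule vol_nonzero_if_spanning[OF len])
    fix x :: 'f
    have "x = (\<Sum>b\<in>set as. of_rat (rat_coord b x) * b)" by (simp add: as rat_coord_sum)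
    also have "\<dots> = (\<Sum>k<length as. of_rat (rat_coord (as ! k) x) * as ! k)"
      by (rule sum.reindex_bij_betw[symmetric]) (use as in \<open>auto intro: bij_betw_nth\<close>)
    finally show "\<exists>q. x = (\<Sum>k<length as. of_rat (q k) * as ! k)" by (rule exI[of _ "\<lambda>k. rat_coord (as ! k) x"])
  qed
  obtain m :: nat where m: "m > 0" "\<And>b. b \<in> set as \<Longrightarrow> of_nat m * b \<in> int_elems"
    using int_elems_multiples[of "set as" "\<lambda>b. b"] by blast
  define bs where "bs = map ((*) (of_nat m)) as"
  have vbs: "vol bs \<noteq> 0" unfolding bs_def using vas m(1) by (intro map_scale_spanning) auto
  have bsO: "b \<in> int_elems" if "b \<in> set bs" for b using that m(2) by (auto simp: bs_def)
  obtain ds where ds: "length ds = length bs"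
    "\<And>i j. i < length bs \<Longrightarrow> j < length bs \<Longrightarrow> field_trace (ds ! i * bs ! j) = (if i = j then 1 else 0)"
    "\<And>x. x = (\<Sum>j<length bs. of_rat (field_trace (x * bs ! j)) * ds ! j)"
    using trace_dual_basis[OF vbs] by blast
  have lbs: "length bs = field_degree TYPE('f)" using vbs by (auto simp: vol_def split: if_splits)
  have vds: "vol ds \<noteq> 0" using vol_dual[OF lbs ds(1,2)] by auto
  have sub: "int_elems \<subseteq> zspan ds"
  proof
    fix x :: 'f assume x: "x \<in> int_elems"
    have "\<exists>k. field_trace (x * bs ! j) = of_int k" if "j < length bs" for j
      using field_trace_int[of "x * bs ! j"] int_elems_closed(6)[OF x bsO[of "bs ! j"]] that
      by (auto simp: int_elems_def Ints_def)
    then obtain c where "\<And>j. j < length bs \<Longrightarrow> field_trace (x * bs ! j) = of_int (c j)" by metis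
    then have "x = (\<Sum>j<length ds. of_int (c j) * ds ! j)" using ds(3)[of x] by (simp add: ds(1))
    then show "x \<in> zspan ds" by (simp only: int_combsI)
  qed
  obtain k :: nat where k: "k > 0" "\<And>b. b \<in> set ds \<Longrightarrow> of_nat k * b \<in> int_elems"
    using int_elems_multiples[of "set ds" "\<lambda>b. b"] by blast
  have mult: "of_nat k * x \<in> int_elems" if x: "x \<in> zspan ds" for x
  proof -
    obtain c where "x = (\<Sum>j<length ds. of_int (c j) * ds ! j)" by (rule zspanE[OF x])
    then have "of_nat k * x = (\<Sum>j<length ds. of_int (c j) * (of_nat k * ds ! j))"
      by (simp add: sum_distrib_left mult.left_commute)
    also have "\<dots> \<in> int_elems"
      by (intro add_subgroup_sum[OF add_subgroup_int_elems] int_elems_closed k(2)) auto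
    finally show ?thesis .
  qed
  have mult': "\<forall>x\<in>zspan ds. of_nat k * x \<in> int_elems" by (rule ballI) (rule mult)
  obtain cs :: "'f list" where cs: "length cs = length ds" "zspan cs = int_elems" "idx (zspan ds) int_elems > 0" "vol cs = real (idx (zspan ds) int_elems) * vol ds"
    using sublattice_basis[OF vds add_subgroup_int_elems sub k(1) mult'] by blast
  show ?thesis by (rule that[of cs]) (use cs vds in auto)
qed

text \<open>\<open>abs_discriminant\<close> picks an arbitrary list with unique integer coordinates.
  Such lists are identified here with the full rank bases to which volume arguments apply: unique
  integer coordinates force rational independence, and every element of F has an integral
  multiple.\<close>

lemma integral_basis_iff:
  fixes bs :: "'f::number_field list"
  shows "integral_basis bs \<longleftrightarrow> vol bs \<noteq> 0 \<and> zspan bs = int_elems"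
proof
  assume "vol bs \<noteq> 0 \<and> zspan bs = int_elems"
  then have v: "vol bs \<noteq> 0" and z: "zspan bs = int_elems" by auto
  have "\<exists>!c. length c = length bs \<and> x = (\<Sum>i<length bs. of_int (c ! i) * bs ! i)" if x: "x \<in> int_elems" for x
  proof -
    obtain a where a: "x = (\<Sum>i<length bs. of_int (a i) * bs ! i)" using x z unfolding zspan_eq by blast
    show ?thesis
    proof (rule ex1I[of _ "map a [0..<length bs]"])
      show "length (map a [0..<length bs]) = length bs \<and> x = (\<Sum>i<length bs. of_int (map a [0..<length bs] ! i) * bs ! i)"
        by (simp add: a)
      fix c assume c: "length c = length bs \<and> x = (\<Sum>i<length bs. of_int (c ! i) * bs ! i)"
      then have "(\<Sum>i<length bs. of_int (a i - c ! i) * bs ! i) = 0"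
        using a by (simp add: left_diff_distrib sum_subtractf)
      then have "a i - c ! i = 0" if "i < length bs" for i
        using vol_nonzero_zindep[OF v] that unfolding zindep_def by (elim allE[of _ "\<lambda>i. a i - c ! i"]) blast
      then show "c = map a [0..<length bs]" using c by (intro nth_equalityI) auto
    qed
  qed
  moreover have "b \<in> int_elems" if b: "b \<in> set bs" for b
  proof -
    obtain i where "i < length bs" "bs ! i = b" using b[unfolded in_set_conv_nth] by blast
    then have "b \<in> zspan bs" using int_combs_base[of "{..<length bs}" i "(!) bs"] by simp
    then show ?thesis using z by simp
  qed
  ultimately show "integral_basis bs"
    by (auto simp: integral_basis_def ring_of_integers_def number_ring_def int_elems_def)
next
  assume ib: "integral_basis bs"
  have bsO: "set bs \<subseteq> int_elems" and ex1: "\<And>x. x \<in> int_elems \<Longrightarrow> \<exists>!c. length c = length bs \<and> x = (\<Sum>i<length bs. of_int (c ! i) * bs ! i)"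
    using ib by (auto simp: integral_basis_def ring_of_integers_def number_ring_def int_elems_def)
  have z: "zspan bs = int_elems"
  proof (intro equalityI subsetI)
    fix x assume x: "x \<in> zspan bs"
    obtain c where "x = (\<Sum>i<length bs. of_int (c i) * bs ! i)" by (rule zspanE[OF x])
    moreover have "of_int (c i) * bs ! i \<in> int_elems" if "i \<in> {..<length bs}" for i
      using that bsO by (intro int_elems_closed(6) int_elems_closed(3)) auto
    ultimately show "x \<in> int_elems" by (simp only: add_subgroup_sum[OF add_subgroup_int_elems])
  next
    fix x :: 'f assume "x \<in> int_elems"
    then obtain c where "x = (\<Sum>i<length bs. of_int (c ! i) * bs ! i)" using ex1 by blast
    then show "x \<in> zspan bs" by (simp only: int_combsI)
  qed
  have zi: "c i = 0" if "(\<Sum>i<length bs. of_int (c i) * bs ! i) = 0" "i < length bs" for c :: "nat \<Rightarrow> int" and i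
  proof -
    let ?c = "map c [0..<length bs]" and ?z = "replicate (length bs) (0::int)"
    have "length ?c = length bs \<and> 0 = (\<Sum>i<length bs. of_int (?c ! i) * bs ! i)" using that(1) by simp
    moreover have "length ?z = length bs \<and> 0 = (\<Sum>i<length bs. of_int (?z ! i) * bs ! i)" by simp
    ultimately have "?c = ?z" using ex1[OF int_elems_closed(1)] by blast
    then have "?c ! i = ?z ! i" by simp
    then show ?thesis using that(2) by simp
  qed
  \<comment> \<open>Uniqueness of integer coordinates excludes only integer relations; a rational
    one is first multiplied by a common denominator.\<close>
  have qi: "q i = 0" if q: "(\<Sum>i<length bs. of_rat (q i) * bs ! i) = 0" and i: "i < length bs" for q i
  proof -
    obtain m :: nat where m: "m > 0" "\<And>i. i \<in> {..<length bs} \<Longrightarrow> of_nat m * (of_rat (q i) :: 'f) \<in> int_elems"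
      using int_elems_multiples[of "{..<length bs}" "\<lambda>i. of_rat (q i)"] by blast
    have "\<exists>k. of_nat m * q i = of_int k" if "i < length bs" for i
    proof -
      have "(of_rat (of_nat m * q i) :: 'f) \<in> \<int>"
        using m(2)[of i] that by (intro rational_algebraic_int_is_int) (auto simp: int_elems_def of_rat_mult)
      then obtain k where "(of_rat (of_nat m * q i) :: 'f) = of_rat (of_int k)" by (auto elim: Ints_cases)
      then show ?thesis by (metis of_rat_eq_iff)
    qed
    then obtain c where c: "\<And>i. i < length bs \<Longrightarrow> of_nat m * q i = of_int (c i)" by metis
    have "(of_int (c i) :: 'f) = of_nat m * of_rat (q i)" if "i < length bs" for i
      using arg_cong[OF c[OF that], of "of_rat :: rat \<Rightarrow> 'f"] by (simp add: of_rat_mult)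
    then have "(\<Sum>i<length bs. of_int (c i) * bs ! i) = (\<Sum>i<length bs. of_nat m * (of_rat (q i) * bs ! i))"
      by (intro sum.cong) (auto simp: mult.assoc)
    also have "\<dots> = 0" using q by (simp add: sum_distrib_left[symmetric])
    finally have "c i = 0" by (rule zi[OF _ i])
    then show ?thesis using c[OF i] m(1) by simp
  qed
  have dist: "distinct bs"
  proof (rule ccontr)
    assume "\<not> distinct bs"
    then obtain i j where ij: "i < length bs" "j < length bs" "i \<noteq> j" "bs ! i = bs ! j" by (auto simp: distinct_conv_nth)
    define q where "q = (\<lambda>k. (if k = i then 1 else 0) - (if k = j then 1 else 0) :: rat)"
    have "(\<Sum>k<length bs. of_rat (q k) * bs ! k) = (\<Sum>k<length bs. if k = i then bs ! k else 0) - (\<Sum>k<length bs. if k = j then bs ! k else 0)"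
      unfolding sum_subtractf[symmetric] by (intro sum.cong) (auto simp: q_def)
    then have "(\<Sum>k<length bs. of_rat (q k) * bs ! k) = 0" using ij by simp
    from qi[OF this ij(1)] show False using ij by (simp add: q_def)
  qed
  have bij: "bij_betw ((!) bs) {..<length bs} (set bs)" using dist by (intro bij_betw_nth) auto
  have sum: "(\<Sum>v\<in>set bs. rat_scale (u v) v) = (\<Sum>k<length bs. of_rat (u (bs ! k)) * bs ! k)" for u
    using sum.reindex_bij_betw[OF bij, of "\<lambda>v. rat_scale (u v) v"] by (simp add: rat_scale_def)
  have ind: "\<not> ratvs.dependent (set bs)"
  proof
    assume "ratvs.dependent (set bs)"
    then obtain u v where u: "v \<in> set bs" "u v \<noteq> 0" "(\<Sum>v\<in>set bs. rat_scale (u v) v) = 0"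
      unfolding ratvs.dependent_finite[OF finite_set] by blast
    obtain k where "k < length bs" "bs ! k = v" using u(1) by (auto simp: in_set_conv_nth)
    then show False using qi[of "\<lambda>k. u (bs ! k)" k] u sum[of u] by simp
  qed
  have spans: "\<exists>q. x = (\<Sum>k<length bs. of_rat (q k) * bs ! k)" for x
  proof -
    obtain m :: nat where m: "m > 0" "of_nat m * x \<in> int_elems" using algebraic_int_multiple[of x] unfolding int_elems_def by blast
    obtain c where c: "of_nat m * x = (\<Sum>i<length bs. of_int (c i) * bs ! i)" by (rule zspanE[OF m(2)[folded z]])
    have "x = (of_nat m * x) / of_nat m" using m(1) by simp
    also have "\<dots> = (\<Sum>i<length bs. of_rat (of_int (c i) / of_nat m) * bs ! i)"
      unfolding c by (simp add: sum_divide_distrib of_rat_divide)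
    finally show ?thesis by (rule exI[of _ "\<lambda>i. of_int (c i) / of_nat m"])
  qed
  have "UNIV \<subseteq> ratvs.span (set bs)"
  proof
    fix x
    obtain q where q: "x = (\<Sum>k<length bs. of_rat (q k) * bs ! k)" using spans by blast
    have "(\<Sum>k<length bs. rat_scale (q k) (bs ! k)) \<in> ratvs.span (set bs)"
      by (intro ratvs.span_sum ratvs.span_scale ratvs.span_base) auto
    then show "x \<in> ratvs.span (set bs)" by (simp add: q rat_scale_def)
  qed
  then have "card (set bs) = field_degree TYPE('f)"
    unfolding field_degree_def using ind by (intro ratvs.basis_card_eq_dim) auto
  then have "length bs = field_degree TYPE('f)" using dist by (simp add: distinct_card)
  from vol_nonzero_if_spanning[OF this spans] z show "vol bs \<noteq> 0 \<and> zspan bs = int_elems" by blast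
qed

definition int_basis :: "'f::number_field list" where
  "int_basis = (SOME bs. integral_basis bs)"

lemma int_basis: "vol (int_basis :: 'f::number_field list) \<noteq> 0" "zspan (int_basis :: 'f list) = int_elems"
  "length (int_basis :: 'f list) = field_degree TYPE('f)"
proof -
  have "\<exists>bs :: 'f list. integral_basis bs" using exists_int_basis integral_basis_iff by metis
  from someI_ex[OF this] show *: "vol (int_basis :: 'f list) \<noteq> 0" "zspan (int_basis :: 'f list) = int_elems"
    unfolding integral_basis_iff int_basis_def by auto
  then show "length (int_basis :: 'f list) = field_degree TYPE('f)" by (auto simp: vol_def split: if_splits)
qed

text \<open>The trace matrix of a basis is the transpose of its embedding matrix times that
  matrix.\<close>

lemma abs_discriminant_eq: "abs_discriminant TYPE('f::number_field) = (vol (int_basis :: 'f list))\<^sup>2"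
  using det_trace_matrix[of "int_basis :: 'f list" int_basis] int_basis(3)[where 'f='f]
  by (simp add: abs_discriminant_def Let_def int_basis_def[symmetric] power2_eq_square)

lemma abs_discriminant_pos: "abs_discriminant TYPE('f::number_field) > 0"
  using int_basis(1)[where 'f='f] by (simp add: abs_discriminant_eq)

text \<open>The absolute value of the norm from F to \<rat>.\<close>

definition field_norm :: "'f::number_field \<Rightarrow> real" where
  "field_norm x = (\<Prod>\<sigma>\<in>complex_embeddings. cmod (\<sigma> x))"

lemma field_norm_pos: "x \<noteq> 0 \<Longrightarrow> field_norm (x :: 'f::number_field) > 0"
  unfolding field_norm_def by (intro prod_pos) (simp add: embeddingD)

text \<open>Multiplying the basis by a multiplies \<open>embmat bs\<close> from the left by the
  diagonal matrix of the \<sigma> a.\<close>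

lemma vol_map_scale:
  fixes bs :: "'f::number_field list"
  shows "vol (map ((*) a) bs) = field_norm a * vol bs"
proof (cases "length bs = field_degree TYPE('f)")
  case True
  let ?n = "field_degree TYPE('f)"
  define D where "D = Matrix.mat ?n ?n (\<lambda>(i, j). if i = j then (emb_list ! i) a else 0)"
  have "embmat (map ((*) a) bs) = D * embmat bs"
  proof (rule eq_matI)
    fix i j assume "i < dim_row (D * embmat bs)" "j < dim_col (D * embmat bs)"
    then have ij: "i < ?n" "j < ?n" by (auto simp: D_def)
    have "(D * embmat bs) $$ (i, j) = (\<Sum>k<?n. (if i = k then (emb_list ! i) a else 0) * (emb_list ! k) (bs ! j))"
      using ij by (simp add: D_def embmat_def scalar_prod_def lessThan_atLeast0)
    also have "\<dots> = (\<Sum>k<?n. if i = k then (emb_list ! i) a * (emb_list ! k) (bs ! j) else 0)"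
      by (intro sum.cong) auto
    also have "\<dots> = (emb_list ! i) a * (emb_list ! i) (bs ! j)" using ij by simp
    finally show "embmat (map ((*) a) bs) $$ (i, j) = (D * embmat bs) $$ (i, j)"
      using ij True by (simp add: embmat_def embeddingD emb_list_nth)
  qed (auto simp: D_def embmat_def)
  moreover have "Determinant.det D = (\<Prod>i = 0..<?n. (emb_list ! i) a)"
    by (subst det_upper_triangular[of _ ?n]) (auto simp: prod_list_diag_prod D_def)
  then have "cmod (Determinant.det D) = field_norm a"
    by (simp add: prod_norm[symmetric] field_norm_def prod_emb_list[symmetric, of "\<lambda>\<sigma>. cmod (\<sigma> a)"] lessThan_atLeast0)
  moreover have "Determinant.det (D * embmat bs) = Determinant.det D * Determinant.det (embmat bs)"
    by (rule det_mult[of _ ?n]) (auto simp: D_def)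
  ultimately show ?thesis using True by (simp add: vol_def norm_mult)
qed (simp add: vol_def)

definition principal :: "'f::number_field \<Rightarrow> 'f set" where
  "principal a = (*) a ` int_elems"

lemma principal_zspan: "principal a = zspan (map ((*) a) int_basis)"
  unfolding zspan_map_scale int_basis(2) principal_def ..

lemma add_subgroup_principal: "add_subgroup (principal a)"
  unfolding principal_zspan by (rule add_subgroup_int_combs)

text \<open>The index is a ratio of covolumes: a basis of the ideal as a sublattice has volume index
  times \<open>vol bs\<close>, and the scaled integral basis spans the same ideal.\<close>

lemma idx_zspan_principal:
  fixes bs :: "'f::number_field list"
  assumes v: "vol bs \<noteq> 0" and sub: "principal a \<subseteq> zspan bs" and a: "a \<noteq> 0"
  shows "real (idx (zspan bs) (principal a)) * vol bs = field_norm a * vol (int_basis :: 'f list)"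
    "idx (zspan bs) (principal a) > 0"
proof -
  obtain k :: nat where k: "k > 0" "\<And>b. b \<in> set bs \<Longrightarrow> of_nat k * (b / a) \<in> int_elems"
    using int_elems_multiples[OF finite_set, of bs "\<lambda>b. b / a"] by blast
  have mult: "of_nat k * x \<in> principal a" if x: "x \<in> zspan bs" for x
  proof -
    obtain c where "x = (\<Sum>j<length bs. of_int (c j) * bs ! j)" by (rule zspanE[OF x])
    moreover have "a * (of_int (c j) * (of_nat k * (bs ! j / a))) = of_nat k * (of_int (c j) * bs ! j)" for j
      using a by simp
    ultimately have "of_nat k * x = a * (\<Sum>j<length bs. of_int (c j) * (of_nat k * (bs ! j / a)))"
      by (simp only: sum_distrib_left)
    moreover have "(\<Sum>j<length bs. of_int (c j) * (of_nat k * (bs ! j / a))) \<in> int_elems"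
      by (intro add_subgroup_sum[OF add_subgroup_int_elems] int_elems_closed k(2)) auto
    ultimately show ?thesis unfolding principal_def by blast
  qed
  have mult': "\<forall>x\<in>zspan bs. of_nat k * x \<in> principal a" by (rule ballI) (rule mult)
  obtain cs :: "'f list" where cs: "length cs = length bs" "zspan cs = principal a" "idx (zspan bs) (principal a) > 0"
    "vol cs = real (idx (zspan bs) (principal a)) * vol bs"
    using sublattice_basis[OF v add_subgroup_principal sub k(1) mult'] by blast
  have len: "length bs = field_degree TYPE('f)" using v by (auto simp: vol_def split: if_splits)
  have "vol (map ((*) a) int_basis) = vol cs"
    by (rule vol_unique) (use cs len v in \<open>auto simp: principal_zspan int_basis(3)\<close>)
  then show "real (idx (zspan bs) (principal a)) * vol bs = field_norm a * vol (int_basis :: 'f list)"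
    using cs(4) by (simp add: vol_map_scale)
  show "idx (zspan bs) (principal a) > 0" by (rule cs(3))
qed

lemma idx_int_elems_principal:
  "a \<in> int_elems \<Longrightarrow> a \<noteq> 0 \<Longrightarrow> real (idx int_elems (principal a)) = field_norm (a :: 'f::number_field)"
proof -
  assume a: "a \<in> int_elems" "a \<noteq> 0"
  have "principal a \<subseteq> zspan int_basis"
    unfolding int_basis(2) principal_def using a(1) by (auto intro: int_elems_closed(6))
  from idx_zspan_principal(1)[OF int_basis(1) this a(2)] int_basis(1)[where 'f='f]
  show ?thesis unfolding int_basis(2) by simp
qed

text \<open>\<kappa> is the covolume of the ring of integers divided by that of I, so the ratio of
  index and norm is the same for all a. For I = {0} there is no admissible a and any \<kappa> will
  do.\<close>

lemma idx_fractional_ideal: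
  fixes I :: "'f::number_field set"
  assumes sub: "add_subgroup I" and stable: "\<And>r x. r \<in> int_elems \<Longrightarrow> x \<in> I \<Longrightarrow> r * x \<in> I"
    and m: "m > 0" "\<And>x. x \<in> I \<Longrightarrow> of_nat m * x \<in> int_elems"
  obtains \<kappa> where "\<kappa> > 0" "\<And>a. a \<in> I \<Longrightarrow> a \<noteq> 0 \<Longrightarrow> real (idx I (principal a)) = \<kappa> * field_norm a"
proof (cases "I \<subseteq> {0}")
  case True
  have "real (idx I (principal a)) = 1 * field_norm a" if "a \<in> I" "a \<noteq> 0" for a
    using True that by blast
  with that[of 1] show ?thesis by simp
next
  case False
  then obtain a where a: "a \<in> I" "a \<noteq> 0" by blast
  \<comment> \<open>I lies in (1/m) O, whose basis is known, and contains a multiple of that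
    lattice, namely one inside the ideal generated by a nonzero a in I; so I inherits a
    basis.\<close>
  define bs where "bs = map ((*) (inverse (of_nat m))) (int_basis :: 'f list)"
  have v: "vol bs \<noteq> 0" unfolding bs_def using m(1) by (intro map_scale_spanning int_basis) auto
  have z: "zspan bs = (*) (inverse (of_nat m)) ` int_elems" unfolding bs_def zspan_map_scale int_basis(2) ..
  have Iz: "I \<subseteq> zspan bs"
  proof
    fix x assume "x \<in> I"
    then have "x = inverse (of_nat m) * (of_nat m * x)" "of_nat m * x \<in> int_elems" using m by auto
    then show "x \<in> zspan bs" unfolding z by blast
  qed
  obtain k :: nat where k: "k > 0" "of_nat k * (inverse (of_nat m) / a) \<in> int_elems"
    by (rule int_elems_multiple)
  have mult: "of_nat k * x \<in> I" if x: "x \<in> zspan bs" for x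
  proof -
    obtain y where y: "y \<in> int_elems" "x = inverse (of_nat m) * y" using x unfolding z by blast
    have "of_nat k * x = (y * (of_nat k * (inverse (of_nat m) / a))) * a"
      using a by (simp add: y)
    then show ?thesis using stable[OF int_elems_closed(6)[OF y(1) k(2)] a(1)] by simp
  qed
  have mult': "\<forall>x\<in>zspan bs. of_nat k * x \<in> I" by (rule ballI) (rule mult)
  obtain cs :: "'f list" where cs: "length cs = length bs" "zspan cs = I" "idx (zspan bs) I > 0" "vol cs = real (idx (zspan bs) I) * vol bs"
    using sublattice_basis[OF v sub Iz k(1) mult'] by blast
  have vcs: "vol cs > 0" using cs v by (simp add: vol_def split: if_splits)
  show ?thesis
  proof (rule that)
    show "vol (int_basis :: 'f list) / vol cs > 0" using vcs int_basis(1)[where 'f='f] by (simp add: vol_def split: if_splits)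
    fix b assume b: "b \<in> I" "b \<noteq> 0"
    have "principal b \<subseteq> zspan cs" unfolding cs(2) principal_def using stable b(1) by (auto simp: mult.commute)
    from idx_zspan_principal(1)[OF _ this b(2)] vcs
    show "real (idx I (principal b)) = vol (int_basis :: 'f list) / vol cs * field_norm b"
      by (simp add: cs(2) field_simps)
  qed
qed

text \<open>The elements of \<omega> are those with integer traces against an integral basis, that
  is with integer coordinates in the trace dual basis ds.\<close>

lemma inverse_different_zspan:
  obtains ds :: "'f::number_field list" where "vol ds \<noteq> 0" "vol ds * vol (int_basis :: 'f list) = 1"
    "carrier (inverse_different :: ('f, 'f) module) = zspan ds"
proof -
  let ?bs = "int_basis :: 'f list"
  obtain ds where ds: "length ds = length ?bs"
    "\<And>i j. i < length ?bs \<Longrightarrow> j < length ?bs \<Longrightarrow> field_trace (ds ! i * ?bs ! j) = (if i = j then 1 else 0)"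
    "\<And>x. x = (\<Sum>j<length ?bs. of_rat (field_trace (x * ?bs ! j)) * ds ! j)"
    using trace_dual_basis[OF int_basis(1)] by blast
  have v: "vol ds * vol ?bs = 1" by (rule vol_dual[OF int_basis(3) ds(1,2)])
  have car: "carrier (inverse_different :: ('f, 'f) module) = {x. \<forall>y\<in>int_elems. field_trace (x * y) \<in> \<int>}"
    by (simp add: inverse_different_def ring_of_integers_def number_ring_def int_elems_def)
  have bsO: "?bs ! j \<in> int_elems" if "j < length ?bs" for j
    unfolding int_basis(2)[symmetric] using that by (intro int_combs_base) auto
  have "{x :: 'f. \<forall>y\<in>int_elems. field_trace (x * y) \<in> \<int>} = zspan ds"
  proof (intro equalityI subsetI)
    fix x :: 'f assume "x \<in> {x. \<forall>y\<in>int_elems. field_trace (x * y) \<in> \<int>}"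
    then have "\<exists>k. field_trace (x * ?bs ! j) = of_int k" if "j < length ?bs" for j
      using bsO[OF that] by (auto simp: Ints_def)
    then obtain c where "\<And>j. j < length ?bs \<Longrightarrow> field_trace (x * ?bs ! j) = of_int (c j)" by metis
    then have "x = (\<Sum>j<length ds. of_int (c j) * ds ! j)" using ds(3)[of x] by (simp add: ds(1))
    then show "x \<in> zspan ds" by (simp only: int_combsI)
  next
    fix x assume "x \<in> zspan ds"
    then obtain c where c: "x = (\<Sum>j<length ?bs. of_int (c j) * ds ! j)" unfolding zspan_eq by (auto simp: ds(1))
    have "field_trace (x * y) \<in> \<int>" if y: "y \<in> int_elems" for y
    proof -
      obtain e where e: "y = (\<Sum>k<length ?bs. of_int (e k) * ?bs ! k)" by (rule zspanE[OF y[folded int_basis(2)]])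
      have "x * y = (\<Sum>j<length ?bs. \<Sum>k<length ?bs. of_rat (of_int (c j * e k)) * (ds ! j * ?bs ! k))"
        by (simp add: c e sum_product of_rat_mult mult_ac)
      then have "field_trace (x * y) = (\<Sum>j<length ?bs. \<Sum>k<length ?bs. of_int (c j * e k) * field_trace (ds ! j * ?bs ! k))"
        by (simp only: field_trace_sum field_trace_linear)
      also have "\<dots> \<in> \<int>" by (intro Ints_sum Ints_mult) (auto simp: ds(2))
      finally show ?thesis .
    qed
    then show "x \<in> {x. \<forall>y\<in>int_elems. field_trace (x * y) \<in> \<int>}" by blast
  qed
  moreover have "vol ds \<noteq> 0" using v by auto
  ultimately show ?thesis using that[of ds] v car by simp
qed

text \<open>Enlarging I to the inverse different can only increase the index, and there it is N(a)
  vol(O) / vol(\<omega>), where vol(\<omega>) = 1 / vol(O) and \<Delta> = vol(O)^2.\<close>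

lemma idx_fractional_ideal_le:
  fixes I :: "'f::number_field set"
  assumes sub: "add_subgroup I" and I: "I \<subseteq> carrier inverse_different" and a: "principal a \<subseteq> I" "a \<noteq> 0"
  shows "real (idx I (principal a)) \<le> abs_discriminant TYPE('f) * field_norm a"
proof -
  obtain ds :: "'f list" where ds: "vol ds \<noteq> 0" "vol ds * vol (int_basis :: 'f list) = 1"
    "carrier (inverse_different :: ('f, 'f) module) = zspan ds" using inverse_different_zspan .
  note * = idx_zspan_principal[OF ds(1) _ a(2)]
  have az: "principal a \<subseteq> zspan ds" using a(1) I ds(3) by auto
  have "finite ((\<lambda>x. (+) x ` principal a) ` zspan ds)"
    using *(2)[OF az] unfolding idx_def by (simp add: card_gt_0_iff)
  then have "idx I (principal a) \<le> idx (zspan ds) (principal a)"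
    unfolding idx_def using I ds(3) by (intro card_mono) auto
  also have "real (idx (zspan ds) (principal a)) = abs_discriminant TYPE('f) * field_norm a"
  proof -
    have "real (idx (zspan ds) (principal a)) = real (idx (zspan ds) (principal a)) * vol ds * vol (int_basis :: 'f list)"
      using ds(2) by simp
    then show ?thesis using *(1)[OF az] by (simp add: abs_discriminant_eq power2_eq_square)
  qed
  finally show ?thesis by simp
qed

section \<open>Packing and Gaussian sums\<close>

text \<open>Packing bound without volumes: the \<open>card A ^ k\<close> sums \<open>\<Sum>\<^sub>j q\<^sup>j a\<^sub>j\<close> with
  \<open>q = 1 + 2 r / l\<close> stay \<open>l\<close>-separated inside a ball of radius \<open>l q\<^sup>k\<close>, and a crude pigeonhole count
  in that ball becomes sharp after taking \<open>k\<close>-th roots.\<close>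

locale coord_norm =
  fixes I :: "'i set" and N :: "('i \<Rightarrow> real) \<Rightarrow> real" and C :: real
  assumes fin: "finite I" and C: "C > 0"
    and tri: "\<And>x y. N (\<lambda>i. x i + y i) \<le> N x + N y"
    and hom: "\<And>c x. N (\<lambda>i. c * x i) = \<bar>c\<bar> * N x"
    and low: "\<And>x i. i \<in> I \<Longrightarrow> \<bar>x i\<bar> \<le> C * N x"
    and up: "\<And>x. N x \<le> C * (\<Sum>i\<in>I. \<bar>x i\<bar>)"
begin

lemma N_zero: "N (\<lambda>i. 0) = 0"
  using hom[of 0 "\<lambda>i. 0"] by simp

lemma N_sum: "N (\<lambda>i. \<Sum>j<k. c j * x j i) \<le> (\<Sum>j<(k::nat). \<bar>c j\<bar> * N (x j))"
proof (induction k)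
  case (Suc k)
  have "N (\<lambda>i. \<Sum>j<Suc k. c j * x j i) \<le> N (\<lambda>i. \<Sum>j<k. c j * x j i) + N (\<lambda>i. c k * x k i)"
    using tri[of "\<lambda>i. \<Sum>j<k. c j * x j i" "\<lambda>i. c k * x k i"] by simp
  then show ?case using Suc hom[of "c k" "x k"] by simp
qed (simp add: N_zero)

lemma N_diff: "N (\<lambda>i. x i - y i) \<le> N x + N y"
  using tri[of x "\<lambda>i. (-1) * y i"] hom[of "-1" y] by simp

lemma N_lower: "N x - N y \<le> N (\<lambda>i. x i + y i)"
  using N_diff[of "\<lambda>i. x i + y i" y] by simp

lemma N_nonneg: "0 \<le> N x"
  using tri[of x "\<lambda>i. (-1) * x i"] hom[of "-1" x] N_zero by simp

text \<open>The largest position where f and g differ dominates: it contributes at least q^k l,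
  while all lower positions together contribute at most 2 r (1 + ... + q^(k-1)) = l (q^k - 1) by the
  choice of q.\<close>

lemma separated_sums:
  fixes f g :: "nat \<Rightarrow> 'i \<Rightarrow> real"
  assumes l: "l > 0" and r: "r > 0" and q: "q = 1 + 2 * r / l"
    and sep: "\<And>x y. x \<in> A \<Longrightarrow> y \<in> A \<Longrightarrow> x \<noteq> y \<Longrightarrow> l \<le> N (\<lambda>i. x i - y i)"
    and bnd: "\<And>x. x \<in> A \<Longrightarrow> N x \<le> r"
  shows "(\<And>j. j < k \<Longrightarrow> f j \<in> A \<and> g j \<in> A) \<Longrightarrow> \<exists>j<k. f j \<noteq> g j \<Longrightarrow> l \<le> N (\<lambda>i. \<Sum>j<k. q ^ j * (f j i - g j i))"
proof (induction k)
  case (Suc k)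
  have q1: "q > 1" using l r by (simp add: q)
  show ?case
  proof (cases "f k = g k")
    case True
    then have "\<exists>j<k. f j \<noteq> g j" using Suc.prems(2) less_Suc_eq by auto
    then show ?thesis using Suc.IH Suc.prems(1) True by simp
  next
    case False
    have geo: "2 * r * (\<Sum>j<k. q ^ j) = l * (q ^ k - 1)"
    proof -
      have "2 * r = l * (q - 1)" using l by (simp add: q)
      then show ?thesis using q1 by (simp add: geometric_sum)
    qed
    have "N (\<lambda>i. \<Sum>j<k. q ^ j * (f j i - g j i)) \<le> (\<Sum>j<k. \<bar>q ^ j\<bar> * N (\<lambda>i. f j i - g j i))"
      by (rule N_sum[of "\<lambda>j. q ^ j" "\<lambda>j i. f j i - g j i" k])
    also have "\<dots> \<le> (\<Sum>j<k. q ^ j * (2 * r))"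
    proof (intro sum_mono)
      fix j assume "j \<in> {..<k}"
      then have "N (f j) \<le> r" "N (g j) \<le> r" using Suc.prems(1)[of j] bnd by auto
      then have "N (\<lambda>i. f j i - g j i) \<le> 2 * r" using N_diff[of "f j" "g j"] by linarith
      then show "\<bar>q ^ j\<bar> * N (\<lambda>i. f j i - g j i) \<le> q ^ j * (2 * r)" using q1 by (simp add: mult_left_mono)
    qed
    also have "\<dots> = l * (q ^ k - 1)" using geo by (simp add: sum_distrib_left mult.commute)
    finally have low: "N (\<lambda>i. \<Sum>j<k. q ^ j * (f j i - g j i)) \<le> l * (q ^ k - 1)" .
    have "l \<le> N (\<lambda>i. f k i - g k i)" using sep Suc.prems(1)[of k] False by simp
    then have "q ^ k * l \<le> N (\<lambda>i. q ^ k * (f k i - g k i))"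
      using q1 hom[of "q ^ k" "\<lambda>i. f k i - g k i"] by simp
    moreover have "N (\<lambda>i. q ^ k * (f k i - g k i)) - N (\<lambda>i. \<Sum>j<k. q ^ j * (f j i - g j i))
        \<le> N (\<lambda>i. q ^ k * (f k i - g k i) + (\<Sum>j<k. q ^ j * (f j i - g j i)))"
      by (rule N_lower)
    ultimately have "l \<le> N (\<lambda>i. q ^ k * (f k i - g k i) + (\<Sum>j<k. q ^ j * (f j i - g j i)))"
      using low by (simp add: algebra_simps)
    then show ?thesis by (simp add: add.commute)
  qed
qed simp

lemma packing:
  assumes A: "finite A" and l: "l > 0" and r: "r > 0"
    and sep: "\<And>x y. x \<in> A \<Longrightarrow> y \<in> A \<Longrightarrow> x \<noteq> y \<Longrightarrow> l \<le> N (\<lambda>i. x i - y i)"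
    and bnd: "\<And>x. x \<in> A \<Longrightarrow> N x \<le> r"
  shows "real (card A) \<le> (1 + 2 * r / l) ^ card I"
proof -
  define q where "q = 1 + 2 * r / l"
  define D where "D = card I"
  have q1: "q > 1" using l r by (simp add: q_def)
  \<comment> \<open>Points in one cell of side e are at distance at most C D e < l. Coordinates are
    bounded by C l q^k, which is K q^k in units of e.\<close>
  define K where "K = C * C * (real D + 1)"
  define e where "e = l / (C * (real D + 1))"
  have e: "e > 0" using l C by (simp add: e_def)
  have K0: "K > 0" using C by (simp add: K_def)
  have main: "real (card A) ^ k \<le> ((2 * K + 5) * q ^ k) ^ D" for k
  proof -
    define S where "S = (\<lambda>(f :: nat \<Rightarrow> 'i \<Rightarrow> real) i. \<Sum>j<k. q ^ j * f j i :: real)"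
    \<comment> \<open>As M \<le> K q^k + 2 and q^k \<ge> 1, each coordinate takes at most 2 M + 1
      \<le> (2 K + 5) q^k values; this is the origin of the 5.\<close>
    define M where "M = \<lceil>K * q ^ k\<rceil> + 1"
    define cell where "cell = (\<lambda>f. \<lambda>i\<in>I. \<lfloor>S f i / e\<rfloor>)"
    let ?P = "{..<k} \<rightarrow>\<^sub>E A"
    have bound: "N (S f) \<le> l * q ^ k" if f: "f \<in> ?P" for f
    proof -
      have "N (S f) \<le> (\<Sum>j<k. \<bar>q ^ j\<bar> * N (f j))" unfolding S_def by (rule N_sum)
      also have "\<dots> \<le> (\<Sum>j<k. q ^ j * r)" using f q1 bnd by (intro sum_mono) (auto intro!: mult_left_mono)
      also have "\<dots> = r * ((q ^ k - 1) / (q - 1))" using q1 by (simp add: sum_distrib_right[symmetric] geometric_sum)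
      also have "\<dots> = l / 2 * (q ^ k - 1)" using l r by (simp add: q_def field_simps)
      also have "\<dots> \<le> l * q ^ k"
      proof -
        have "l * q ^ k \<ge> 0" using l q1 by simp
        then show ?thesis using l by (simp add: algebra_simps)
      qed
      finally show ?thesis .
    qed
    have cell: "cell f \<in> I \<rightarrow>\<^sub>E {-M..M}" if f: "f \<in> ?P" for f
    proof -
      have "\<lfloor>S f i / e\<rfloor> \<in> {-M..M}" if i: "i \<in> I" for i
      proof -
        have "\<bar>S f i\<bar> \<le> C * (l * q ^ k)"
          using low[OF i, of "S f"] bound[OF f] C by (meson mult_left_mono less_imp_le order_trans)
        then have "\<bar>S f i / e\<bar> \<le> C * (l * q ^ k) / e" using e by (simp add: divide_right_mono)
        also have "\<dots> = K * q ^ k" using l C by (simp add: e_def K_def)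
        finally show ?thesis unfolding M_def atLeastAtMost_iff by linarith
      qed
      then show ?thesis by (auto simp: cell_def)
    qed
    have inj: "inj_on cell ?P"
    proof (rule inj_onI, rule ccontr)
      fix f g assume fg: "f \<in> ?P" "g \<in> ?P" "cell f = cell g" "f \<noteq> g"
      have ex: "\<exists>j<k. f j \<noteq> g j"
      proof (rule ccontr)
        assume "\<not> (\<exists>j<k. f j \<noteq> g j)"
        then have "f = g" using fg(1,2) by (intro PiE_ext[of f "{..<k}" "\<lambda>_. A" g]) auto
        then show False using fg(4) by simp
      qed
      have "l \<le> N (\<lambda>i. \<Sum>j<k. q ^ j * (f j i - g j i))"
        by (rule separated_sums[where A = A, OF l r q_def sep bnd _ ex]) (use fg(1,2) in \<open>auto simp: PiE_iff\<close>)
      also have "(\<lambda>i. \<Sum>j<k. q ^ j * (f j i - g j i)) = (\<lambda>i. S f i - S g i)"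
        by (simp add: S_def right_diff_distrib sum_subtractf)
      also have "N (\<lambda>i. S f i - S g i) \<le> C * (\<Sum>i\<in>I. \<bar>S f i - S g i\<bar>)" by (rule up)
      also have "\<dots> \<le> C * (\<Sum>i\<in>I. e)"
      proof (intro mult_left_mono sum_mono)
        fix i assume i: "i \<in> I"
        have "\<lfloor>S f i / e\<rfloor> = \<lfloor>S g i / e\<rfloor>" using fun_cong[OF fg(3), of i] i by (simp add: cell_def)
        then have "\<bar>S f i / e - S g i / e\<bar> < 1" by linarith
        then have "\<bar>S f i - S g i\<bar> / e < 1" using e by (simp add: diff_divide_distrib[symmetric])
        then show "\<bar>S f i - S g i\<bar> \<le> e" using e by (simp add: field_simps)
      qed (use C in simp)
      also have "\<dots> = l * (real D / (real D + 1))" using C by (simp add: e_def D_def)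
      also have "\<dots> < l * 1" using l by (intro mult_strict_left_mono) auto
      finally show False by simp
    qed
    have "card ?P \<le> card (I \<rightarrow>\<^sub>E {-M..M})"
      by (rule card_inj_on_le[OF inj]) (use cell fin in \<open>auto intro!: finite_PiE\<close>)
    then have "card A ^ k \<le> nat (2 * M + 1) ^ D"
      by (simp add: card_PiE fin D_def) 
    then have "real (card A) ^ k \<le> real (nat (2 * M + 1)) ^ D"
      by (metis of_nat_le_iff of_nat_power)
    also have "\<dots> \<le> ((2 * K + 5) * q ^ k) ^ D"
    proof (rule power_mono)
      have "K * q ^ k \<ge> 0" using K0 q1 by simp
      then have "M \<ge> 0" unfolding M_def by linarith
      have "real_of_int M \<le> K * q ^ k + 2" unfolding M_def by linarith
      moreover have "1 \<le> q ^ k" using q1 by simp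
      moreover have "real (nat (2 * M + 1)) = 2 * real_of_int M + 1" using \<open>M \<ge> 0\<close> by simp
      ultimately show "real (nat (2 * M + 1)) \<le> (2 * K + 5) * q ^ k" by (simp add: algebra_simps)
    qed simp
    finally show ?thesis .
  qed
  \<comment> \<open>The factor (2 K + 5)^D does not depend on k, so a ratio card A / q^D above 1
    would outgrow it.\<close>
  have "real (card A) \<le> q ^ D"
  proof (rule ccontr)
    assume "\<not> real (card A) \<le> q ^ D"
    then have x: "1 < real (card A) / q ^ D" using q1 by simp
    obtain k where k: "(2 * K + 5) ^ D < (real (card A) / q ^ D) ^ k" using real_arch_pow[OF x] by blast
    also have "\<dots> = real (card A) ^ k / (q ^ k) ^ D" by (simp add: power_divide power_mult[symmetric] mult.commute)
    finally have "(2 * K + 5) ^ D * (q ^ k) ^ D < real (card A) ^ k" using q1 by (simp add: field_simps)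
    then show False using main[of k] by (simp add: power_mult_distrib)
  qed
  then show ?thesis by (simp add: q_def D_def)
qed

end

text \<open>With y = u/l this is y \<le> exp (y - 1) raised to the power D/2. The hypothesis D \<le>
  l enters here and makes the exponent (u - l)/2 independent of D.\<close>

lemma sqrt_power_le_exp:
  assumes "l > 0" "real D \<le> l" "l \<le> u"
  shows "sqrt (u / l) ^ D \<le> exp ((u - l) / 2)"
proof -
  have "u / l \<le> exp (u / l - 1)" using exp_ge_add_one_self[of "u / l - 1"] by simp
  then have "sqrt (u / l) \<le> sqrt (exp (u / l - 1))" by simp
  also have "\<dots> = exp ((u / l - 1) / 2)"
    by (rule real_sqrt_unique) (simp_all add: power2_eq_square exp_add[symmetric])
  finally have "sqrt (u / l) ^ D \<le> exp ((u / l - 1) / 2) ^ D"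
    using assms by (intro power_mono) auto
  also have "\<dots> = exp (real D * ((u / l - 1) / 2))" by (rule exp_of_nat_mult[symmetric])
  also have "\<dots> \<le> exp ((u - l) / 2)"
  proof -
    have "real D * (u / l - 1) \<le> l * (u / l - 1)" using assms by (intro mult_right_mono) auto
    also have "\<dots> = u - l" using assms by (simp add: field_simps)
    finally show ?thesis by simp
  qed
  finally show ?thesis .
qed

text \<open>Layer cake: exp (-t Q) is t times the integral of exp (-t u) over u \<ge> Q, so the sum
  is t times the integral of the counting function against exp (-t u). The growth of the count costs
  a factor exp (u/2), whence t > 1/2.\<close>

lemma gauss_sum_bound:
  fixes Q :: "'x \<Rightarrow> real"
  assumes Y: "finite Y" and l: "l > 0" "real D \<le> l" and t: "t > 1 / 2"
    and Q: "\<And>y. y \<in> Y \<Longrightarrow> l \<le> Q y"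
    and count: "\<And>u. l \<le> u \<Longrightarrow> real (card {y \<in> Y. Q y \<le> u}) \<le> (3 * sqrt (u / l)) ^ D"
  shows "(\<Sum>y\<in>Y. exp (- t * Q y)) \<le> 3 ^ D * exp (- t * l) * (t / (t - 1 / 2))"
proof -
  have t0: "t > 0" using t by simp
  have exp_int: "((\<lambda>u. if u \<in> {Q y..} then exp (- t * u) else 0) has_integral exp (- t * Q y) / t) {l..}" if "y \<in> Y" for y
    using Q[OF that]
    by (intro iffD2[OF has_integral_restrict[of "{Q y..}" "{l..}" "\<lambda>u. exp (- t * u)"]]
        has_integral_exp_minus_to_infinity[OF t0]) auto
  have lhs: "((\<lambda>u. t * (\<Sum>y\<in>Y. if u \<in> {Q y..} then exp (- t * u) else 0)) has_integral t * (\<Sum>y\<in>Y. exp (- t * Q y) / t)) {l..}"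
    using Y exp_int by (intro has_integral_mult_right has_integral_sum) auto
  have rhs: "((\<lambda>u. (t * 3 ^ D * exp (- l / 2)) * exp (- (t - 1 / 2) * u)) has_integral
      (t * 3 ^ D * exp (- l / 2)) * (exp (- (t - 1 / 2) * l) / (t - 1 / 2))) {l..}"
    using t by (intro has_integral_mult_right has_integral_exp_minus_to_infinity) simp
  have "t * (\<Sum>y\<in>Y. exp (- t * Q y) / t) \<le> (t * 3 ^ D * exp (- l / 2)) * (exp (- (t - 1 / 2) * l) / (t - 1 / 2))"
  proof (rule has_integral_le[OF lhs rhs])
    fix u assume u: "u \<in> {l..}"
    have "(\<Sum>y\<in>Y. if u \<in> {Q y..} then exp (- t * u) else 0) = real (card {y \<in> Y. Q y \<le> u}) * exp (- t * u)"
      using Y by (simp add: sum.If_cases Int_def)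
    also have "\<dots> \<le> (3 * sqrt (u / l)) ^ D * exp (- t * u)"
      using count u by (intro mult_right_mono) auto
    also have "\<dots> \<le> (3 ^ D * exp ((u - l) / 2)) * exp (- t * u)"
      using sqrt_power_le_exp[OF l, of u] u by (intro mult_right_mono) (auto simp: power_mult_distrib)
    also have "\<dots> = 3 ^ D * (exp (- l / 2) * exp (- (t - 1 / 2) * u))"
      unfolding mult.assoc exp_add[symmetric] by (simp add: field_simps)
    finally show "t * (\<Sum>y\<in>Y. if u \<in> {Q y..} then exp (- t * u) else 0) \<le> (t * 3 ^ D * exp (- l / 2)) * exp (- (t - 1 / 2) * u)"
      using t0 by (simp add: mult.assoc)
  qed
  also have "t * (\<Sum>y\<in>Y. exp (- t * Q y) / t) = (\<Sum>y\<in>Y. exp (- t * Q y))"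
    using t0 by (simp add: sum_distrib_left)
  also have "(t * 3 ^ D * exp (- l / 2)) * (exp (- (t - 1 / 2) * l) / (t - 1 / 2)) =
      3 ^ D * (exp (- l / 2) * exp (- (t - 1 / 2) * l)) * (t / (t - 1 / 2))" by simp
  also have "exp (- l / 2) * exp (- (t - 1 / 2) * l) = exp (- t * l)"
    unfolding exp_add[symmetric] by (simp add: algebra_simps)
  finally show ?thesis .
qed

context coord_norm
begin

text \<open>Here l bounds the norm and l^2 its square. For u \<ge> l^2 one has sqrt u / l \<ge> 1,
  so the packing bound (1 + 2 sqrt u / l)^D is at most (3 sqrt u / l)^D.\<close>

lemma lattice_gauss_bound:
  fixes l t :: real and L Y :: "('i \<Rightarrow> real) set"
  assumes L: "\<And>x y. x \<in> L \<Longrightarrow> y \<in> L \<Longrightarrow> (\<lambda>i. x i - y i) \<in> L" "(\<lambda>i. 0) \<in> L"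
    and l: "l > 0" "real (card I) \<le> l ^ 2" and min: "\<And>x. x \<in> L \<Longrightarrow> x \<noteq> (\<lambda>i. 0) \<Longrightarrow> l \<le> N x"
    and t: "t > 1 / 2" and Y: "finite Y" "Y \<subseteq> L" "(\<lambda>i. 0) \<notin> Y"
  shows "(\<Sum>y\<in>Y. exp (- t * (N y)\<^sup>2)) \<le> 3 ^ card I * exp (- t * l ^ 2) * (t / (t - 1 / 2))"
proof (rule gauss_sum_bound[OF Y(1) _ l(2) t])
  show "0 < l ^ 2" using l by simp
  show "l ^ 2 \<le> (N y)\<^sup>2" if "y \<in> Y" for y
  proof -
    have "l \<le> N y" using min[of y] that Y(2,3) by auto
    then show ?thesis using l by (intro power_mono) auto
  qed
  fix u assume u: "l ^ 2 \<le> u"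
  then have u0: "u > 0" using l by (smt (verit) zero_less_power)
  have su: "l \<le> sqrt u" using u l by (simp add: real_le_rsqrt)
  have "real (card (insert (\<lambda>i. 0) {y \<in> Y. (N y)\<^sup>2 \<le> u})) \<le> (1 + 2 * sqrt u / l) ^ card I"
  proof (rule packing)
    fix x y assume xy: "x \<in> insert (\<lambda>i. 0) {y \<in> Y. (N y)\<^sup>2 \<le> u}" "y \<in> insert (\<lambda>i. 0) {y \<in> Y. (N y)\<^sup>2 \<le> u}" "x \<noteq> y"
    then have "x \<in> L" "y \<in> L" using Y(2) L(2) by auto
    moreover have "(\<lambda>i. x i - y i) \<noteq> (\<lambda>i. 0)" using xy(3) by (auto simp: fun_eq_iff)
    ultimately show "l \<le> N (\<lambda>i. x i - y i)" using min L(1) by blast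
  next
    fix x assume "x \<in> insert (\<lambda>i. 0) {y \<in> Y. (N y)\<^sup>2 \<le> u}"
    then show "N x \<le> sqrt u" using N_zero u0 by (auto intro: real_le_rsqrt)
  qed (use Y l u0 in auto)
  then have "real (card {y \<in> Y. (N y)\<^sup>2 \<le> u}) \<le> (1 + 2 * sqrt u / l) ^ card I"
    using card_insert_le[of "{y \<in> Y. (N y)\<^sup>2 \<le> u}" "\<lambda>i. 0"] by linarith
  also have "\<dots> \<le> (3 * sqrt (u / l ^ 2)) ^ card I"
  proof (rule power_mono)
    have "sqrt (u / l ^ 2) = sqrt u / l" using l by (simp add: real_sqrt_divide)
    moreover have "1 \<le> sqrt u / l" using su l by simp
    ultimately show "1 + 2 * sqrt u / l \<le> 3 * sqrt (u / l ^ 2)" by simp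
    show "0 \<le> 1 + 2 * sqrt u / l" using l u0 by simp
  qed
  finally show "real (card {y \<in> Y. (N y)\<^sup>2 \<le> u}) \<le> (3 * sqrt (u / l ^ 2)) ^ card I" .
qed

end

section \<open>Base change of a module over the ring of integers\<close>

lemma carrier_ring_of_integers: "carrier (ring_of_integers :: 'f::number_field ring) = int_elems"
  and ring_of_integers_ops [simp]:
    "(\<otimes>\<^bsub>ring_of_integers :: 'f ring\<^esub>) = (*)" "(\<oplus>\<^bsub>ring_of_integers :: 'f ring\<^esub>) = (+)"
    "\<one>\<^bsub>ring_of_integers :: 'f ring\<^esub> = 1" "\<zero>\<^bsub>ring_of_integers :: 'f ring\<^esub> = 0"
  by (simp_all add: ring_of_integers_def number_ring_def int_elems_def)

text \<open>Functionals with values in F. In contrast to \<open>linear_maps\<close>, nothing is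
  prescribed outside the carrier, so coordinate functions qualify as they stand.\<close>

definition of_linear :: "('f::number_field, 'm) module \<Rightarrow> ('m \<Rightarrow> 'f) \<Rightarrow> bool" where
  "of_linear M \<xi> \<longleftrightarrow> (\<forall>x\<in>carrier M. \<forall>y\<in>carrier M. \<xi> (x \<oplus>\<^bsub>M\<^esub> y) = \<xi> x + \<xi> y) \<and>
     (\<forall>r\<in>int_elems. \<forall>x\<in>carrier M. \<xi> (r \<odot>\<^bsub>M\<^esub> x) = r * \<xi> x)"

lemma of_linearD:
  assumes "of_linear M \<xi>"
  shows "x \<in> carrier M \<Longrightarrow> y \<in> carrier M \<Longrightarrow> \<xi> (x \<oplus>\<^bsub>M\<^esub> y) = \<xi> x + \<xi> y"
    "r \<in> int_elems \<Longrightarrow> x \<in> carrier M \<Longrightarrow> \<xi> (r \<odot>\<^bsub>M\<^esub> x) = r * \<xi> x"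
  using assms by (auto simp: of_linear_def)

locale of_module =
  fixes M :: "('f::number_field, 'm) module"
  assumes M: "Module.module ring_of_integers M"
begin

sublocale Module.module ring_of_integers M by (rule M)

lemma smult_mem [simp]: "r \<in> int_elems \<Longrightarrow> x \<in> carrier M \<Longrightarrow> r \<odot>\<^bsub>M\<^esub> x \<in> carrier M"
  by (simp add: smult_closed carrier_ring_of_integers)

lemma of_linear_zero: "of_linear M \<xi> \<Longrightarrow> \<xi> \<zero>\<^bsub>M\<^esub> = 0"
  using of_linearD(1)[of M \<xi> "\<zero>\<^bsub>M\<^esub>" "\<zero>\<^bsub>M\<^esub>"] by simp

lemma of_linear_finsum:
  assumes "of_linear M \<xi>" "finite A" "\<And>i. i \<in> A \<Longrightarrow> g i \<in> carrier M"
  shows "\<xi> (\<Oplus>\<^bsub>M\<^esub>i\<in>A. g i) = (\<Sum>i\<in>A. \<xi> (g i))"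
  using assms(2,3)
proof (induction A rule: finite_induct)
  case (insert a A)
  then have "g \<in> A \<rightarrow> carrier M" "g a \<in> carrier M" by auto
  then show ?case using insert by (simp add: of_linearD(1)[OF assms(1)])
qed (simp add: of_linear_zero[OF assms(1)])

end

text \<open>Serves the generic fibre, with K all of F and \<psi> the identity, and the fibres at the
  infinite places. K is a subset because the completion at a real place is realised inside the type
  \<open>complex\<close>.\<close>

locale base_change_field = of_module M for M :: "('f::number_field, 'm) module" +
  fixes K :: "'s::field_char_0 set" and \<psi> :: "'f \<Rightarrow> 's"
  assumes K: "0 \<in> K" "1 \<in> K" "\<And>x y. x \<in> K \<Longrightarrow> y \<in> K \<Longrightarrow> x + y \<in> K" "\<And>x y. x \<in> K \<Longrightarrow> y \<in> K \<Longrightarrow> x * y \<in> K"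
      "\<And>x. x \<in> K \<Longrightarrow> - x \<in> K" "\<And>x. x \<in> K \<Longrightarrow> inverse x \<in> K"
    and \<psi>K: "\<And>x. \<psi> x \<in> K"
    and \<psi>: "\<psi> 1 = 1" "\<And>x y. \<psi> (x + y) = \<psi> x + \<psi> y" "\<And>x y. \<psi> (x * y) = \<psi> x * \<psi> y"
begin

lemma \<psi>_0: "\<psi> 0 = 0" using \<psi>(2)[of 0 0] by simp

lemma \<psi>_of_nat: "\<psi> (of_nat m) = of_nat m"
  by (induction m) (simp_all add: \<psi> \<psi>_0)

definition S :: "'s ring" where
  "S = \<lparr>carrier = K, monoid.mult = (*), one = 1, ring.zero = 0, ring.add = (+)\<rparr>"

definition B :: "('s, ('m, 's) tensor) module" where
  "B = base_change ring_of_integers S \<psi> M"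

definition H :: "('m, 's) tensor" where
  "H = tensor_kernel ring_of_integers S \<psi> M"

definition T :: "('m, 's) tensor" where
  "T = {t. Poly_Mapping.keys t \<subseteq> carrier M \<times> K}"

definition cls :: "(('m \<times> 's) \<Rightarrow>\<^sub>0 int) \<Rightarrow> ('m, 's) tensor" where
  "cls t = tensor_class ring_of_integers S \<psi> M t"

lemma S_simps [simp]: "carrier S = K" "(\<otimes>\<^bsub>S\<^esub>) = (*)" "\<one>\<^bsub>S\<^esub> = 1" "\<zero>\<^bsub>S\<^esub> = 0" "(\<oplus>\<^bsub>S\<^esub>) = (+)"
  by (simp_all add: S_def)

lemma T_closed: "0 \<in> T" "t \<in> T \<Longrightarrow> u \<in> T \<Longrightarrow> t + u \<in> T" "t \<in> T \<Longrightarrow> u \<in> T \<Longrightarrow> t - u \<in> T" "t \<in> T \<Longrightarrow> - t \<in> T"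
  "x \<in> carrier M \<Longrightarrow> a \<in> K \<Longrightarrow> frag_of (x, a) \<in> T"
  unfolding T_def using keys_add[of t u] keys_diff[of t u] by (auto simp del: keys_add)

lemma T_sum: "(\<And>i. i \<in> A \<Longrightarrow> g i \<in> T) \<Longrightarrow> (\<Sum>i\<in>A. g i) \<in> T"
  by (induction A rule: infinite_finite_induct) (auto simp: T_closed)

lemma formal_tensors_simps:
  "carrier (formal_tensors S M) = T" "(\<otimes>\<^bsub>formal_tensors S M\<^esub>) = (+)" "\<one>\<^bsub>formal_tensors S M\<^esub> = 0"
  "comm_group (formal_tensors S M)"
  by (auto simp: formal_tensors_def T_def abelian_free_Abelian_group fun_eq_iff)

abbreviation rels :: "('m, 's) tensor" where
  "rels \<equiv> tensor_relations ring_of_integers S \<psi> M"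

lemma rels_subset: "rels \<subseteq> T"
  unfolding tensor_relations_def
  by (auto simp: carrier_ring_of_integers K \<psi>K intro!: T_closed(3) T_closed(5))

lemma H_subgroup: "subgroup H (formal_tensors S M)"
  unfolding H_def tensor_kernel_def
  by (rule group.generate_is_subgroup) (use formal_tensors_simps rels_subset in \<open>auto simp: comm_group_def\<close>)

lemma H_add_subgroup: "add_subgroup H" and HT: "H \<subseteq> T" and rels_H: "rels \<subseteq> H"
proof -
  interpret subgroup H "formal_tensors S M" by (rule H_subgroup)
  interpret G: comm_group "formal_tensors S M" by (rule formal_tensors_simps)
  show HT: "H \<subseteq> T" using subset by (simp add: formal_tensors_simps)
  have "x - y \<in> H" if xy: "x \<in> H" "y \<in> H" for x y
  proof -
    have "inv\<^bsub>formal_tensors S M\<^esub> y = - y"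
      unfolding formal_tensors_def by (rule inv_free_Abelian_group) (use xy(2) HT in \<open>auto simp: T_def\<close>)
    then show ?thesis using m_closed[OF xy(1) m_inv_closed[OF xy(2)]] by (simp add: formal_tensors_simps)
  qed
  then show "add_subgroup H" using one_closed by (simp add: add_subgroup_def formal_tensors_simps)
  show "rels \<subseteq> H" unfolding H_def tensor_kernel_def by (auto intro: generate.incl)
qed

lemma H_induct [consumes 1, case_names zero rel add minus]:
  assumes "h \<in> H" "P 0" "\<And>r. r \<in> rels \<Longrightarrow> P r" "\<And>x y. P x \<Longrightarrow> P y \<Longrightarrow> P (x + y)" "\<And>x. P x \<Longrightarrow> P (- x)"
  shows "P h"
proof -
  have "h \<in> generate (formal_tensors S M) rels" using assms(1) by (simp add: H_def tensor_kernel_def)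
  then show ?thesis
  proof (induction rule: generate.induct)
    case (inv h)
    have "inv\<^bsub>formal_tensors S M\<^esub> h = - h"
      unfolding formal_tensors_def by (rule inv_free_Abelian_group) (use inv rels_subset in \<open>auto simp: T_def\<close>)
    then show ?case using assms(3,5) inv by simp
  qed (use assms in \<open>auto simp: formal_tensors_simps\<close>)
qed

lemma cls_coset: "cls t = (+) t ` H"
  unfolding cls_def tensor_class_def r_coset_def H_def[symmetric]
  by (auto simp: formal_tensors_simps add.commute image_iff)

lemma cls_eq_iff: "cls t = cls u \<longleftrightarrow> t - u \<in> H"
  unfolding cls_coset by (rule coset_eq_iff[OF H_add_subgroup])

lemma mem_cls: "t \<in> cls t" unfolding cls_coset using add_subgroupD(1)[OF H_add_subgroup] by force

lemma mem_clsD: "u \<in> cls t \<Longrightarrow> u - t \<in> H" "u \<in> cls t \<Longrightarrow> cls u = cls t"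
  unfolding cls_eq_iff by (auto simp: cls_coset)

lemma carrier_B: "carrier B = cls ` T"
proof -
  have "carrier B = rcosets\<^bsub>formal_tensors S M\<^esub> H"
    by (simp add: B_def base_change_def Let_def FactGroup_def H_def)
  also have "\<dots> = cls ` T"
    unfolding RCOSETS_def cls_def tensor_class_def H_def[symmetric] by (auto simp: formal_tensors_simps)
  finally show ?thesis .
qed

lemma zero_B: "\<zero>\<^bsub>B\<^esub> = cls 0"
  unfolding cls_coset by (simp add: B_def base_change_def Let_def FactGroup_def H_def)

lemma add_B: "t \<in> T \<Longrightarrow> u \<in> T \<Longrightarrow> cls t \<oplus>\<^bsub>B\<^esub> cls u = cls (t + u)"
proof -
  assume tu: "t \<in> T" "u \<in> T"
  interpret normal H "formal_tensors S M"
    by (rule comm_group.subgroup_imp_normal[OF formal_tensors_simps(4) H_subgroup])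
  have "cls t \<oplus>\<^bsub>B\<^esub> cls u = cls t <#>\<^bsub>formal_tensors S M\<^esub> cls u"
    by (simp add: B_def base_change_def Let_def FactGroup_def)
  also have "\<dots> = cls (t + u)"
    unfolding cls_def tensor_class_def H_def[symmetric]
    using rcos_sum[of t u] tu by (simp add: formal_tensors_simps)
  finally show ?thesis .
qed

lemma abelian_group_B: "abelian_group B"
proof (rule abelian_groupI)
  fix x y z assume xyz: "x \<in> carrier B" "y \<in> carrier B" "z \<in> carrier B"
  then obtain t u w where *: "t \<in> T" "u \<in> T" "w \<in> T" "x = cls t" "y = cls u" "z = cls w" by (auto simp: carrier_B)
  show "x \<oplus>\<^bsub>B\<^esub> y \<oplus>\<^bsub>B\<^esub> z = x \<oplus>\<^bsub>B\<^esub> (y \<oplus>\<^bsub>B\<^esub> z)"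
    using * by (simp add: add_B T_closed add.assoc)
next
  fix x y assume xy: "x \<in> carrier B" "y \<in> carrier B"
  then obtain t u where *: "t \<in> T" "u \<in> T" "x = cls t" "y = cls u" by (auto simp: carrier_B)
  show "x \<oplus>\<^bsub>B\<^esub> y \<in> carrier B" using * by (auto simp: add_B T_closed carrier_B)
  show "x \<oplus>\<^bsub>B\<^esub> y = y \<oplus>\<^bsub>B\<^esub> x" using * by (simp add: add_B T_closed add.commute)
next
  fix x assume "x \<in> carrier B"
  then obtain t where *: "t \<in> T" "x = cls t" by (auto simp: carrier_B)
  show "\<zero>\<^bsub>B\<^esub> \<oplus>\<^bsub>B\<^esub> x = x" using * by (simp add: zero_B add_B T_closed)
  show "\<exists>y\<in>carrier B. y \<oplus>\<^bsub>B\<^esub> x = \<zero>\<^bsub>B\<^esub>"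
    using * by (intro bexI[of _ "cls (- t)"]) (auto simp: zero_B add_B T_closed carrier_B)
qed (auto simp: zero_B carrier_B T_closed)

lemma finsum_B:
  assumes "finite A" "\<And>i. i \<in> A \<Longrightarrow> t i \<in> T"
  shows "(\<Oplus>\<^bsub>B\<^esub>i\<in>A. cls (t i)) = cls (\<Sum>i\<in>A. t i)"
proof -
  interpret B: abelian_group B by (rule abelian_group_B)
  show ?thesis
    using assms
  proof (induction A rule: finite_induct)
    case (insert a A)
    then have "(\<lambda>i. cls (t i)) \<in> A \<rightarrow> carrier B" "cls (t a) \<in> carrier B" by (auto simp: carrier_B)
    then show ?case using insert by (simp add: add_B T_sum)
  qed (simp add: zero_B)
qed

definition scl :: "'s \<Rightarrow> (('m \<times> 's) \<Rightarrow>\<^sub>0 int) \<Rightarrow> (('m \<times> 's) \<Rightarrow>\<^sub>0 int)" where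
  "scl s t = frag_extend (\<lambda>(x, a). frag_of (x, s * a)) t"

lemma scl_simps: "scl s 0 = 0" "scl s (t + u) = scl s t + scl s u" "scl s (t - u) = scl s t - scl s u"
  "scl s (- t) = - scl s t" "scl s (frag_of (x, a)) = frag_of (x, s * a)"
  by (simp_all add: scl_def frag_extend_add frag_extend_diff frag_extend_minus)

lemma relsI:
  "x \<in> carrier M \<Longrightarrow> y \<in> carrier M \<Longrightarrow> a \<in> K \<Longrightarrow> frag_of (x \<oplus>\<^bsub>M\<^esub> y, a) - frag_of (x, a) - frag_of (y, a) \<in> rels"
  "x \<in> carrier M \<Longrightarrow> a \<in> K \<Longrightarrow> b \<in> K \<Longrightarrow> frag_of (x, a + b) - frag_of (x, a) - frag_of (x, b) \<in> rels"
  "r \<in> int_elems \<Longrightarrow> x \<in> carrier M \<Longrightarrow> a \<in> K \<Longrightarrow> frag_of (r \<odot>\<^bsub>M\<^esub> x, a) - frag_of (x, \<psi> r * a) \<in> rels"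
  unfolding tensor_relations_def S_simps carrier_ring_of_integers by blast+

lemma rels_cases [consumes 1, case_names left right smult]:
  assumes "r \<in> rels"
  obtains x y a where "x \<in> carrier M" "y \<in> carrier M" "a \<in> K" "r = frag_of (x \<oplus>\<^bsub>M\<^esub> y, a) - frag_of (x, a) - frag_of (y, a)"
  | x a b where "x \<in> carrier M" "a \<in> K" "b \<in> K" "r = frag_of (x, a + b) - frag_of (x, a) - frag_of (x, b)"
  | c x a where "c \<in> int_elems" "x \<in> carrier M" "a \<in> K" "r = frag_of (c \<odot>\<^bsub>M\<^esub> x, a) - frag_of (x, \<psi> c * a)"
  using assms unfolding tensor_relations_def S_simps carrier_ring_of_integers
proof (elim UnE CollectE exE conjE)
  fix x y a assume "r = frag_of (x \<oplus>\<^bsub>M\<^esub> y, a) - frag_of (x, a) - frag_of (y, a)" "x \<in> carrier M" "y \<in> carrier M" "a \<in> K"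
  then show thesis using that(1)[of x y a] by simp
next
  fix x a b assume "r = frag_of (x, a + b) - frag_of (x, a) - frag_of (x, b)" "x \<in> carrier M" "a \<in> K" "b \<in> K"
  then show thesis using that(2)[of x a b] by simp
next
  fix c x a assume "r = frag_of (c \<odot>\<^bsub>M\<^esub> x, a) - frag_of (x, \<psi> c * a)" "c \<in> int_elems" "x \<in> carrier M" "a \<in> K"
  then show thesis using that(3)[of c x a] by simp
qed

text \<open>Scaling the second factor maps each of the three kinds of relations to a relation of the
  same kind; hence scalar multiplication is well defined on cosets.\<close>

lemma scl_H: "s \<in> K \<Longrightarrow> h \<in> H \<Longrightarrow> scl s h \<in> H"
proof -
  assume s: "s \<in> K" and h: "h \<in> H"
  from h show ?thesis
  proof (induction rule: H_induct)
    case (rel r)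
    then have "scl s r \<in> rels"
    proof (cases rule: rels_cases)
      case (left x y a)
      then show ?thesis using relsI(1)[of x y "s * a"] s by (simp add: scl_simps K)
    next
      case (right x a b)
      then show ?thesis using relsI(2)[of x "s * a" "s * b"] s by (simp add: scl_simps K distrib_left)
    next
      case (smult c x a)
      then show ?thesis using relsI(3)[of c x "s * a"] s by (simp add: scl_simps K mult.left_commute)
    qed
    then show ?case using rels_H by blast
  qed (auto simp: scl_simps add_subgroupD[OF H_add_subgroup])
qed

lemma smult_B: "s \<in> K \<Longrightarrow> s \<odot>\<^bsub>B\<^esub> cls t = cls (scl s t)"
proof -
  assume s: "s \<in> K"
  have "s \<odot>\<^bsub>B\<^esub> cls t = (\<Union>u\<in>cls t. cls (scl s u))"
    by (simp add: B_def base_change_def Let_def cls_def scl_def)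
  moreover have "cls (scl s u) = cls (scl s t)" if "u \<in> cls t" for u
    using scl_H[OF s mem_clsD(1)[OF that]] by (simp add: cls_eq_iff scl_simps)
  moreover have "cls t \<noteq> {}" using mem_cls by blast
  ultimately show ?thesis by simp
qed

lemma pure_tensor_cls: "pure_tensor ring_of_integers S \<psi> M x a = cls (frag_of (x, a))"
  by (simp add: pure_tensor_def cls_def)

lemma cls_rel:
  "x \<in> carrier M \<Longrightarrow> y \<in> carrier M \<Longrightarrow> a \<in> K \<Longrightarrow> cls (frag_of (x \<oplus>\<^bsub>M\<^esub> y, a)) = cls (frag_of (x, a) + frag_of (y, a))"
  "x \<in> carrier M \<Longrightarrow> a \<in> K \<Longrightarrow> b \<in> K \<Longrightarrow> cls (frag_of (x, a + b)) = cls (frag_of (x, a) + frag_of (x, b))"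
  "r \<in> int_elems \<Longrightarrow> x \<in> carrier M \<Longrightarrow> a \<in> K \<Longrightarrow> cls (frag_of (r \<odot>\<^bsub>M\<^esub> x, a)) = cls (frag_of (x, \<psi> r * a))"
  unfolding cls_eq_iff using relsI rels_H by (auto simp: diff_diff_eq[symmetric])

lemma cls_add_cong: "cls t = cls t' \<Longrightarrow> cls u = cls u' \<Longrightarrow> cls (t + u) = cls (t' + u')"
  unfolding cls_eq_iff using add_subgroupD(4)[OF H_add_subgroup, of "t - t'" "u - u'"] by (simp add: algebra_simps)

lemma cls_diff_cong: "cls t = cls t' \<Longrightarrow> cls u = cls u' \<Longrightarrow> cls (t - u) = cls (t' - u')"
  unfolding cls_eq_iff using add_subgroupD(2)[OF H_add_subgroup, of "t - t'" "u - u'"] by (simp add: algebra_simps)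

lemma cls_diff:
  assumes "x \<in> carrier M" "a \<in> K" "b \<in> K"
  shows "cls (frag_of (x, a - b)) = cls (frag_of (x, a) - frag_of (x, b))"
proof -
  have "a - b \<in> K" using K(3)[OF assms(2) K(5)[OF assms(3)]] by simp
  from cls_rel(2)[OF assms(1) this assms(3)]
  have "frag_of (x, a) - (frag_of (x, a - b) + frag_of (x, b)) \<in> H" by (simp add: cls_eq_iff)
  from add_subgroupD(3)[OF H_add_subgroup this] show ?thesis by (simp add: cls_eq_iff algebra_simps)
qed

lemma cls_sum_cong: "(\<And>i. i \<in> A \<Longrightarrow> cls (t i) = cls (u i)) \<Longrightarrow> cls (\<Sum>i\<in>A. t i) = cls (\<Sum>i\<in>A. u i)"
proof (induction A rule: infinite_finite_induct)
  case (insert a A)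
  have "cls (t a) = cls (u a)" "cls (\<Sum>i\<in>A. t i) = cls (\<Sum>i\<in>A. u i)"
    using insert.prems insert.IH by blast+
  from cls_add_cong[OF this] show ?case unfolding sum.insert[OF insert.hyps] .
qed simp_all

lemma cls_zero: "x \<in> carrier M \<Longrightarrow> cls (frag_of (x, 0)) = cls 0" "a \<in> K \<Longrightarrow> cls (frag_of (\<zero>\<^bsub>M\<^esub>, a)) = cls 0"
proof -
  assume x: "x \<in> carrier M"
  have "- frag_of (x, 0) \<in> H" using cls_rel(2)[OF x K(1) K(1)] by (simp add: cls_eq_iff)
  from add_subgroupD(3)[OF H_add_subgroup this] show "cls (frag_of (x, 0)) = cls 0" by (simp add: cls_eq_iff)
next
  assume a: "a \<in> K"
  have "- frag_of (\<zero>\<^bsub>M\<^esub>, a) \<in> H" using cls_rel(1)[of "\<zero>\<^bsub>M\<^esub>" "\<zero>\<^bsub>M\<^esub>" a] a by (simp add: cls_eq_iff)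
  from add_subgroupD(3)[OF H_add_subgroup this] show "cls (frag_of (\<zero>\<^bsub>M\<^esub>, a)) = cls 0" by (simp add: cls_eq_iff)
qed

lemma cls_finsum:
  assumes "finite A" "\<And>i. i \<in> A \<Longrightarrow> g i \<in> carrier M" "a \<in> K"
  shows "cls (frag_of (\<Oplus>\<^bsub>M\<^esub>i\<in>A. g i, a)) = cls (\<Sum>i\<in>A. frag_of (g i, a))"
  using assms(1,2)
proof (induction A rule: finite_induct)
  case (insert x A)
  then have g: "g \<in> A \<rightarrow> carrier M" "g x \<in> carrier M" by auto
  have "cls (frag_of (\<Oplus>\<^bsub>M\<^esub>i\<in>insert x A. g i, a)) = cls (frag_of (g x, a) + frag_of (\<Oplus>\<^bsub>M\<^esub>i\<in>A. g i, a))"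
    using insert.hyps g assms(3) by (simp add: cls_rel(1) finsum_closed)
  also have "\<dots> = cls (frag_of (g x, a) + (\<Sum>i\<in>A. frag_of (g i, a)))"
    using insert by (intro cls_add_cong) auto
  finally show ?case using insert.hyps by simp
qed (use assms(3) in \<open>simp add: cls_zero\<close>)

text \<open>The linear extension of \<xi> evaluated on a formal sum, before passing to cosets;
  \<open>extend_functional\<close> is this expression at a chosen representative.\<close>

definition efun :: "('m \<Rightarrow> 'f) \<Rightarrow> (('m \<times> 's) \<Rightarrow>\<^sub>0 int) \<Rightarrow> 's" where
  "efun \<xi> t = (\<Sum>(x, a)\<in>Poly_Mapping.keys t. of_int (Poly_Mapping.lookup t (x, a)) * (\<psi> (\<xi> x) * a))"

lemma efun_superset:
  assumes "finite A" "Poly_Mapping.keys t \<subseteq> A"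
  shows "efun \<xi> t = (\<Sum>(x, a)\<in>A. of_int (Poly_Mapping.lookup t (x, a)) * (\<psi> (\<xi> x) * a))"
  unfolding efun_def using assms by (intro sum.mono_neutral_left) (auto simp: in_keys_iff)

lemma efun_simps: "efun \<xi> 0 = 0" "efun \<xi> (t + u) = efun \<xi> t + efun \<xi> u" "efun \<xi> (- t) = - efun \<xi> t"
  "efun \<xi> (t - u) = efun \<xi> t - efun \<xi> u" "efun \<xi> (frag_of (x, a)) = \<psi> (\<xi> x) * a"
proof -
  show "efun \<xi> 0 = 0" by (simp add: efun_def)
  have add: "efun \<xi> (t + u) = efun \<xi> t + efun \<xi> u" for t u
  proof -
    let ?A = "Poly_Mapping.keys t \<union> Poly_Mapping.keys u"
    have "efun \<xi> (t + u) = (\<Sum>(x, a)\<in>?A. of_int (Poly_Mapping.lookup (t + u) (x, a)) * (\<psi> (\<xi> x) * a))"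
      by (rule efun_superset) (use keys_add[of t u] in auto)
    also have "\<dots> = (\<Sum>(x, a)\<in>?A. of_int (Poly_Mapping.lookup t (x, a)) * (\<psi> (\<xi> x) * a)) +
        (\<Sum>(x, a)\<in>?A. of_int (Poly_Mapping.lookup u (x, a)) * (\<psi> (\<xi> x) * a))"
      unfolding sum.distrib[symmetric] by (intro sum.cong) (auto simp: lookup_add distrib_right)
    also have "\<dots> = efun \<xi> t + efun \<xi> u"
      using efun_superset[of ?A t \<xi>] efun_superset[of ?A u \<xi>] by simp
    finally show ?thesis .
  qed
  then show "efun \<xi> (t + u) = efun \<xi> t + efun \<xi> u" .
  have neg: "efun \<xi> (- t) = - efun \<xi> t" for t
    using add[of t "- t"] \<open>efun \<xi> 0 = 0\<close> by (simp add: eq_neg_iff_add_eq_0 add.commute)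
  then show "efun \<xi> (- t) = - efun \<xi> t" .
  show "efun \<xi> (t - u) = efun \<xi> t - efun \<xi> u" using add[of t "- u"] neg[of u] by simp
  show "efun \<xi> (frag_of (x, a)) = \<psi> (\<xi> x) * a" by (simp add: efun_def)
qed

lemma efun_sum: "efun \<xi> (\<Sum>i\<in>A. g i) = (\<Sum>i\<in>A. efun \<xi> (g i))"
  by (induction A rule: infinite_finite_induct) (auto simp: efun_simps)

lemma efun_H: "of_linear M \<xi> \<Longrightarrow> h \<in> H \<Longrightarrow> efun \<xi> h = 0"
proof -
  assume \<xi>: "of_linear M \<xi>" and h: "h \<in> H"
  from h show ?thesis
  proof (induction rule: H_induct)
    case (rel r)
    then show ?case
      by (cases rule: rels_cases) (simp_all add: efun_simps of_linearD[OF \<xi>] \<psi> distrib_left distrib_right mult_ac)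
  qed (auto simp: efun_simps)
qed

text \<open>Extended functionals are what tells tensors apart: a tensor is shown to be nonzero by
  exhibiting a functional with a nonzero value on it.\<close>

definition ext :: "('m \<Rightarrow> 'f) \<Rightarrow> ('m, 's) tensor \<Rightarrow> 's" where
  "ext \<xi> c = efun \<xi> (SOME t. t \<in> c)"

lemma ext_cls: "of_linear M \<xi> \<Longrightarrow> ext \<xi> (cls t) = efun \<xi> t"
proof -
  assume \<xi>: "of_linear M \<xi>"
  have "(SOME u. u \<in> cls t) \<in> cls t" by (rule someI[of _ t]) (rule mem_cls)
  from efun_H[OF \<xi> mem_clsD(1)[OF this]] show ?thesis by (simp add: ext_def efun_simps)
qed

lemma efun_K: "t \<in> T \<Longrightarrow> efun \<xi> t \<in> K"
proof -
  assume "t \<in> T"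
  then have "Poly_Mapping.keys t \<subseteq> carrier M \<times> K" by (simp add: T_def)
  then show ?thesis
  proof (induction t rule: frag_induction)
    case (diff a b)
    then show ?case using K(3)[of "efun \<xi> a" "- efun \<xi> b"] K(5) by (simp add: efun_simps)
  qed (auto simp: efun_simps K \<psi>K)
qed

text \<open>Families \<open>es\<close> together with linear coordinates \<open>c\<close>: multiples of elements of \<open>M\<close> are combinations
  of \<open>es\<close>, so that \<open>es\<close> spans after base change.\<close>

definition rho :: "'m list \<Rightarrow> (nat \<Rightarrow> 's) \<Rightarrow> ('m, 's) tensor" where
  "rho es a = cls (\<Sum>i<length es. frag_of (es ! i, a i))"

lemma rho_T: "set es \<subseteq> carrier M \<Longrightarrow> (\<And>i. i < length es \<Longrightarrow> a i \<in> K) \<Longrightarrow> (\<Sum>i<length es. frag_of (es ! i, a i)) \<in> T"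
  by (intro T_sum T_closed) auto

lemma rho_carrier: "set es \<subseteq> carrier M \<Longrightarrow> (\<And>i. i < length es \<Longrightarrow> a i \<in> K) \<Longrightarrow> rho es a \<in> carrier B"
  by (auto simp: rho_def carrier_B rho_T)

lemma rho_cong: "(\<And>i. i < length es \<Longrightarrow> a i = b i) \<Longrightarrow> rho es a = rho es b"
  unfolding rho_def by (intro arg_cong[of _ _ cls] sum.cong) auto

lemma ext_rho: "of_linear M \<xi> \<Longrightarrow> ext \<xi> (rho es a) = (\<Sum>i<length es. \<psi> (\<xi> (es ! i)) * a i)"
  by (simp add: rho_def ext_cls efun_sum efun_simps)

text \<open>Coordinates of x may have denominators. They are cleared by x \<otimes> a = (m x)
  \<otimes> (a / m), possible since K is a field of characteristic 0; then m x is expanded in M and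
  the scalars move across the tensor sign.\<close>

lemma rho_coordinates:
  assumes es: "set es \<subseteq> carrier M"
    and lin: "\<And>i. i < length es \<Longrightarrow> of_linear M (\<lambda>x. c x i)"
    and comb: "\<And>x. x \<in> carrier M \<Longrightarrow> \<exists>m::nat. m > 0 \<and> (\<forall>i<length es. of_nat m * c x i \<in> int_elems) \<and>
        of_nat m \<odot>\<^bsub>M\<^esub> x = (\<Oplus>\<^bsub>M\<^esub>i\<in>{..<length es}. (of_nat m * c x i) \<odot>\<^bsub>M\<^esub> es ! i)"
    and u: "u \<in> carrier B"
  shows "u = rho es (\<lambda>i. ext (\<lambda>x. c x i) u)"
proof -
  have esM: "es ! i \<in> carrier M" if "i < length es" for i using es that by auto
  obtain t where t: "t \<in> T" "u = cls t" using u by (auto simp: carrier_B)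
  have "t \<in> T \<and> cls t = cls (\<Sum>i<length es. frag_of (es ! i, efun (\<lambda>x. c x i) t))"
    using t(1)[unfolded T_def, simplified]
  proof (induction t rule: frag_induction)
    case zero
    have "cls (\<Sum>i<length es. frag_of (es ! i, 0)) = cls (\<Sum>i<length es. 0 :: ('m \<times> 's) \<Rightarrow>\<^sub>0 int)"
    proof (rule cls_sum_cong)
      fix i assume "i \<in> {..<length es}"
      then have "es ! i \<in> carrier M" using es by auto
      then show "cls (frag_of (es ! i, 0)) = cls 0" by (rule cls_zero)
    qed
    then show ?case by (simp add: efun_simps T_closed)
  next
    case (one p)
    obtain x a where p: "p = (x, a)" "x \<in> carrier M" "a \<in> K" using one by auto
    obtain m :: nat where m: "m > 0" "\<And>i. i < length es \<Longrightarrow> of_nat m * c x i \<in> int_elems"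
      "of_nat m \<odot>\<^bsub>M\<^esub> x = (\<Oplus>\<^bsub>M\<^esub>i\<in>{..<length es}. (of_nat m * c x i) \<odot>\<^bsub>M\<^esub> es ! i)" using comb[OF p(2)] by blast
    have inK: "of_nat m \<in> K" using \<psi>K[of "of_nat m"] by (simp add: \<psi>_of_nat)
    define b where "b = inverse (of_nat m) * a"
    have b: "b \<in> K" "of_nat m * b = a" using m(1) inK p(3) by (auto simp: b_def K)
    have "cls (frag_of (x, a)) = cls (frag_of (of_nat m \<odot>\<^bsub>M\<^esub> x, b))"
      using cls_rel(3)[of "of_nat m" x b] b p(2) by (simp add: \<psi>_of_nat int_elems_closed)
    also have "\<dots> = cls (\<Sum>i<length es. frag_of ((of_nat m * c x i) \<odot>\<^bsub>M\<^esub> es ! i, b))"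
      unfolding m(3) using m(2) b by (intro cls_finsum) (auto simp: esM)
    also have "\<dots> = cls (\<Sum>i<length es. frag_of (es ! i, \<psi> (c x i) * a))"
    proof (rule cls_sum_cong)
      fix i assume i: "i \<in> {..<length es}"
      have "cls (frag_of ((of_nat m * c x i) \<odot>\<^bsub>M\<^esub> es ! i, b)) = cls (frag_of (es ! i, \<psi> (of_nat m * c x i) * b))"
        using i m(2) b by (intro cls_rel(3)) (auto simp: esM)
      also have "\<psi> (of_nat m * c x i) * b = \<psi> (c x i) * a" using b(2) by (simp add: \<psi> \<psi>_of_nat mult_ac flip: b(2))
      finally show "cls (frag_of ((of_nat m * c x i) \<odot>\<^bsub>M\<^esub> es ! i, b)) = cls (frag_of (es ! i, \<psi> (c x i) * a))" .
    qed
    finally show ?case using p by (simp add: efun_simps T_closed)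
  next
    case (diff a b)
    let ?f = "\<lambda>t. \<Sum>i<length es. frag_of (es ! i, efun (\<lambda>x. c x i) t)"
    have ab: "a \<in> T" "b \<in> T" "cls a = cls (?f a)" "cls b = cls (?f b)" using diff by auto
    have "cls (a - b) = cls (?f a - ?f b)" by (rule cls_diff_cong) (fact ab)+
    also have "\<dots> = cls (\<Sum>i<length es. frag_of (es ! i, efun (\<lambda>x. c x i) a) - frag_of (es ! i, efun (\<lambda>x. c x i) b))"
      by (simp add: sum_subtractf)
    also have "\<dots> = cls (?f (a - b))"
    proof (rule cls_sum_cong)
      fix i assume "i \<in> {..<length es}"
      then have "es ! i \<in> carrier M" using es by auto
      from cls_diff[OF this efun_K[OF ab(1)] efun_K[OF ab(2)]]
      show "cls (frag_of (es ! i, efun (\<lambda>x. c x i) a) - frag_of (es ! i, efun (\<lambda>x. c x i) b)) =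
          cls (frag_of (es ! i, efun (\<lambda>x. c x i) (a - b)))" by (simp add: efun_simps)
    qed
    finally show ?case using ab by (simp add: T_closed)
  qed
  moreover have "(\<Sum>i<length es. frag_of (es ! i, ext (\<lambda>x. c x i) (cls t))) =
      (\<Sum>i<length es. frag_of (es ! i, efun (\<lambda>x. c x i) t))"
    using lin by (intro sum.cong) (auto simp: ext_cls)
  ultimately show ?thesis unfolding t(2) rho_def by simp
qed

end

section \<open>Positive definite forms\<close>

text \<open>A Gram matrix over the reals or the complex numbers. Treating \<real> as a subset of
  \<complex>, where conjugation is trivial on it, lets one locale cover both kinds of
  places.\<close>

locale posdef_form =
  fixes n :: nat and K :: "complex set" and G :: "nat \<Rightarrow> nat \<Rightarrow> complex"
  assumes K: "K = \<real> \<or> K = UNIV"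
    and GK: "\<And>i j. i < n \<Longrightarrow> j < n \<Longrightarrow> G i j \<in> K"
    and herm: "\<And>i j. i < n \<Longrightarrow> j < n \<Longrightarrow> G j i = cnj (G i j)"
    and posdef: "\<And>a. (\<And>i. i < n \<Longrightarrow> a i \<in> K) \<Longrightarrow> \<exists>i<n. a i \<noteq> 0 \<Longrightarrow>
        Re (\<Sum>i<n. \<Sum>j<n. a i * cnj (a j) * G i j) > 0"
begin

definition kvec :: "(nat \<Rightarrow> complex) \<Rightarrow> bool" where
  "kvec a \<longleftrightarrow> (\<forall>i<n. a i \<in> K)"

definition frm :: "(nat \<Rightarrow> complex) \<Rightarrow> (nat \<Rightarrow> complex) \<Rightarrow> complex" where
  "frm a b = (\<Sum>i<n. \<Sum>j<n. a i * cnj (b j) * G i j)"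

definition unitv :: "nat \<Rightarrow> nat \<Rightarrow> complex" where
  "unitv i = (\<lambda>j. if j = i then 1 else 0)"

lemma K_closed: "0 \<in> K" "1 \<in> K" "x \<in> K \<Longrightarrow> y \<in> K \<Longrightarrow> x + y \<in> K" "x \<in> K \<Longrightarrow> y \<in> K \<Longrightarrow> x - y \<in> K"
  "x \<in> K \<Longrightarrow> y \<in> K \<Longrightarrow> x * y \<in> K" "x \<in> K \<Longrightarrow> y \<in> K \<Longrightarrow> x / y \<in> K" "x \<in> K \<Longrightarrow> cnj x \<in> K" "x \<in> K \<Longrightarrow> - x \<in> K"
  "of_real r \<in> K"
  using K by (auto simp: Reals_cnj_iff)

lemma K_sum: "(\<And>i. i \<in> A \<Longrightarrow> g i \<in> K) \<Longrightarrow> (\<Sum>i\<in>A. g i) \<in> K"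
  by (induction A rule: infinite_finite_induct) (auto simp: K_closed)

lemma frm_K: "kvec a \<Longrightarrow> kvec b \<Longrightarrow> frm a b \<in> K"
  unfolding frm_def kvec_def by (intro K_sum K_closed GK) auto

lemma kvec_unitv: "kvec (unitv i)" by (auto simp: kvec_def unitv_def K_closed)

lemma kvec_closed: "kvec a \<Longrightarrow> kvec b \<Longrightarrow> kvec (\<lambda>i. a i + b i)" "kvec a \<Longrightarrow> kvec b \<Longrightarrow> kvec (\<lambda>i. a i - b i)"
  "c \<in> K \<Longrightarrow> kvec a \<Longrightarrow> kvec (\<lambda>i. c * a i)"
  by (auto simp: kvec_def K_closed)

lemma frm_left: "frm (\<lambda>i. a i + a' i) b = frm a b + frm a' b" "frm (\<lambda>i. a i - a' i) b = frm a b - frm a' b"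
  "frm (\<lambda>i. c * a i) b = c * frm a b" "frm (\<lambda>i. 0) b = 0"
  by (simp_all add: frm_def distrib_right left_diff_distrib sum.distrib sum_subtractf sum_distrib_left mult.assoc)

lemma frm_right: "frm a (\<lambda>i. b i + b' i) = frm a b + frm a b'" "frm a (\<lambda>i. b i - b' i) = frm a b - frm a b'"
  "frm a (\<lambda>i. c * b i) = cnj c * frm a b" "frm a (\<lambda>i. 0) = 0"
  by (simp_all add: frm_def distrib_left distrib_right left_diff_distrib right_diff_distrib sum.distrib sum_subtractf
      sum_distrib_left mult_ac)

lemma frm_cong: "(\<And>i. i < n \<Longrightarrow> a i = a' i) \<Longrightarrow> (\<And>i. i < n \<Longrightarrow> b i = b' i) \<Longrightarrow> frm a b = frm a' b'"
  unfolding frm_def by (intro sum.cong) auto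

lemma frm_cnj: "frm b a = cnj (frm a b)"
proof -
  have "cnj (frm a b) = (\<Sum>i<n. \<Sum>j<n. b j * cnj (a i) * cnj (G i j))"
    by (simp add: frm_def mult_ac)
  also have "\<dots> = (\<Sum>j<n. \<Sum>i<n. b j * cnj (a i) * cnj (G i j))" by (rule sum.swap)
  also have "\<dots> = frm b a" unfolding frm_def by (intro sum.cong refl) (simp add: herm[symmetric])
  finally show ?thesis by (rule sym)
qed

lemma frm_self_real: "frm a a = of_real (Re (frm a a))"
  using frm_cnj[of a a] by (simp add: complex_eq_iff)

lemma frm_pos: "kvec a \<Longrightarrow> \<exists>i<n. a i \<noteq> 0 \<Longrightarrow> Re (frm a a) > 0"
  unfolding frm_def kvec_def by (rule posdef) auto

lemma frm_nonneg: "kvec a \<Longrightarrow> Re (frm a a) \<ge> 0"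
proof (cases "\<exists>i<n. a i \<noteq> 0")
  case False
  then have "frm a a = frm (\<lambda>i. 0) (\<lambda>i. 0)" by (intro frm_cong) auto
  then show ?thesis by (simp add: frm_left)
qed (use frm_pos in force)

lemma frm_left_sum: "frm (\<lambda>i. \<Sum>k\<in>A. g k i) b = (\<Sum>k\<in>A. frm (g k) b)"
  by (induction A rule: infinite_finite_induct) (auto simp: frm_left)

lemma frm_right_sum: "frm b (\<lambda>i. \<Sum>k\<in>A. g k i) = (\<Sum>k\<in>A. frm b (g k))"
  by (induction A rule: infinite_finite_induct) (auto simp: frm_right)

lemma unitv_expand: "i < n \<Longrightarrow> (\<Sum>j<n. a j * unitv j i) = a i"
proof -
  assume i: "i < n"
  have "(\<Sum>j<n. a j * unitv j i) = (\<Sum>j<n. if j = i then a j else 0)" by (intro sum.cong) (auto simp: unitv_def)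
  then show ?thesis using i by simp
qed

lemma frm_expand: "frm a b = (\<Sum>j<n. a j * frm (unitv j) b)"
proof -
  have "frm a b = frm (\<lambda>i. \<Sum>j<n. a j * unitv j i) b" by (rule frm_cong) (auto simp: unitv_expand)
  also have "\<dots> = (\<Sum>j<n. frm (\<lambda>i. a j * unitv j i) b)" by (rule frm_left_sum)
  finally show ?thesis by (simp add: frm_left)
qed

lemma frm_unitv: "i < n \<Longrightarrow> j < n \<Longrightarrow> frm (unitv i) (unitv j) = G i j"
proof -
  assume ij: "i < n" "j < n"
  have "frm (unitv i) (unitv j) = (\<Sum>k<n. \<Sum>l<n. if l = j then if k = i then G k l else 0 else 0)"
    unfolding frm_def by (intro sum.cong refl) (auto simp: unitv_def)
  then show ?thesis using ij by simp
qed

text \<open>Subtract from \<open>a\<close> its projection on \<open>b\<close>.\<close>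

lemma cauchy_schwarz:
  assumes "kvec a" "kvec b"
  shows "(cmod (frm a b))\<^sup>2 \<le> Re (frm a a) * Re (frm b b)"
proof (cases "\<exists>i<n. b i \<noteq> 0")
  case False
  then have "frm a b = frm a (\<lambda>i. 0)" by (intro frm_cong) auto
  then show ?thesis using frm_nonneg assms by (simp add: frm_right)
next
  case True
  define N where "N = Re (frm b b)"
  have N: "N > 0" "frm b b = of_real N" using frm_pos[OF assms(2) True] frm_self_real[of b] by (auto simp: N_def)
  define c where "c = frm a b / of_real N"
  have cK: "c \<in> K" unfolding c_def using assms by (intro K_closed frm_K)
  let ?u = "\<lambda>i. a i - c * b i"
  have "frm ?u ?u = frm a a - cnj c * frm a b - c * frm b a + c * cnj c * frm b b"
    by (simp add: frm_left frm_right algebra_simps)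
  also have "c * cnj c * frm b b = c * frm b a"
    using N by (simp add: c_def frm_cnj[of b a])
  finally have "frm ?u ?u = frm a a - cnj c * frm a b" by simp
  moreover have "cnj c * frm a b = of_real ((cmod (frm a b))\<^sup>2 / N)"
    using complex_norm_square[of "frm a b"] by (simp add: c_def mult.commute)
  ultimately have "Re (frm ?u ?u) = Re (frm a a) - (cmod (frm a b))\<^sup>2 / N" by simp
  moreover have "Re (frm ?u ?u) \<ge> 0" using assms cK by (intro frm_nonneg kvec_closed)
  ultimately have "(cmod (frm a b))\<^sup>2 / N \<le> Re (frm a a)" by simp
  then show ?thesis using N(1) by (simp add: field_simps N_def)
qed

definition fnorm :: "(nat \<Rightarrow> complex) \<Rightarrow> real" where
  "fnorm a = sqrt (Re (frm a a))"

lemma fnorm_nonneg: "kvec a \<Longrightarrow> fnorm a \<ge> 0" using frm_nonneg by (simp add: fnorm_def)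

lemma fnorm_square: "kvec a \<Longrightarrow> (fnorm a)\<^sup>2 = Re (frm a a)" using frm_nonneg by (simp add: fnorm_def)

lemma frm_le_fnorm: "kvec a \<Longrightarrow> kvec b \<Longrightarrow> cmod (frm a b) \<le> fnorm a * fnorm b"
proof -
  assume *: "kvec a" "kvec b"
  have "(cmod (frm a b))\<^sup>2 \<le> (fnorm a * fnorm b)\<^sup>2"
    using cauchy_schwarz[OF *] * by (simp add: power_mult_distrib fnorm_square)
  moreover have "0 \<le> fnorm a * fnorm b" using * by (simp add: fnorm_nonneg)
  ultimately show ?thesis by (rule power2_le_imp_le)
qed

lemma fnorm_scale: "fnorm (\<lambda>i. c * a i) = cmod c * fnorm a"
proof -
  have "frm (\<lambda>i. c * a i) (\<lambda>i. c * a i) = of_real ((cmod c)\<^sup>2) * frm a a"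
    using complex_norm_square[of c] by (simp add: frm_left frm_right mult_ac)
  then show ?thesis by (simp add: fnorm_def real_sqrt_mult)
qed

lemma fnorm_triangle:
  assumes "kvec a" "kvec b"
  shows "fnorm (\<lambda>i. a i + b i) \<le> fnorm a + fnorm b"
proof -
  have "Re (frm (\<lambda>i. a i + b i) (\<lambda>i. a i + b i)) = Re (frm a a) + 2 * Re (frm a b) + Re (frm b b)"
    by (simp add: frm_left frm_right frm_cnj[of b a])
  also have "\<dots> \<le> (fnorm a)\<^sup>2 + 2 * (fnorm a * fnorm b) + (fnorm b)\<^sup>2"
    using assms frm_le_fnorm[OF assms] complex_Re_le_cmod[of "frm a b"] by (simp add: fnorm_square)
  also have "\<dots> = (fnorm a + fnorm b)\<^sup>2" by (simp add: power2_sum)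
  finally show ?thesis
    unfolding fnorm_def[of "\<lambda>i. a i + b i"] using assms by (intro real_le_lsqrt) (auto simp: fnorm_nonneg)
qed

lemma fnorm_zero: "fnorm (\<lambda>i. 0) = 0" by (simp add: fnorm_def frm_left)

lemma fnorm_cong: "(\<And>i. i < n \<Longrightarrow> a i = a' i) \<Longrightarrow> fnorm a = fnorm a'"
  using frm_cong[of a a' a a'] by (simp add: fnorm_def)

lemma fnorm_le: "kvec a \<Longrightarrow> fnorm a \<le> (\<Sum>i<n. cmod (a i) * fnorm (unitv i))"
proof -
  assume a: "kvec a"
  have "fnorm (\<lambda>i. \<Sum>j\<in>A. a j * unitv j i) \<le> (\<Sum>j\<in>A. cmod (a j) * fnorm (unitv j)) \<and> kvec (\<lambda>i. \<Sum>j\<in>A. a j * unitv j i)"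
    if "A \<subseteq> {..<n}" "finite A" for A
    using that(2,1)
  proof (induction A rule: finite_induct)
    case empty
    then show ?case using fnorm_zero by (simp add: kvec_def K_closed)
  next
    case (insert k A)
    have k: "kvec (\<lambda>i. a k * unitv k i)" using a insert.prems kvec_unitv by (intro kvec_closed) (auto simp: kvec_def)
    have IH: "fnorm (\<lambda>i. \<Sum>j\<in>A. a j * unitv j i) \<le> (\<Sum>j\<in>A. cmod (a j) * fnorm (unitv j))" "kvec (\<lambda>i. \<Sum>j\<in>A. a j * unitv j i)"
      using insert by auto
    have "fnorm (\<lambda>i. a k * unitv k i + (\<Sum>j\<in>A. a j * unitv j i)) \<le> cmod (a k) * fnorm (unitv k) + fnorm (\<lambda>i. \<Sum>j\<in>A. a j * unitv j i)"
      using fnorm_triangle[OF k IH(2)] fnorm_scale[of "a k" "unitv k"] by simp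
    then show ?case using insert.hyps IH kvec_closed(1)[OF k IH(2)] by simp
  qed
  from this[of "{..<n}"] have "fnorm (\<lambda>i. \<Sum>j<n. a j * unitv j i) \<le> (\<Sum>i<n. cmod (a i) * fnorm (unitv i))" by auto
  moreover have "fnorm (\<lambda>i. \<Sum>j<n. a j * unitv j i) = fnorm a" by (rule fnorm_cong) (simp add: unitv_expand)
  ultimately show ?thesis by simp
qed

text \<open>Gram--Schmidt: the next vector of the induction is \<open>unitv m\<close> minus its projection.\<close>

lemma riesz_aux:
  "m \<le> n \<Longrightarrow> kvec l \<Longrightarrow> \<exists>w. kvec w \<and> (\<forall>i\<ge>m. w i = 0) \<and> (\<forall>j<m. frm (unitv j) w = l j)"
proof (induction m arbitrary: l)
  case 0
  then show ?case by (intro exI[of _ "\<lambda>i. 0"]) (auto simp: kvec_def K_closed)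
next
  case (Suc m)
  have m: "m < n" using Suc.prems(1) by simp
  obtain w where w: "kvec w" "\<forall>i\<ge>m. w i = 0" "\<forall>j<m. frm (unitv j) w = l j" using Suc.IH[of l] Suc.prems by auto
  have "kvec (\<lambda>j. frm (unitv j) (unitv m))" using frm_K kvec_unitv by (auto simp: kvec_def[of "\<lambda>j. frm (unitv j) (unitv m)"])
  then obtain p where p: "kvec p" "\<forall>i\<ge>m. p i = 0" "\<forall>j<m. frm (unitv j) p = frm (unitv j) (unitv m)"
    using Suc.IH[of "\<lambda>j. frm (unitv j) (unitv m)"] Suc.prems(1) by auto
  define U where "U = (\<lambda>i. unitv m i - p i)"
  have U: "kvec U" unfolding U_def by (intro kvec_closed kvec_unitv p)
  have Um: "U m = 1" using p(2) by (simp add: U_def unitv_def)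
  have ort: "frm (unitv j) U = 0" if "j < m" for j using p(3) that by (simp add: U_def frm_right)
  have pU: "frm p U = 0"
  proof -
    have "p j * frm (unitv j) U = 0" if "j < n" for j using p(2) ort by (cases "j < m") auto
    then have "(\<Sum>j<n. p j * frm (unitv j) U) = 0" by (intro sum.neutral) auto
    then show ?thesis using frm_expand[of p U] by simp
  qed
  have "frm (unitv m) U = frm (\<lambda>i. U i + p i) U" by (rule frm_cong) (auto simp: U_def)
  also have "\<dots> = frm U U" by (simp add: frm_left pU)
  finally have mU: "frm (unitv m) U = frm U U" .
  have "Re (frm U U) > 0" using Um m by (intro frm_pos[OF U] exI[of _ m]) simp
  then have UU: "frm U U \<noteq> 0" by auto
  \<comment> \<open>U is orthogonal to the first m unit vectors, so adding a multiple of it corrects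
    the value at \<open>unitv m\<close> and keeps the earlier ones. The conjugate of \<beta> is used
    because \<open>frm\<close> is conjugate linear on the right.\<close>
  define \<beta> where "\<beta> = (l m - frm (unitv m) w) / frm U U"
  have \<beta>: "\<beta> \<in> K" unfolding \<beta>_def using Suc.prems(2) m by (intro K_closed frm_K kvec_unitv w U) (auto simp: kvec_def)
  have "kvec (\<lambda>i. w i + cnj \<beta> * U i)" by (intro kvec_closed w U K_closed \<beta>)
  moreover have "w i + cnj \<beta> * U i = 0" if "i \<ge> Suc m" for i using w(2) p(2) that by (simp add: U_def unitv_def)
  moreover have "frm (unitv j) (\<lambda>i. w i + cnj \<beta> * U i) = l j" if "j < Suc m" for j
  proof (cases "j = m")
    case True
    have "frm (unitv m) (\<lambda>i. w i + cnj \<beta> * U i) = frm (unitv m) w + \<beta> * frm U U" by (simp add: frm_right mU)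
    also have "\<dots> = l m" using UU by (simp add: \<beta>_def)
    finally show ?thesis using True by simp
  next
    case False
    then show ?thesis using that w(3) ort[of j] by (simp add: frm_right)
  qed
  ultimately show ?case by (intro exI[of _ "\<lambda>i. w i + cnj \<beta> * U i"]) auto
qed

text \<open>The basis dual to the unit vectors with respect to \<open>frm\<close>: pairing with
  \<open>wv k\<close> reads off the k-th coordinate.\<close>

definition wv :: "nat \<Rightarrow> nat \<Rightarrow> complex" where
  "wv k = (SOME w. kvec w \<and> (\<forall>i\<ge>n. w i = 0) \<and> (\<forall>j<n. frm (unitv j) w = unitv k j))"

lemma wv: "kvec (wv k)" "i \<ge> n \<Longrightarrow> wv k i = 0" "j < n \<Longrightarrow> frm (unitv j) (wv k) = unitv k j"
proof -
  have "\<exists>w. kvec w \<and> (\<forall>i\<ge>n. w i = 0) \<and> (\<forall>j<n. frm (unitv j) w = unitv k j)"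
    using riesz_aux[of n "unitv k"] kvec_unitv by blast
  from someI_ex[OF this] have "kvec (wv k) \<and> (\<forall>i\<ge>n. wv k i = 0) \<and> (\<forall>j<n. frm (unitv j) (wv k) = unitv k j)"
    unfolding wv_def .
  then show "kvec (wv k)" "i \<ge> n \<Longrightarrow> wv k i = 0" "j < n \<Longrightarrow> frm (unitv j) (wv k) = unitv k j" by auto
qed

lemma frm_wv: "k < n \<Longrightarrow> frm a (wv k) = a k"
proof -
  assume k: "k < n"
  have "frm a (wv k) = (\<Sum>j<n. a j * unitv k j)" by (subst frm_expand) (simp add: wv)
  also have "\<dots> = (\<Sum>j<n. if j = k then a j else 0)" by (intro sum.cong) (auto simp: unitv_def)
  finally show ?thesis using k by simp
qed

definition riesz :: "(nat \<Rightarrow> complex) \<Rightarrow> nat \<Rightarrow> complex" where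
  "riesz l = (\<lambda>i. \<Sum>k<n. cnj (l k) * wv k i)"

lemma kvec_riesz: "kvec l \<Longrightarrow> kvec (riesz l)"
  using wv(1) by (auto simp: riesz_def kvec_def intro!: K_sum K_closed)

lemma frm_riesz: "frm a (riesz l) = (\<Sum>k<n. l k * a k)"
  unfolding riesz_def by (simp add: frm_right_sum frm_right frm_wv)

lemma riesz_unique:
  assumes "kvec w" "kvec w'" "\<And>a. kvec a \<Longrightarrow> frm a w = frm a w'" "i < n"
  shows "w i = w' i"
proof (rule ccontr)
  assume "w i \<noteq> w' i"
  let ?u = "\<lambda>i. w i - w' i"
  have "kvec ?u" using assms by (intro kvec_closed)
  then have "Re (frm ?u ?u) > 0" using \<open>w i \<noteq> w' i\<close> assms(4) by (intro frm_pos) auto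
  moreover have "frm ?u ?u = 0" using assms(3)[OF \<open>kvec ?u\<close>] by (simp add: frm_right)
  ultimately show False by simp
qed

text \<open>Gram matrix of the dual form in the coordinates of functionals. The indices are swapped
  because passing to the Riesz vector is conjugate linear.\<close>

definition dualG :: "nat \<Rightarrow> nat \<Rightarrow> complex" where
  "dualG i j = frm (wv j) (wv i)"

lemma dual_form_eq: "(\<Sum>i<n. \<Sum>j<n. l i * cnj (l' j) * dualG i j) = frm (riesz l') (riesz l)"
proof -
  have "frm (riesz l') (riesz l) = (\<Sum>j<n. \<Sum>i<n. cnj (l' j) * (l i * frm (wv j) (wv i)))"
    unfolding riesz_def frm_left_sum frm_left(3) frm_right_sum frm_right(3) by (simp add: sum_distrib_left)
  also have "\<dots> = (\<Sum>i<n. \<Sum>j<n. cnj (l' j) * (l i * frm (wv j) (wv i)))" by (rule sum.swap)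
  finally show ?thesis by (simp add: dualG_def mult_ac)
qed

lemma posdef_dual: "posdef_form n K dualG"
proof
  show "K = \<real> \<or> K = UNIV" by (rule K)
  show "dualG i j \<in> K" for i j unfolding dualG_def by (intro frm_K wv)
  show "dualG j i = cnj (dualG i j)" for i j unfolding dualG_def by (rule frm_cnj)
  fix a assume a: "\<And>i. i < n \<Longrightarrow> a i \<in> K" "\<exists>i<n. a i \<noteq> (0::complex)"
  then obtain i where i: "i < n" "a i \<noteq> 0" by blast
  have ka: "kvec a" using a(1) by (simp add: kvec_def)
  have "\<exists>i<n. riesz a i \<noteq> 0"
  proof (rule ccontr)
    assume "\<not> (\<exists>i<n. riesz a i \<noteq> 0)"
    then have "frm (unitv i) (riesz a) = frm (unitv i) (\<lambda>i. 0)" by (intro frm_cong) auto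
    then have "(\<Sum>k<n. a k * unitv i k) = 0" by (simp add: frm_riesz frm_right)
    also have "(\<Sum>k<n. a k * unitv i k) = (\<Sum>k<n. if k = i then a k else 0)" by (intro sum.cong) (auto simp: unitv_def)
    finally show False using i by simp
  qed
  then show "Re (\<Sum>i<n. \<Sum>j<n. a i * cnj (a j) * dualG i j) > 0"
    unfolding dual_form_eq by (rule frm_pos[OF kvec_riesz[OF ka]])
qed

text \<open>Cramer's rule: the conjugate of the Riesz vector u solves A v = l, and applying the
  adjugate gives det A times cnj (u i) = minor times l i. As l is supported at i, the dual length of
  l is l i times u i.\<close>

lemma det_gram_minor:
  assumes i: "i < n" and l: "\<And>j. j < n \<Longrightarrow> j \<noteq> i \<Longrightarrow> l j = 0"
  shows "Determinant.det (Matrix.mat n n (\<lambda>(i, j). G i j)) * frm (riesz l) (riesz l) =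
    of_real ((cmod (l i))\<^sup>2) * Determinant.det (mat_delete (Matrix.mat n n (\<lambda>(i, j). G i j)) i i)"
proof -
  let ?A = "Matrix.mat n n (\<lambda>(i, j). G i j)"
  let ?u = "riesz l"
  have A: "?A \<in> carrier_mat n n" by simp
  have Gu: "(\<Sum>k<n. G j k * cnj (?u k)) = l j" if j: "j < n" for j
  proof -
    have "frm (unitv j) ?u = cnj (frm ?u (unitv j))" by (rule frm_cnj)
    also have "frm ?u (unitv j) = (\<Sum>k<n. ?u k * frm (unitv k) (unitv j))" by (rule frm_expand)
    also have "cnj \<dots> = (\<Sum>k<n. G j k * cnj (?u k))"
      using j by (simp add: frm_unitv herm[of j] mult.commute)
    finally have "(\<Sum>k<n. G j k * cnj (?u k)) = (\<Sum>k<n. l k * unitv j k)" by (simp add: frm_riesz)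
    also have "\<dots> = (\<Sum>k<n. if k = j then l k else 0)" by (intro sum.cong) (auto simp: unitv_def)
    finally show ?thesis using j by simp
  qed
  define v where "v = Matrix.vec n (\<lambda>k. cnj (?u k))"
  have "?A *\<^sub>v v = Matrix.vec n l"
    by (rule eq_vecI) (auto simp: v_def scalar_prod_def lessThan_atLeast0[symmetric] Gu)
  then have "adj_mat ?A *\<^sub>v (?A *\<^sub>v v) = adj_mat ?A *\<^sub>v Matrix.vec n l" by simp
  moreover have "adj_mat ?A *\<^sub>v (?A *\<^sub>v v) = (adj_mat ?A * ?A) *\<^sub>v v"
    by (rule assoc_mult_mat_vec[symmetric, of _ n n _ n]) (auto simp: v_def adj_mat(1)[OF A])
  moreover have "adj_mat ?A * ?A = Determinant.det ?A \<cdot>\<^sub>m 1\<^sub>m n" by (rule adj_mat(3)[OF A])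
  ultimately have "((Determinant.det ?A \<cdot>\<^sub>m 1\<^sub>m n) *\<^sub>v v) $ i = (adj_mat ?A *\<^sub>v Matrix.vec n l) $ i" by simp
  moreover have "((Determinant.det ?A \<cdot>\<^sub>m 1\<^sub>m n) *\<^sub>v v) $ i = Determinant.det ?A * cnj (?u i)"
  proof -
    have "((Determinant.det ?A \<cdot>\<^sub>m 1\<^sub>m n) *\<^sub>v v) $ i =
        (\<Sum>k<n. Determinant.det ?A * (if k = i then 1 else 0) * cnj (?u k))"
      using i by (simp add: v_def scalar_prod_def lessThan_atLeast0)
    also have "\<dots> = (\<Sum>k<n. if k = i then Determinant.det ?A * cnj (?u k) else 0)"
      by (intro sum.cong) auto
    finally have "((Determinant.det ?A \<cdot>\<^sub>m 1\<^sub>m n) *\<^sub>v v) $ i = (\<Sum>k<n. if k = i then Determinant.det ?A * cnj (?u k) else 0)" .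
    then show ?thesis using i by simp
  qed
  moreover have "(adj_mat ?A *\<^sub>v Matrix.vec n l) $ i = Determinant.det (mat_delete ?A i i) * l i"
  proof -
    have "(adj_mat ?A *\<^sub>v Matrix.vec n l) $ i = (\<Sum>k<n. adj_mat ?A $$ (i, k) * l k)"
      using i adj_mat(1)[OF A] by (auto simp: scalar_prod_def lessThan_atLeast0 intro!: sum.cong)
    also have "\<dots> = (\<Sum>k<n. if k = i then adj_mat ?A $$ (i, k) * l k else 0)"
      using l by (intro sum.cong) auto
    also have "\<dots> = adj_mat ?A $$ (i, i) * l i" using i by simp
    also have "adj_mat ?A $$ (i, i) = Determinant.det (mat_delete ?A i i)"
      using i by (simp add: adj_mat_def cofactor_def)
    finally show ?thesis .
  qed
  ultimately have key: "Determinant.det ?A * cnj (?u i) = Determinant.det (mat_delete ?A i i) * l i" by simp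
  have "frm ?u ?u = (\<Sum>k<n. if k = i then l k * ?u k else 0)"
    unfolding frm_riesz using l by (intro sum.cong) auto
  then have "frm ?u ?u = l i * ?u i" using i by simp
  moreover have "frm ?u ?u = cnj (frm ?u ?u)" by (rule frm_cnj)
  ultimately have "frm ?u ?u = cnj (l i) * cnj (?u i)" by simp
  then have "Determinant.det ?A * frm ?u ?u = cnj (l i) * (Determinant.det ?A * cnj (?u i))" by simp
  also have "\<dots> = (l i * cnj (l i)) * Determinant.det (mat_delete ?A i i)" unfolding key by simp
  also have "l i * cnj (l i) = of_real ((cmod (l i))\<^sup>2)" by (rule complex_norm_square[symmetric])
  finally show ?thesis .
qed

end

lemma posdef_form_restrict:
  assumes "posdef_form (Suc n) K G"
  shows "posdef_form n K G"
proof -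
  interpret posdef_form "Suc n" K G by fact
  show ?thesis
  proof
    fix a assume a: "\<And>i. i < n \<Longrightarrow> a i \<in> K" "\<exists>i<n. a i \<noteq> (0::complex)"
    have "Re (\<Sum>i<Suc n. \<Sum>j<Suc n. (a(n := 0)) i * cnj ((a(n := 0)) j) * G i j) > 0"
    proof (rule posdef)
      show "(a(n := 0)) i \<in> K" if "i < Suc n" for i using that a(1) K_closed(1) by (auto simp: less_Suc_eq)
      obtain i where "i < n" "a i \<noteq> 0" using a(2) by blast
      then show "\<exists>i<Suc n. (a(n := 0)) i \<noteq> 0" by (intro exI[of _ i]) auto
    qed
    also have "(\<Sum>i<Suc n. \<Sum>j<Suc n. (a(n := 0)) i * cnj ((a(n := 0)) j) * G i j) = (\<Sum>i<n. \<Sum>j<n. a i * cnj (a j) * G i j)"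
      by (simp)
    finally show "Re (\<Sum>i<n. \<Sum>j<n. a i * cnj (a j) * G i j) > 0" .
  next
    show "K = \<real> \<or> K = UNIV" by (rule K)
    show "G i j \<in> K" if "i < n" "j < n" for i j using that by (intro GK) simp_all
    show "G j i = cnj (G i j)" if "i < n" "j < n" for i j using that by (intro herm) simp_all
  qed
qed

text \<open>Induction with \<open>det_gram_minor\<close> for the last coordinate functional: the
  determinant times a dual length, which is nonnegative, equals the determinant of the leading
  block.\<close>

lemma det_gram_pos:
  "posdef_form n K G \<Longrightarrow> \<exists>r>0. Determinant.det (Matrix.mat n n (\<lambda>(i, j). G i j)) = of_real r"
proof (induction n)
  case 0
  have "Determinant.det (Matrix.mat 0 0 (\<lambda>(i, j). G i j)) = 1" by (rule det_dim_zero) (rule mat_carrier)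
  then show ?case by (intro exI[of _ 1]) simp
next
  case (Suc n)
  interpret posdef_form "Suc n" K G by (rule Suc.prems)
  obtain r where r: "r > 0" "Determinant.det (Matrix.mat n n (\<lambda>(i, j). G i j)) = of_real r"
    using Suc.IH[OF posdef_form_restrict[OF Suc.prems]] by blast
  let ?l = "unitv n"
  have "mat_delete (Matrix.mat (Suc n) (Suc n) (\<lambda>(i, j). G i j)) n n = Matrix.mat n n (\<lambda>(i, j). G i j)"
    by (rule eq_matI) (auto simp: mat_delete_def)
  then have eq: "Determinant.det (Matrix.mat (Suc n) (Suc n) (\<lambda>(i, j). G i j)) * frm (riesz ?l) (riesz ?l) = of_real r"
    using det_gram_minor[of n ?l] r(2) by (simp add: unitv_def)
  define N where "N = Re (frm (riesz ?l) (riesz ?l))"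
  have N: "frm (riesz ?l) (riesz ?l) = of_real N" unfolding N_def by (rule frm_self_real)
  have "N \<ge> 0" unfolding N_def by (intro frm_nonneg kvec_riesz kvec_unitv)
  moreover have "N \<noteq> 0" using eq N r(1) by auto
  ultimately have "N > 0" by simp
  then show ?case using eq N r(1) by (intro exI[of _ "r / N"]) (auto simp: field_simps)
qed

section \<open>Infinite places\<close>

lemma cnj_comp_embedding: "\<sigma> \<in> complex_embeddings \<Longrightarrow> cnj \<circ> \<sigma> \<in> complex_embeddings"
  by (auto simp: complex_embeddings_def)

lemma place_embedding:
  assumes "v \<in> infinite_places"
  shows "place_embedding v \<in> complex_embeddings" "v = {place_embedding v, cnj \<circ> place_embedding v}"
proof -
  obtain \<sigma> where \<sigma>: "\<sigma> \<in> complex_embeddings" "v = {\<sigma>, cnj \<circ> \<sigma>}" using assms by (auto simp: infinite_places_def)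
  have "place_embedding v \<in> v" unfolding place_embedding_def by (rule someI[of _ \<sigma>]) (simp add: \<sigma>(2))
  then have "place_embedding v = \<sigma> \<or> place_embedding v = cnj \<circ> \<sigma>" using \<sigma>(2) by simp
  moreover have "cnj \<circ> (cnj \<circ> \<sigma>) = \<sigma>" by (auto simp: fun_eq_iff)
  ultimately show "v = {place_embedding v, cnj \<circ> place_embedding v}" using \<sigma>(2) by (metis insert_commute)
  show "place_embedding v \<in> complex_embeddings"
    using \<open>place_embedding v = \<sigma> \<or> place_embedding v = cnj \<circ> \<sigma>\<close> \<sigma>(1) cnj_comp_embedding by auto
qed

lemma finite_infinite_places: "finite (infinite_places :: 'f::number_field place set)"
  unfolding infinite_places_def by (intro finite_imageI finite_card_embeddings)

lemma real_place_iff: "v \<in> infinite_places \<Longrightarrow> real_place v \<longleftrightarrow> cnj \<circ> place_embedding v = place_embedding v"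
  unfolding real_place_def fun_eq_iff image_subset_iff Reals_cnj_iff comp_apply by blast

text \<open>A place is the set {\<sigma>, cnj \<circ> \<sigma>} and its local degree is the number
  of its elements, so a sum over embeddings of a conjugation invariant function is a weighted sum
  over places.\<close>

lemma sum_places:
  fixes f :: "('f::number_field \<Rightarrow> complex) \<Rightarrow> real"
  assumes "\<And>\<sigma>. \<sigma> \<in> complex_embeddings \<Longrightarrow> f (cnj \<circ> \<sigma>) = f \<sigma>"
  shows "(\<Sum>v\<in>infinite_places. local_degree v * f (place_embedding v)) = (\<Sum>\<sigma>\<in>complex_embeddings. f \<sigma>)"
proof -
  have un: "\<Union>infinite_places = (complex_embeddings :: ('f \<Rightarrow> complex) set)"
    by (auto simp: infinite_places_def cnj_comp_embedding simp del: comp_apply)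
  have disj: "u \<inter> v = {}" if uv: "u \<in> infinite_places" "v \<in> infinite_places" "u \<noteq> v" for u v :: "'f place"
  proof (rule ccontr)
    assume "u \<inter> v \<noteq> {}"
    then obtain \<tau> where \<tau>: "\<tau> \<in> u" "\<tau> \<in> v" by blast
    have "w = {\<tau>, cnj \<circ> \<tau>}" if w: "w \<in> infinite_places" "\<tau> \<in> w" for w
    proof -
      obtain \<sigma> where \<sigma>: "w = {\<sigma>, cnj \<circ> \<sigma>}" using w(1) unfolding infinite_places_def by blast
      have "cnj \<circ> (cnj \<circ> \<sigma>) = \<sigma>" by (simp add: fun_eq_iff)
      then show ?thesis using w(2) \<sigma> by (metis insert_commute insertE singletonD)
    qed
    then show False using \<tau> uv by blast
  qed
  have "(\<Sum>\<sigma>\<in>complex_embeddings. f \<sigma>) = (\<Sum>v\<in>infinite_places. \<Sum>\<sigma>\<in>v. f \<sigma>)"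
    unfolding un[symmetric] using sum.Union_disjoint[of "infinite_places :: 'f place set" f] disj
    by (auto simp: infinite_places_def)
  also have "\<dots> = (\<Sum>v\<in>infinite_places. local_degree v * f (place_embedding v))"
  proof (rule sum.cong[OF refl])
    fix v :: "'f place" assume v: "v \<in> infinite_places"
    let ?\<sigma> = "place_embedding v"
    have "(\<Sum>\<sigma>\<in>v. f \<sigma>) = (\<Sum>\<sigma>\<in>{?\<sigma>, cnj \<circ> ?\<sigma>}. f \<sigma>)" using place_embedding(2)[OF v] by simp
    also have "\<dots> = local_degree v * f ?\<sigma>"
      using real_place_iff[OF v] assms[OF place_embedding(1)[OF v]] by (auto simp: local_degree_def)
    finally show "(\<Sum>\<sigma>\<in>v. f \<sigma>) = local_degree v * f ?\<sigma>" .
  qed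
  finally show ?thesis by simp
qed

lemma sum_local_degree: "(\<Sum>v\<in>(infinite_places :: 'f::number_field place set). local_degree v) = real (field_degree TYPE('f))"
  using sum_places[of "\<lambda>_ :: 'f \<Rightarrow> complex. 1"] by (simp add: finite_card_embeddings)

lemma local_degree_pos: "local_degree v > 0" "local_degree v \<ge> 1" by (auto simp: local_degree_def)

lemma infinite_places_nonempty: "(infinite_places :: 'f::number_field place set) \<noteq> {}"
  using sum_local_degree[where 'f='f] field_degree_pos[where 'f='f] by auto

lemma ln_field_norm:
  fixes a :: "'f::number_field"
  assumes "a \<noteq> 0"
  shows "ln (field_norm a) = (\<Sum>v\<in>infinite_places. local_degree v * ln (cmod (place_embedding v a)))"
proof -
  have "ln (field_norm a) = (\<Sum>\<sigma>\<in>complex_embeddings. ln (cmod (\<sigma> a)))"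
    unfolding field_norm_def using assms by (intro ln_prod finite_card_embeddings) (auto simp: embeddingD)
  also have "\<dots> = (\<Sum>v\<in>infinite_places. local_degree v * ln (cmod (place_embedding v a)))"
    by (rule sum_places[symmetric]) simp
  finally show ?thesis .
qed

lemma sum_local_trace:
  fixes x :: "'f::number_field"
  shows "(\<Sum>v\<in>infinite_places. local_trace v (place_embedding v x)) = real_of_rat (field_trace x)"
proof -
  have "(\<Sum>v\<in>infinite_places. local_trace v (place_embedding v x)) =
      (\<Sum>v\<in>infinite_places. local_degree v * Re (place_embedding v x))"
    by (intro sum.cong) (auto simp: local_trace_def local_degree_def)
  also have "\<dots> = Re (\<Sum>\<sigma>\<in>complex_embeddings. \<sigma> x)"
    using sum_places[of "\<lambda>\<sigma>. Re (\<sigma> x)"] by simp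
  also have "\<dots> = real_of_rat (field_trace x)"
    unfolding of_rat_field_trace[symmetric] by (cases "field_trace x") (simp add: of_rat_rat)
  finally show ?thesis .
qed

text \<open>The tangent line inequality \<open>1 + ln y \<le> y\<close>, summed with weights, gives AM--GM.\<close>

lemma places_am_gm:
  fixes g :: "'f::number_field place \<Rightarrow> real"
  assumes g: "\<And>v. v \<in> infinite_places \<Longrightarrow> g v > 0"
    and s: "(\<Sum>v\<in>infinite_places. local_degree v * ln (g v)) \<ge> real (field_degree TYPE('f)) * s"
  shows "(\<Sum>v\<in>infinite_places. local_degree v * g v) \<ge> real (field_degree TYPE('f)) * exp s"
proof -
  let ?d = "real (field_degree TYPE('f))"
  have "local_degree v * (1 + ln (g v) - s) \<le> local_degree v * (g v / exp s)" if v: "v \<in> infinite_places" for v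
  proof (rule mult_left_mono)
    have "ln (g v / exp s) \<le> g v / exp s - 1" using g[OF v] by (intro ln_le_minus_one) simp
    moreover have "ln (g v / exp s) = ln (g v) - s" using g[OF v] by (simp add: ln_div)
    ultimately show "1 + ln (g v) - s \<le> g v / exp s" by simp
  qed (use local_degree_pos(1)[of v] in simp)
  then have "(\<Sum>v\<in>infinite_places. local_degree v * (1 + ln (g v) - s)) \<le> (\<Sum>v\<in>infinite_places. local_degree v * (g v / exp s))"
    by (rule sum_mono)
  also have "\<dots> = (\<Sum>v\<in>infinite_places. local_degree v * g v) / exp s" by (simp add: sum_divide_distrib)
  finally have "(\<Sum>v\<in>infinite_places. local_degree v * (1 + ln (g v) - s)) \<le> (\<Sum>v\<in>infinite_places. local_degree v * g v) / exp s" .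
  moreover have "(\<Sum>v\<in>infinite_places. local_degree v * (1 + ln (g v) - s)) =
      ?d + (\<Sum>v\<in>infinite_places. local_degree v * ln (g v)) - ?d * s"
    by (simp add: algebra_simps sum.distrib sum_subtractf sum_distrib_left[symmetric] sum_local_degree)
  ultimately have "?d \<le> (\<Sum>v\<in>infinite_places. local_degree v * g v) / exp s" using s by linarith
  then show ?thesis by (simp add: field_simps)
qed

section \<open>Gaussian sums over lattices in \<open>F\<^sup>n\<close>\<close>

locale place_forms =
  fixes n :: nat and G :: "'f::number_field place \<Rightarrow> nat \<Rightarrow> nat \<Rightarrow> complex"
  assumes forms: "\<And>v. v \<in> infinite_places \<Longrightarrow> posdef_form n (carrier (completion_ring v)) (G v)"
begin

abbreviation pfrm :: "'f place \<Rightarrow> (nat \<Rightarrow> complex) \<Rightarrow> (nat \<Rightarrow> complex) \<Rightarrow> complex" where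
  "pfrm v \<equiv> posdef_form.frm n (G v)"

abbreviation pnorm :: "'f place \<Rightarrow> (nat \<Rightarrow> complex) \<Rightarrow> real" where
  "pnorm v \<equiv> posdef_form.fnorm n (G v)"

definition qform :: "(nat \<Rightarrow> 'f) \<Rightarrow> real" where
  "qform x = (\<Sum>v\<in>infinite_places. local_degree v *
     Re (pfrm v (\<lambda>i. place_embedding v (x i)) (\<lambda>i. place_embedding v (x i))))"

text \<open>Real coordinates of \<open>\<Prod>\<^sub>v F\<^sub>v\<^sup>n\<close>: the boolean selects the imaginary part, absent at real places.\<close>

definition cidx :: "('f place \<times> nat \<times> bool) set" where
  "cidx = (SIGMA v:infinite_places. {..<n} \<times> (if real_place v then {False} else UNIV))"

definition zc :: "'f place \<Rightarrow> ('f place \<times> nat \<times> bool \<Rightarrow> real) \<Rightarrow> nat \<Rightarrow> complex" where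
  "zc v y = (\<lambda>i. of_real (y (v, i, False)) + (if real_place v then 0 else \<i> * of_real (y (v, i, True))))"

text \<open>Lives on real coordinates, where the packing bound applies; on the coordinates of
  vectors over F its square is \<open>qform\<close>.\<close>

definition cnorm :: "('f place \<times> nat \<times> bool \<Rightarrow> real) \<Rightarrow> real" where
  "cnorm y = L2_set (\<lambda>v. sqrt (local_degree v) * pnorm v (zc v y)) infinite_places"

lemma finite_cidx: "finite cidx"
  unfolding cidx_def by (intro finite_SigmaI finite_infinite_places) auto

lemma card_cidx: "card cidx = n * field_degree TYPE('f)"
proof -
  have "real (card cidx) = (\<Sum>v\<in>(infinite_places :: 'f place set). real n * local_degree v)"
    unfolding cidx_def
    by (subst card_SigmaI) (auto simp: finite_infinite_places card_cartesian_product local_degree_def intro!: sum.cong)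
  also have "\<dots> = real (n * field_degree TYPE('f))"
    by (simp add: sum_distrib_left[symmetric] sum_local_degree)
  finally show ?thesis by (simp only: of_nat_eq_iff)
qed

lemma kvec_zc:
  assumes "v \<in> infinite_places"
  shows "posdef_form.kvec n (carrier (completion_ring v)) (zc v y)"
  unfolding posdef_form.kvec_def[OF forms[OF assms]] by (simp add: zc_def completion_ring_def)

lemma coord_norm_cnorm: "\<exists>C. coord_norm cidx cnorm C"
proof -
  let ?P = "infinite_places :: 'f place set"
  let ?wv = "\<lambda>v. posdef_form.wv n (carrier (completion_ring v)) (G v)"
  let ?un = "posdef_form.unitv"
  \<comment> \<open>The dual basis vectors bound coordinates by the norm, through Cauchy-Schwarz.
    The unit vectors bound the norm by coordinates; the 4 is a 2 for sqrt (local_degree v) times a 2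
    for real and imaginary part.\<close>
  define C where "C = 1 + (\<Sum>v\<in>?P. \<Sum>k<n. pnorm v (?wv v k) + 4 * pnorm v (?un k))"
  have nn: "pnorm v (?wv v k) \<ge> 0" "pnorm v (?un k) \<ge> 0" if v: "v \<in> ?P" for v k
  proof -
    interpret posdef_form n "carrier (completion_ring v)" "G v" by (rule forms[OF v])
    show "pnorm v (?wv v k) \<ge> 0" "pnorm v (?un k) \<ge> 0" by (simp_all add: fnorm_nonneg wv kvec_unitv)
  qed
  have nz: "pnorm v (zc v y) \<ge> 0" if v: "v \<in> ?P" for v y
    by (rule posdef_form.fnorm_nonneg[OF forms[OF v] kvec_zc[OF v]])
  have C1: "C \<ge> 1" unfolding C_def using nn by (simp add: sum_nonneg)
  have Cv: "pnorm v (?wv v k) \<le> C" if v: "v \<in> ?P" and k: "k < n" for v k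
  proof -
    have "pnorm v (?wv v k) \<le> pnorm v (?wv v k) + 4 * pnorm v (?un k)" using nn[OF v, of k] by simp
    also have "\<dots> \<le> (\<Sum>k<n. pnorm v (?wv v k) + 4 * pnorm v (?un k))"
      using k nn[OF v] by (intro member_le_sum) auto
    also have "\<dots> \<le> (\<Sum>v\<in>?P. \<Sum>k<n. pnorm v (?wv v k) + 4 * pnorm v (?un k))"
      using v nn finite_infinite_places
      by (intro member_le_sum[of v ?P "\<lambda>v. \<Sum>k<n. pnorm v (?wv v k) + 4 * pnorm v (?un k)"]) (auto intro!: sum_nonneg)
    finally show ?thesis by (simp add: C_def)
  qed
  have "coord_norm cidx cnorm C"
  proof
    show "finite cidx" by (rule finite_cidx)
    show "0 < C" using C1 by simp
    fix x y :: "'f place \<times> nat \<times> bool \<Rightarrow> real"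
    have "cnorm (\<lambda>i. x i + y i) \<le> L2_set (\<lambda>v. sqrt (local_degree v) * pnorm v (zc v x) + sqrt (local_degree v) * pnorm v (zc v y)) ?P"
      unfolding cnorm_def
    proof (rule L2_set_mono)
      fix v assume v: "v \<in> ?P"
      interpret posdef_form n "carrier (completion_ring v)" "G v" by (rule forms[OF v])
      have "zc v (\<lambda>i. x i + y i) = (\<lambda>i. zc v x i + zc v y i)" by (auto simp: zc_def algebra_simps)
      then have "pnorm v (zc v (\<lambda>i. x i + y i)) \<le> pnorm v (zc v x) + pnorm v (zc v y)"
        using fnorm_triangle[OF kvec_zc[OF v] kvec_zc[OF v], of x y] by simp
      then show "sqrt (local_degree v) * pnorm v (zc v (\<lambda>i. x i + y i)) \<le>
          sqrt (local_degree v) * pnorm v (zc v x) + sqrt (local_degree v) * pnorm v (zc v y)"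
        using local_degree_pos(1)[of v] by (simp flip: distrib_left)
      show "0 \<le> sqrt (local_degree v) * pnorm v (zc v (\<lambda>i. x i + y i))"
        using nz[OF v] local_degree_pos(1)[of v] by simp
    qed
    also have "\<dots> \<le> cnorm x + cnorm y" unfolding cnorm_def by (rule L2_set_triangle_ineq)
    finally show "cnorm (\<lambda>i. x i + y i) \<le> cnorm x + cnorm y" .
  next
    fix c :: real and x :: "'f place \<times> nat \<times> bool \<Rightarrow> real"
    have "sqrt (local_degree v) * pnorm v (zc v (\<lambda>i. c * x i)) = \<bar>c\<bar> * (sqrt (local_degree v) * pnorm v (zc v x))"
      if v: "v \<in> ?P" for v
    proof -
      interpret posdef_form n "carrier (completion_ring v)" "G v" by (rule forms[OF v])
      have "zc v (\<lambda>i. c * x i) = (\<lambda>i. of_real c * zc v x i)" by (auto simp: zc_def algebra_simps)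
      then show ?thesis using fnorm_scale[of "of_real c" "zc v x"] by simp
    qed
    then have "cnorm (\<lambda>i. c * x i) = L2_set (\<lambda>v. \<bar>c\<bar> * (sqrt (local_degree v) * pnorm v (zc v x))) ?P"
      unfolding cnorm_def by (intro L2_set_cong) auto
    then show "cnorm (\<lambda>i. c * x i) = \<bar>c\<bar> * cnorm x" by (simp add: cnorm_def L2_set_right_distrib)
  next
    fix y :: "'f place \<times> nat \<times> bool \<Rightarrow> real" and i assume i: "i \<in> cidx"
    obtain v k b where vk: "i = (v, k, b)" "v \<in> ?P" "k < n" "b \<Longrightarrow> \<not> real_place v"
      using i by (auto simp: cidx_def split: if_splits)
    interpret posdef_form n "carrier (completion_ring v)" "G v" by (rule forms[OF vk(2)])
    have "\<bar>y i\<bar> \<le> cmod (zc v y k)"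
    proof (cases b)
      case True
      then have "y i = Im (zc v y k)" using vk by (simp add: zc_def)
      then show ?thesis by (simp add: abs_Im_le_cmod)
    next
      case False
      then have "y i = Re (zc v y k)" using vk by (simp add: zc_def)
      then show ?thesis by (simp add: abs_Re_le_cmod)
    qed
    also have "zc v y k = frm (zc v y) (wv k)" using vk(3) by (simp add: frm_wv)
    also have "cmod \<dots> \<le> fnorm (zc v y) * fnorm (wv k)" by (rule frm_le_fnorm[OF kvec_zc[OF vk(2)] wv(1)])
    also have "\<dots> \<le> cnorm y * C"
    proof (rule mult_mono)
      have "1 \<le> sqrt (local_degree v)" using local_degree_pos(2) by simp
      then have "fnorm (zc v y) \<le> sqrt (local_degree v) * fnorm (zc v y)"
        using nz[OF vk(2), of y] mult_right_mono[of 1 "sqrt (local_degree v)" "fnorm (zc v y)"] by simp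
      also have "\<dots> \<le> cnorm y" unfolding cnorm_def
        by (rule member_le_L2_set[of ?P v "\<lambda>v. sqrt (local_degree v) * pnorm v (zc v y)"]) (use finite_infinite_places vk(2) in auto)
      finally show "fnorm (zc v y) \<le> cnorm y" .
      show "fnorm (wv k) \<le> C" by (rule Cv[OF vk(2,3)])
      show "0 \<le> cnorm y" by (simp add: cnorm_def)
      show "0 \<le> fnorm (wv k)" by (simp add: fnorm_nonneg wv)
    qed
    finally show "\<bar>y i\<bar> \<le> C * cnorm y" by (simp add: mult.commute)
  next
    fix y :: "'f place \<times> nat \<times> bool \<Rightarrow> real"
    define S where "S = (\<Sum>i\<in>cidx. \<bar>y i\<bar>)"
    have yS: "\<bar>y i\<bar> \<le> S" if "i \<in> cidx" for i
      unfolding S_def using that finite_cidx by (intro member_le_sum) auto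
    have S0: "S \<ge> 0" unfolding S_def by (rule sum_nonneg) simp
    have z: "cmod (zc v y k) \<le> 2 * S" if v: "v \<in> ?P" and k: "k < n" for v k
    proof -
      have "cmod (zc v y k) \<le> \<bar>y (v, k, False)\<bar> + (if real_place v then 0 else \<bar>y (v, k, True)\<bar>)"
        unfolding zc_def using norm_triangle_ineq[of "of_real (y (v, k, False)) :: complex" "\<i> * of_real (y (v, k, True))"]
        by (simp add: norm_mult)
      moreover have "\<bar>y (v, k, False)\<bar> \<le> S" using v k by (intro yS) (auto simp: cidx_def)
      moreover have "(if real_place v then 0 else \<bar>y (v, k, True)\<bar>) \<le> S"
        using v k S0 yS[of "(v, k, True)"] by (auto simp: cidx_def)
      ultimately show ?thesis by linarith
    qed
    have "cnorm y \<le> (\<Sum>v\<in>?P. sqrt (local_degree v) * pnorm v (zc v y))"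
      unfolding cnorm_def by (rule L2_set_le_sum) (simp add: nz local_degree_def)
    also have "\<dots> \<le> (\<Sum>v\<in>?P. (\<Sum>k<n. 4 * pnorm v (?un k)) * S)"
    proof (rule sum_mono)
      fix v assume v: "v \<in> ?P"
      interpret posdef_form n "carrier (completion_ring v)" "G v" by (rule forms[OF v])
      have "fnorm (zc v y) \<le> (\<Sum>k<n. cmod (zc v y k) * fnorm (unitv k))" by (rule fnorm_le[OF kvec_zc[OF v]])
      also have "\<dots> \<le> (\<Sum>k<n. (2 * S) * fnorm (unitv k))"
        using z[OF v] by (intro sum_mono mult_right_mono) (auto simp: fnorm_nonneg kvec_unitv)
      finally have f: "fnorm (zc v y) \<le> (\<Sum>k<n. 2 * fnorm (unitv k)) * S" unfolding sum_distrib_right by (simp add: mult_ac)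
      have "sqrt (local_degree v) \<le> sqrt 4" by (simp only: real_sqrt_le_iff) (simp add: local_degree_def)
      then have "sqrt (local_degree v) \<le> 2" by simp
      then have "sqrt (local_degree v) * fnorm (zc v y) \<le> 2 * ((\<Sum>k<n. 2 * fnorm (unitv k)) * S)"
        using f nz[OF v, of y] by (intro mult_mono) auto
      then show "sqrt (local_degree v) * pnorm v (zc v y) \<le> (\<Sum>k<n. 4 * pnorm v (?un k)) * S"
        by (simp add: sum_distrib_left mult_ac)
    qed
    also have "\<dots> = (\<Sum>v\<in>?P. \<Sum>k<n. 4 * pnorm v (?un k)) * S" by (simp add: sum_distrib_right)
    also have "\<dots> \<le> C * S"
    proof (rule mult_right_mono[OF _ S0])
      have "(\<Sum>v\<in>?P. \<Sum>k<n. 4 * pnorm v (?un k)) \<le> (\<Sum>v\<in>?P. \<Sum>k<n. pnorm v (?wv v k) + 4 * pnorm v (?un k))"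
        using nn by (intro sum_mono) simp
      then show "(\<Sum>v\<in>?P. \<Sum>k<n. 4 * pnorm v (?un k)) \<le> C" by (simp add: C_def)
    qed
    finally show "cnorm y \<le> C * (\<Sum>i\<in>cidx. \<bar>y i\<bar>)" by (simp add: S_def)
  qed
  then show ?thesis by blast
qed

text \<open>Set to 0 outside \<open>cidx\<close>, so that the zero vector goes to the zero function
  and differences are respected as equations between functions.\<close>

definition to_coords :: "(nat \<Rightarrow> 'f) \<Rightarrow> 'f place \<times> nat \<times> bool \<Rightarrow> real" where
  "to_coords x = (\<lambda>i. if i \<in> cidx then
     (case i of (v, k, b) \<Rightarrow> if b then Im (place_embedding v (x k)) else Re (place_embedding v (x k))) else 0)"

lemma zc_to_coords: "v \<in> infinite_places \<Longrightarrow> k < n \<Longrightarrow> zc v (to_coords x) k = place_embedding v (x k)"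
proof -
  assume vk: "v \<in> infinite_places" "k < n"
  show ?thesis
  proof (cases "real_place v")
    case True
    then have "place_embedding v (x k) \<in> \<real>" by (auto simp: real_place_def)
    then show ?thesis using vk True by (auto simp: zc_def to_coords_def cidx_def complex_is_Real_iff complex_eq_iff)
  next
    case False
    then show ?thesis using vk by (auto simp: zc_def to_coords_def cidx_def complex_eq_iff)
  qed
qed

lemma cnorm_to_coords: "(cnorm (to_coords x))\<^sup>2 = qform x"
proof -
  have "(cnorm (to_coords x))\<^sup>2 = (\<Sum>v\<in>infinite_places. (sqrt (local_degree v) * pnorm v (zc v (to_coords x)))\<^sup>2)"
    unfolding cnorm_def L2_set_def by (simp add: sum_nonneg)
  also have "\<dots> = qform x"
    unfolding qform_def
  proof (rule sum.cong[OF refl])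
    fix v :: "'f place" assume v: "v \<in> infinite_places"
    interpret posdef_form n "carrier (completion_ring v)" "G v" by (rule forms[OF v])
    have "frm (zc v (to_coords x)) (zc v (to_coords x)) = frm (\<lambda>i. place_embedding v (x i)) (\<lambda>i. place_embedding v (x i))"
      by (rule frm_cong) (auto simp: zc_to_coords v)
    then show "(sqrt (local_degree v) * pnorm v (zc v (to_coords x)))\<^sup>2 = local_degree v *
        Re (pfrm v (\<lambda>i. place_embedding v (x i)) (\<lambda>i. place_embedding v (x i)))"
      using local_degree_pos(1)[of v] fnorm_square[OF kvec_zc[OF v]] by (simp add: power_mult_distrib)
  qed
  finally show ?thesis .
qed

text \<open>Embeddings are injective and vectors of L vanish from index n on, so real coordinates
  are faithful on L. As l bounds the squared norm, the packing estimate is applied with sqrt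
  l.\<close>

lemma lattice_sum_bound:
  fixes L :: "(nat \<Rightarrow> 'f) set"
  assumes diff: "\<And>x y. x \<in> L \<Longrightarrow> y \<in> L \<Longrightarrow> (\<lambda>i. x i - y i) \<in> L" and zero: "(\<lambda>i. 0) \<in> L"
    and supp: "\<And>x i. x \<in> L \<Longrightarrow> i \<ge> n \<Longrightarrow> x i = 0"
    and l: "l > 0" "real (n * field_degree TYPE('f)) \<le> l"
    and min: "\<And>x. x \<in> L \<Longrightarrow> x \<noteq> (\<lambda>i. 0) \<Longrightarrow> l \<le> qform x"
    and t: "t > 1 / 2" and Y: "finite Y" "Y \<subseteq> L" "(\<lambda>i. 0) \<notin> Y"
  shows "(\<Sum>y\<in>Y. exp (- t * qform y)) \<le> 3 ^ (n * field_degree TYPE('f)) * exp (- t * l) * (t / (t - 1 / 2))"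
proof -
  obtain C where "coord_norm cidx cnorm C" using coord_norm_cnorm by blast
  then interpret coord_norm cidx cnorm C .
  have cdiff: "to_coords (\<lambda>i. x i - y i) = (\<lambda>i. to_coords x i - to_coords y i)" for x y
    by (auto simp: to_coords_def cidx_def embeddingD(6)[OF place_embedding(1)] fun_eq_iff)
  have czero: "to_coords (\<lambda>i. 0) = (\<lambda>i. 0)"
    by (auto simp: to_coords_def cidx_def embeddingD(4)[OF place_embedding(1)] fun_eq_iff)
  have eq0: "x = (\<lambda>i. 0)" if x: "x \<in> L" "to_coords x = (\<lambda>i. 0)" for x
  proof
    fix i
    obtain v :: "'f place" where v: "v \<in> infinite_places" using infinite_places_nonempty by blast
    show "x i = 0"
    proof (cases "i < n")
      case True
      have "place_embedding v (x i) = zc v (to_coords x) i" using zc_to_coords[OF v True] by simp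
      also have "\<dots> = 0" by (simp add: x(2) zc_def)
      finally show ?thesis by (simp add: embeddingD(10)[OF place_embedding(1)[OF v]])
    qed (use supp x(1) in simp)
  qed
  have inj: "inj_on to_coords L"
  proof (rule inj_onI)
    fix x y assume xy: "x \<in> L" "y \<in> L" "to_coords x = to_coords y"
    have "(\<lambda>i. x i - y i) = (\<lambda>i. 0)" by (rule eq0[OF diff[OF xy(1,2)]]) (simp add: cdiff xy(3))
    then show "x = y" by (simp add: fun_eq_iff)
  qed
  have "(\<Sum>y\<in>to_coords ` Y. exp (- t * (cnorm y)\<^sup>2)) \<le> 3 ^ card cidx * exp (- t * (sqrt l) ^ 2) * (t / (t - 1 / 2))"
  proof (rule lattice_gauss_bound[of "to_coords ` L"])
    show "(\<lambda>i. x i - y i) \<in> to_coords ` L" if xy: "x \<in> to_coords ` L" "y \<in> to_coords ` L" for x y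
    proof -
      obtain x' y' where "x' \<in> L" "y' \<in> L" "x = to_coords x'" "y = to_coords y'" using xy by blast
      then show ?thesis using diff[of x' y'] cdiff[of x' y'] by (metis imageI)
    qed
    show "(\<lambda>i. 0) \<in> to_coords ` L" using zero czero by (metis imageI)
    show "real (card cidx) \<le> (sqrt l) ^ 2" using l by (simp add: card_cidx)
    show "sqrt l \<le> cnorm x" if x: "x \<in> to_coords ` L" "x \<noteq> (\<lambda>i. 0)" for x
    proof -
      obtain x' where x': "x' \<in> L" "x = to_coords x'" using x(1) by blast
      then have "l \<le> (cnorm x)\<^sup>2" using min[of x'] x(2) czero by (auto simp: cnorm_to_coords)
      then show ?thesis using N_nonneg[of x] by (intro real_le_lsqrt) auto
    qed
    show "to_coords ` Y \<subseteq> to_coords ` L" using Y(2) by blast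
    show "(\<lambda>i. 0) \<notin> to_coords ` Y" using eq0 Y(2,3) by (metis imageE subsetD)
  qed (use l t Y(1) in auto)
  moreover have "(\<Sum>y\<in>to_coords ` Y. exp (- t * (cnorm y)\<^sup>2)) = (\<Sum>y\<in>Y. exp (- t * qform y))"
    by (subst sum.reindex) (use inj Y(2) inj_on_subset in \<open>auto simp: cnorm_to_coords\<close>)
  ultimately show ?thesis using l(1) by (simp add: card_cidx)
qed

end

section \<open>Linear algebra for families of functions\<close>

text \<open>Padding A with zero rows gives a square matrix; its row m is zero, so
  \<open>unit_vec n m\<close> lies in the left kernel and the matrix is singular.\<close>

lemma homogeneous_solution:
  fixes A :: "nat \<Rightarrow> nat \<Rightarrow> 'a::field"
  assumes "m < n"
  shows "\<exists>c. (\<exists>j<n. c j \<noteq> 0) \<and> (\<forall>i<m. (\<Sum>j<n. A i j * c j) = 0)"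
proof -
  define B where "B = Matrix.mat n n (\<lambda>(i, j). if i < m then A i j else 0)"
  have B: "B \<in> carrier_mat n n" by (simp add: B_def)
  have "transpose_mat B *\<^sub>v unit_vec n m = 0\<^sub>v n"
  proof (rule eq_vecI)
    fix j assume "j < dim_vec (0\<^sub>v n :: 'a Matrix.vec)"
    then have j: "j < n" by simp
    have "(transpose_mat B *\<^sub>v unit_vec n m) $ j = (\<Sum>i = 0..<n. B $$ (i, j) * (if i = m then 1 else 0))"
      using j assms by (auto simp: scalar_prod_def B_def unit_vec_def intro!: sum.cong)
    also have "\<dots> = (\<Sum>i = 0..<n. if i = m then B $$ (i, j) else 0)" by (intro sum.cong) auto
    also have "\<dots> = 0" using j assms by (simp add: B_def)
    finally show "(transpose_mat B *\<^sub>v unit_vec n m) $ j = 0\<^sub>v n $ j" using j by simp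
  qed (simp add: B_def)
  moreover have "unit_vec n m \<noteq> (0\<^sub>v n :: 'a Matrix.vec)"
  proof
    assume "unit_vec n m = (0\<^sub>v n :: 'a Matrix.vec)"
    then have "unit_vec n m $ m = (0\<^sub>v n :: 'a Matrix.vec) $ m" by simp
    then show False using assms by simp
  qed
  ultimately have "Determinant.det (transpose_mat B) = 0"
    using det_0_iff_vec_prod_zero[of "transpose_mat B" n] B by (metis transpose_carrier_mat unit_vec_carrier)
  then have "Determinant.det B = 0" using Determinant.det_transpose[OF B] by simp
  then obtain v where v: "v \<in> carrier_vec n" "v \<noteq> 0\<^sub>v n" "B *\<^sub>v v = 0\<^sub>v n"
    using det_0_iff_vec_prod_zero[OF B] by blast
  have "\<exists>j<n. v $ j \<noteq> 0"
  proof (rule ccontr)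
    assume "\<not> (\<exists>j<n. v $ j \<noteq> 0)"
    then have "v = 0\<^sub>v n" using v(1) by (intro eq_vecI) auto
    then show False using v(2) by simp
  qed
  moreover have "(\<Sum>j<n. A i j * v $ j) = 0" if i: "i < m" for i
  proof -
    have "(B *\<^sub>v v) $ i = (\<Sum>j<n. A i j * v $ j)"
      using i assms v(1) by (auto simp: scalar_prod_def B_def lessThan_atLeast0 intro!: sum.cong)
    then show ?thesis using v(3) i assms by simp
  qed
  ultimately show ?thesis by (intro exI[of _ "\<lambda>j. v $ j"]) auto
qed

text \<open>Independence of a list as a family, so a repeated function counts as dependent.\<close>

definition findep :: "('b \<Rightarrow> 'a::field) list \<Rightarrow> bool" where
  "findep vs \<longleftrightarrow> (\<forall>c. (\<forall>j. (\<Sum>i<length vs. c i * (vs ! i) j) = 0) \<longrightarrow> (\<forall>i<length vs. c i = 0))"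

lemma findepD: "findep vs \<Longrightarrow> (\<And>j. (\<Sum>i<length vs. c i * (vs ! i) j) = 0) \<Longrightarrow> i < length vs \<Longrightarrow> c i = 0"
  unfolding findep_def by blast

lemma not_findep_snoc:
  assumes "findep vs" "\<not> findep (vs @ [w])"
  shows "\<exists>c. \<forall>j. w j = (\<Sum>i<length vs. c i * (vs ! i) j)"
proof -
  obtain c k where c: "\<forall>j. (\<Sum>i<length (vs @ [w]). c i * ((vs @ [w]) ! i) j) = 0" "k < length (vs @ [w])" "c k \<noteq> 0"
    using assms(2) unfolding findep_def by blast
  have s: "(\<Sum>i<length vs. c i * (vs ! i) j) + c (length vs) * w j = 0" for j
    using c(1)[rule_format, of j] by (simp add: nth_append)
  have "c (length vs) \<noteq> 0"
  proof
    assume "c (length vs) = 0"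
    then have "(\<Sum>i<length vs. c i * (vs ! i) j) = 0" for j using s[of j] by simp
    from findepD[OF assms(1) this] have "i < length vs \<Longrightarrow> c i = 0" for i by blast
    then show False using c(2,3) \<open>c (length vs) = 0\<close> by (auto simp: less_Suc_eq)
  qed
  then have "w j = (\<Sum>i<length vs. - c i / c (length vs) * (vs ! i) j)" for j
    using s[of j] by (simp add: sum_divide_distrib[symmetric] sum_negf field_simps eq_neg_iff_add_eq_0)
  then show ?thesis by (intro exI[of _ "\<lambda>i. - c i / c (length vs)"]) blast
qed

text \<open>If ws were longer, the system for its coefficients would have more unknowns than
  equations, and a nonzero solution is a relation between the ws.\<close>

lemma findep_length_le:
  assumes "findep ws" "\<And>j. j < length ws \<Longrightarrow> \<exists>c. \<forall>l. (ws ! j) l = (\<Sum>i<length vs. c i * (vs ! i) l)"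
  shows "length ws \<le> length vs"
proof (rule ccontr)
  assume "\<not> length ws \<le> length vs"
  then have less: "length vs < length ws" by simp
  obtain A where A: "\<And>j l. j < length ws \<Longrightarrow> (ws ! j) l = (\<Sum>i<length vs. A j i * (vs ! i) l)" using assms(2) by metis
  obtain c where c: "\<exists>j<length ws. c j \<noteq> 0" "\<forall>i<length vs. (\<Sum>j<length ws. A j i * c j) = 0"
    using homogeneous_solution[OF less, of "\<lambda>i j. A j i"] by blast
  have "(\<Sum>j<length ws. c j * (ws ! j) l) = 0" for l
  proof -
    have "(\<Sum>j<length ws. c j * (ws ! j) l) = (\<Sum>j<length ws. \<Sum>i<length vs. (A j i * c j) * (vs ! i) l)"
      by (intro sum.cong refl) (simp add: A sum_distrib_left mult_ac)
    also have "\<dots> = (\<Sum>i<length vs. (\<Sum>j<length ws. A j i * c j) * (vs ! i) l)"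
      by (subst sum.swap) (simp add: sum_distrib_right)
    also have "\<dots> = 0" using c(2) by simp
    finally show ?thesis .
  qed
  from findepD[OF assms(1) this] show False using c(1) by blast
qed

section \<open>Coordinates on a lattice\<close>

text \<open>A dual basis in the sense of projective modules: functionals with integral values and
  elements \<gamma> that generate the module. The \<gamma> may well be dependent.\<close>

definition coordinate_system ::
    "('f::number_field, 'm) module \<Rightarrow> nat \<Rightarrow> ('m \<Rightarrow> nat \<Rightarrow> 'f) \<Rightarrow> (nat \<Rightarrow> 'm) \<Rightarrow> bool" where
  "coordinate_system M k e \<gamma> \<longleftrightarrow> (\<forall>j. of_linear M (\<lambda>x. e x j)) \<and> (\<forall>x\<in>carrier M. \<forall>j. e x j \<in> int_elems) \<and>
     (\<forall>j<k. \<gamma> j \<in> carrier M) \<and>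
     (\<forall>x\<in>carrier M. x = (\<Oplus>\<^bsub>M\<^esub>j\<in>{..<k}. e x j \<odot>\<^bsub>M\<^esub> \<gamma> j) \<and> (\<forall>j\<ge>k. e x j = 0))"

text \<open>The module is a summand of a free one: the functionals are the components of the section
  s, and the \<gamma> are the images of the unit vectors under the projection p.\<close>

lemma projective_coordinates:
  fixes M :: "('f::number_field, 'm) module"
  assumes "fg_projective ring_of_integers M"
  shows "\<exists>e k \<gamma>. coordinate_system M k e \<gamma>"
proof -
  let ?O = "ring_of_integers :: 'f ring"
  interpret of_module M by (rule of_module.intro) (use assms in \<open>simp add: fg_projective_def\<close>)
  obtain k s p where s: "s \<in> linear_maps ?O M (free_module ?O k)" and p: "p \<in> linear_maps ?O (free_module ?O k) M"
    and ps: "\<forall>x\<in>carrier M. p (s x) = x"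
    using assms unfolding fg_projective_def by blast
  let ?F = "free_module ?O k"
  have carF: "carrier ?F = {..<k} \<rightarrow>\<^sub>E int_elems" by (simp add: free_module_def carrier_ring_of_integers)
  have addF: "f \<oplus>\<^bsub>?F\<^esub> g = (\<lambda>i\<in>{..<k}. f i + g i)" for f g by (simp add: free_module_def)
  have smF: "r \<odot>\<^bsub>?F\<^esub> f = (\<lambda>i\<in>{..<k}. r * f i)" for r f by (simp add: free_module_def)
  have sF: "s x \<in> carrier ?F" if "x \<in> carrier M" for x using s that by (auto simp: linear_maps_def)
  have sO: "s x j \<in> int_elems" if "x \<in> carrier M" "j < k" for x j using sF[OF that(1)] that(2) by (auto simp: carF)
  have pM: "p f \<in> carrier M" if "f \<in> carrier ?F" for f using p that by (auto simp: linear_maps_def)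
  have padd: "p (f \<oplus>\<^bsub>?F\<^esub> g) = p f \<oplus>\<^bsub>M\<^esub> p g" if "f \<in> carrier ?F" "g \<in> carrier ?F" for f g
    using p that by (simp add: linear_maps_def)
  have psm: "p (r \<odot>\<^bsub>?F\<^esub> f) = r \<odot>\<^bsub>M\<^esub> p f" if "r \<in> int_elems" "f \<in> carrier ?F" for r f
    using p that by (simp add: linear_maps_def carrier_ring_of_integers)
  define \<delta> where "\<delta> = (\<lambda>j. \<lambda>i\<in>{..<k}. if i = j then 1 else 0 :: 'f)"
  have \<delta>: "\<delta> j \<in> carrier ?F" for j by (auto simp: \<delta>_def carF int_elems_closed)
  define e where "e = (\<lambda>x j. if j < k then s x j else 0)"
  have expand: "p f = (\<Oplus>\<^bsub>M\<^esub>j\<in>{..<k}. f j \<odot>\<^bsub>M\<^esub> p (\<delta> j))" if f: "f \<in> carrier ?F" for f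
  proof -
    \<comment> \<open>Truncations of f: p is known to respect the sum of two elements, so its value
      at f is built up one coordinate at a time.\<close>
    define tr where "tr = (\<lambda>m. \<lambda>i\<in>{..<k}. if i < m then f i else 0)"
    have fO: "f i \<in> int_elems" if "i < k" for i using f that by (auto simp: carF)
    have tr: "tr m \<in> carrier ?F" for m unfolding carF tr_def by (simp add: restrict_PiE_iff fO int_elems_closed(1))
    have "m \<le> k \<Longrightarrow> p (tr m) = (\<Oplus>\<^bsub>M\<^esub>j\<in>{..<m}. f j \<odot>\<^bsub>M\<^esub> p (\<delta> j))" for m
    proof (induction m)
      case 0
      have "tr 0 = 0 \<odot>\<^bsub>?F\<^esub> f" by (auto simp: tr_def smF fun_eq_iff)
      then have "p (tr 0) = 0 \<odot>\<^bsub>M\<^esub> p f" using psm[of 0 f] f by (simp add: int_elems_closed)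
      also have "\<dots> = \<zero>\<^bsub>M\<^esub>" using smult_l_null[OF pM[OF f]] by simp
      finally show ?case by simp
    next
      case (Suc m)
      then have fm: "f m \<in> int_elems" by (intro fO) simp
      have "tr (Suc m) = tr m \<oplus>\<^bsub>?F\<^esub> (f m \<odot>\<^bsub>?F\<^esub> \<delta> m)"
        using Suc.prems by (auto simp: tr_def addF smF \<delta>_def fun_eq_iff less_Suc_eq)
      moreover have "f m \<odot>\<^bsub>?F\<^esub> \<delta> m \<in> carrier ?F" unfolding carF smF \<delta>_def by (simp add: restrict_PiE_iff fm int_elems_closed(1))
      ultimately have "p (tr (Suc m)) = p (tr m) \<oplus>\<^bsub>M\<^esub> (f m \<odot>\<^bsub>M\<^esub> p (\<delta> m))"
        using padd[OF tr] psm[OF fm \<delta>] by simp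
      also have "\<dots> = (f m \<odot>\<^bsub>M\<^esub> p (\<delta> m)) \<oplus>\<^bsub>M\<^esub> (\<Oplus>\<^bsub>M\<^esub>j\<in>{..<m}. f j \<odot>\<^bsub>M\<^esub> p (\<delta> j))"
        using Suc a_comm[OF pM[OF tr, of m] smult_mem[OF fm pM[OF \<delta>, of m]]] by simp
      also have "\<dots> = (\<Oplus>\<^bsub>M\<^esub>j\<in>insert m {..<m}. f j \<odot>\<^bsub>M\<^esub> p (\<delta> j))"
      proof (rule finsum_insert[symmetric])
        show "(\<lambda>j. f j \<odot>\<^bsub>M\<^esub> p (\<delta> j)) \<in> {..<m} \<rightarrow> carrier M"
          using fO Suc.prems pM[OF \<delta>] by auto
      qed (use fm pM[OF \<delta>] in auto)
      finally show ?case by (simp add: lessThan_Suc)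
    qed
    moreover have "tr k = f" using f by (auto simp: tr_def carF fun_eq_iff PiE_iff extensional_def)
    ultimately show ?thesis by auto
  qed
  have "coordinate_system M k e (\<lambda>j. p (\<delta> j))"
    unfolding coordinate_system_def
  proof (intro conjI allI ballI impI)
    show "of_linear M (\<lambda>x. e x j)" for j
    proof -
      have "e (x \<oplus>\<^bsub>M\<^esub> y) j = e x j + e y j" if "x \<in> carrier M" "y \<in> carrier M" for x y
        using s that by (simp add: e_def linear_maps_def addF)
      moreover have "e (r \<odot>\<^bsub>M\<^esub> x) j = r * e x j" if "r \<in> int_elems" "x \<in> carrier M" for r x
        using s that by (simp add: e_def linear_maps_def smF carrier_ring_of_integers)
      ultimately show ?thesis by (simp add: of_linear_def)
    qed
    show "e x j \<in> int_elems" if "x \<in> carrier M" for x j using sO that by (auto simp: e_def int_elems_closed)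
    show "p (\<delta> j) \<in> carrier M" for j by (rule pM[OF \<delta>])
    show "x = (\<Oplus>\<^bsub>M\<^esub>j\<in>{..<k}. e x j \<odot>\<^bsub>M\<^esub> p (\<delta> j))" if x: "x \<in> carrier M" for x
    proof -
      have "x = (\<Oplus>\<^bsub>M\<^esub>j\<in>{..<k}. s x j \<odot>\<^bsub>M\<^esub> p (\<delta> j))" using expand[OF sF[OF x]] ps x by simp
      also have "\<dots> = (\<Oplus>\<^bsub>M\<^esub>j\<in>{..<k}. e x j \<odot>\<^bsub>M\<^esub> p (\<delta> j))"
        by (intro finsum_cong') (use sO x pM[OF \<delta>] in \<open>auto simp: e_def\<close>)
      finally show ?thesis .
    qed
    show "e x j = 0" if "k \<le> j" for x j using that by (simp add: e_def)
  qed
  then show ?thesis by blast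
qed

locale hermitian_lattice =
  fixes \<Lambda> :: "('f::number_field, 'm) module" and h :: "('f, 'm) metrics"
  assumes lattice: "is_lattice \<Lambda> h"
begin

sublocale of_module \<Lambda>
  by (rule of_module.intro) (use lattice in \<open>simp add: is_lattice_def fg_projective_def\<close>)

text \<open>Fixes an embedding of \<Lambda> into a space of F-valued functions. Linear algebra over
  F is carried out on these coordinate vectors instead of in the generic fibre.\<close>

definition emb :: "'m \<Rightarrow> nat \<Rightarrow> 'f" where
  "emb = (SOME e. \<exists>k \<gamma>. coordinate_system \<Lambda> k e \<gamma>)"

lemma emb_system:
  obtains k \<gamma> where "coordinate_system \<Lambda> k emb \<gamma>"
proof -
  have "\<exists>e k \<gamma>. coordinate_system \<Lambda> k e \<gamma>"
    by (rule projective_coordinates) (use lattice in \<open>simp add: is_lattice_def\<close>)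
  from someI_ex[OF this] show thesis using that unfolding emb_def by blast
qed

lemma emb_linear: "of_linear \<Lambda> (\<lambda>x. emb x j)"
  by (rule emb_system) (simp add: coordinate_system_def)

lemma emb_inj: "x \<in> carrier \<Lambda> \<Longrightarrow> y \<in> carrier \<Lambda> \<Longrightarrow> emb x = emb y \<Longrightarrow> x = y"
proof (rule emb_system)
  fix k \<gamma> assume "coordinate_system \<Lambda> k emb \<gamma>"
  then have *: "x = (\<Oplus>\<^bsub>\<Lambda>\<^esub>j\<in>{..<k}. emb x j \<odot>\<^bsub>\<Lambda>\<^esub> \<gamma> j)" if "x \<in> carrier \<Lambda>" for x
    using that unfolding coordinate_system_def by blast
  assume "x \<in> carrier \<Lambda>" "y \<in> carrier \<Lambda>" "emb x = emb y"
  then show "x = y" using *[of x] *[of y] by simp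
qed

lemma inj_on_emb: "inj_on emb (carrier \<Lambda>)" by (rule inj_onI) (rule emb_inj)

lemma emb_add: "x \<in> carrier \<Lambda> \<Longrightarrow> y \<in> carrier \<Lambda> \<Longrightarrow> emb (x \<oplus>\<^bsub>\<Lambda>\<^esub> y) = emb x + emb y"
  using of_linearD(1)[OF emb_linear] by (simp add: fun_eq_iff)

lemma emb_smult: "r \<in> int_elems \<Longrightarrow> x \<in> carrier \<Lambda> \<Longrightarrow> emb (r \<odot>\<^bsub>\<Lambda>\<^esub> x) j = r * emb x j"
  using of_linearD(2)[OF emb_linear] by simp

lemma emb_zero: "emb \<zero>\<^bsub>\<Lambda>\<^esub> = 0"
  using of_linear_zero[OF emb_linear] by (simp add: fun_eq_iff)

lemma emb_uminus: "x \<in> carrier \<Lambda> \<Longrightarrow> emb (\<ominus>\<^bsub>\<Lambda>\<^esub> x) = - emb x"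
  using emb_add[of x "\<ominus>\<^bsub>\<Lambda>\<^esub> x"] by (simp add: r_neg emb_zero eq_neg_iff_add_eq_0 add.commute)

lemma comb_mem:
  assumes "finite A" "\<And>i. i \<in> A \<Longrightarrow> c i \<in> int_elems" "\<And>i. i \<in> A \<Longrightarrow> g i \<in> carrier \<Lambda>"
  shows "(\<Oplus>\<^bsub>\<Lambda>\<^esub>i\<in>A. c i \<odot>\<^bsub>\<Lambda>\<^esub> g i) \<in> carrier \<Lambda>"
  using assms by (intro finsum_closed) auto

lemma of_linear_comb:
  assumes "of_linear \<Lambda> \<xi>" "finite A" "\<And>i. i \<in> A \<Longrightarrow> c i \<in> int_elems" "\<And>i. i \<in> A \<Longrightarrow> g i \<in> carrier \<Lambda>"
  shows "\<xi> (\<Oplus>\<^bsub>\<Lambda>\<^esub>i\<in>A. c i \<odot>\<^bsub>\<Lambda>\<^esub> g i) = (\<Sum>i\<in>A. c i * \<xi> (g i))"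
  using assms by (subst of_linear_finsum) (auto simp: of_linearD(2)[OF assms(1)])

lemma emb_comb:
  assumes "finite A" "\<And>i. i \<in> A \<Longrightarrow> c i \<in> int_elems" "\<And>i. i \<in> A \<Longrightarrow> g i \<in> carrier \<Lambda>"
  shows "emb (\<Oplus>\<^bsub>\<Lambda>\<^esub>i\<in>A. c i \<odot>\<^bsub>\<Lambda>\<^esub> g i) j = (\<Sum>i\<in>A. c i * emb (g i) j)"
  using assms by (rule of_linear_comb[OF emb_linear])

text \<open>Clearing denominators turns an \<open>F\<close>-linear relation between coordinate vectors into a relation in
  \<open>\<Lambda>\<close>, so it persists under every functional.\<close>

lemma relation_multiple:
  assumes es: "set es \<subseteq> carrier \<Lambda>" and x: "x \<in> carrier \<Lambda>"
    and c: "\<And>j. emb x j = (\<Sum>i<length es. c i * emb (es ! i) j)"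
  shows "\<exists>m::nat. m > 0 \<and> (\<forall>i<length es. of_nat m * c i \<in> int_elems) \<and>
    of_nat m \<odot>\<^bsub>\<Lambda>\<^esub> x = (\<Oplus>\<^bsub>\<Lambda>\<^esub>i\<in>{..<length es}. (of_nat m * c i) \<odot>\<^bsub>\<Lambda>\<^esub> es ! i)"
proof -
  obtain m :: nat where m: "m > 0" "\<forall>i\<in>{..<length es}. of_nat m * c i \<in> int_elems"
    using int_elems_multiples[of "{..<length es}" c] by auto
  have esM: "es ! i \<in> carrier \<Lambda>" if "i < length es" for i using es that by auto
  have "of_nat m \<odot>\<^bsub>\<Lambda>\<^esub> x = (\<Oplus>\<^bsub>\<Lambda>\<^esub>i\<in>{..<length es}. (of_nat m * c i) \<odot>\<^bsub>\<Lambda>\<^esub> es ! i)"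
  proof (rule emb_inj)
    show "emb (of_nat m \<odot>\<^bsub>\<Lambda>\<^esub> x) = emb (\<Oplus>\<^bsub>\<Lambda>\<^esub>i\<in>{..<length es}. (of_nat m * c i) \<odot>\<^bsub>\<Lambda>\<^esub> es ! i)"
    proof
      fix j
      show "emb (of_nat m \<odot>\<^bsub>\<Lambda>\<^esub> x) j = emb (\<Oplus>\<^bsub>\<Lambda>\<^esub>i\<in>{..<length es}. (of_nat m * c i) \<odot>\<^bsub>\<Lambda>\<^esub> es ! i) j"
        by (subst emb_comb) (use m(2) esM x in \<open>auto simp: emb_smult int_elems_closed c sum_distrib_left mult_ac\<close>)
    qed
  qed (use m(2) esM x in \<open>auto simp: int_elems_closed intro!: comb_mem\<close>)
  then show ?thesis using m by (intro exI[of _ m]) auto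
qed

lemma functional_relation:
  assumes es: "set es \<subseteq> carrier \<Lambda>" and x: "x \<in> carrier \<Lambda>"
    and c: "\<And>j. emb x j = (\<Sum>i<length es. c i * emb (es ! i) j)" and \<xi>: "of_linear \<Lambda> \<xi>"
  shows "\<xi> x = (\<Sum>i<length es. c i * \<xi> (es ! i))"
proof -
  obtain m :: nat where m: "m > 0" "\<forall>i<length es. of_nat m * c i \<in> int_elems"
    "of_nat m \<odot>\<^bsub>\<Lambda>\<^esub> x = (\<Oplus>\<^bsub>\<Lambda>\<^esub>i\<in>{..<length es}. (of_nat m * c i) \<odot>\<^bsub>\<Lambda>\<^esub> es ! i)"
    using relation_multiple[OF es x c] by blast
  have esM: "es ! i \<in> carrier \<Lambda>" if "i < length es" for i using es that by auto
  have "of_nat m * \<xi> x = \<xi> (of_nat m \<odot>\<^bsub>\<Lambda>\<^esub> x)" using x by (simp add: of_linearD(2)[OF \<xi>] int_elems_closed)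
  also have "\<dots> = (\<Sum>i<length es. (of_nat m * c i) * \<xi> (es ! i))"
    unfolding m(3) using m(2) esM by (intro of_linear_comb[OF \<xi>]) auto
  also have "\<dots> = of_nat m * (\<Sum>i<length es. c i * \<xi> (es ! i))" by (simp add: sum_distrib_left mult_ac)
  finally show ?thesis using m(1) by simp
qed

abbreviation indep :: "'m list \<Rightarrow> bool" where
  "indep es \<equiv> findep (map emb es)"

lemma indep_iff:
  "indep es \<longleftrightarrow> (\<forall>c. (\<forall>j. (\<Sum>i<length es. c i * emb (es ! i) j) = 0) \<longrightarrow> (\<forall>i<length es. c i = 0))"
proof -
  have "(\<Sum>i<length es. c i * (map emb es ! i) j) = (\<Sum>i<length es. c i * emb (es ! i) j)" for c j
    by (intro sum.cong) auto
  then show ?thesis by (simp add: findep_def)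
qed

lemma indepD: "indep es \<Longrightarrow> (\<And>j. (\<Sum>i<length es. c i * emb (es ! i) j) = 0) \<Longrightarrow> i < length es \<Longrightarrow> c i = 0"
  unfolding indep_iff by blast

text \<open>An F-relation between coordinate vectors becomes a relation in \<Lambda> after clearing
  denominators and then maps to the fibre; conversely the extended coordinate functionals turn a
  relation in the generic fibre into one between coordinate vectors.\<close>

lemma lin_indep_over_field_iff:
  assumes es: "set es \<subseteq> carrier \<Lambda>"
  shows "lin_indep_over_field \<Lambda> es \<longleftrightarrow> indep es"
proof -
  interpret gf: base_change_field \<Lambda> UNIV "id :: 'f \<Rightarrow> 'f" by unfold_locales auto
  have S: "gf.S = number_ring" by (simp add: gf.S_def number_ring_def)
  have B: "generic_fibre \<Lambda> = gf.B" by (simp add: generic_fibre_def gf.B_def S)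
  have esM: "es ! i \<in> carrier \<Lambda>" if "i < length es" for i using es that by auto
  have tau: "to_generic_fibre \<Lambda> x = gf.cls (frag_of (x, 1))" for x
    by (simp add: to_generic_fibre_def gf.pure_tensor_cls[symmetric] S)
  have sum: "(\<Oplus>\<^bsub>gf.B\<^esub>i\<in>{..<length es}. c i \<odot>\<^bsub>gf.B\<^esub> map (to_generic_fibre \<Lambda>) es ! i) = gf.rho es c" for c
  proof -
    have "(\<Oplus>\<^bsub>gf.B\<^esub>i\<in>{..<length es}. c i \<odot>\<^bsub>gf.B\<^esub> map (to_generic_fibre \<Lambda>) es ! i) =
        (\<Oplus>\<^bsub>gf.B\<^esub>i\<in>{..<length es}. gf.cls (frag_of (es ! i, c i)))"
    proof -
      interpret B: abelian_group gf.B by (rule gf.abelian_group_B)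
      show ?thesis
        by (rule B.finsum_cong') (auto simp: tau gf.smult_B gf.scl_simps gf.carrier_B gf.T_closed esM)
    qed
    also have "\<dots> = gf.rho es c" unfolding gf.rho_def by (rule gf.finsum_B) (auto simp: gf.T_closed esM)
    finally show ?thesis .
  qed
  have iff: "lin_indep_over_field \<Lambda> es \<longleftrightarrow> (\<forall>c. gf.rho es c = gf.cls 0 \<longrightarrow> (\<forall>i<length es. c i = 0))"
    by (simp add: lin_indep_over_field_def lin_indep_def B sum gf.zero_B[symmetric]) (simp add: number_ring_def)
  show ?thesis
  proof
    assume l: "lin_indep_over_field \<Lambda> es"
    show "indep es"
      unfolding indep_iff
    proof (intro allI impI)
      fix c i assume c: "\<forall>j. (\<Sum>i<length es. c i * emb (es ! i) j) = 0" and i: "i < length es"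
      obtain m :: nat where m: "m > 0" "\<forall>i<length es. of_nat m * c i \<in> int_elems"
        "of_nat m \<odot>\<^bsub>\<Lambda>\<^esub> \<zero>\<^bsub>\<Lambda>\<^esub> = (\<Oplus>\<^bsub>\<Lambda>\<^esub>i\<in>{..<length es}. (of_nat m * c i) \<odot>\<^bsub>\<Lambda>\<^esub> es ! i)"
        using relation_multiple[OF es zero_closed, of c] c by (auto simp: emb_zero)
      have "gf.cls 0 = gf.cls (frag_of (of_nat m \<odot>\<^bsub>\<Lambda>\<^esub> \<zero>\<^bsub>\<Lambda>\<^esub>, 1))"
        using gf.cls_zero(2)[of 1] smult_r_null[of "of_nat m"] by (simp add: carrier_ring_of_integers int_elems_closed)
      also have "\<dots> = gf.cls (\<Sum>i<length es. frag_of ((of_nat m * c i) \<odot>\<^bsub>\<Lambda>\<^esub> es ! i, 1))"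
        unfolding m(3) using m(2) esM by (intro gf.cls_finsum) auto
      also have "\<dots> = gf.rho es (\<lambda>i. of_nat m * c i)"
        unfolding gf.rho_def
      proof (rule gf.cls_sum_cong)
        fix i assume "i \<in> {..<length es}"
        then show "gf.cls (frag_of ((of_nat m * c i) \<odot>\<^bsub>\<Lambda>\<^esub> es ! i, 1)) = gf.cls (frag_of (es ! i, of_nat m * c i))"
          using gf.cls_rel(3)[of "of_nat m * c i" "es ! i" 1] m(2) esM by simp
      qed
      finally have "of_nat m * c i = 0" using l i unfolding iff by metis
      then show "c i = 0" using m(1) by simp
    qed
  next
    assume ind: "indep es"
    show "lin_indep_over_field \<Lambda> es"
      unfolding iff
    proof (intro allI impI)
      fix c i assume c: "gf.rho es c = gf.cls 0" and i: "i < length es"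
      have "(\<Sum>i<length es. c i * emb (es ! i) j) = 0" for j
      proof -
        have "gf.ext (\<lambda>x. emb x j) (gf.rho es c) = 0"
          unfolding c gf.ext_cls[OF emb_linear] by (simp add: gf.efun_simps)
        then show ?thesis by (simp add: gf.ext_rho[OF emb_linear] mult.commute)
      qed
      from indepD[OF ind this i] show "c i = 0" .
    qed
  qed
qed

text \<open>Makes the set of lengths in \<open>lattice_rank\<close> finite, so that its
  \<open>Max\<close> is attained. The bound is the number of coordinates, beyond which
  \<open>emb\<close> vanishes.\<close>

lemma indep_bound:
  "\<exists>b. \<forall>es. set es \<subseteq> carrier \<Lambda> \<longrightarrow> indep es \<longrightarrow> length es \<le> b"
proof (rule emb_system)
  fix k \<gamma> assume sys: "coordinate_system \<Lambda> k emb \<gamma>"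
  let ?us = "map (\<lambda>i j. if j = i then 1 else 0 :: 'f) [0..<k]"
  have "length es \<le> k" if es: "set es \<subseteq> carrier \<Lambda>" "indep es" for es
  proof -
    have "length (map emb es) \<le> length ?us"
    proof (rule findep_length_le[OF es(2)])
      fix j assume j: "j < length (map emb es)"
      have "es ! j \<in> carrier \<Lambda>" using es(1) j by auto
      then have z: "emb (es ! j) l = 0" if "l \<ge> k" for l using sys es(1) j that unfolding coordinate_system_def by auto
      have ex: "emb (es ! j) l = (\<Sum>i<k. emb (es ! j) i * (?us ! i) l)" for l
      proof -
        have "(\<Sum>i<k. emb (es ! j) i * (?us ! i) l) = (\<Sum>i<k. if i = l then emb (es ! j) i else 0)"
          by (intro sum.cong) auto
        then show ?thesis using z by (cases "l < k") auto
      qed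
      show "\<exists>c. \<forall>l. (map emb es ! j) l = (\<Sum>i<length ?us. c i * (?us ! i) l)"
      proof (intro exI allI)
        fix l show "(map emb es ! j) l = (\<Sum>i<length ?us. emb (es ! j) i * (?us ! i) l)"
          using j ex[of l] by simp
      qed
    qed
    then show ?thesis by simp
  qed
  then show ?thesis by blast
qed

abbreviation rank :: "'m set \<Rightarrow> nat" where
  "rank \<equiv> lattice_rank \<Lambda>"

lemma rank_props:
  assumes N: "N \<subseteq> carrier \<Lambda>"
  shows "\<exists>es. set es \<subseteq> N \<and> length es = rank N \<and> indep es"
    and "set es \<subseteq> N \<Longrightarrow> indep es \<Longrightarrow> length es \<le> rank N"
proof -
  let ?R = "{length es | es. set es \<subseteq> N \<and> lin_indep_over_field \<Lambda> es}"
  obtain b where b: "\<And>es. set es \<subseteq> carrier \<Lambda> \<Longrightarrow> indep es \<Longrightarrow> length es \<le> b" using indep_bound by blast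
  have R: "?R = {length es | es. set es \<subseteq> N \<and> indep es}"
    using lin_indep_over_field_iff N by (metis (no_types, lifting) order_trans)
  have fin: "finite ?R" unfolding R by (rule finite_subset[of _ "{..b}"]) (use b N in auto)
  have "length ([] :: 'm list) \<in> ?R" unfolding R by (intro CollectI exI[of _ "[]"]) (simp add: findep_def)
  then have "?R \<noteq> {}" by (metis (no_types, lifting) empty_iff)
  with fin have "Max ?R \<in> ?R" by (rule Max_in)
  then show "\<exists>es. set es \<subseteq> N \<and> length es = rank N \<and> indep es"
    unfolding lattice_rank_def R by auto
  show "length es \<le> rank N" if "set es \<subseteq> N" "indep es"
    unfolding lattice_rank_def using fin that unfolding R by (intro Max_ge) auto
qed

lemma indep_spans:
  assumes N: "N \<subseteq> carrier \<Lambda>" and es: "set es \<subseteq> N" "length es = rank N" "indep es" and x: "x \<in> N"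
  shows "\<exists>c. \<forall>j. emb x j = (\<Sum>i<length es. c i * emb (es ! i) j)"
proof -
  have "\<not> indep (es @ [x])"
  proof
    assume "indep (es @ [x])"
    from rank_props(2)[OF N _ this] es x show False by auto
  qed
  then obtain c where "\<forall>j. emb x j = (\<Sum>i<length (map emb es). c i * (map emb es ! i) j)"
    using not_findep_snoc[OF es(3), of "emb x"] by auto
  then show ?thesis by (intro exI[of _ c]) simp
qed

text \<open>A basis of \<Lambda> \<otimes> F consisting of vectors of \<Lambda>; its span over the
  ring of integers may be smaller than \<Lambda>.\<close>

definition frame :: "'m list \<Rightarrow> bool" where
  "frame fs \<longleftrightarrow> set fs \<subseteq> carrier \<Lambda> \<and> length fs = rank (carrier \<Lambda>) \<and> indep fs"

lemma frameD: "frame fs \<Longrightarrow> set fs \<subseteq> carrier \<Lambda>" "frame fs \<Longrightarrow> length fs = rank (carrier \<Lambda>)" "frame fs \<Longrightarrow> indep fs"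
  "frame fs \<Longrightarrow> i < length fs \<Longrightarrow> fs ! i \<in> carrier \<Lambda>"
  by (auto simp: frame_def)

text \<open>Coordinates in F, possibly with denominators. They are set to 0 beyond the frame, which
  makes them unique as functions on the naturals.\<close>

definition crd :: "'m list \<Rightarrow> 'm \<Rightarrow> nat \<Rightarrow> 'f" where
  "crd fs x = (SOME c. (\<forall>i\<ge>length fs. c i = 0) \<and> (\<forall>j. emb x j = (\<Sum>i<length fs. c i * emb (fs ! i) j)))"

lemma crd:
  assumes "frame fs" "x \<in> carrier \<Lambda>"
  shows "i \<ge> length fs \<Longrightarrow> crd fs x i = 0" "emb x j = (\<Sum>i<length fs. crd fs x i * emb (fs ! i) j)"
proof -
  obtain c where c: "\<forall>j. emb x j = (\<Sum>i<length fs. c i * emb (fs ! i) j)"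
    using indep_spans[of "carrier \<Lambda>" fs x] assms by (auto simp: frame_def)
  have "\<exists>c. (\<forall>i\<ge>length fs. c i = 0) \<and> (\<forall>j. emb x j = (\<Sum>i<length fs. c i * emb (fs ! i) j))"
    by (rule exI[of _ "\<lambda>i. if i < length fs then c i else 0"]) (simp add: c)
  from someI_ex[OF this, folded crd_def]
  have *: "(\<forall>i\<ge>length fs. crd fs x i = 0) \<and> (\<forall>j. emb x j = (\<Sum>i<length fs. crd fs x i * emb (fs ! i) j))" .
  show "i \<ge> length fs \<Longrightarrow> crd fs x i = 0" "emb x j = (\<Sum>i<length fs. crd fs x i * emb (fs ! i) j)"
    using * by blast+
qed

lemma crd_unique:
  assumes "frame fs" "x \<in> carrier \<Lambda>" "\<And>j. emb x j = (\<Sum>i<length fs. c i * emb (fs ! i) j)" "i < length fs"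
  shows "crd fs x i = c i"
proof -
  have "crd fs x i - c i = 0"
  proof (rule indepD[OF frameD(3)[OF assms(1)] _ assms(4)])
    fix j show "(\<Sum>i<length fs. (crd fs x i - c i) * emb (fs ! i) j) = 0"
      using crd(2)[OF assms(1,2), of j] assms(3)[of j] by (simp add: left_diff_distrib sum_subtractf)
  qed
  then show ?thesis by simp
qed

lemma crd_basis: "frame fs \<Longrightarrow> k < length fs \<Longrightarrow> i < length fs \<Longrightarrow> crd fs (fs ! k) i = (if i = k then 1 else 0)"
proof (rule crd_unique)
  assume "k < length fs"
  then have "(\<Sum>i<length fs. if i = k then emb (fs ! i) j else 0) = emb (fs ! k) j" for j by simp
  moreover have "(\<Sum>i<length fs. (if i = k then 1 else 0) * emb (fs ! i) j) = (\<Sum>i<length fs. if i = k then emb (fs ! i) j else 0)" for j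
    by (intro sum.cong) auto
  ultimately show "emb (fs ! k) j = (\<Sum>i<length fs. (if i = k then 1 else 0) * emb (fs ! i) j)" for j by simp
qed (auto simp: frameD)

lemma crd_linear: "frame fs \<Longrightarrow> of_linear \<Lambda> (\<lambda>x. crd fs x i)"
proof -
  assume fs: "frame fs"
  have "crd fs (x \<oplus>\<^bsub>\<Lambda>\<^esub> y) i = crd fs x i + crd fs y i" if xy: "x \<in> carrier \<Lambda>" "y \<in> carrier \<Lambda>" for x y
  proof (cases "i < length fs")
    case True
    show ?thesis
    proof (rule crd_unique[OF fs _ _ True])
      show "emb (x \<oplus>\<^bsub>\<Lambda>\<^esub> y) j = (\<Sum>i<length fs. (crd fs x i + crd fs y i) * emb (fs ! i) j)" for j
        using crd(2)[OF fs xy(1), of j] crd(2)[OF fs xy(2), of j] by (simp add: emb_add xy distrib_right sum.distrib)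
    qed (use xy in auto)
  qed (use crd(1)[OF fs] xy in auto)
  moreover have "crd fs (r \<odot>\<^bsub>\<Lambda>\<^esub> x) i = r * crd fs x i" if rx: "r \<in> int_elems" "x \<in> carrier \<Lambda>" for r x
  proof (cases "i < length fs")
    case True
    show ?thesis
    proof (rule crd_unique[OF fs _ _ True])
      show "emb (r \<odot>\<^bsub>\<Lambda>\<^esub> x) j = (\<Sum>i<length fs. (r * crd fs x i) * emb (fs ! i) j)" for j
        using crd(2)[OF fs rx(2), of j] by (simp add: emb_smult rx sum_distrib_left mult.assoc)
    qed (use rx in auto)
  qed (use crd(1)[OF fs] rx in auto)
  ultimately show ?thesis by (simp add: of_linear_def)
qed

lemma crd_inj: "frame fs \<Longrightarrow> x \<in> carrier \<Lambda> \<Longrightarrow> y \<in> carrier \<Lambda> \<Longrightarrow> crd fs x = crd fs y \<Longrightarrow> x = y"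
proof (rule emb_inj)
  assume *: "frame fs" "x \<in> carrier \<Lambda>" "y \<in> carrier \<Lambda>" "crd fs x = crd fs y"
  show "emb x = emb y"
  proof
    fix j show "emb x j = emb y j"
      by (simp only: crd(2)[OF *(1,2), of j] crd(2)[OF *(1,3), of j] *(4))
  qed
qed

lemma functional_crd:
  assumes "frame fs" "x \<in> carrier \<Lambda>" "of_linear \<Lambda> \<xi>"
  shows "\<xi> x = (\<Sum>i<length fs. crd fs x i * \<xi> (fs ! i))"
  by (rule functional_relation[OF frameD(1)[OF assms(1)] assms(2) crd(2)[OF assms(1,2)] assms(3)])

lemma frame_exists: "\<exists>fs. frame fs"
  using rank_props(1)[of "carrier \<Lambda>"] by (auto simp: frame_def)

end

section \<open>The fibres at the infinite places\<close>

context hermitian_lattice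
begin

definition gram :: "'f place \<Rightarrow> 'm list \<Rightarrow> nat \<Rightarrow> nat \<Rightarrow> complex" where
  "gram v fs i j = h v (to_place_fibre \<Lambda> v (fs ! i)) (to_place_fibre \<Lambda> v (fs ! j))"

definition gram_mat :: "'f place \<Rightarrow> 'm list \<Rightarrow> complex mat" where
  "gram_mat v fs = Matrix.mat (length fs) (length fs) (\<lambda>(i, j). gram v fs i j)"

text \<open>The squared dual length of \<xi> at v, that is one term of \<open>dual_norm_sq\<close>
  without its weight.\<close>

definition dnorm :: "'f place \<Rightarrow> ('m \<Rightarrow> 'f) \<Rightarrow> real" where
  "dnorm v \<xi> = Re (h v (riesz_vector \<Lambda> h v \<xi>) (riesz_vector \<Lambda> h v \<xi>))"

end

locale lattice_place = hermitian_lattice \<Lambda> h for \<Lambda> :: "('f::number_field, 'm) module" and h +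
  fixes v :: "'f place"
  assumes v: "v \<in> infinite_places"
begin

abbreviation "Kv \<equiv> carrier (completion_ring v)"
abbreviation "sv \<equiv> place_embedding v"

lemma Kv: "Kv = \<real> \<or> Kv = UNIV" by (simp add: completion_ring_def)

lemma sv_Kv: "sv x \<in> Kv" by (auto simp: completion_ring_def real_place_def)

lemmas svD = embeddingD[OF place_embedding(1)[OF v]]

sublocale bc: base_change_field \<Lambda> Kv sv
proof
  show "sv x \<in> Kv" for x by (rule sv_Kv)
  consider "Kv = \<real>" | "Kv = UNIV" using Kv by blast
  then have "0 \<in> Kv \<and> 1 \<in> Kv \<and> (\<forall>x\<in>Kv. - x \<in> Kv \<and> inverse x \<in> Kv \<and> (\<forall>y\<in>Kv. x + y \<in> Kv \<and> x * y \<in> Kv))"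
    by cases simp_all
  then show "0 \<in> Kv" "1 \<in> Kv" "\<And>x. x \<in> Kv \<Longrightarrow> - x \<in> Kv" "\<And>x. x \<in> Kv \<Longrightarrow> inverse x \<in> Kv"
    "\<And>x y. x \<in> Kv \<Longrightarrow> y \<in> Kv \<Longrightarrow> x + y \<in> Kv" "\<And>x y. x \<in> Kv \<Longrightarrow> y \<in> Kv \<Longrightarrow> x * y \<in> Kv" by blast+
qed (rule svD)+

lemma S: "bc.S = completion_ring v" unfolding bc.S_def by (simp add: completion_ring_def)

lemma B: "place_fibre \<Lambda> v = bc.B" by (simp add: place_fibre_def bc.B_def S)

lemma tau: "to_place_fibre \<Lambda> v x = bc.cls (frag_of (x, 1))"
  by (simp add: to_place_fibre_def bc.pure_tensor_cls[symmetric] S)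

lemma extend_functional_ext: "extend_functional v \<xi> u = bc.ext \<xi> u"
  by (simp add: extend_functional_def bc.ext_def bc.efun_def Let_def)

lemma h_props:
  shows h_Kv: "x \<in> carrier bc.B \<Longrightarrow> y \<in> carrier bc.B \<Longrightarrow> h v x y \<in> Kv"
    and h_add: "x \<in> carrier bc.B \<Longrightarrow> y \<in> carrier bc.B \<Longrightarrow> z \<in> carrier bc.B \<Longrightarrow> h v (x \<oplus>\<^bsub>bc.B\<^esub> y) z = h v x z + h v y z"
    and h_smult: "a \<in> Kv \<Longrightarrow> x \<in> carrier bc.B \<Longrightarrow> y \<in> carrier bc.B \<Longrightarrow> h v (a \<odot>\<^bsub>bc.B\<^esub> x) y = a * h v x y"
    and h_cnj: "x \<in> carrier bc.B \<Longrightarrow> y \<in> carrier bc.B \<Longrightarrow> h v y x = cnj (h v x y)"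
    and h_pos: "x \<in> carrier bc.B \<Longrightarrow> x \<noteq> \<zero>\<^bsub>bc.B\<^esub> \<Longrightarrow> Re (h v x x) > 0"
proof -
  have ip: "inner_product_on (completion_ring v) bc.B (h v)"
    using lattice v unfolding is_lattice_def B[symmetric] by blast
  note ip' = ip[unfolded inner_product_on_def]
  show "x \<in> carrier bc.B \<Longrightarrow> y \<in> carrier bc.B \<Longrightarrow> h v x y \<in> Kv"
    using ip'[THEN conjunct1] by blast
  show "x \<in> carrier bc.B \<Longrightarrow> y \<in> carrier bc.B \<Longrightarrow> z \<in> carrier bc.B \<Longrightarrow> h v (x \<oplus>\<^bsub>bc.B\<^esub> y) z = h v x z + h v y z"
    using ip'[THEN conjunct2, THEN conjunct1] by blast
  show "a \<in> Kv \<Longrightarrow> x \<in> carrier bc.B \<Longrightarrow> y \<in> carrier bc.B \<Longrightarrow> h v (a \<odot>\<^bsub>bc.B\<^esub> x) y = a * h v x y"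
    using ip'[THEN conjunct2, THEN conjunct2, THEN conjunct1] by blast
  show "x \<in> carrier bc.B \<Longrightarrow> y \<in> carrier bc.B \<Longrightarrow> h v y x = cnj (h v x y)"
    using ip'[THEN conjunct2, THEN conjunct2, THEN conjunct2, THEN conjunct1] by blast
  show "x \<in> carrier bc.B \<Longrightarrow> x \<noteq> \<zero>\<^bsub>bc.B\<^esub> \<Longrightarrow> Re (h v x x) > 0"
    using ip'[THEN conjunct2, THEN conjunct2, THEN conjunct2, THEN conjunct2] by blast
qed

lemma cls_mem: "x \<in> carrier \<Lambda> \<Longrightarrow> a \<in> Kv \<Longrightarrow> bc.cls (frag_of (x, a)) \<in> carrier bc.B"
  by (auto simp: bc.carrier_B bc.T_closed)

lemma cls_smult: "a \<in> Kv \<Longrightarrow> bc.cls (frag_of (x, a)) = a \<odot>\<^bsub>bc.B\<^esub> bc.cls (frag_of (x, 1))"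
  by (simp add: bc.smult_B bc.scl_simps)

lemma additive_rho:
  fixes g :: "('m, complex) tensor \<Rightarrow> complex"
  assumes g: "\<And>x y. x \<in> carrier bc.B \<Longrightarrow> y \<in> carrier bc.B \<Longrightarrow> g (x \<oplus>\<^bsub>bc.B\<^esub> y) = g x + g y"
    and fs: "set fs \<subseteq> carrier \<Lambda>" and a: "\<And>i. i < length fs \<Longrightarrow> a i \<in> Kv"
  shows "g (bc.rho fs a) = (\<Sum>i<length fs. g (bc.cls (frag_of (fs ! i, a i))))"
proof -
  have T: "frag_of (fs ! i, a i) \<in> bc.T" if "i < length fs" for i
    using fs a[OF that] that by (intro bc.T_closed) auto
  have "g (bc.cls (\<Sum>i\<in>A. frag_of (fs ! i, a i))) = (\<Sum>i\<in>A. g (bc.cls (frag_of (fs ! i, a i))))"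
    if "finite A" "A \<subseteq> {..<length fs}" for A
    using that
  proof (induction A rule: finite_induct)
    case empty
    have "bc.cls 0 \<in> carrier bc.B" by (simp add: bc.carrier_B bc.T_closed)
    moreover have "bc.cls 0 \<oplus>\<^bsub>bc.B\<^esub> bc.cls 0 = bc.cls 0" by (simp add: bc.add_B bc.T_closed)
    ultimately show ?case using g[of "bc.cls 0" "bc.cls 0"] by simp
  next
    case (insert i A)
    then have i: "frag_of (fs ! i, a i) \<in> bc.T" and A: "(\<Sum>i\<in>A. frag_of (fs ! i, a i)) \<in> bc.T"
      using T by (auto intro: bc.T_sum)
    then have "g (bc.cls (frag_of (fs ! i, a i) + (\<Sum>i\<in>A. frag_of (fs ! i, a i)))) =
        g (bc.cls (frag_of (fs ! i, a i))) + g (bc.cls (\<Sum>i\<in>A. frag_of (fs ! i, a i)))"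
      using g[of "bc.cls (frag_of (fs ! i, a i))" "bc.cls (\<Sum>i\<in>A. frag_of (fs ! i, a i))"]
      by (simp add: bc.add_B bc.carrier_B)
    then show ?case using insert by simp
  qed
  from this[of "{..<length fs}"] show ?thesis by (simp add: bc.rho_def)
qed

lemma h_rho:
  assumes fs: "set fs \<subseteq> carrier \<Lambda>" and a: "\<And>i. i < length fs \<Longrightarrow> a i \<in> Kv" and b: "\<And>i. i < length fs \<Longrightarrow> b i \<in> Kv"
  shows "h v (bc.rho fs a) (bc.rho fs b) = (\<Sum>i<length fs. \<Sum>j<length fs. a i * cnj (b j) * gram v fs i j)"
proof -
  have fsM: "fs ! i \<in> carrier \<Lambda>" if "i < length fs" for i using fs that by auto
  have one: "1 \<in> Kv" by (rule bc.K(2))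
  have rb: "bc.rho fs b \<in> carrier bc.B" using fs b by (rule bc.rho_carrier)
  have "h v (bc.rho fs a) (bc.rho fs b) = (\<Sum>i<length fs. h v (bc.cls (frag_of (fs ! i, a i))) (bc.rho fs b))"
    by (rule additive_rho[of "\<lambda>x. h v x (bc.rho fs b)"]) (use h_add rb fs a in auto)
  also have "\<dots> = (\<Sum>i<length fs. a i * h v (bc.cls (frag_of (fs ! i, 1))) (bc.rho fs b))"
    by (intro sum.cong refl) (simp add: cls_smult[OF a] h_smult[OF a] cls_mem fsM one rb)
  also have "\<dots> = (\<Sum>i<length fs. a i * (\<Sum>j<length fs. cnj (b j) * gram v fs i j))"
  proof (intro sum.cong refl arg_cong[of _ _ "(*) _"])
    fix i assume i: "i \<in> {..<length fs}"
    let ?x = "bc.cls (frag_of (fs ! i, 1))"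
    have x: "?x \<in> carrier bc.B" using i by (intro cls_mem fsM one) auto
    have "h v ?x (bc.rho fs b) = cnj (h v (bc.rho fs b) ?x)" by (rule h_cnj[OF rb x])
    also have "h v (bc.rho fs b) ?x = (\<Sum>j<length fs. h v (bc.cls (frag_of (fs ! j, b j))) ?x)"
      by (rule additive_rho[of "\<lambda>y. h v y ?x"]) (use h_add x fs b in auto)
    also have "\<dots> = (\<Sum>j<length fs. b j * h v (bc.cls (frag_of (fs ! j, 1))) ?x)"
      by (intro sum.cong refl) (simp add: cls_smult[OF b] h_smult[OF b] cls_mem fsM one x)
    also have "cnj \<dots> = (\<Sum>j<length fs. cnj (b j) * cnj (h v (bc.cls (frag_of (fs ! j, 1))) ?x))" by simp
    also have "\<dots> = (\<Sum>j<length fs. cnj (b j) * gram v fs i j)"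
      by (intro sum.cong refl) (simp add: gram_def tau h_cnj[symmetric] cls_mem fsM one x)
    finally show "h v ?x (bc.rho fs b) = (\<Sum>j<length fs. cnj (b j) * gram v fs i j)" .
  qed
  finally show ?thesis by (simp add: sum_distrib_left mult.assoc)
qed

text \<open>Positivity of the metric applies once the combination \<open>rho fs a\<close> is known
  to be nonzero; the extended k-th coordinate functional takes the value a k on it.\<close>

lemma posdef_gram:
  assumes fs: "frame fs"
  shows "posdef_form (length fs) Kv (gram v fs)"
proof
  note fsM = frameD(4)[OF fs]
  show "Kv = \<real> \<or> Kv = UNIV" by (rule Kv)
  show "gram v fs i j \<in> Kv" if "i < length fs" "j < length fs" for i j
    unfolding gram_def tau by (intro h_Kv cls_mem fsM bc.K that)
  show "gram v fs j i = cnj (gram v fs i j)" if "i < length fs" "j < length fs" for i j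
    unfolding gram_def tau by (intro h_cnj cls_mem fsM bc.K that)
  fix a assume a: "\<And>i. i < length fs \<Longrightarrow> a i \<in> Kv" "\<exists>i<length fs. a i \<noteq> (0::complex)"
  then obtain k where k: "k < length fs" "a k \<noteq> 0" by blast
  have "bc.rho fs a \<noteq> \<zero>\<^bsub>bc.B\<^esub>"
  proof
    assume z: "bc.rho fs a = \<zero>\<^bsub>bc.B\<^esub>"
    have "bc.ext (\<lambda>x. crd fs x k) (bc.rho fs a) = (\<Sum>i<length fs. sv (crd fs (fs ! i) k) * a i)"
      by (rule bc.ext_rho[OF crd_linear[OF fs]])
    also have "\<dots> = (\<Sum>i<length fs. if i = k then a i else 0)"
      by (intro sum.cong refl) (use k svD in \<open>auto simp: crd_basis[OF fs]\<close>)
    also have "\<dots> = a k" using k(1) by simp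
    finally have "bc.ext (\<lambda>x. crd fs x k) (bc.cls 0) = a k" unfolding z bc.zero_B .
    then show False using k(2) unfolding bc.ext_cls[OF crd_linear[OF fs]] by (simp add: bc.efun_simps)
  qed
  then show "Re (\<Sum>i<length fs. \<Sum>j<length fs. a i * cnj (a j) * gram v fs i j) > 0"
    using h_pos[OF bc.rho_carrier[OF frameD(1)[OF fs] a(1)]] by (simp add: h_rho[OF frameD(1)[OF fs] a(1) a(1)])
qed

text \<open>With \<open>h_rho\<close> this identifies the fibre at v with coordinate space carrying
  the Gram form: a frame still spans after base change.\<close>

lemma fibre_rho:
  assumes fs: "frame fs" and u: "u \<in> carrier bc.B"
  shows "u = bc.rho fs (\<lambda>i. bc.ext (\<lambda>x. crd fs x i) u)" "bc.ext (\<lambda>x. crd fs x i) u \<in> Kv"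
proof -
  show "u = bc.rho fs (\<lambda>i. bc.ext (\<lambda>x. crd fs x i) u)"
  proof (rule bc.rho_coordinates[OF frameD(1)[OF fs] crd_linear[OF fs] _ u])
    fix x assume x: "x \<in> carrier \<Lambda>"
    show "\<exists>m::nat. m > 0 \<and> (\<forall>i<length fs. of_nat m * crd fs x i \<in> int_elems) \<and>
        of_nat m \<odot>\<^bsub>\<Lambda>\<^esub> x = (\<Oplus>\<^bsub>\<Lambda>\<^esub>i\<in>{..<length fs}. (of_nat m * crd fs x i) \<odot>\<^bsub>\<Lambda>\<^esub> fs ! i)"
      by (rule relation_multiple[OF frameD(1)[OF fs] x crd(2)[OF fs x]])
  qed
  obtain t where t: "t \<in> bc.T" "u = bc.cls t" using u by (auto simp: bc.carrier_B)
  then show "bc.ext (\<lambda>x. crd fs x i) u \<in> Kv" by (simp add: bc.ext_cls[OF crd_linear[OF fs]] bc.efun_K)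
qed

lemma tau_rho:
  assumes fs: "frame fs" and x: "x \<in> carrier \<Lambda>"
  shows "to_place_fibre \<Lambda> v x = bc.rho fs (\<lambda>i. sv (crd fs x i))"
  using fibre_rho(1)[OF fs cls_mem[OF x bc.K(2)]]
  by (simp add: tau bc.ext_cls[OF crd_linear[OF fs]] bc.efun_simps)

text \<open>\<open>riesz_vector\<close> is a definite description, so uniqueness is proved along
  with existence; both are those of the Riesz vector in frame coordinates.\<close>

lemma riesz_vector_rho:
  assumes fs: "frame fs" and \<xi>: "of_linear \<Lambda> \<xi>"
  shows "riesz_vector \<Lambda> h v \<xi> =
    bc.rho fs (posdef_form.riesz (length fs) Kv (gram v fs) (\<lambda>i. sv (\<xi> (fs ! i))))"
proof -
  interpret pd: posdef_form "length fs" Kv "gram v fs" by (rule posdef_gram[OF fs])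
  note fsM = frameD(1)[OF fs]
  let ?l = "\<lambda>i. sv (\<xi> (fs ! i))"
  have kl: "pd.kvec ?l" by (simp add: pd.kvec_def sv_Kv)
  have kr: "pd.riesz ?l i \<in> Kv" if "i < length fs" for i using pd.kvec_riesz[OF kl] that by (simp add: pd.kvec_def)
  have ext: "bc.ext \<xi> (bc.rho fs a) = pd.frm a (pd.riesz ?l)" for a
    by (simp add: bc.ext_rho[OF \<xi>] pd.frm_riesz)
  have hfrm: "h v (bc.rho fs a) (bc.rho fs b) = pd.frm a b" if "pd.kvec a" "pd.kvec b" for a b
    using h_rho[OF fsM, of a b] that by (simp add: pd.kvec_def pd.frm_def)
  show ?thesis
    unfolding riesz_vector_def B
  proof (rule the_equality)
    show "bc.rho fs (pd.riesz ?l) \<in> carrier bc.B \<and>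
        (\<forall>x\<in>carrier bc.B. extend_functional v \<xi> x = h v x (bc.rho fs (pd.riesz ?l)))"
    proof (intro conjI ballI bc.rho_carrier fsM kr)
      fix x assume "x \<in> carrier bc.B"
      from fibre_rho[OF fs this] obtain a where a: "x = bc.rho fs a" "pd.kvec a"
        by (auto simp: pd.kvec_def)
      show "extend_functional v \<xi> x = h v x (bc.rho fs (pd.riesz ?l))"
        unfolding extend_functional_ext a(1) ext using hfrm[OF a(2) pd.kvec_riesz[OF kl]] by simp
    qed
  next
    fix w assume w: "w \<in> carrier bc.B \<and> (\<forall>x\<in>carrier bc.B. extend_functional v \<xi> x = h v x w)"
    then obtain b where b: "w = bc.rho fs b" "pd.kvec b"
      using fibre_rho[OF fs, of w] by (auto simp: pd.kvec_def)
    have "pd.frm a b = pd.frm a (pd.riesz ?l)" if a: "pd.kvec a" for a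
    proof -
      have "bc.rho fs a \<in> carrier bc.B" using a fsM by (intro bc.rho_carrier) (auto simp: pd.kvec_def)
      then have "bc.ext \<xi> (bc.rho fs a) = h v (bc.rho fs a) (bc.rho fs b)"
        using w unfolding extend_functional_ext b(1) by blast
      then show ?thesis using ext hfrm[OF a b(2)] by simp
    qed
    then show "w = bc.rho fs (pd.riesz ?l)"
      unfolding b(1) using pd.riesz_unique[OF b(2) pd.kvec_riesz[OF kl]] by (intro bc.rho_cong) blast
  qed
qed

lemma dnorm_frm:
  assumes fs: "frame fs" and \<xi>: "of_linear \<Lambda> \<xi>"
  defines "l \<equiv> \<lambda>i. sv (\<xi> (fs ! i))"
  shows "h v (riesz_vector \<Lambda> h v \<xi>) (riesz_vector \<Lambda> h v \<xi>) =
      posdef_form.frm (length fs) (gram v fs) (posdef_form.riesz (length fs) Kv (gram v fs) l)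
        (posdef_form.riesz (length fs) Kv (gram v fs) l)"
proof -
  interpret pd: posdef_form "length fs" Kv "gram v fs" by (rule posdef_gram[OF fs])
  have "pd.kvec l" by (simp add: pd.kvec_def sv_Kv l_def)
  then have kr: "pd.riesz l i \<in> Kv" if "i < length fs" for i using pd.kvec_riesz[of l] that by (simp add: pd.kvec_def)
  show ?thesis
    unfolding riesz_vector_rho[OF fs \<xi>] l_def[symmetric]
    using h_rho[OF frameD(1)[OF fs] kr kr] by (simp add: pd.frm_def)
qed

lemma dnorm_pos:
  assumes \<xi>: "of_linear \<Lambda> \<xi>" and x: "x \<in> carrier \<Lambda>" "\<xi> x \<noteq> 0"
  shows "dnorm v \<xi> > 0"
proof -
  obtain fs where fs: "frame fs" using frame_exists by blast
  interpret pd: posdef_form "length fs" Kv "gram v fs" by (rule posdef_gram[OF fs])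
  let ?l = "\<lambda>i. sv (\<xi> (fs ! i))"
  have kl: "pd.kvec ?l" by (simp add: pd.kvec_def sv_Kv)
  have "\<exists>i<length fs. \<xi> (fs ! i) \<noteq> 0"
  proof (rule ccontr)
    assume "\<not> (\<exists>i<length fs. \<xi> (fs ! i) \<noteq> 0)"
    then show False using functional_crd[OF fs x(1) \<xi>] x(2) by simp
  qed
  then obtain i where i: "i < length fs" "\<xi> (fs ! i) \<noteq> 0" by blast
  have "\<exists>i<length fs. pd.riesz ?l i \<noteq> 0"
  proof (rule ccontr)
    assume "\<not> (\<exists>i<length fs. pd.riesz ?l i \<noteq> 0)"
    then have "pd.frm (pd.unitv i) (pd.riesz ?l) = pd.frm (pd.unitv i) (\<lambda>i. 0)" by (intro pd.frm_cong) auto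
    then have "(\<Sum>k<length fs. ?l k * pd.unitv i k) = 0" by (simp add: pd.frm_riesz pd.frm_right)
    also have "(\<Sum>k<length fs. ?l k * pd.unitv i k) = (\<Sum>k<length fs. if k = i then ?l k else 0)"
      by (intro sum.cong refl) (auto simp: pd.unitv_def)
    finally show False using i svD(10) by simp
  qed
  then show ?thesis
    unfolding dnorm_def dnorm_frm[OF fs \<xi>] by (rule pd.frm_pos[OF pd.kvec_riesz[OF kl]])
qed

lemma det_gram_mat_pos: "frame fs \<Longrightarrow> Re (Determinant.det (gram_mat v fs)) > 0"
  using det_gram_pos[OF posdef_gram, of fs] by (auto simp: gram_mat_def)

lemma det_gram_dual:
  assumes fs: "frame fs" and \<xi>: "of_linear \<Lambda> \<xi>" and i: "i < length fs"
    and z: "\<And>j. j < length fs \<Longrightarrow> j \<noteq> i \<Longrightarrow> \<xi> (fs ! j) = 0"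
  shows "Re (Determinant.det (gram_mat v fs)) * dnorm v \<xi> =
    (cmod (sv (\<xi> (fs ! i))))\<^sup>2 * Re (Determinant.det (mat_delete (gram_mat v fs) i i))"
proof -
  interpret pd: posdef_form "length fs" Kv "gram v fs" by (rule posdef_gram[OF fs])
  let ?l = "\<lambda>i. sv (\<xi> (fs ! i))"
  obtain r where r: "Determinant.det (gram_mat v fs) = of_real r"
    using det_gram_pos[OF posdef_gram[OF fs]] by (auto simp: gram_mat_def)
  have "of_real (r * Re (pd.frm (pd.riesz ?l) (pd.riesz ?l))) =
      of_real ((cmod (?l i))\<^sup>2) * Determinant.det (mat_delete (gram_mat v fs) i i)"
    using pd.det_gram_minor[OF i, of ?l] z svD(4) r pd.frm_self_real[of "pd.riesz ?l"]
    by (simp add: gram_mat_def)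
  then have "r * Re (pd.frm (pd.riesz ?l) (pd.riesz ?l)) =
      Re (of_real ((cmod (?l i))\<^sup>2) * Determinant.det (mat_delete (gram_mat v fs) i i))"
    by (metis Re_complex_of_real)
  then show ?thesis unfolding dnorm_def dnorm_frm[OF fs \<xi>] r by simp
qed

lemma tau_smult: "r \<in> int_elems \<Longrightarrow> x \<in> carrier \<Lambda> \<Longrightarrow>
    to_place_fibre \<Lambda> v (r \<odot>\<^bsub>\<Lambda>\<^esub> x) = sv r \<odot>\<^bsub>bc.B\<^esub> to_place_fibre \<Lambda> v x"
  using bc.cls_rel(3)[of r x 1] cls_smult[OF sv_Kv] bc.K(2) by (simp add: tau)

lemma h_tau_smult:
  assumes "r \<in> int_elems" "x \<in> carrier \<Lambda>"
  shows "Re (h v (to_place_fibre \<Lambda> v (r \<odot>\<^bsub>\<Lambda>\<^esub> x)) (to_place_fibre \<Lambda> v (r \<odot>\<^bsub>\<Lambda>\<^esub> x))) =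
    (cmod (sv r))\<^sup>2 * Re (h v (to_place_fibre \<Lambda> v x) (to_place_fibre \<Lambda> v x))"
proof -
  let ?t = "to_place_fibre \<Lambda> v x"
  have t: "?t \<in> carrier bc.B" using assms(2) bc.K(2) by (simp add: tau cls_mem)
  have rt: "sv r \<odot>\<^bsub>bc.B\<^esub> ?t \<in> carrier bc.B"
    unfolding tau using cls_mem[OF assms(2) sv_Kv, of r] cls_smult[OF sv_Kv] by simp
  have "h v (sv r \<odot>\<^bsub>bc.B\<^esub> ?t) (sv r \<odot>\<^bsub>bc.B\<^esub> ?t) = sv r * cnj (h v (sv r \<odot>\<^bsub>bc.B\<^esub> ?t) ?t)"
    using h_smult[OF sv_Kv t rt] h_cnj[OF rt t] by simp
  also have "\<dots> = (sv r * cnj (sv r)) * cnj (h v ?t ?t)" using h_smult[OF sv_Kv t t] by simp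
  also have "\<dots> = of_real ((cmod (sv r))\<^sup>2) * h v ?t ?t"
    using complex_norm_square[of "sv r"] h_cnj[OF t t] by simp
  finally show ?thesis by (simp add: tau_smult[OF assms])
qed

lemma h_tau_pos:
  assumes x: "x \<in> carrier \<Lambda>" "x \<noteq> \<zero>\<^bsub>\<Lambda>\<^esub>"
  shows "Re (h v (to_place_fibre \<Lambda> v x) (to_place_fibre \<Lambda> v x)) > 0"
proof (rule h_pos)
  show "to_place_fibre \<Lambda> v x \<in> carrier bc.B" using x(1) bc.K(2) by (simp add: tau cls_mem)
  obtain j where j: "emb x j \<noteq> 0"
    using emb_inj[OF x(1) zero_closed] x(2) by (auto simp: emb_zero fun_eq_iff)
  show "to_place_fibre \<Lambda> v x \<noteq> \<zero>\<^bsub>bc.B\<^esub>"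
  proof
    assume "to_place_fibre \<Lambda> v x = \<zero>\<^bsub>bc.B\<^esub>"
    then have "bc.ext (\<lambda>x. emb x j) (bc.cls (frag_of (x, 1))) = bc.ext (\<lambda>x. emb x j) (bc.cls 0)"
      by (simp add: tau bc.zero_B)
    then have "sv (emb x j) = 0" unfolding bc.ext_cls[OF emb_linear] by (simp add: bc.efun_simps)
    then show False using j svD(10) by simp
  qed
qed

end

section \<open>The degree\<close>

context hermitian_lattice
begin

lemma lattice_place: "v \<in> infinite_places \<Longrightarrow> lattice_place \<Lambda> h v"
  by (intro lattice_place.intro hermitian_lattice_axioms lattice_place_axioms.intro)

definition espan :: "'m list \<Rightarrow> (nat \<Rightarrow> 'f) set" where
  "espan es = {(\<lambda>j. \<Sum>i<length es. c i * emb (es ! i) j) | c. \<forall>i. c i \<in> int_elems}"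

text \<open>The span of the family without its k-th member, written over the full list so that the
  remaining positions keep their numbers.\<close>

definition espan_del :: "'m list \<Rightarrow> nat \<Rightarrow> (nat \<Rightarrow> 'f) set" where
  "espan_del es k = {(\<lambda>j. \<Sum>i<length es. c i * emb (es ! i) j) | c. (\<forall>i. c i \<in> int_elems) \<and> c k = 0}"

lemma espanI: "\<forall>i. c i \<in> int_elems \<Longrightarrow> (\<lambda>j. \<Sum>i<length es. c i * emb (es ! i) j) \<in> espan es"
  unfolding espan_def by blast

lemma emb_lin_span:
  assumes es: "set es \<subseteq> carrier \<Lambda>"
  shows "emb ` lin_span ring_of_integers \<Lambda> es = espan es" "lin_span ring_of_integers \<Lambda> es \<subseteq> carrier \<Lambda>"
proof -
  have esM: "es ! i \<in> carrier \<Lambda>" if "i < length es" for i using es that by auto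
  have comb: "emb (\<Oplus>\<^bsub>\<Lambda>\<^esub>i\<in>{..<length es}. c i \<odot>\<^bsub>\<Lambda>\<^esub> es ! i) = (\<lambda>j. \<Sum>i<length es. c i * emb (es ! i) j)"
    if "\<forall>i<length es. c i \<in> int_elems" for c
  proof
    fix j show "emb (\<Oplus>\<^bsub>\<Lambda>\<^esub>i\<in>{..<length es}. c i \<odot>\<^bsub>\<Lambda>\<^esub> es ! i) j = (\<Sum>i<length es. c i * emb (es ! i) j)"
      by (rule emb_comb) (use that esM in auto)
  qed
  show "emb ` lin_span ring_of_integers \<Lambda> es = espan es"
  proof (intro equalityI subsetI)
    fix y assume "y \<in> emb ` lin_span ring_of_integers \<Lambda> es"
    then obtain c where c: "c \<in> {..<length es} \<rightarrow> int_elems"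
      "y = emb (\<Oplus>\<^bsub>\<Lambda>\<^esub>i\<in>{..<length es}. c i \<odot>\<^bsub>\<Lambda>\<^esub> es ! i)"
      unfolding lin_span_def carrier_ring_of_integers by blast
    let ?c = "\<lambda>i. if i < length es then c i else 0"
    have "y = (\<lambda>j. \<Sum>i<length es. ?c i * emb (es ! i) j)"
      unfolding c(2) by (subst comb) (use c(1) in \<open>auto intro!: sum.cong\<close>)
    moreover have "\<forall>i. ?c i \<in> int_elems" using c(1) by (auto simp: int_elems_closed(1))
    ultimately show "y \<in> espan es" using espanI[of ?c es] by simp
  next
    fix y assume "y \<in> espan es"
    then obtain c where c: "y = (\<lambda>j. \<Sum>i<length es. c i * emb (es ! i) j)" "\<forall>i. c i \<in> int_elems"
      unfolding espan_def by blast
    then have "y = emb (\<Oplus>\<^bsub>\<Lambda>\<^esub>i\<in>{..<length es}. c i \<odot>\<^bsub>\<Lambda>\<^esub> es ! i)" using comb by simp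
    then show "y \<in> emb ` lin_span ring_of_integers \<Lambda> es"
      using c(2) unfolding lin_span_def carrier_ring_of_integers by blast
  qed
  show "lin_span ring_of_integers \<Lambda> es \<subseteq> carrier \<Lambda>"
  proof
    fix x assume "x \<in> lin_span ring_of_integers \<Lambda> es"
    then obtain c where c: "c \<in> {..<length es} \<rightarrow> int_elems"
      "x = (\<Oplus>\<^bsub>\<Lambda>\<^esub>i\<in>{..<length es}. c i \<odot>\<^bsub>\<Lambda>\<^esub> es ! i)"
      unfolding lin_span_def carrier_ring_of_integers by blast
    show "x \<in> carrier \<Lambda>" unfolding c(2) by (rule comb_mem) (use c(1) esM in auto)
  qed
qed

text \<open>The injection \<open>emb\<close> carries cosets in the record based group to cosets in a
  function space, where \<open>idx\<close> and its multiplicativity are available.\<close>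

lemma card_rcosets:
  assumes N: "N \<subseteq> carrier \<Lambda>" and es: "set es \<subseteq> N"
  shows "card (rcosets\<^bsub>add_monoid (\<Lambda>\<lparr>carrier := N\<rparr>)\<^esub> (lin_span ring_of_integers \<Lambda> es)) = idx (emb ` N) (espan es)"
proof -
  let ?H = "lin_span ring_of_integers \<Lambda> es"
  have H: "?H \<subseteq> carrier \<Lambda>" "emb ` ?H = espan es" using emb_lin_span[of es] es N by auto
  have rc: "rcosets\<^bsub>add_monoid (\<Lambda>\<lparr>carrier := N\<rparr>)\<^esub> ?H = (\<lambda>a. (\<lambda>h. h \<oplus>\<^bsub>\<Lambda>\<^esub> a) ` ?H) ` N"
    by (auto simp: RCOSETS_def r_coset_def)
  have sub: "(\<lambda>a. (\<lambda>h. h \<oplus>\<^bsub>\<Lambda>\<^esub> a) ` ?H) ` N \<subseteq> Pow (carrier \<Lambda>)" using N H(1) by auto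
  have "card (rcosets\<^bsub>add_monoid (\<Lambda>\<lparr>carrier := N\<rparr>)\<^esub> ?H) = card ((`) emb ` (\<lambda>a. (\<lambda>h. h \<oplus>\<^bsub>\<Lambda>\<^esub> a) ` ?H) ` N)"
    unfolding rc by (rule card_image[symmetric]) (rule inj_on_subset[OF inj_on_image_Pow[OF inj_on_emb] sub])
  also have "(`) emb ` (\<lambda>a. (\<lambda>h. h \<oplus>\<^bsub>\<Lambda>\<^esub> a) ` ?H) ` N = (\<lambda>x. (+) x ` espan es) ` emb ` N"
    unfolding image_image
  proof (rule image_cong[OF refl])
    fix a assume a: "a \<in> N"
    have "(\<lambda>x. emb (x \<oplus>\<^bsub>\<Lambda>\<^esub> a)) ` ?H = (\<lambda>x. emb a + emb x) ` ?H"
    proof (rule image_cong[OF refl])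
      fix x assume "x \<in> ?H"
      then show "emb (x \<oplus>\<^bsub>\<Lambda>\<^esub> a) = emb a + emb x" using emb_add[of x a] H(1) N a by (auto simp: add.commute)
    qed
    then show "(\<lambda>x. emb (x \<oplus>\<^bsub>\<Lambda>\<^esub> a)) ` ?H = (+) (emb a) ` espan es" by (simp add: H(2)[symmetric] image_image)
  qed
  finally show ?thesis by (simp add: idx_def)
qed

lemma degree_wrt_eq:
  assumes "N \<subseteq> carrier \<Lambda>" "set es \<subseteq> N"
  shows "degree_wrt \<Lambda> h N es = ln (real (idx (emb ` N) (espan es))) -
    1 / 2 * (\<Sum>v\<in>infinite_places. local_degree v * ln (Re (Determinant.det (gram_mat v es))))"
  unfolding degree_wrt_def Let_def card_rcosets[OF assms] gram_mat_def gram_def by simp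

lemma add_subgroup_emb: "add_subgroup (emb ` carrier \<Lambda>)"
  unfolding add_subgroup_def
proof (intro conjI ballI)
  show "0 \<in> emb ` carrier \<Lambda>" using emb_zero zero_closed by force
  fix x y assume "x \<in> emb ` carrier \<Lambda>" "y \<in> emb ` carrier \<Lambda>"
  then obtain a b where ab: "a \<in> carrier \<Lambda>" "b \<in> carrier \<Lambda>" "x = emb a" "y = emb b" by blast
  then have "x - y = emb (a \<oplus>\<^bsub>\<Lambda>\<^esub> (\<ominus>\<^bsub>\<Lambda>\<^esub> b))" by (simp add: emb_add emb_uminus)
  then show "x - y \<in> emb ` carrier \<Lambda>" using ab by simp
qed

lemma add_subgroup_espan: "add_subgroup (espan es)"
  unfolding add_subgroup_def
proof (intro conjI ballI)
  show "0 \<in> espan es" unfolding espan_def by (intro CollectI exI[of _ "\<lambda>i. 0"]) (auto simp: int_elems_closed(1))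
  fix x y assume "x \<in> espan es" "y \<in> espan es"
  then obtain c d where cd: "x = (\<lambda>j. \<Sum>i<length es. c i * emb (es ! i) j)" "\<forall>i. c i \<in> int_elems"
    "y = (\<lambda>j. \<Sum>i<length es. d i * emb (es ! i) j)" "\<forall>i. d i \<in> int_elems" unfolding espan_def by blast
  have "x - y = (\<lambda>j. \<Sum>i<length es. (c i - d i) * emb (es ! i) j)"
    by (simp add: cd(1,3) fun_eq_iff left_diff_distrib sum_subtractf)
  moreover have "\<forall>i. c i - d i \<in> int_elems" using cd(2,4) int_elems_closed(7) by blast
  ultimately show "x - y \<in> espan es" using espanI[of "\<lambda>i. c i - d i" es] by simp
qed

lemma espan_subset: "set es \<subseteq> carrier \<Lambda> \<Longrightarrow> espan es \<subseteq> emb ` carrier \<Lambda>"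
  using emb_lin_span[of es] by blast

text \<open>Over the integers \<Lambda> is generated by the products of an integral basis with the
  \<gamma>. If m is a common denominator of the coordinates of the \<gamma>, then m times each of
  these generators lies in the span of the frame.\<close>

lemma index_frame_pos:
  assumes fs: "frame fs"
  shows "idx (emb ` carrier \<Lambda>) (espan fs) > 0"
proof (rule emb_system)
  fix k \<gamma> assume sys: "coordinate_system \<Lambda> k emb \<gamma>"
  let ?b = "int_basis :: 'f list"
  have \<gamma>: "\<gamma> j \<in> carrier \<Lambda>" if "j < k" for j using sys that by (simp add: coordinate_system_def)
  obtain m :: nat where m: "m > 0" "\<forall>p\<in>{..<k} \<times> {..<length fs}. of_nat m * crd fs (\<gamma> (fst p)) (snd p) \<in> int_elems"
    using int_elems_multiples[of "{..<k} \<times> {..<length fs}" "\<lambda>p. crd fs (\<gamma> (fst p)) (snd p)"] by auto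
  define s where "s = (\<lambda>(c::int) (p :: nat \<times> nat) l. of_int c * (?b ! fst p * emb (\<gamma> (snd p)) l))"
  have bO: "?b ! i \<in> int_elems" if "i < length ?b" for i
    using int_combs_base[of "{..<length ?b}" i "(!) ?b"] that int_basis(2) by auto
  show ?thesis
  proof (rule idx_pos(1)[OF add_subgroup_emb add_subgroup_espan m(1), of "{..<length ?b} \<times> {..<k}" s])
    fix y assume "y \<in> emb ` carrier \<Lambda>"
    then obtain x where x: "x \<in> carrier \<Lambda>" "y = emb x" by blast
    have xO: "emb x j \<in> int_elems" for j using sys x(1) by (simp add: coordinate_system_def)
    have "\<exists>c. \<forall>j. emb x j = (\<Sum>i<length ?b. of_int (c j i) * ?b ! i)"
    proof -
      have "\<forall>j. \<exists>c. emb x j = (\<Sum>i<length ?b. of_int (c i) * ?b ! i)"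
        using xO unfolding int_basis(2)[symmetric] int_combs_def by blast
      then show ?thesis by (rule choice)
    qed
    then obtain c where c: "\<And>j. emb x j = (\<Sum>i<length ?b. of_int (c j i) * ?b ! i)" by blast
    have "emb x l = (\<Sum>p\<in>{..<length ?b} \<times> {..<k}. s (c (snd p) (fst p)) p l)" for l
    proof -
      have "x = (\<Oplus>\<^bsub>\<Lambda>\<^esub>j\<in>{..<k}. emb x j \<odot>\<^bsub>\<Lambda>\<^esub> \<gamma> j)" using sys x(1) unfolding coordinate_system_def by blast
      then have "emb x l = emb (\<Oplus>\<^bsub>\<Lambda>\<^esub>j\<in>{..<k}. emb x j \<odot>\<^bsub>\<Lambda>\<^esub> \<gamma> j) l" by (rule arg_cong)
      also have "\<dots> = (\<Sum>j<k. emb x j * emb (\<gamma> j) l)" by (rule emb_comb) (use xO \<gamma> in auto)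
      also have "\<dots> = (\<Sum>j<k. \<Sum>i<length ?b. s (c j i) (i, j) l)"
        unfolding c by (simp add: s_def sum_distrib_right mult.assoc)
      also have "\<dots> = (\<Sum>i<length ?b. \<Sum>j<k. s (c j i) (i, j) l)" by (rule sum.swap)
      finally show ?thesis by (simp add: sum.cartesian_product case_prod_unfold)
    qed
    then have "y = (\<Sum>p\<in>{..<length ?b} \<times> {..<k}. s (c (snd p) (fst p)) p)"
      unfolding x(2) by (intro ext) (simp add: sum_fun_apply)
    then show "\<exists>c. y = (\<Sum>p\<in>{..<length ?b} \<times> {..<k}. s (c p) p)"
      by (intro exI[of _ "\<lambda>p. c (snd p) (fst p)"])
  next
    show "s (a + b) g = s a g + s b g" for a b g by (simp add: s_def fun_eq_iff distrib_right)
  next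
    fix a and p :: "nat \<times> nat" assume p: "p \<in> {..<length ?b} \<times> {..<k}"
    let ?c = "\<lambda>i. if i < length fs then of_int a * (?b ! fst p * (of_nat m * crd fs (\<gamma> (snd p)) i)) else 0"
    have "s (int m * a) p l = (\<Sum>i<length fs. ?c i * emb (fs ! i) l)" for l
    proof -
      have "s (int m * a) p l = of_int a * (?b ! fst p * (of_nat m * emb (\<gamma> (snd p)) l))" by (simp add: s_def mult_ac)
      also have "emb (\<gamma> (snd p)) l = (\<Sum>i<length fs. crd fs (\<gamma> (snd p)) i * emb (fs ! i) l)"
        using p by (intro crd(2)[OF fs] \<gamma>) auto
      finally show ?thesis by (simp add: sum_distrib_left mult.assoc)
    qed
    then have "s (int m * a) p = (\<lambda>l. \<Sum>i<length fs. ?c i * emb (fs ! i) l)" by (rule ext)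
    moreover have "\<forall>i. ?c i \<in> int_elems"
    proof
      fix i
      have "of_int a * (?b ! fst p * (of_nat m * crd fs (\<gamma> (snd p)) i)) \<in> int_elems" if "i < length fs"
      proof -
        have "of_nat m * crd fs (\<gamma> (snd p)) i \<in> int_elems" using m(2)[rule_format, of "(snd p, i)"] p that by auto
        moreover have "?b ! fst p \<in> int_elems" using p by (intro bO) auto
        ultimately show ?thesis by (rule int_elems_closed(6)[OF int_elems_closed(3) int_elems_closed(6), rotated])
      qed
      then show "?c i \<in> int_elems" by (simp add: int_elems_closed(1))
    qed
    ultimately show "s (int m * a) p \<in> espan fs" using espanI[of ?c fs] by simp
  qed simp
qed

text \<open>The three facts say that the image is a fractional ideal. A common denominator of the
  values at the generators \<gamma> serves for all values.\<close>

lemma functional_image: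
  assumes \<xi>: "of_linear \<Lambda> \<xi>"
  shows "add_subgroup (\<xi> ` carrier \<Lambda>)" "r \<in> int_elems \<Longrightarrow> y \<in> \<xi> ` carrier \<Lambda> \<Longrightarrow> r * y \<in> \<xi> ` carrier \<Lambda>"
    "\<exists>m::nat. m > 0 \<and> (\<forall>y\<in>\<xi> ` carrier \<Lambda>. of_nat m * y \<in> int_elems)"
proof -
  show st: "r * y \<in> \<xi> ` carrier \<Lambda>" if r: "r \<in> int_elems" and y: "y \<in> \<xi> ` carrier \<Lambda>" for r y
  proof -
    obtain x where "x \<in> carrier \<Lambda>" "y = \<xi> x" using y by blast
    then show ?thesis using of_linearD(2)[OF \<xi> r] smult_mem[OF r] by (metis imageI)
  qed
  have m1: "(- 1 :: 'f) \<in> int_elems" using int_elems_closed(8)[OF int_elems_closed(2)] .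
  show "add_subgroup (\<xi> ` carrier \<Lambda>)"
    unfolding add_subgroup_def
  proof (intro conjI ballI)
    show "0 \<in> \<xi> ` carrier \<Lambda>" using of_linear_zero[OF \<xi>] zero_closed by force
    fix x y assume "x \<in> \<xi> ` carrier \<Lambda>" "y \<in> \<xi> ` carrier \<Lambda>"
    then obtain a b where ab: "a \<in> carrier \<Lambda>" "b \<in> carrier \<Lambda>" "x = \<xi> a" "- 1 * y = \<xi> b" using st[OF m1, of y] by blast
    then have "x - y = \<xi> (a \<oplus>\<^bsub>\<Lambda>\<^esub> b)" by (simp add: of_linearD(1)[OF \<xi>] flip: ab(4))
    then show "x - y \<in> \<xi> ` carrier \<Lambda>" using ab by simp
  qed
  show "\<exists>m::nat. m > 0 \<and> (\<forall>y\<in>\<xi> ` carrier \<Lambda>. of_nat m * y \<in> int_elems)"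
  proof (rule emb_system)
    fix k \<gamma> assume sys: "coordinate_system \<Lambda> k emb \<gamma>"
    obtain m :: nat where m: "m > 0" "\<forall>j\<in>{..<k}. of_nat m * \<xi> (\<gamma> j) \<in> int_elems"
      using int_elems_multiples[of "{..<k}" "\<lambda>j. \<xi> (\<gamma> j)"] by auto
    have "of_nat m * \<xi> x \<in> int_elems" if x: "x \<in> carrier \<Lambda>" for x
    proof -
      have xO: "emb x j \<in> int_elems" for j using sys x by (simp add: coordinate_system_def)
      have "x = (\<Oplus>\<^bsub>\<Lambda>\<^esub>j\<in>{..<k}. emb x j \<odot>\<^bsub>\<Lambda>\<^esub> \<gamma> j)" using sys x unfolding coordinate_system_def by blast
      then have "\<xi> x = \<xi> (\<Oplus>\<^bsub>\<Lambda>\<^esub>j\<in>{..<k}. emb x j \<odot>\<^bsub>\<Lambda>\<^esub> \<gamma> j)" by (rule arg_cong)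
      also have "\<dots> = (\<Sum>j<k. emb x j * \<xi> (\<gamma> j))"
        by (rule of_linear_comb[OF \<xi>]) (use xO sys in \<open>auto simp: coordinate_system_def\<close>)
      finally have "of_nat m * \<xi> x = (\<Sum>j<k. emb x j * (of_nat m * \<xi> (\<gamma> j)))" by (simp add: sum_distrib_left mult_ac)
      moreover have "emb x j * (of_nat m * \<xi> (\<gamma> j)) \<in> int_elems" if "j \<in> {..<k}" for j
        using int_elems_closed(6)[OF xO m(2)[rule_format, OF that]] .
      ultimately show ?thesis by (metis (no_types, lifting) add_subgroup_sum[OF add_subgroup_int_elems])
    qed
    then show ?thesis using m(1) by blast
  qed
qed

text \<open>A functional vanishing on all but one vector of the frame splits the degree: the index is
  multiplicative along its kernel and image, and the Gram determinant is expanded by \<open>det_gram_dual\<close>.\<close>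

lemma degree_split:
  assumes fs: "frame fs" and i: "i < length fs" and \<xi>: "of_linear \<Lambda> \<xi>"
    and z: "\<And>j. j < length fs \<Longrightarrow> j \<noteq> i \<Longrightarrow> \<xi> (fs ! j) = 0" and nz: "\<xi> (fs ! i) \<noteq> 0"
  shows "degree_wrt \<Lambda> h (carrier \<Lambda>) fs =
      ln (real (idx (emb ` {x \<in> carrier \<Lambda>. \<xi> x = 0}) (espan_del fs i))) -
      1 / 2 * (\<Sum>v\<in>infinite_places. local_degree v * ln (Re (Determinant.det (mat_delete (gram_mat v fs) i i)))) +
      1 / 2 * (\<Sum>v\<in>infinite_places. local_degree v * ln (dnorm v \<xi>)) +
      ln (real (idx (\<xi> ` carrier \<Lambda>) (principal (\<xi> (fs ! i)))) / field_norm (\<xi> (fs ! i)))"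
    and "idx (\<xi> ` carrier \<Lambda>) (principal (\<xi> (fs ! i))) > 0"
proof -
  note fsM = frameD(4)[OF fs]
  let ?a = "\<xi> (fs ! i)" and ?A = "emb ` carrier \<Lambda>"
  \<comment> \<open>\<open>idx_exact\<close> is applied to coordinate vectors, so \<xi> is
    transported along the inverse of \<open>emb\<close>.\<close>
  define f where "f = (\<lambda>y. \<xi> (inv_into (carrier \<Lambda>) emb y))"
  have f: "f (emb x) = \<xi> x" if "x \<in> carrier \<Lambda>" for x using that by (simp add: f_def inv_into_f_f[OF inj_on_emb])
  have fadd: "f (x + y) = f x + f y" if xy: "x \<in> ?A" "y \<in> ?A" for x y
  proof -
    obtain a b where ab: "a \<in> carrier \<Lambda>" "b \<in> carrier \<Lambda>" "x = emb a" "y = emb b" using xy by blast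
    then have "f (x + y) = f (emb (a \<oplus>\<^bsub>\<Lambda>\<^esub> b))" by (simp add: emb_add)
    then show ?thesis using ab by (simp add: f of_linearD(1)[OF \<xi>])
  qed
  have fspan: "f (\<lambda>j. \<Sum>k<length fs. c k * emb (fs ! k) j) = c i * ?a" if c: "\<forall>k. c k \<in> int_elems" for c
  proof -
    have mem: "(\<Oplus>\<^bsub>\<Lambda>\<^esub>k\<in>{..<length fs}. c k \<odot>\<^bsub>\<Lambda>\<^esub> fs ! k) \<in> carrier \<Lambda>" by (rule comb_mem) (use c fsM in auto)
    have "(\<lambda>j. \<Sum>k<length fs. c k * emb (fs ! k) j) = emb (\<Oplus>\<^bsub>\<Lambda>\<^esub>k\<in>{..<length fs}. c k \<odot>\<^bsub>\<Lambda>\<^esub> fs ! k)"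
      by (rule ext, rule emb_comb[symmetric]) (use c fsM in auto)
    then have "f (\<lambda>j. \<Sum>k<length fs. c k * emb (fs ! k) j) = \<xi> (\<Oplus>\<^bsub>\<Lambda>\<^esub>k\<in>{..<length fs}. c k \<odot>\<^bsub>\<Lambda>\<^esub> fs ! k)"
      using f[OF mem] by simp
    also have "\<dots> = (\<Sum>k<length fs. c k * \<xi> (fs ! k))" by (rule of_linear_comb[OF \<xi>]) (use c fsM in auto)
    also have "\<dots> = (\<Sum>k<length fs. if k = i then c k * ?a else 0)" by (intro sum.cong refl) (use z in auto)
    finally show ?thesis using i by simp
  qed
  have fA: "f ` ?A = \<xi> ` carrier \<Lambda>" unfolding image_image by (rule image_cong) (auto simp: f)
  have fB: "f ` espan fs = principal ?a"
  proof (intro equalityI subsetI)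
    fix y assume "y \<in> f ` espan fs"
    then obtain c where "\<forall>k. c k \<in> int_elems" "y = f (\<lambda>j. \<Sum>k<length fs. c k * emb (fs ! k) j)"
      unfolding espan_def by blast
    then show "y \<in> principal ?a" using fspan by (auto simp: principal_def mult.commute)
  next
    fix y assume "y \<in> principal ?a"
    then obtain r where r: "r \<in> int_elems" "y = r * ?a" by (auto simp: principal_def mult.commute)
    let ?c = "\<lambda>k. if k = i then r else 0"
    have c: "\<forall>k. ?c k \<in> int_elems" using r by (simp add: int_elems_closed(1))
    from fspan[OF c] have "y = f (\<lambda>j. \<Sum>k<length fs. ?c k * emb (fs ! k) j)" using r(2) by simp
    moreover have "(\<lambda>j. \<Sum>k<length fs. ?c k * emb (fs ! k) j) \<in> espan fs" by (rule espanI[OF c])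
    ultimately show "y \<in> f ` espan fs" by (rule image_eqI)
  qed
  have kA: "{x \<in> ?A. f x = 0} = emb ` {x \<in> carrier \<Lambda>. \<xi> x = 0}"
  proof (intro equalityI subsetI)
    fix y assume y: "y \<in> {x \<in> ?A. f x = 0}"
    then obtain x where x: "x \<in> carrier \<Lambda>" "y = emb x" by blast
    with y f[OF x(1)] show "y \<in> emb ` {x \<in> carrier \<Lambda>. \<xi> x = 0}" by simp
  qed (use f in auto)
  have kB: "{x \<in> espan fs. f x = 0} = espan_del fs i"
  proof (intro equalityI subsetI)
    fix y assume y: "y \<in> {x \<in> espan fs. f x = 0}"
    then obtain c where c: "\<forall>k. c k \<in> int_elems" "y = (\<lambda>j. \<Sum>k<length fs. c k * emb (fs ! k) j)"
      unfolding espan_def by blast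
    with y fspan[OF c(1)] nz have "c i = 0" by simp
    with c show "y \<in> espan_del fs i" unfolding espan_del_def by blast
  next
    fix y assume "y \<in> espan_del fs i"
    then obtain c where c: "\<forall>k. c k \<in> int_elems" "c i = 0" "y = (\<lambda>j. \<Sum>k<length fs. c k * emb (fs ! k) j)"
      unfolding espan_del_def by blast
    then have "y \<in> espan fs" unfolding espan_def by blast
    moreover have "f y = 0" using fspan[OF c(1)] c(2,3) by simp
    ultimately show "y \<in> {x \<in> espan fs. f x = 0}" by simp
  qed
  let ?k = "idx (emb ` {x \<in> carrier \<Lambda>. \<xi> x = 0}) (espan_del fs i)"
  let ?p = "idx (\<xi> ` carrier \<Lambda>) (principal ?a)"
  have ix: "idx ?A (espan fs) = ?k * ?p"
    unfolding fA[symmetric] fB[symmetric] kA[symmetric] kB[symmetric]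
    by (rule idx_exact[OF add_subgroup_emb add_subgroup_espan espan_subset[OF frameD(1)[OF fs]]]) (rule fadd)
  have kp: "?k > 0" "?p > 0" using index_frame_pos[OF fs] by (auto simp: ix)
  then show "?p > 0" by simp
  have norm: "field_norm ?a > 0" by (rule field_norm_pos[OF nz])
  let ?m = "\<lambda>v. Re (Determinant.det (mat_delete (gram_mat v fs) i i))"
  have "local_degree v * ln (Re (Determinant.det (gram_mat v fs))) =
      2 * (local_degree v * ln (cmod (place_embedding v ?a))) + local_degree v * ln (?m v) - local_degree v * ln (dnorm v \<xi>)"
    if v: "v \<in> infinite_places" for v
  proof -
    interpret lattice_place \<Lambda> h v by (rule lattice_place[OF v])
    let ?g = "Re (Determinant.det (gram_mat v fs))"
    have eq: "?g * dnorm v \<xi> = (cmod (sv ?a))\<^sup>2 * ?m v" by (rule det_gram_dual[OF fs \<xi> i z])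
    have pos: "?g > 0" "dnorm v \<xi> > 0" "cmod (sv ?a) > 0"
      using det_gram_mat_pos[OF fs] dnorm_pos[OF \<xi> fsM[OF i] nz] svD(10)[of ?a] nz by auto
    have "?m v > 0"
    proof -
      have "(cmod (sv ?a))\<^sup>2 * ?m v > 0" unfolding eq[symmetric] using pos by simp
      then show ?thesis using pos(3) by (simp add: zero_less_mult_iff)
    qed
    then have "ln (?g * dnorm v \<xi>) = 2 * ln (cmod (sv ?a)) + ln (?m v)"
      unfolding eq using pos by (simp add: ln_mult ln_realpow)
    then have g: "ln ?g = 2 * ln (cmod (sv ?a)) + ln (?m v) - ln (dnorm v \<xi>)" using pos by (simp add: ln_mult)
    show ?thesis unfolding g by (simp add: algebra_simps)
  qed
  then have "(\<Sum>v\<in>infinite_places. local_degree v * ln (Re (Determinant.det (gram_mat v fs)))) =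
      2 * ln (field_norm ?a) + (\<Sum>v\<in>infinite_places. local_degree v * ln (?m v)) -
      (\<Sum>v\<in>infinite_places. local_degree v * ln (dnorm v \<xi>))"
    by (simp add: ln_field_norm[OF nz] sum.distrib sum_subtractf sum_distrib_left)
  moreover have "ln (real (idx ?A (espan fs))) = ln (real ?k) + ln (real ?p)" unfolding ix using kp by (simp add: ln_mult)
  moreover have "ln (real ?p / field_norm ?a) = ln (real ?p) - ln (field_norm ?a)" using kp norm by (simp add: ln_div)
  ultimately show "degree_wrt \<Lambda> h (carrier \<Lambda>) fs = ln (real ?k) -
      1 / 2 * (\<Sum>v\<in>infinite_places. local_degree v * ln (?m v)) +
      1 / 2 * (\<Sum>v\<in>infinite_places. local_degree v * ln (dnorm v \<xi>)) + ln (real ?p / field_norm ?a)"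
    unfolding degree_wrt_eq[OF subset_refl frameD(1)[OF fs]] by (simp add: algebra_simps)
qed

lemma sum_list_update:
  fixes F :: "'m \<Rightarrow> 'f"
  assumes "i < length fs"
  shows "(\<Sum>k<length fs. c k * F (fs[i := y] ! k)) = (\<Sum>k<length fs. (if k = i then 0 else c k) * F (fs ! k)) + c i * F y"
proof -
  have "(\<Sum>k<length fs. c k * F (fs[i := y] ! k)) =
      (\<Sum>k<length fs. (if k = i then 0 else c k) * F (fs ! k) + (if k = i then c k * F y else 0))"
    by (intro sum.cong refl) auto
  then show ?thesis using assms by (simp add: sum.distrib)
qed

lemma frame_update:
  assumes fs: "frame fs" and y: "y \<in> carrier \<Lambda>" and i: "i < length fs" and nz: "crd fs y i \<noteq> 0"
  shows "frame (fs[i := y])"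
proof -
  have "indep (fs[i := y])"
    unfolding indep_iff
  proof (intro allI impI)
    fix c k assume c: "\<forall>j. (\<Sum>k<length (fs[i := y]). c k * emb (fs[i := y] ! k) j) = 0" and k: "k < length (fs[i := y])"
    let ?d = "\<lambda>k. (if k = i then 0 else c k) + c i * crd fs y k"
    have d: "(\<Sum>k<length fs. ?d k * emb (fs ! k) j) = 0" for j
    proof -
      have "(\<Sum>k<length fs. ?d k * emb (fs ! k) j) =
          (\<Sum>k<length fs. (if k = i then 0 else c k) * emb (fs ! k) j) + c i * (\<Sum>k<length fs. crd fs y k * emb (fs ! k) j)"
        by (simp add: distrib_right sum.distrib sum_distrib_left mult.assoc)
      also have "\<dots> = (\<Sum>k<length fs. c k * emb (fs[i := y] ! k) j)"
        unfolding crd(2)[OF fs y, symmetric] using sum_list_update[OF i, of c "\<lambda>x. emb x j" y] by simp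
      finally show ?thesis using c by simp
    qed
    have dk: "?d k = 0" if "k < length fs" for k by (rule indepD[OF frameD(3)[OF fs] d that])
    have "c i = 0" using dk[OF i] nz by simp
    then show "c k = 0" using dk[of k] k by (simp split: if_splits)
  qed
  then show ?thesis using fs y by (auto simp: frame_def dest!: set_update_subset_insert[THEN subsetD])
qed

text \<open>Split both degrees along the i-th coordinate functional \<xi>. The kernel index and the
  minors involve only the unchanged vectors, and the index of the ideal generated by a in the image
  of \<xi>, divided by the norm of a, is the same \<kappa> for the old and the new a.\<close>

lemma degree_update:
  assumes fs: "frame fs" and y: "y \<in> carrier \<Lambda>" and i: "i < length fs" and nz: "crd fs y i \<noteq> 0"
  shows "degree_wrt \<Lambda> h (carrier \<Lambda>) (fs[i := y]) = degree_wrt \<Lambda> h (carrier \<Lambda>) fs"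
proof -
  let ?gs = "fs[i := y]" and ?\<xi> = "\<lambda>x. crd fs x i"
  note \<xi> = crd_linear[OF fs, of i]
  have gs: "frame ?gs" by (rule frame_update[OF assms])
  have len: "length ?gs = length fs" by simp
  have fi: "?\<xi> (fs ! i) \<noteq> 0" "?\<xi> (?gs ! i) \<noteq> 0" using i nz by (simp_all add: crd_basis[OF fs])
  have zf: "?\<xi> (fs ! j) = 0" if "j < length fs" "j \<noteq> i" for j using that i by (simp add: crd_basis[OF fs])
  have zg: "?\<xi> (?gs ! j) = 0" if "j < length ?gs" "j \<noteq> i" for j using that i by (simp add: crd_basis[OF fs])
  obtain m :: nat where m: "m > 0" "\<And>x. x \<in> ?\<xi> ` carrier \<Lambda> \<Longrightarrow> of_nat m * x \<in> int_elems"
    using functional_image(3)[OF \<xi>] by blast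
  obtain \<kappa> where \<kappa>: "\<kappa> > 0" "\<And>a. a \<in> ?\<xi> ` carrier \<Lambda> \<Longrightarrow> a \<noteq> 0 \<Longrightarrow>
      real (idx (?\<xi> ` carrier \<Lambda>) (principal a)) = \<kappa> * field_norm a"
    using idx_fractional_ideal[OF functional_image(1)[OF \<xi>] functional_image(2)[OF \<xi>] m] by blast
  have k: "real (idx (?\<xi> ` carrier \<Lambda>) (principal (?\<xi> x))) / field_norm (?\<xi> x) = \<kappa>" if "x \<in> carrier \<Lambda>" "?\<xi> x \<noteq> 0" for x
    using \<kappa>(2)[of "?\<xi> x"] that field_norm_pos[OF that(2)] by (simp add: field_simps)
  have del: "espan_del ?gs i = espan_del fs i"
  proof -
    have eq: "(\<lambda>j. \<Sum>k<length fs. c k * emb (?gs ! k) j) = (\<lambda>j. \<Sum>k<length fs. c k * emb (fs ! k) j)" if "c i = 0" for c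
    proof (rule ext, rule sum.cong[OF refl])
      fix j k show "c k * emb (?gs ! k) j = c k * emb (fs ! k) j" using that by (cases "k = i") simp_all
    qed
    show ?thesis
      unfolding espan_del_def len
    proof (rule Collect_cong, rule iff_exI)
      fix u c
      show "(u = (\<lambda>j. \<Sum>k<length fs. c k * emb (?gs ! k) j) \<and> (\<forall>i. c i \<in> int_elems) \<and> c i = 0) =
          (u = (\<lambda>j. \<Sum>k<length fs. c k * emb (fs ! k) j) \<and> (\<forall>i. c i \<in> int_elems) \<and> c i = 0)"
        by (cases "c i = 0") (simp_all only: eq simp_thms)
    qed
  qed
  have mat: "mat_delete (gram_mat v ?gs) i i = mat_delete (gram_mat v fs) i i" for v
    by (rule eq_matI) (auto simp: mat_delete_def gram_mat_def gram_def nth_list_update)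
  have split: "degree_wrt \<Lambda> h (carrier \<Lambda>) es =
      ln (real (idx (emb ` {x \<in> carrier \<Lambda>. ?\<xi> x = 0}) (espan_del es i))) -
      1 / 2 * (\<Sum>v\<in>infinite_places. local_degree v * ln (Re (Determinant.det (mat_delete (gram_mat v es) i i)))) +
      1 / 2 * (\<Sum>v\<in>infinite_places. local_degree v * ln (dnorm v ?\<xi>)) +
      ln (real (idx (?\<xi> ` carrier \<Lambda>) (principal (?\<xi> (es ! i)))) / field_norm (?\<xi> (es ! i)))"
    if "frame es" "i < length es" "\<forall>j<length es. j \<noteq> i \<longrightarrow> ?\<xi> (es ! j) = 0" "?\<xi> (es ! i) \<noteq> 0" for es
    by (rule degree_split(1)[OF that(1,2) \<xi> _ that(4)]) (use that(3) in auto)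
  have i': "i < length ?gs" using i by simp
  have kf: "real (idx (?\<xi> ` carrier \<Lambda>) (principal (?\<xi> (fs ! i)))) / field_norm (?\<xi> (fs ! i)) = \<kappa>"
    by (rule k[OF frameD(4)[OF fs i] fi(1)])
  have kg: "real (idx (?\<xi> ` carrier \<Lambda>) (principal (?\<xi> (?gs ! i)))) / field_norm (?\<xi> (?gs ! i)) = \<kappa>"
    by (rule k[OF frameD(4)[OF gs i'] fi(2)])
  have "degree_wrt \<Lambda> h (carrier \<Lambda>) fs =
      ln (real (idx (emb ` {x \<in> carrier \<Lambda>. ?\<xi> x = 0}) (espan_del fs i))) -
      1 / 2 * (\<Sum>v\<in>infinite_places. local_degree v * ln (Re (Determinant.det (mat_delete (gram_mat v fs) i i)))) +
      1 / 2 * (\<Sum>v\<in>infinite_places. local_degree v * ln (dnorm v ?\<xi>)) + ln \<kappa>"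
    using split[OF fs i _ fi(1)] zf unfolding kf by blast
  moreover have "degree_wrt \<Lambda> h (carrier \<Lambda>) ?gs =
      ln (real (idx (emb ` {x \<in> carrier \<Lambda>. ?\<xi> x = 0}) (espan_del fs i))) -
      1 / 2 * (\<Sum>v\<in>infinite_places. local_degree v * ln (Re (Determinant.det (mat_delete (gram_mat v fs) i i)))) +
      1 / 2 * (\<Sum>v\<in>infinite_places. local_degree v * ln (dnorm v ?\<xi>)) + ln \<kappa>"
    using split[OF gs i' _ fi(2)] zg unfolding kg del mat by blast
  ultimately show ?thesis by simp
qed

text \<open>The vectors of a frame are replaced one by one by those of another one. When the coefficient in
  position \<open>j\<close> vanishes, some later vector \<open>fs ! i\<close> is first changed to \<open>fs ! i \<oplus> fs ! j\<close>.\<close>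

lemma degree_frame_independent:
  assumes fs: "frame fs" and gs: "frame gs"
  shows "degree_wrt \<Lambda> h (carrier \<Lambda>) fs = degree_wrt \<Lambda> h (carrier \<Lambda>) gs"
proof -
  let ?deg = "degree_wrt \<Lambda> h (carrier \<Lambda>)"
  have "j \<le> length gs \<Longrightarrow> \<exists>es. frame es \<and> ?deg es = ?deg fs \<and> (\<forall>i<j. es ! i = gs ! i)" for j
  proof (induction j)
    case 0
    then show ?case using fs by auto
  next
    case (Suc j)
    then obtain es where es: "frame es" "?deg es = ?deg fs" "\<forall>i<j. es ! i = gs ! i" by auto
    have len: "length es = length gs" using es(1) gs by (simp add: frame_def)
    let ?y = "gs ! j"
    have j: "j < length gs" "j < length es" using Suc.prems len by auto
    have y: "?y \<in> carrier \<Lambda>" by (rule frameD(4)[OF gs j(1)])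
    have replace: ?case if es': "frame es'" "?deg es' = ?deg fs" "\<forall>i<j. es' ! i = gs ! i" "crd es' ?y j \<noteq> 0" for es'
    proof -
      have j': "j < length es'" using es'(1) es(1) j(2) by (simp add: frame_def)
      have "frame (es'[j := ?y])" "?deg (es'[j := ?y]) = ?deg fs"
        using frame_update[OF es'(1) y j' es'(4)] degree_update[OF es'(1) y j' es'(4)] es'(2) by auto
      moreover have "\<forall>i<Suc j. es'[j := ?y] ! i = gs ! i" using es'(3) j' by (auto simp: less_Suc_eq)
      ultimately show ?thesis by blast
    qed
    show ?case
    proof (cases "crd es ?y j = 0")
      case False
      then show ?thesis using es by (intro replace) auto
    next
      case True
      \<comment> \<open>If all coefficients from j on vanished, \<open>gs ! j\<close> would be a
        combination of the vectors before it, which are already those of gs.\<close>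
      have "\<exists>i<length es. j \<le> i \<and> crd es ?y i \<noteq> 0"
      proof (rule ccontr)
        assume none: "\<not> (\<exists>i<length es. j \<le> i \<and> crd es ?y i \<noteq> 0)"
        let ?c = "\<lambda>k. (if k < j then crd es ?y k else 0) - (if k = j then 1 else 0)"
        have "(\<Sum>k<length gs. ?c k * emb (gs ! k) l) = 0" for l
        proof -
          have "(\<Sum>k<length gs. (if k < j then crd es ?y k else 0) * emb (gs ! k) l) =
              (\<Sum>k<length es. crd es ?y k * emb (es ! k) l)"
            unfolding len by (intro sum.cong refl) (use none es(3) len in auto)
          also have "\<dots> = emb ?y l" by (rule crd(2)[OF es(1) y, symmetric])
          finally have "(\<Sum>k<length gs. (if k < j then crd es ?y k else 0) * emb (gs ! k) l) = emb ?y l" .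
          moreover have "(\<Sum>k<length gs. (if k = j then 1 else 0) * emb (gs ! k) l) = (\<Sum>k<length gs. if k = j then emb (gs ! k) l else 0)"
            by (intro sum.cong) auto
          ultimately show ?thesis using j(1) by (simp add: left_diff_distrib sum_subtractf)
        qed
        from indepD[OF frameD(3)[OF gs] this j(1)] show False by simp
      qed
      then obtain i where i: "i < length es" "j < i" "crd es ?y i \<noteq> 0" using True by (metis le_neq_implies_less)
      let ?w = "es ! i \<oplus>\<^bsub>\<Lambda>\<^esub> es ! j"
      let ?es = "es[i := ?w]"
      have w: "?w \<in> carrier \<Lambda>" using frameD(4)[OF es(1)] i(1) j(2) by simp
      have "crd es ?w i = crd es (es ! i) i + crd es (es ! j) i"
        using frameD(4)[OF es(1)] i(1) j(2) by (intro of_linearD(1)[OF crd_linear[OF es(1)]])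
      then have nz: "crd es ?w i \<noteq> 0" using i j by (simp add: crd_basis[OF es(1)])
      have es': "frame ?es" "?deg ?es = ?deg fs"
        using frame_update[OF es(1) w i(1) nz] degree_update[OF es(1) w i(1) nz] es(2) by auto
      \<comment> \<open>Coordinates of \<open>?y\<close> after the change: the coefficient at i
        stays, and since \<open>es ! i\<close> is the new vector minus \<open>es ! j\<close>, the
        coefficient at j turns from 0 into minus the one at i, which is nonzero.\<close>
      let ?b = "\<lambda>k. if k = j then - crd es ?y i else crd es ?y k"
      have "crd ?es ?y j = ?b j"
      proof (rule crd_unique[where c = ?b and i = j, OF es'(1) y])
        fix l
        have "(\<Sum>k<length es. ?b k * emb (?es ! k) l) =
            (\<Sum>k<length es. (if k = i then 0 else ?b k) * emb (es ! k) l) + ?b i * emb ?w l"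
          by (rule sum_list_update[OF i(1), of ?b "\<lambda>x. emb x l" ?w])
        also have "emb ?w l = emb (es ! i) l + emb (es ! j) l"
          using frameD(4)[OF es(1)] i(1) j(2) by (simp add: emb_add)
        also have "?b i * (emb (es ! i) l + emb (es ! j) l) =
            (\<Sum>k<length es. if k = i then ?b i * emb (es ! k) l else 0) + (\<Sum>k<length es. if k = j then ?b i * emb (es ! k) l else 0)"
          using i(1) j(2) by (simp add: distrib_left)
        also have "(\<Sum>k<length es. (if k = i then 0 else ?b k) * emb (es ! k) l) + \<dots> =
            (\<Sum>k<length es. crd es ?y k * emb (es ! k) l)"
          unfolding sum.distrib[symmetric] by (intro sum.cong refl) (use i True in auto)
        also have "\<dots> = emb ?y l" by (rule crd(2)[OF es(1) y, symmetric])
        finally show "emb ?y l = (\<Sum>k<length ?es. ?b k * emb (?es ! k) l)" by simp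
      qed (use j in simp)
      then show ?thesis using es es' i by (intro replace[of ?es]) auto
    qed
  qed
  from this[of "length gs"] obtain es where es: "frame es" "?deg es = ?deg fs" "\<forall>i<length gs. es ! i = gs ! i" by auto
  have "es = gs" using es gs by (intro nth_equalityI) (auto simp: frame_def)
  then show ?thesis using es(2) by simp
qed

lemma lattice_degree_some:
  assumes N: "N \<subseteq> carrier \<Lambda>"
  shows "\<exists>es. set es \<subseteq> N \<and> length es = rank N \<and> indep es \<and> lattice_degree \<Lambda> h N = degree_wrt \<Lambda> h N es"
proof -
  let ?P = "\<lambda>es. set es \<subseteq> N \<and> length es = rank N \<and> lin_indep_over_field \<Lambda> es"
  obtain es where es: "set es \<subseteq> N" "length es = rank N" "indep es" using rank_props(1)[OF N] by blast
  then have "?P es" using lin_indep_over_field_iff[of es] N by auto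
  then have P: "?P (SOME es. ?P es)" by (rule someI)
  then have "indep (SOME es. ?P es)" using lin_indep_over_field_iff N by blast
  with P show ?thesis unfolding lattice_degree_def by blast
qed

lemma lattice_degree_frame: "frame fs \<Longrightarrow> lattice_degree \<Lambda> h (carrier \<Lambda>) = degree_wrt \<Lambda> h (carrier \<Lambda>) fs"
  using lattice_degree_some[OF subset_refl] degree_frame_independent by (metis frame_def)

end

section \<open>Minimal vectors\<close>

context hermitian_lattice
begin

lemma norm_sq_eq:
  "norm_sq h (to_lattice_space \<Lambda> x) =
    (\<Sum>v\<in>infinite_places. local_degree v * Re (h v (to_place_fibre \<Lambda> v x) (to_place_fibre \<Lambda> v x)))"
  unfolding norm_sq_def to_lattice_space_def by (intro sum.cong) auto

lemma indep_single:
  assumes "x \<in> carrier \<Lambda>" "x \<noteq> \<zero>\<^bsub>\<Lambda>\<^esub>"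
  shows "indep [x]"
proof -
  obtain j where "emb x j \<noteq> 0" using emb_inj[OF assms(1) zero_closed] assms(2) by (auto simp: emb_zero fun_eq_iff)
  then show ?thesis unfolding indep_iff by auto
qed

text \<open>The family picked by \<open>lattice_degree\<close> consists of some multiple of x by a
  nonzero integer r. The index of its span is the norm of r, whose logarithm cancels against the
  factors |r|^2 of the Gram terms.\<close>

lemma degree_cyclic:
  assumes x: "x \<in> carrier \<Lambda>" "x \<noteq> \<zero>\<^bsub>\<Lambda>\<^esub>"
  defines "N \<equiv> (\<lambda>r. r \<odot>\<^bsub>\<Lambda>\<^esub> x) ` int_elems"
  shows "submodule N ring_of_integers \<Lambda>" "N \<noteq> {\<zero>\<^bsub>\<Lambda>\<^esub>}" "rank N = 1"
    "lattice_degree \<Lambda> h N = - 1 / 2 * (\<Sum>v\<in>infinite_places. local_degree v *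
        ln (Re (h v (to_place_fibre \<Lambda> v x) (to_place_fibre \<Lambda> v x))))"
proof -
  have N: "N \<subseteq> carrier \<Lambda>" using x(1) by (auto simp: N_def)
  have xN: "x \<in> N" unfolding N_def using smult_one[OF x(1)] int_elems_closed(2) by (intro image_eqI[of _ _ 1]) simp_all
  show "submodule N ring_of_integers \<Lambda>"
  proof (rule submoduleI)
    show "N \<subseteq> carrier \<Lambda>" by (rule N)
    show "\<zero>\<^bsub>\<Lambda>\<^esub> \<in> N" unfolding N_def
      using smult_l_null[OF x(1)] int_elems_closed(1) by (intro image_eqI[of _ _ 0]) simp_all
    show "\<ominus>\<^bsub>\<Lambda>\<^esub> a \<in> N" if aN: "a \<in> N" for a
    proof -
      obtain r where r: "r \<in> int_elems" "a = r \<odot>\<^bsub>\<Lambda>\<^esub> x" using aN by (auto simp: N_def)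
      have "\<ominus>\<^bsub>\<Lambda>\<^esub> a = (- r) \<odot>\<^bsub>\<Lambda>\<^esub> x"
      proof (rule emb_inj)
        show "emb (\<ominus>\<^bsub>\<Lambda>\<^esub> a) = emb ((- r) \<odot>\<^bsub>\<Lambda>\<^esub> x)"
          using r x(1) int_elems_closed(8)[OF r(1)] by (simp add: fun_eq_iff emb_uminus emb_smult)
      qed (use r x(1) int_elems_closed(8)[OF r(1)] in simp_all)
      then show ?thesis unfolding N_def using int_elems_closed(8)[OF r(1)] by blast
    qed
    show "a \<oplus>\<^bsub>\<Lambda>\<^esub> b \<in> N" if "a \<in> N" "b \<in> N" for a b
    proof -
      obtain r s where rs: "r \<in> int_elems" "a = r \<odot>\<^bsub>\<Lambda>\<^esub> x" "s \<in> int_elems" "b = s \<odot>\<^bsub>\<Lambda>\<^esub> x"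
        using \<open>a \<in> N\<close> \<open>b \<in> N\<close> by (auto simp: N_def)
      then have "a \<oplus>\<^bsub>\<Lambda>\<^esub> b = (r + s) \<odot>\<^bsub>\<Lambda>\<^esub> x" using smult_l_distr[of r s x] x(1) by (simp add: carrier_ring_of_integers)
      then show ?thesis unfolding N_def using int_elems_closed(5)[OF rs(1,3)] by blast
    qed
    show "a \<odot>\<^bsub>\<Lambda>\<^esub> b \<in> N" if aO: "a \<in> carrier ring_of_integers" and bN: "b \<in> N" for a b
    proof -
      obtain r where r: "r \<in> int_elems" "b = r \<odot>\<^bsub>\<Lambda>\<^esub> x" using bN by (auto simp: N_def)
      have a: "a \<in> int_elems" using aO by (simp add: carrier_ring_of_integers)
      have "a \<odot>\<^bsub>\<Lambda>\<^esub> b = (a * r) \<odot>\<^bsub>\<Lambda>\<^esub> x" using smult_assoc1[of a r x] a r x(1) by (simp add: carrier_ring_of_integers)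
      then show ?thesis unfolding N_def using int_elems_closed(6)[OF a r(1)] by blast
    qed
  qed
  show "N \<noteq> {\<zero>\<^bsub>\<Lambda>\<^esub>}" using xN x(2) by blast
  obtain es where es: "set es \<subseteq> N" "length es = rank N" "indep es" "lattice_degree \<Lambda> h N = degree_wrt \<Lambda> h N es"
    using lattice_degree_some[OF N] by blast
  have "length (map emb es) \<le> length [emb x]"
  proof (rule findep_length_le[OF es(3)])
    fix j assume j: "j < length (map emb es)"
    then have "es ! j \<in> N" using es(1) by auto
    then obtain r where r: "r \<in> int_elems" "es ! j = r \<odot>\<^bsub>\<Lambda>\<^esub> x" by (auto simp: N_def)
    then show "\<exists>c. \<forall>l. (map emb es ! j) l = (\<Sum>i<length [emb x]. c i * ([emb x] ! i) l)"
      using j x(1) by (intro exI[of _ "\<lambda>_. r"]) (simp add: emb_smult)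
  qed
  moreover have "length [x] \<le> rank N" by (rule rank_props(2)[OF N _ indep_single[OF x]]) (use xN in simp)
  ultimately show rank1: "rank N = 1" using es(2) by simp
  obtain y where y: "es = [y]" using rank1 es(2) by (metis One_nat_def length_0_conv length_Suc_conv)
  obtain r where r: "r \<in> int_elems" "y = r \<odot>\<^bsub>\<Lambda>\<^esub> x" using es(1) by (auto simp: y N_def)
  have r0: "r \<noteq> 0"
  proof
    assume "r = 0"
    then have "emb y j = 0" for j using r x(1) by (simp add: emb_smult)
    then show False using indepD[OF es(3), of "\<lambda>_. 1" 0] by (simp add: y)
  qed
  let ?f = "\<lambda>r j. r * emb x j"
  have fN: "emb ` N = ?f ` int_elems"
    unfolding N_def image_image by (rule image_cong) (auto simp: emb_smult x(1))
  have fS: "espan [y] = ?f ` principal r"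
  proof -
    have "espan [y] = {?f (r * c 0) | c. \<forall>i::nat. c i \<in> int_elems}"
      unfolding espan_def using r x(1) by (simp add: emb_smult mult_ac)
    also have "\<dots> = ?f ` principal r"
    proof (intro equalityI subsetI)
      fix u assume "u \<in> ?f ` principal r"
      then obtain a where a: "a \<in> int_elems" "u = ?f (r * a)" by (auto simp: principal_def)
      show "u \<in> {?f (r * c 0) | c. \<forall>i::nat. c i \<in> int_elems}"
        by (rule CollectI, rule exI[of _ "\<lambda>_. a"]) (use a in simp)
    qed (auto simp: principal_def)
    finally show ?thesis .
  qed
  have "idx (?f ` int_elems) (?f ` principal r) = idx int_elems (principal r)"
  proof (rule idx_image[OF add_subgroup_principal _ add_subgroup_int_elems])
    show "principal r \<subseteq> int_elems" using r(1) int_elems_closed(6) by (auto simp: principal_def)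
    obtain j where j: "emb x j \<noteq> 0" using emb_inj[OF x(1) zero_closed] x(2) by (auto simp: emb_zero fun_eq_iff)
    show "inj_on ?f int_elems"
    proof (rule inj_onI)
      fix a b assume "?f a = ?f b"
      then have "a * emb x j = b * emb x j" by (rule fun_cong)
      then show "a = b" using j by simp
    qed
  qed (simp add: fun_eq_iff distrib_right)
  then have ix: "real (idx (emb ` N) (espan [y])) = field_norm r"
    using idx_int_elems_principal[OF r(1) r0] by (simp add: fN fS)
  have g: "ln (Re (Determinant.det (gram_mat v es))) = 2 * ln (cmod (place_embedding v r)) +
      ln (Re (h v (to_place_fibre \<Lambda> v x) (to_place_fibre \<Lambda> v x)))" if v: "v \<in> infinite_places" for v
  proof -
    interpret lattice_place \<Lambda> h v by (rule lattice_place[OF v])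
    have "gram_mat v es \<in> carrier_mat 1 1" by (simp add: gram_mat_def y)
    then have "Determinant.det (gram_mat v es) = gram v es 0 0" by (simp add: det_single) (simp add: gram_mat_def y)
    then have "Re (Determinant.det (gram_mat v es)) =
        (cmod (sv r))\<^sup>2 * Re (h v (to_place_fibre \<Lambda> v x) (to_place_fibre \<Lambda> v x))"
      using h_tau_smult[OF r(1) x(1)] by (simp add: gram_def y r(2))
    moreover have "cmod (sv r) > 0" using svD(10)[of r] r0 by simp
    ultimately show ?thesis using h_tau_pos[OF x] by (simp add: ln_mult ln_realpow)
  qed
  have "(\<Sum>v\<in>infinite_places. local_degree v * ln (Re (Determinant.det (gram_mat v es)))) =
      (\<Sum>v\<in>infinite_places. 2 * (local_degree v * ln (cmod (place_embedding v r))) +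
        local_degree v * ln (Re (h v (to_place_fibre \<Lambda> v x) (to_place_fibre \<Lambda> v x))))"
    by (intro sum.cong refl) (simp add: g distrib_left)
  also have "\<dots> = 2 * ln (field_norm r) + (\<Sum>v\<in>infinite_places. local_degree v *
        ln (Re (h v (to_place_fibre \<Lambda> v x) (to_place_fibre \<Lambda> v x))))"
    by (simp add: sum.distrib sum_distrib_left[symmetric] ln_field_norm[OF r0])
  finally show "lattice_degree \<Lambda> h N = - 1 / 2 * (\<Sum>v\<in>infinite_places. local_degree v *
        ln (Re (h v (to_place_fibre \<Lambda> v x) (to_place_fibre \<Lambda> v x))))"
    unfolding es(4) degree_wrt_eq[OF N es(1)] using ix by (simp add: y)
qed

lemma min_norm:
  assumes ss: "semistable \<Lambda> h" and x: "x \<in> carrier \<Lambda>" "x \<noteq> \<zero>\<^bsub>\<Lambda>\<^esub>"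
  defines "d \<equiv> real (field_degree TYPE('f))" and "n \<equiv> real (rank (carrier \<Lambda>))"
  shows "d * exp (- (2 * lattice_degree \<Lambda> h (carrier \<Lambda>) / (n * d))) \<le> norm_sq h (to_lattice_space \<Lambda> x)"
proof -
  let ?N = "(\<lambda>r. r \<odot>\<^bsub>\<Lambda>\<^esub> x) ` int_elems" and ?deg = "lattice_degree \<Lambda> h (carrier \<Lambda>)"
  let ?g = "\<lambda>v. Re (h v (to_place_fibre \<Lambda> v x) (to_place_fibre \<Lambda> v x))"
  note N = degree_cyclic[OF x]
  have d: "d > 0" using field_degree_pos[where 'f='f] by (simp add: d_def)
  have "lattice_degree \<Lambda> h ?N / rank ?N \<le> ?deg / n" using ss N(1,2) unfolding semistable_def n_def by blast
  then have "- 1 / 2 * (\<Sum>v\<in>infinite_places. local_degree v * ln (?g v)) \<le> ?deg / n" by (simp add: N(3,4))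
  moreover have "d * (- (2 * ?deg / (n * d))) = - 2 * (?deg / n)" using d by simp
  ultimately have s: "(\<Sum>v\<in>infinite_places. local_degree v * ln (?g v)) \<ge> d * (- (2 * ?deg / (n * d)))" by linarith
  have "?g v > 0" if "v \<in> infinite_places" for v by (rule lattice_place.h_tau_pos[OF lattice_place[OF that] x])
  from places_am_gm[of ?g, OF this s[unfolded d_def]] show ?thesis by (simp add: norm_sq_eq d_def)
qed

text \<open>The family picked for the kernel together with x is a frame, so
  \<open>degree_split\<close> expresses the degree of \<Lambda> as that of the kernel, plus half the
  weighted logarithms of the squared dual lengths, plus ln \<kappa>. Semi-stability bounds the
  kernel term by (n - 1) / n times the degree of \<Lambda>, the inverse different bounds \<kappa> by
  \<Delta>, and AM--GM finishes.\<close>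

lemma min_dual_norm:
  assumes ss: "semistable \<Lambda> h" and \<xi>: "of_linear \<Lambda> \<xi>" "\<xi> ` carrier \<Lambda> \<subseteq> carrier inverse_different"
    and x: "x \<in> carrier \<Lambda>" "\<xi> x \<noteq> 0"
  defines "d \<equiv> real (field_degree TYPE('f))" and "n \<equiv> real (rank (carrier \<Lambda>))"
  shows "d * (abs_discriminant TYPE('f) powr (- (2 / d)) * exp (2 * lattice_degree \<Lambda> h (carrier \<Lambda>) / (n * d)))
    \<le> dual_norm_sq \<Lambda> h \<xi>"
proof -
  let ?N = "{y \<in> carrier \<Lambda>. \<xi> y = 0}" and ?deg = "lattice_degree \<Lambda> h (carrier \<Lambda>)" and ?\<Delta> = "abs_discriminant TYPE('f)"
  have d: "d > 0" using field_degree_pos[where 'f='f] by (simp add: d_def)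
  have N: "?N \<subseteq> carrier \<Lambda>" by blast
  have \<xi>0: "\<xi> \<zero>\<^bsub>\<Lambda>\<^esub> = 0" by (rule of_linear_zero[OF \<xi>(1)])
  have sub: "submodule ?N ring_of_integers \<Lambda>"
  proof (rule submoduleI)
    show "\<ominus>\<^bsub>\<Lambda>\<^esub> a \<in> ?N" if "a \<in> ?N" for a
      using of_linearD(1)[OF \<xi>(1), of a "\<ominus>\<^bsub>\<Lambda>\<^esub> a"] that \<xi>0 by (auto simp: r_neg)
    show "a \<odot>\<^bsub>\<Lambda>\<^esub> b \<in> ?N" if "a \<in> carrier ring_of_integers" "b \<in> ?N" for a b
      using that of_linearD(2)[OF \<xi>(1)] by (auto simp: carrier_ring_of_integers)
  qed (use \<xi>0 of_linearD(1)[OF \<xi>(1)] in auto)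
  obtain es where es: "set es \<subseteq> ?N" "length es = rank ?N" "indep es" "lattice_degree \<Lambda> h ?N = degree_wrt \<Lambda> h ?N es"
    using lattice_degree_some[OF N] by blast
  let ?r = "length es" and ?fs = "es @ [x]"
  have esN: "es ! i \<in> carrier \<Lambda>" "\<xi> (es ! i) = 0" if "i < ?r" for i using es(1) nth_mem[OF that] by auto
  have ind: "indep ?fs"
    unfolding indep_iff
  proof (intro allI impI)
    fix c i assume c: "\<forall>j. (\<Sum>i<length ?fs. c i * emb (?fs ! i) j) = 0" and i: "i < length ?fs"
    have "0 = (\<Sum>i<length ?fs. c i * \<xi> (?fs ! i))"
      using functional_relation[of ?fs "\<zero>\<^bsub>\<Lambda>\<^esub>" c \<xi>] c es(1) x(1) \<xi>(1) by (auto simp: emb_zero \<xi>0)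
    also have "\<dots> = c ?r * \<xi> x" by (simp add: nth_append esN)
    finally have cr: "c ?r = 0" using x(2) by simp
    have "(\<Sum>i<?r. c i * emb (es ! i) j) = 0" for j using c[rule_format, of j] cr by (simp add: nth_append)
    from indepD[OF es(3) this] show "c i = 0" using cr i by (cases "i = ?r") auto
  qed
  have fsM: "set ?fs \<subseteq> carrier \<Lambda>" using es(1) x(1) by auto
  have le: "length ?fs \<le> rank (carrier \<Lambda>)" by (rule rank_props(2)[OF subset_refl fsM ind])
  obtain gs where gs: "frame gs" using frame_exists by blast
  have "length (map emb gs) \<le> length (map emb ?fs)"
  proof (rule findep_length_le)
    show "indep gs" by (rule frameD(3)[OF gs])
    fix j assume "j < length (map emb gs)"
    then have j: "j < length gs" by simp
    let ?y = "gs ! j"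
    have y: "?y \<in> carrier \<Lambda>" by (rule frameD(4)[OF gs j])
    obtain m :: nat where m: "m > 0" "\<forall>z\<in>{\<xi> x, \<xi> ?y}. of_nat m * z \<in> int_elems"
      using int_elems_multiples[of "{\<xi> x, \<xi> ?y}" "\<lambda>z. z"] by auto
    let ?a = "of_nat m * \<xi> x" and ?b = "of_nat m * \<xi> ?y"
    have ab: "?a \<in> int_elems" "- ?b \<in> int_elems" using m(2) int_elems_closed(8) by auto
    \<comment> \<open>The combination of y and x with coefficients \<open>?a\<close> and minus
      \<open>?b\<close> is killed by \<xi>, so it depends on es, and y depends on es and x. Hence
      the rank of the kernel is one less than that of \<Lambda>.\<close>
    let ?z = "(?a \<odot>\<^bsub>\<Lambda>\<^esub> ?y) \<oplus>\<^bsub>\<Lambda>\<^esub> ((- ?b) \<odot>\<^bsub>\<Lambda>\<^esub> x)"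
    have z: "?z \<in> ?N" using ab x(1) y by (simp add: of_linearD[OF \<xi>(1)])
    obtain c where c: "\<forall>j. emb ?z j = (\<Sum>i<?r. c i * emb (es ! i) j)" using indep_spans[OF N es(1-3) z] by blast
    have a0: "?a \<noteq> 0" using m(1) x(2) by simp
    let ?c = "\<lambda>i. if i = ?r then ?b / ?a else c i / ?a"
    have "emb ?y l = (\<Sum>i<?r. c i / ?a * emb (es ! i) l) + ?b / ?a * emb x l" for l
    proof -
      have "?a * emb ?y l - ?b * emb x l = emb ?z l" using ab x(1) y by (simp add: emb_add emb_smult)
      also have "\<dots> = (\<Sum>i<?r. c i * emb (es ! i) l)" using c by blast
      finally have "emb ?y l = ((\<Sum>i<?r. c i * emb (es ! i) l) + ?b * emb x l) / ?a"
        using a0 by (simp only: eq_divide_eq) (simp add: algebra_simps)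
      then show ?thesis by (simp add: add_divide_distrib sum_divide_distrib)
    qed
    then have "emb ?y l = (\<Sum>i<length (map emb ?fs). ?c i * (map emb ?fs ! i) l)" for l
      by (simp add: nth_append)
    then show "\<exists>c. \<forall>l. (map emb gs ! j) l = (\<Sum>i<length (map emb ?fs). c i * (map emb ?fs ! i) l)"
      using j by (intro exI[of _ ?c]) (simp only: nth_map, blast)
  qed
  then have n: "rank (carrier \<Lambda>) = Suc ?r" using le frameD(2)[OF gs] by simp
  have fs: "frame ?fs" using fsM ind n by (simp add: frame_def)
  have ix: "idx (\<xi> ` carrier \<Lambda>) (principal (\<xi> x)) > 0"
    using degree_split(2)[OF fs _ \<xi>(1), of ?r] esN(2) x(2) by (simp add: nth_append)
  let ?\<kappa> = "real (idx (\<xi> ` carrier \<Lambda>) (principal (\<xi> x))) / field_norm (\<xi> x)"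
  have norm: "field_norm (\<xi> x) > 0" by (rule field_norm_pos[OF x(2)])
  have pr: "principal (\<xi> x) \<subseteq> \<xi> ` carrier \<Lambda>"
    using functional_image(2)[OF \<xi>(1)] x(1) by (auto simp: principal_def mult.commute)
  have "?\<kappa> \<le> ?\<Delta>"
    using idx_fractional_ideal_le[OF functional_image(1)[OF \<xi>(1)] \<xi>(2) pr x(2)] norm by (simp add: field_simps)
  then have \<kappa>: "ln ?\<kappa> \<le> ln ?\<Delta>" using ix norm by (intro ln_mono) auto
  have del: "espan_del ?fs ?r = espan es"
  proof (intro equalityI subsetI)
    fix u assume "u \<in> espan_del ?fs ?r"
    then obtain c where c: "u = (\<lambda>j. \<Sum>i<length ?fs. c i * emb (?fs ! i) j)" "\<forall>i. c i \<in> int_elems" "c ?r = 0"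
      unfolding espan_del_def by blast
    then have "u = (\<lambda>j. \<Sum>i<?r. c i * emb (es ! i) j)" by (simp add: nth_append)
    then show "u \<in> espan es" using espanI[OF c(2)] by simp
  next
    fix u assume "u \<in> espan es"
    then obtain c where c: "u = (\<lambda>j. \<Sum>i<?r. c i * emb (es ! i) j)" "\<forall>i. c i \<in> int_elems" unfolding espan_def by blast
    let ?c = "\<lambda>i. if i = ?r then 0 else c i"
    have "u = (\<lambda>j. \<Sum>i<length ?fs. ?c i * emb (?fs ! i) j)" unfolding c(1) by (simp add: nth_append)
    moreover have "\<forall>i. ?c i \<in> int_elems" using c(2) by (simp add: int_elems_closed(1))
    ultimately show "u \<in> espan_del ?fs ?r"
      unfolding espan_del_def by (intro CollectI exI[of _ ?c] conjI) simp_all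
  qed
  have mat: "mat_delete (gram_mat v ?fs) ?r ?r = gram_mat v es" for v
    by (rule eq_matI) (auto simp: mat_delete_def gram_mat_def gram_def nth_append)
  have "?deg = lattice_degree \<Lambda> h ?N + 1 / 2 * (\<Sum>v\<in>infinite_places. local_degree v * ln (dnorm v \<xi>)) + ln ?\<kappa>"
    unfolding lattice_degree_frame[OF fs] es(4) degree_wrt_eq[OF N es(1)]
    using degree_split(1)[OF fs _ \<xi>(1), of ?r] esN(2) x(2) by (simp add: nth_append del mat)
  moreover have "lattice_degree \<Lambda> h ?N \<le> (n - 1) * (?deg / n)"
  proof (cases "?N = {\<zero>\<^bsub>\<Lambda>\<^esub>}")
    \<comment> \<open>Semi-stability says nothing about the zero module. There the family is empty
      and the degree is 0, while n = 1 makes the right side 0.\<close>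
    case True
    have "es = []"
    proof (rule ccontr)
      assume "es \<noteq> []"
      then have "0 < length es" by simp
      then have "es ! 0 \<in> ?N" using es(1) nth_mem by blast
      then have "emb (es ! 0) = 0" unfolding True by (simp add: emb_zero)
      then show False using indepD[OF es(3), of "\<lambda>i. if i = 0 then 1 else 0" 0] \<open>es \<noteq> []\<close> by (simp add: if_distrib[of "\<lambda>x. x * _"] cong: if_cong)
    qed
    have "emb ` ?N = {0}" "espan [] = {0}" unfolding True espan_def by (auto simp: emb_zero fun_eq_iff int_elems_closed(1) intro: exI[of _ "\<lambda>_. 0"])
    then have "lattice_degree \<Lambda> h ?N = 0"
      unfolding es(4) degree_wrt_eq[OF N es(1)] using idx_same[of "{0 :: nat \<Rightarrow> 'f}"]
      by (simp add: \<open>es = []\<close> gram_mat_def add_subgroup_def)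
    then show ?thesis using n by (simp add: n_def \<open>es = []\<close>)
  next
    case False
    then have le: "lattice_degree \<Lambda> h ?N / rank ?N \<le> ?deg / n" using ss sub unfolding semistable_def n_def by blast
    obtain y where y: "y \<in> ?N" "y \<noteq> \<zero>\<^bsub>\<Lambda>\<^esub>" using False \<xi>0 zero_closed by blast
    have "length [y] \<le> rank ?N" by (rule rank_props(2)[OF N]) (use y indep_single in auto)
    then have "real (rank ?N) > 0" by simp
    moreover have "n - 1 = real (rank ?N)" using n es(2) by (simp add: n_def)
    ultimately show ?thesis using le by (simp add: divide_le_eq mult.commute)
  qed
  moreover have "(n - 1) * (?deg / n) = ?deg - ?deg / n" using n by (simp add: n_def field_simps)
  ultimately have "(\<Sum>v\<in>infinite_places. local_degree v * ln (dnorm v \<xi>)) \<ge> 2 * (?deg / n) - 2 * ln ?\<Delta>"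
    using \<kappa> by linarith
  moreover have "n \<noteq> 0" by (simp add: n_def n)
  then have "2 * (?deg / n) - 2 * ln ?\<Delta> = d * (- (2 / d) * ln ?\<Delta> + 2 * ?deg / (n * d))"
    using d by (simp add: field_simps)
  ultimately have s: "(\<Sum>v\<in>infinite_places. local_degree v * ln (dnorm v \<xi>)) \<ge> d * (- (2 / d) * ln ?\<Delta> + 2 * ?deg / (n * d))"
    by simp
  have "dnorm v \<xi> > 0" if "v \<in> infinite_places" for v
    by (rule lattice_place.dnorm_pos[OF lattice_place[OF that] \<xi>(1) x])
  from places_am_gm[of "\<lambda>v. dnorm v \<xi>", OF this s[unfolded d_def]]
  have "d * exp (- (2 / d) * ln ?\<Delta> + 2 * ?deg / (n * d)) \<le> dual_norm_sq \<Lambda> h \<xi>"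
    by (simp add: dual_norm_sq_def dnorm_def d_def)
  then show ?thesis using abs_discriminant_pos[where 'f='f] by (simp only: exp_add powr_def) simp
qed

end

section \<open>Theta series\<close>

text \<open>In the applications a is the zero vector, whose Gaussian term is 1. A uniform bound on
  the finite sums avoiding a gives summability as well as the estimate.\<close>

lemma infsum_one_plus_bound:
  fixes f :: "'x \<Rightarrow> real"
  assumes nonneg: "\<And>x. x \<in> A \<Longrightarrow> f x \<ge> 0" and a: "a \<in> A" "f a = 1"
    and b: "\<And>Y. finite Y \<Longrightarrow> Y \<subseteq> A - {a} \<Longrightarrow> sum f Y \<le> b"
  shows "finite Y \<Longrightarrow> Y \<subseteq> A \<Longrightarrow> sum f Y \<le> 1 + b" "f summable_on A" "1 \<le> infsum f A" "infsum f A \<le> 1 + b"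
proof -
  show fin: "sum f Y \<le> 1 + b" if "finite Y" "Y \<subseteq> A" for Y
  proof -
    have "sum f Y \<le> sum f (insert a (Y - {a}))" using that a nonneg by (intro sum_mono2) auto
    also have "\<dots> = f a + sum f (Y - {a})" by (rule sum.insert) (use that in auto)
    also have "\<dots> \<le> 1 + b" using a(2) b[of "Y - {a}"] that by auto
    finally show ?thesis .
  qed
  show sm: "f summable_on A"
    by (rule nonneg_bdd_above_summable_on) (use nonneg fin in \<open>auto intro!: bdd_aboveI[of _ "1 + b"]\<close>)
  show "infsum f A \<le> 1 + b" by (rule infsum_le_finite_sums[OF sm fin])
  show "1 \<le> infsum f A" using finite_sum_le_infsum[OF sm, of "{a}"] a nonneg by simp
qed

context hermitian_lattice
begin

lemma h0_bound:
  assumes l: "l > 0" "real (rank (carrier \<Lambda>) * field_degree TYPE('f)) \<le> l"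
    and min: "\<And>x. x \<in> carrier \<Lambda> \<Longrightarrow> x \<noteq> \<zero>\<^bsub>\<Lambda>\<^esub> \<Longrightarrow> l \<le> norm_sq h (to_lattice_space \<Lambda> x)"
  shows "h0 \<Lambda> h \<le> 3 ^ (rank (carrier \<Lambda>) * field_degree TYPE('f)) * exp (- pi * l) * (pi / (pi - 1 / 2))"
proof -
  obtain fs where fs: "frame fs" using frame_exists by blast
  note len = frameD(2)[OF fs]
  interpret pf: place_forms "length fs" "\<lambda>v. gram v fs"
    by (rule place_forms.intro) (rule lattice_place.posdef_gram[OF lattice_place fs])
  have q: "pf.qform (crd fs x) = norm_sq h (to_lattice_space \<Lambda> x)" if x: "x \<in> carrier \<Lambda>" for x
    unfolding pf.qform_def norm_sq_eq
  proof (rule sum.cong[OF refl])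
    fix v :: "'f place" assume v: "v \<in> infinite_places"
    interpret lattice_place \<Lambda> h v by (rule lattice_place[OF v])
    interpret pd: posdef_form "length fs" Kv "gram v fs" by (rule posdef_gram[OF fs])
    show "local_degree v * Re (pd.frm (\<lambda>i. sv (crd fs x i)) (\<lambda>i. sv (crd fs x i))) =
        local_degree v * Re (h v (to_place_fibre \<Lambda> v x) (to_place_fibre \<Lambda> v x))"
      unfolding tau_rho[OF fs x] by (simp add: h_rho[OF frameD(1)[OF fs] sv_Kv sv_Kv] pd.frm_def)
  qed
  have c0: "crd fs \<zero>\<^bsub>\<Lambda>\<^esub> = (\<lambda>i. 0)" using of_linear_zero[OF crd_linear[OF fs]] by (simp add: fun_eq_iff)
  have inj: "inj_on (crd fs) (carrier \<Lambda>)" by (rule inj_onI) (rule crd_inj[OF fs])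
  let ?f = "\<lambda>x. exp (- pi * norm_sq h (to_lattice_space \<Lambda> x))"
  let ?b = "3 ^ (length fs * field_degree TYPE('f)) * exp (- pi * l) * (pi / (pi - 1 / 2))"
  have b: "sum ?f Y \<le> ?b" if Y: "finite Y" "Y \<subseteq> carrier \<Lambda> - {\<zero>\<^bsub>\<Lambda>\<^esub>}" for Y
  proof -
    have "(\<Sum>y\<in>crd fs ` Y. exp (- pi * pf.qform y)) \<le> ?b"
    proof (rule pf.lattice_sum_bound[of "crd fs ` carrier \<Lambda>"])
      show "(\<lambda>i. x i - y i) \<in> crd fs ` carrier \<Lambda>" if xy: "x \<in> crd fs ` carrier \<Lambda>" "y \<in> crd fs ` carrier \<Lambda>" for x y
      proof -
        obtain a b where ab: "a \<in> carrier \<Lambda>" "b \<in> carrier \<Lambda>" "x = crd fs a" "y = crd fs b" using xy by blast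
        have neg: "crd fs (\<ominus>\<^bsub>\<Lambda>\<^esub> b) i = - crd fs b i" for i
        proof -
          have "crd fs (b \<oplus>\<^bsub>\<Lambda>\<^esub> (\<ominus>\<^bsub>\<Lambda>\<^esub> b)) i = crd fs b i + crd fs (\<ominus>\<^bsub>\<Lambda>\<^esub> b) i"
            using ab(2) by (intro of_linearD(1)[OF crd_linear[OF fs]]) auto
          then show ?thesis using ab(2) c0 by (simp add: r_neg eq_neg_iff_add_eq_0 add.commute)
        qed
        have "(\<lambda>i. x i - y i) = crd fs (a \<oplus>\<^bsub>\<Lambda>\<^esub> (\<ominus>\<^bsub>\<Lambda>\<^esub> b))"
        proof
          fix i
          have "crd fs (a \<oplus>\<^bsub>\<Lambda>\<^esub> (\<ominus>\<^bsub>\<Lambda>\<^esub> b)) i = crd fs a i + crd fs (\<ominus>\<^bsub>\<Lambda>\<^esub> b) i"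
            using ab by (intro of_linearD(1)[OF crd_linear[OF fs]]) auto
          then show "x i - y i = crd fs (a \<oplus>\<^bsub>\<Lambda>\<^esub> (\<ominus>\<^bsub>\<Lambda>\<^esub> b)) i" by (simp add: ab neg)
        qed
        then show ?thesis using ab by auto
      qed
      show "(\<lambda>i. 0) \<in> crd fs ` carrier \<Lambda>" using c0 zero_closed by (metis imageI)
      show "x i = 0" if "x \<in> crd fs ` carrier \<Lambda>" "length fs \<le> i" for x i using that crd(1)[OF fs] by auto
      show "l \<le> pf.qform x" if x: "x \<in> crd fs ` carrier \<Lambda>" "x \<noteq> (\<lambda>i. 0)" for x
      proof -
        obtain a where a: "a \<in> carrier \<Lambda>" "x = crd fs a" using x(1) by blast
        then show ?thesis using min[OF a(1)] x(2) c0 q[OF a(1)] by auto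
      qed
      show "real (length fs * field_degree TYPE('f)) \<le> l" using l(2) len by simp
      show "(\<lambda>i. 0) \<notin> crd fs ` Y"
      proof
        assume "(\<lambda>i. 0) \<in> crd fs ` Y"
        then obtain y where "y \<in> Y" "crd fs y = crd fs \<zero>\<^bsub>\<Lambda>\<^esub>" using c0 by auto
        then show False using crd_inj[OF fs, of y "\<zero>\<^bsub>\<Lambda>\<^esub>"] Y(2) by auto
      qed
    qed (use l Y pi_gt3 in auto)
    moreover have "(\<Sum>y\<in>crd fs ` Y. exp (- pi * pf.qform y)) = (\<Sum>y\<in>Y. exp (- pi * pf.qform (crd fs y)))"
      by (rule sum.reindex_cong[OF inj_on_subset[OF inj]]) (use Y(2) in auto)
    moreover have "\<dots> = sum ?f Y" using Y(2) by (intro sum.cong) (auto simp: q)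
    ultimately show ?thesis by simp
  qed
  have "norm_sq h (to_lattice_space \<Lambda> \<zero>\<^bsub>\<Lambda>\<^esub>) = 0"
    unfolding q[OF zero_closed, symmetric] c0 pf.qform_def
  proof (intro sum.neutral ballI)
    fix v :: "'f place" assume v: "v \<in> infinite_places"
    interpret lattice_place \<Lambda> h v by (rule lattice_place[OF v])
    interpret pd: posdef_form "length fs" Kv "gram v fs" by (rule posdef_gram[OF fs])
    show "local_degree v * Re (pd.frm (\<lambda>i. sv 0) (\<lambda>i. sv 0)) = 0" by (simp add: svD(4) pd.frm_left)
  qed
  then have z: "?f \<zero>\<^bsub>\<Lambda>\<^esub> = 1" by simp
  note s = infsum_one_plus_bound(3,4)[of "carrier \<Lambda>" ?f "\<zero>\<^bsub>\<Lambda>\<^esub>" ?b, OF _ zero_closed z b]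
  \<comment> \<open>The theta series lies between 1 and 1 + \<open>?b\<close>, and ln y \<le> y - 1
    removes the term of the zero vector.\<close>
  have "h0 \<Lambda> h \<le> infsum ?f (carrier \<Lambda>) - 1" unfolding h0_def using s(1) by (intro ln_le_minus_one) auto
  also have "\<dots> \<le> ?b" using s(2) by simp
  finally show ?thesis unfolding len by simp
qed

end

context hermitian_lattice
begin

lemma dual_latticeD:
  assumes "\<xi> \<in> dual_lattice \<Lambda>"
  shows "of_linear \<Lambda> \<xi>" "\<xi> ` carrier \<Lambda> \<subseteq> carrier inverse_different" "x \<notin> carrier \<Lambda> \<Longrightarrow> \<xi> x = undefined"
  using assms by (auto simp: dual_lattice_def linear_maps_def of_linear_def inverse_different_def carrier_ring_of_integers)

lemma dual_latticeI:
  assumes "of_linear \<Lambda> \<xi>" "\<xi> ` carrier \<Lambda> \<subseteq> carrier inverse_different"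
  shows "restrict \<xi> (carrier \<Lambda>) \<in> dual_lattice \<Lambda>"
proof -
  have "restrict \<xi> (carrier \<Lambda>) \<in> carrier \<Lambda> \<rightarrow>\<^sub>E carrier inverse_different" using assms(2) by auto
  then show ?thesis
    using of_linearD[OF assms(1)]
    by (simp add: dual_lattice_def linear_maps_def carrier_ring_of_integers) (simp add: inverse_different_def)
qed

lemma inverse_different_diff:
  "x \<in> carrier inverse_different \<Longrightarrow> y \<in> carrier inverse_different \<Longrightarrow> x - y \<in> carrier (inverse_different :: ('f, 'f) module)"
proof -
  have "field_trace ((x - y) * z) = field_trace (x * z) - field_trace (y * z)" for z
    using field_trace_linear(1)[of "(x - y) * z" "y * z"] by (simp add: algebra_simps)
  then show "x \<in> carrier inverse_different \<Longrightarrow> y \<in> carrier inverse_different \<Longrightarrow> x - y \<in> carrier (inverse_different :: ('f, 'f) module)"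
    by (auto simp: inverse_different_def)
qed

lemma dual_diff:
  assumes "\<xi> \<in> dual_lattice \<Lambda>" "\<eta> \<in> dual_lattice \<Lambda>"
  shows "of_linear \<Lambda> (\<lambda>x. \<xi> x - \<eta> x)" "(\<lambda>x. \<xi> x - \<eta> x) ` carrier \<Lambda> \<subseteq> carrier inverse_different"
proof -
  note x = dual_latticeD[OF assms(1)] and e = dual_latticeD[OF assms(2)]
  show "of_linear \<Lambda> (\<lambda>x. \<xi> x - \<eta> x)"
    unfolding of_linear_def by (simp add: of_linearD[OF x(1)] of_linearD[OF e(1)] right_diff_distrib)
  show "(\<lambda>x. \<xi> x - \<eta> x) ` carrier \<Lambda> \<subseteq> carrier inverse_different"
    using x(2) e(2) by (auto intro!: inverse_different_diff)
qed

lemma zero_dual: "restrict (\<lambda>x. 0) (carrier \<Lambda>) \<in> dual_lattice \<Lambda>"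
  by (rule dual_latticeI) (auto simp: of_linear_def inverse_different_def field_trace_linear(2)[of 0 0, simplified])

lemma dual_nonzero:
  assumes "\<xi> \<in> dual_lattice \<Lambda>" "\<eta> \<in> dual_lattice \<Lambda>" "\<xi> \<noteq> \<eta>"
  shows "\<exists>x\<in>carrier \<Lambda>. \<xi> x \<noteq> \<eta> x"
  using assms dual_latticeD(3) by (metis ext)

text \<open>Evaluation on a frame embeds the dual lattice into F^n, where the squared lengths become
  values of the dual Gram forms. The parameter t is kept since \<open>h1\<close> needs t = pi / 2
  for convergence and t = pi for the estimate.\<close>

lemma dual_sum_bound:
  assumes l: "l > 0" "real (rank (carrier \<Lambda>) * field_degree TYPE('f)) \<le> l"
    and min: "\<And>\<xi>. \<xi> \<in> dual_lattice \<Lambda> \<Longrightarrow> \<exists>x\<in>carrier \<Lambda>. \<xi> x \<noteq> 0 \<Longrightarrow> l \<le> dual_norm_sq \<Lambda> h \<xi>"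
    and t: "t > 1 / 2"
  shows "finite Y \<Longrightarrow> Y \<subseteq> dual_lattice \<Lambda> - {restrict (\<lambda>x. 0) (carrier \<Lambda>)} \<Longrightarrow>
      (\<Sum>\<xi>\<in>Y. exp (- t * dual_norm_sq \<Lambda> h \<xi>)) \<le>
      3 ^ (rank (carrier \<Lambda>) * field_degree TYPE('f)) * exp (- t * l) * (t / (t - 1 / 2))"
    and "dual_norm_sq \<Lambda> h (restrict (\<lambda>x. 0) (carrier \<Lambda>)) = 0"
proof -
  let ?D = "dual_lattice \<Lambda>" and ?z = "restrict (\<lambda>x. 0) (carrier \<Lambda>) :: 'm \<Rightarrow> 'f"
  obtain fs where fs: "frame fs" using frame_exists by blast
  note len = frameD(2)[OF fs] and fsM = frameD(4)[OF fs]
  let ?G = "\<lambda>v. posdef_form.dualG (length fs) (carrier (completion_ring v)) (gram v fs)"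
  interpret pf: place_forms "length fs" ?G
    by (rule place_forms.intro) (rule posdef_form.posdef_dual[OF lattice_place.posdef_gram[OF lattice_place fs]])
  define ev where "ev = (\<lambda>(\<xi> :: 'm \<Rightarrow> 'f) i. if i < length fs then \<xi> (fs ! i) else 0)"
  have q: "pf.qform (ev \<xi>) = dual_norm_sq \<Lambda> h \<xi>" if \<xi>: "\<xi> \<in> ?D" for \<xi>
    unfolding pf.qform_def dual_norm_sq_def
  proof (rule sum.cong[OF refl])
    fix v :: "'f place" assume v: "v \<in> infinite_places"
    interpret lattice_place \<Lambda> h v by (rule lattice_place[OF v])
    interpret pd: posdef_form "length fs" Kv "gram v fs" by (rule posdef_gram[OF fs])
    let ?l = "\<lambda>i. sv (ev \<xi> i)"
    have r: "pd.riesz ?l = pd.riesz (\<lambda>i. sv (\<xi> (fs ! i)))" unfolding pd.riesz_def ev_def by (intro ext sum.cong) auto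
    have "pf.pfrm v ?l ?l = (\<Sum>i<length fs. \<Sum>j<length fs. ?l i * cnj (?l j) * pd.dualG i j)"
      by (rule posdef_form.frm_def[OF pd.posdef_dual])
    also have "\<dots> = pd.frm (pd.riesz ?l) (pd.riesz ?l)" by (rule pd.dual_form_eq)
    finally show "local_degree v * Re (pf.pfrm v ?l ?l) = local_degree v * Re (h v (riesz_vector \<Lambda> h v \<xi>) (riesz_vector \<Lambda> h v \<xi>))"
      unfolding r dnorm_frm[OF fs dual_latticeD(1)[OF \<xi>]] by simp
  qed
  have ev0: "\<xi> x = 0" if "of_linear \<Lambda> \<xi>" "ev \<xi> = (\<lambda>i. 0)" "x \<in> carrier \<Lambda>" for \<xi> x
  proof -
    have "\<xi> (fs ! i) = 0" if "i < length fs" for i using fun_cong[OF \<open>ev \<xi> = (\<lambda>i. 0)\<close>, of i] that by (simp add: ev_def)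
    then show ?thesis using functional_crd[OF fs that(3) that(1)] by simp
  qed
  have ev_diff: "ev (\<lambda>x. \<xi> x - \<eta> x) = (\<lambda>i. ev \<xi> i - ev \<eta> i)" for \<xi> \<eta> by (auto simp: ev_def)
  have inj: "inj_on ev ?D"
  proof (rule inj_onI, rule ccontr)
    fix \<xi> \<eta> assume xe: "\<xi> \<in> ?D" "\<eta> \<in> ?D" "ev \<xi> = ev \<eta>" "\<xi> \<noteq> \<eta>"
    obtain x where x: "x \<in> carrier \<Lambda>" "\<xi> x \<noteq> \<eta> x" using dual_nonzero[OF xe(1,2,4)] by blast
    have "\<xi> x - \<eta> x = 0" by (rule ev0[OF dual_diff(1)[OF xe(1,2)] _ x(1)]) (simp add: ev_diff xe(3))
    then show False using x(2) by simp
  qed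
  have evz: "ev ?z = (\<lambda>i. 0)" using fsM by (auto simp: ev_def)
  show "dual_norm_sq \<Lambda> h ?z = 0"
    unfolding q[OF zero_dual, symmetric] evz pf.qform_def
  proof (intro sum.neutral ballI)
    fix v :: "'f place" assume v: "v \<in> infinite_places"
    interpret lattice_place \<Lambda> h v by (rule lattice_place[OF v])
    interpret pd: posdef_form "length fs" Kv "?G v" by (rule pf.forms[OF v])
    show "local_degree v * Re (pd.frm (\<lambda>i. sv 0) (\<lambda>i. sv 0)) = 0" by (simp add: svD(4) pd.frm_left)
  qed
  assume Y: "finite Y" "Y \<subseteq> ?D - {?z}"
  have "(\<Sum>y\<in>ev ` Y. exp (- t * pf.qform y)) \<le> 3 ^ (length fs * field_degree TYPE('f)) * exp (- t * l) * (t / (t - 1 / 2))"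
  proof (rule pf.lattice_sum_bound[of "ev ` ?D"])
    show "(\<lambda>i. x i - y i) \<in> ev ` ?D" if xy: "x \<in> ev ` ?D" "y \<in> ev ` ?D" for x y
    proof -
      obtain \<xi> \<eta> where xe: "\<xi> \<in> ?D" "\<eta> \<in> ?D" "x = ev \<xi>" "y = ev \<eta>" using xy by blast
      have "(\<lambda>i. x i - y i) = ev (restrict (\<lambda>x. \<xi> x - \<eta> x) (carrier \<Lambda>))"
        using fsM by (auto simp: xe ev_def)
      moreover have "restrict (\<lambda>x. \<xi> x - \<eta> x) (carrier \<Lambda>) \<in> ?D" by (rule dual_latticeI[OF dual_diff[OF xe(1,2)]])
      ultimately show ?thesis by blast
    qed
    show "(\<lambda>i. 0) \<in> ev ` ?D" using evz zero_dual by (metis imageI)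
    show "x i = 0" if "x \<in> ev ` ?D" "length fs \<le> i" for x i using that by (auto simp: ev_def)
    show "l \<le> pf.qform x" if x: "x \<in> ev ` ?D" "x \<noteq> (\<lambda>i. 0)" for x
    proof -
      obtain \<xi> where \<xi>: "\<xi> \<in> ?D" "x = ev \<xi>" using x(1) by blast
      then obtain i where "i < length fs" "\<xi> (fs ! i) \<noteq> 0" using x(2) by (auto simp: ev_def fun_eq_iff split: if_splits)
      then have "\<exists>x\<in>carrier \<Lambda>. \<xi> x \<noteq> 0" using fsM by blast
      then show ?thesis using min[OF \<xi>(1)] q[OF \<xi>(1)] \<xi>(2) by simp
    qed
    show "real (length fs * field_degree TYPE('f)) \<le> l" using l(2) len by simp
    show "(\<lambda>i. 0) \<notin> ev ` Y"
    proof
      assume "(\<lambda>i. 0) \<in> ev ` Y"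
      then obtain y where y: "y \<in> Y" "ev y = ev ?z" using evz by auto
      then have "y = ?z" using inj_onD[OF inj, OF y(2)] Y(2) zero_dual by blast
      then show False using y(1) Y(2) by blast
    qed
  qed (use l t Y in auto)
  moreover have "(\<Sum>y\<in>ev ` Y. exp (- t * pf.qform y)) = (\<Sum>\<xi>\<in>Y. exp (- t * pf.qform (ev \<xi>)))"
    by (rule sum.reindex_cong[OF inj_on_subset[OF inj]]) (use Y(2) in auto)
  moreover have "\<dots> = (\<Sum>\<xi>\<in>Y. exp (- t * dual_norm_sq \<Lambda> h \<xi>))" using Y(2) by (intro sum.cong) (auto simp: q)
  ultimately show "(\<Sum>\<xi>\<in>Y. exp (- t * dual_norm_sq \<Lambda> h \<xi>)) \<le>
      3 ^ (rank (carrier \<Lambda>) * field_degree TYPE('f)) * exp (- t * l) * (t / (t - 1 / 2))"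
    by (simp add: len)
qed

end

section \<open>Parseval's inequality by averaging over translations\<close>

text \<open>Averaging a function over the \<open>2\<^sup>m\<close> products of subfamilies of \<open>gs\<close>. Every character \<open>\<chi>\<close> is
  multiplied by \<open>\<Prod>\<^sub>g (1 + \<chi>(g))/2\<close>, which vanishes when \<open>\<chi>(g) = -1\<close> for some \<open>g\<close>. This gives the
  orthogonality of characters without using that they are measurable.\<close>

primrec avg :: "'g monoid \<Rightarrow> 'g list \<Rightarrow> ('g \<Rightarrow> 'b::real_vector) \<Rightarrow> 'g \<Rightarrow> 'b" where
  "avg G [] u Z = u Z"
| "avg G (g # gs) u Z = avg G gs (\<lambda>Z. (1 / 2) *\<^sub>R (u Z + u (g \<otimes>\<^bsub>G\<^esub> Z))) Z"

lemma avg_sum: "avg G gs (\<lambda>Z. \<Sum>i\<in>A. u i Z) Z = (\<Sum>i\<in>A. avg G gs (u i) Z)"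
proof (induction gs arbitrary: u)
  case (Cons g gs)
  have "(\<lambda>Z. (1 / 2) *\<^sub>R ((\<Sum>i\<in>A. u i Z) + (\<Sum>i\<in>A. u i (g \<otimes>\<^bsub>G\<^esub> Z)))) =
      (\<lambda>Z. \<Sum>i\<in>A. (1 / 2) *\<^sub>R (u i Z + u i (g \<otimes>\<^bsub>G\<^esub> Z)))"
    by (simp add: sum.distrib[symmetric] scaleR_sum_right)
  then show ?case by (simp only: avg.simps Cons.IH)
qed simp

lemma avg_add: "avg G gs (\<lambda>Z. u Z + w Z) Z = avg G gs u Z + avg G gs w Z"
proof (induction gs arbitrary: u w)
  case (Cons g gs)
  have "(\<lambda>Z. (1 / 2) *\<^sub>R (u Z + w Z + (u (g \<otimes>\<^bsub>G\<^esub> Z) + w (g \<otimes>\<^bsub>G\<^esub> Z)))) =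
      (\<lambda>Z. (1 / 2) *\<^sub>R (u Z + u (g \<otimes>\<^bsub>G\<^esub> Z)) + (1 / 2) *\<^sub>R (w Z + w (g \<otimes>\<^bsub>G\<^esub> Z)))"
    by (simp add: algebra_simps)
  then show ?case by (simp add: Cons.IH)
qed simp

lemma avg_const: "avg G gs (\<lambda>Z. k) Z = k"
  by (induction gs) (simp_all flip: scaleR_2)

lemma avg_Re: "Re (avg G gs u Z) = avg G gs (\<lambda>Z. Re (u Z)) Z"
  by (induction gs arbitrary: u) simp_all

lemma avg_mono:
  fixes u w :: "'g \<Rightarrow> real"
  assumes G: "group G"
  shows "set gs \<subseteq> carrier G \<Longrightarrow> (\<And>Z. Z \<in> carrier G \<Longrightarrow> u Z \<le> w Z) \<Longrightarrow> Z \<in> carrier G \<Longrightarrow>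
    avg G gs u Z \<le> avg G gs w Z"
proof (induction gs arbitrary: u w)
  case (Cons g gs)
  interpret group G by (rule G)
  have "(1 / 2) *\<^sub>R (u Z + u (g \<otimes>\<^bsub>G\<^esub> Z)) \<le> (1 / 2) *\<^sub>R (w Z + w (g \<otimes>\<^bsub>G\<^esub> Z))" if "Z \<in> carrier G" for Z
    using Cons.prems(2)[OF that] Cons.prems(2)[of "g \<otimes>\<^bsub>G\<^esub> Z"] Cons.prems(1) that by simp
  from Cons.IH[OF _ this Cons.prems(3)] Cons.prems(1) show ?case by simp
qed simp

lemma avg_cong:
  assumes G: "group G"
  shows "set gs \<subseteq> carrier G \<Longrightarrow> (\<And>Z. Z \<in> carrier G \<Longrightarrow> u Z = w Z) \<Longrightarrow> Z \<in> carrier G \<Longrightarrow>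
    avg G gs u Z = avg G gs w Z"
proof (induction gs arbitrary: u w)
  case (Cons g gs)
  interpret group G by (rule G)
  have "(1 / 2) *\<^sub>R (u Z + u (g \<otimes>\<^bsub>G\<^esub> Z)) = (1 / 2) *\<^sub>R (w Z + w (g \<otimes>\<^bsub>G\<^esub> Z))" if "Z \<in> carrier G" for Z
    using Cons.prems(2)[OF that] Cons.prems(2)[of "g \<otimes>\<^bsub>G\<^esub> Z"] Cons.prems(1) that by simp
  from Cons.IH[OF _ this Cons.prems(3)] Cons.prems(1) show ?case by simp
qed simp

lemma avg_character:
  fixes e :: "'g \<Rightarrow> complex"
  assumes G: "group G" and gs: "set gs \<subseteq> carrier G" and Z: "Z \<in> carrier G"
    and hom: "\<And>g Z. g \<in> carrier G \<Longrightarrow> Z \<in> carrier G \<Longrightarrow> e (g \<otimes>\<^bsub>G\<^esub> Z) = e g * e Z"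
  shows "avg G gs (\<lambda>Z. k * e Z) Z = k * (\<Prod>g\<leftarrow>gs. (1 + e g) / 2) * e Z"
  using gs
proof (induction gs arbitrary: k)
  case (Cons g gs)
  then have g: "g \<in> carrier G" and gs: "set gs \<subseteq> carrier G" by simp_all
  have "avg G (g # gs) (\<lambda>Z. k * e Z) Z = avg G gs (\<lambda>Z. (k * ((1 + e g) / 2)) * e Z) Z"
    unfolding avg.simps
  proof (rule avg_cong[OF G gs _ Z])
    fix Z assume "Z \<in> carrier G"
    then show "(1 / 2) *\<^sub>R (k * e Z + k * e (g \<otimes>\<^bsub>G\<^esub> Z)) = (k * ((1 + e g) / 2)) * e Z"
      by (simp add: hom[OF g] scaleR_conv_of_real distrib_left distrib_right)
  qed
  also have "\<dots> = k * ((1 + e g) / 2) * (\<Prod>g\<leftarrow>gs. (1 + e g) / 2) * e Z" by (rule Cons.IH[OF gs])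
  finally show ?case by (simp add: mult.assoc)
qed simp

text \<open>Translates of measurable sets are measurable: a set of nonzero measure is measurable, and
  null sets are handled through their complement.\<close>

lemma haar_translate:
  assumes G: "group G" and \<mu>: "haar_probability G T \<mu>" and g: "g \<in> carrier G"
  shows "(\<lambda>Z. g \<otimes>\<^bsub>G\<^esub> Z) \<in> measurable \<mu> \<mu>" "distr \<mu> \<mu> (\<lambda>Z. g \<otimes>\<^bsub>G\<^esub> Z) = \<mu>"
proof -
  interpret group G by (rule G)
  have sp: "space \<mu> = carrier G" and one: "emeasure \<mu> (carrier G) = 1"
    and inv: "\<And>g A. g \<in> carrier G \<Longrightarrow> A \<in> sets \<mu> \<Longrightarrow> emeasure \<mu> (g <#\<^bsub>G\<^esub> A) = emeasure \<mu> A"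
    using \<mu> by (auto simp: haar_probability_def)
  have lc: "g <#\<^bsub>G\<^esub> A = (\<lambda>Z. g \<otimes>\<^bsub>G\<^esub> Z) ` A" for g A by (auto simp: l_coset_def)
  have meas: "(\<lambda>Z. g \<otimes>\<^bsub>G\<^esub> Z) ` A \<in> sets \<mu>" if g: "g \<in> carrier G" and A: "A \<in> sets \<mu>" for g A
  proof (cases "emeasure \<mu> A = 0")
    case False
    then have "emeasure \<mu> ((\<lambda>Z. g \<otimes>\<^bsub>G\<^esub> Z) ` A) \<noteq> 0" using inv[OF g A] by (simp add: lc)
    then show ?thesis using emeasure_notin_sets by blast
  next
    case True
    have Ac: "A \<subseteq> carrier G" using sets.sets_into_space[OF A] by (simp add: sp)
    let ?C = "carrier G - A"
    have C: "?C \<in> sets \<mu>" using A sets.compl_sets[OF A] by (simp add: sp)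
    have "emeasure \<mu> ?C = 1" using emeasure_compl[OF A] True one by (simp add: sp)
    then have "emeasure \<mu> ((\<lambda>Z. g \<otimes>\<^bsub>G\<^esub> Z) ` ?C) \<noteq> 0" using inv[OF g C] by (simp add: lc)
    then have "(\<lambda>Z. g \<otimes>\<^bsub>G\<^esub> Z) ` ?C \<in> sets \<mu>" using emeasure_notin_sets by blast
    then have "carrier G - (\<lambda>Z. g \<otimes>\<^bsub>G\<^esub> Z) ` ?C \<in> sets \<mu>" using sets.compl_sets[of "(\<lambda>Z. g \<otimes>\<^bsub>G\<^esub> Z) ` ?C" \<mu>] by (simp add: sp)
    moreover have "carrier G - (\<lambda>Z. g \<otimes>\<^bsub>G\<^esub> Z) ` ?C = (\<lambda>Z. g \<otimes>\<^bsub>G\<^esub> Z) ` A"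
    proof (intro equalityI subsetI)
      fix Z assume Z: "Z \<in> carrier G - (\<lambda>Z. g \<otimes>\<^bsub>G\<^esub> Z) ` ?C"
      have eq: "Z = g \<otimes>\<^bsub>G\<^esub> (inv\<^bsub>G\<^esub> g \<otimes>\<^bsub>G\<^esub> Z)" using Z g by (simp add: m_assoc[symmetric])
      have "inv\<^bsub>G\<^esub> g \<otimes>\<^bsub>G\<^esub> Z \<in> carrier G" using Z g by simp
      then have "inv\<^bsub>G\<^esub> g \<otimes>\<^bsub>G\<^esub> Z \<in> A" using Z eq by blast
      then show "Z \<in> (\<lambda>Z. g \<otimes>\<^bsub>G\<^esub> Z) ` A" using eq by blast
    next
      fix Z assume "Z \<in> (\<lambda>Z. g \<otimes>\<^bsub>G\<^esub> Z) ` A"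
      then show "Z \<in> carrier G - (\<lambda>Z. g \<otimes>\<^bsub>G\<^esub> Z) ` ?C" using Ac g by auto
    qed
    ultimately show ?thesis by simp
  qed
  have pre: "(\<lambda>Z. g \<otimes>\<^bsub>G\<^esub> Z) -` A \<inter> space \<mu> = (\<lambda>Z. inv\<^bsub>G\<^esub> g \<otimes>\<^bsub>G\<^esub> Z) ` A" if A: "A \<in> sets \<mu>" for A
  proof (intro equalityI subsetI)
    fix Z assume Z: "Z \<in> (\<lambda>Z. g \<otimes>\<^bsub>G\<^esub> Z) -` A \<inter> space \<mu>"
    then have "Z = inv\<^bsub>G\<^esub> g \<otimes>\<^bsub>G\<^esub> (g \<otimes>\<^bsub>G\<^esub> Z)" using g by (simp add: m_assoc[symmetric] sp)
    then show "Z \<in> (\<lambda>Z. inv\<^bsub>G\<^esub> g \<otimes>\<^bsub>G\<^esub> Z) ` A" using Z by blast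
  next
    fix Z assume "Z \<in> (\<lambda>Z. inv\<^bsub>G\<^esub> g \<otimes>\<^bsub>G\<^esub> Z) ` A"
    then obtain W where W: "W \<in> A" "Z = inv\<^bsub>G\<^esub> g \<otimes>\<^bsub>G\<^esub> W" by blast
    then have "W \<in> carrier G" using sets.sets_into_space[OF A] by (auto simp: sp)
    then show "Z \<in> (\<lambda>Z. g \<otimes>\<^bsub>G\<^esub> Z) -` A \<inter> space \<mu>" using W g by (simp add: m_assoc[symmetric] sp)
  qed
  show T: "(\<lambda>Z. g \<otimes>\<^bsub>G\<^esub> Z) \<in> measurable \<mu> \<mu>"
    by (rule measurableI) (use g meas pre in \<open>auto simp: sp\<close>)
  show "distr \<mu> \<mu> (\<lambda>Z. g \<otimes>\<^bsub>G\<^esub> Z) = \<mu>"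
  proof (rule measure_eqI)
    fix A assume "A \<in> sets (distr \<mu> \<mu> (\<lambda>Z. g \<otimes>\<^bsub>G\<^esub> Z))"
    then have A: "A \<in> sets \<mu>" by simp
    show "emeasure (distr \<mu> \<mu> (\<lambda>Z. g \<otimes>\<^bsub>G\<^esub> Z)) A = emeasure \<mu> A"
      unfolding emeasure_distr[OF T A] pre[OF A] using inv[OF inv_closed[OF g] A] by (simp add: lc)
  qed simp
qed

text \<open>Each averaging step takes the mean of u and a translate of u, which has the same
  integral by invariance.\<close>

lemma avg_integral:
  fixes u :: "'g \<Rightarrow> real"
  assumes G: "group G" and \<mu>: "haar_probability G T \<mu>"
  shows "set gs \<subseteq> carrier G \<Longrightarrow> integrable \<mu> u \<Longrightarrow>
    integrable \<mu> (avg G gs u) \<and> integral\<^sup>L \<mu> (avg G gs u) = integral\<^sup>L \<mu> u"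
proof (induction gs arbitrary: u)
  case Nil
  have "avg G [] u = u" by (rule ext) simp
  with Nil show ?case by simp
next
  case (Cons g gs)
  then have g: "g \<in> carrier G" by simp
  note tr = haar_translate[OF G \<mu> g]
  have int: "integrable \<mu> (\<lambda>Z. u (g \<otimes>\<^bsub>G\<^esub> Z))"
    using integrable_distr[OF tr(1), of u] Cons.prems(2) tr(2) by simp
  have "integral\<^sup>L \<mu> (\<lambda>Z. u (g \<otimes>\<^bsub>G\<^esub> Z)) = integral\<^sup>L (distr \<mu> \<mu> (\<lambda>Z. g \<otimes>\<^bsub>G\<^esub> Z)) u"
    using Cons.prems(2) by (intro integral_distr[symmetric] tr(1)) auto
  then have eq: "integral\<^sup>L \<mu> (\<lambda>Z. u (g \<otimes>\<^bsub>G\<^esub> Z)) = integral\<^sup>L \<mu> u" by (simp add: tr(2))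
  let ?w = "\<lambda>Z. (1 / 2) *\<^sub>R (u Z + u (g \<otimes>\<^bsub>G\<^esub> Z))"
  have w: "integrable \<mu> ?w" "integral\<^sup>L \<mu> ?w = integral\<^sup>L \<mu> u" using int Cons.prems(2) eq by simp_all
  have "avg G (g # gs) u = avg G gs ?w" by (rule ext) simp
  then show ?case using Cons.IH[of ?w] Cons.prems(1) w by simp
qed

text \<open>Truncate the series F to a finite sum P with a small tail, so that |F|^2 \<le> |P|^2 +
  \<delta> at every point. Averaging leaves only the diagonal terms of |P|^2, so the average of
  |F|^2 is at most b + \<delta> everywhere, and it has the same integral as |F|^2.\<close>

lemma parseval_bound:
  fixes e :: "'x \<Rightarrow> 'g \<Rightarrow> complex"
  assumes G: "group G" and \<mu>: "haar_probability G T \<mu>"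
    and hom: "\<And>\<xi> g Z. \<xi> \<in> D \<Longrightarrow> g \<in> carrier G \<Longrightarrow> Z \<in> carrier G \<Longrightarrow> e \<xi> (g \<otimes>\<^bsub>G\<^esub> Z) = e \<xi> g * e \<xi> Z"
    and unit: "\<And>\<xi> Z. \<xi> \<in> D \<Longrightarrow> Z \<in> carrier G \<Longrightarrow> cmod (e \<xi> Z) = 1"
    and sep: "\<And>\<xi> \<eta>. \<xi> \<in> D \<Longrightarrow> \<eta> \<in> D \<Longrightarrow> \<xi> \<noteq> \<eta> \<Longrightarrow> \<exists>g\<in>carrier G. e \<xi> g * cnj (e \<eta> g) = -1"
    and c: "\<And>\<xi>. \<xi> \<in> D \<Longrightarrow> c \<xi> \<ge> 0" "c summable_on D"
    and b: "\<And>Y. finite Y \<Longrightarrow> Y \<subseteq> D \<Longrightarrow> (\<Sum>\<xi>\<in>Y. (c \<xi>)\<^sup>2) \<le> b"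
  shows "(LINT Z|\<mu>. (cmod (\<Sum>\<^sub>\<infinity>\<xi>\<in>D. e \<xi> Z * of_real (c \<xi>)))\<^sup>2) \<le> b"
proof (rule field_le_epsilon)
  let ?F = "\<lambda>Z. \<Sum>\<^sub>\<infinity>\<xi>\<in>D. e \<xi> Z * of_real (c \<xi>)" and ?C = "infsum c D"
  fix \<delta> :: real assume \<delta>: "\<delta> > 0"
  have b0: "b \<ge> 0" using b[of "{}"] by simp
  have C0: "?C \<ge> 0" using c(1) by (rule infsum_nonneg)
  \<comment> \<open>Chosen so that (|P| + \<epsilon>)^2 - |P|^2 \<le> \<delta>, given |P| \<le>
    \<open>?C\<close> and \<epsilon> \<le> 1.\<close>
  define \<epsilon> where "\<epsilon> = min 1 (\<delta> / (2 * ?C + 1))"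
  have \<epsilon>: "\<epsilon> > 0" "\<epsilon> \<le> 1" "\<epsilon> * (2 * ?C + 1) \<le> \<delta>" 
  proof -
    have p: "2 * ?C + 1 > 0" using C0 by simp
    show "\<epsilon> > 0" "\<epsilon> \<le> 1" using \<delta> p by (simp_all add: \<epsilon>_def)
    have "\<epsilon> \<le> \<delta> / (2 * ?C + 1)" by (simp add: \<epsilon>_def)
    then show "\<epsilon> * (2 * ?C + 1) \<le> \<delta>" using p by (simp add: pos_le_divide_eq)
  qed
  obtain Y where Y: "finite Y" "Y \<subseteq> D" "dist (sum c Y) ?C \<le> \<epsilon>" using infsum_finite_approximation[OF c(2) \<epsilon>(1)] by blast
  let ?P = "\<lambda>Z. \<Sum>\<xi>\<in>Y. e \<xi> Z * of_real (c \<xi>)"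
  have sD: "c summable_on (D - Y)" by (rule summable_on_subset_banach[OF c(2)]) blast
  have tail: "infsum c (D - Y) \<le> \<epsilon>"
    using infsum_Diff[OF c(2) _ Y(2)] Y(1,3) by (simp add: dist_real_def abs_le_iff)
  have norms: "norm (e \<xi> Z * of_real (c \<xi>)) = c \<xi>" if "Z \<in> carrier G" "\<xi> \<in> D" for Z \<xi>
    using unit[OF that(2,1)] c(1)[OF that(2)] by (simp add: norm_mult)
  have close: "cmod (?F Z) \<le> cmod (?P Z) + \<epsilon>" if Z: "Z \<in> carrier G" for Z
  proof -
    have abs: "(\<lambda>\<xi>. norm (e \<xi> Z * of_real (c \<xi>))) summable_on A" if "A \<subseteq> D" for A
      using summable_on_subset_banach[OF c(2) that] by (rule summable_on_cong[THEN iffD1, rotated]) (use norms[OF Z] that in auto)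
    have sm: "(\<lambda>\<xi>. e \<xi> Z * of_real (c \<xi>)) summable_on A" if "A \<subseteq> D" for A by (rule abs_summable_summable[OF abs[OF that]])
    have "?F Z = infsum (\<lambda>\<xi>. e \<xi> Z * of_real (c \<xi>)) (D - Y) + ?P Z"
      using infsum_Diff[OF sm[OF subset_refl] sm[OF Y(2)] Y(2)] Y(1) by (simp add: algebra_simps)
    moreover have "cmod (infsum (\<lambda>\<xi>. e \<xi> Z * of_real (c \<xi>)) (D - Y)) \<le> \<epsilon>"
    proof -
      have "cmod (infsum (\<lambda>\<xi>. e \<xi> Z * of_real (c \<xi>)) (D - Y)) \<le> infsum (\<lambda>\<xi>. norm (e \<xi> Z * of_real (c \<xi>))) (D - Y)"
        by (rule norm_infsum_bound[OF abs]) blast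
      also have "\<dots> = infsum c (D - Y)" by (rule infsum_cong) (use norms[OF Z] in auto)
      finally show ?thesis using tail by simp
    qed
    ultimately show ?thesis using norm_triangle_ineq[of "infsum (\<lambda>\<xi>. e \<xi> Z * of_real (c \<xi>)) (D - Y)" "?P Z"] by simp
  qed
  have PC: "cmod (?P Z) \<le> ?C" if Z: "Z \<in> carrier G" for Z
  proof -
    have "cmod (?P Z) \<le> (\<Sum>\<xi>\<in>Y. norm (e \<xi> Z * of_real (c \<xi>)))" by (rule norm_sum)
    also have "\<dots> = sum c Y" using Y(2) norms[OF Z] by (intro sum.cong) auto
    also have "\<dots> \<le> ?C" by (rule finite_sum_le_infsum[OF c(2) Y(1,2)]) (use c(1) in auto)
    finally show ?thesis .
  qed
  have sq: "(cmod (?F Z))\<^sup>2 \<le> (cmod (?P Z))\<^sup>2 + \<delta>" if Z: "Z \<in> carrier G" for Z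
  proof -
    have "(cmod (?F Z))\<^sup>2 \<le> (cmod (?P Z) + \<epsilon>)\<^sup>2" using close[OF Z] by (intro power_mono) auto
    also have "\<dots> = (cmod (?P Z))\<^sup>2 + \<epsilon> * (2 * cmod (?P Z) + \<epsilon>)" by (simp add: power2_eq_square algebra_simps)
    also have "\<dots> \<le> (cmod (?P Z))\<^sup>2 + \<epsilon> * (2 * ?C + 1)"
      using PC[OF Z] \<epsilon> by (intro add_left_mono mult_left_mono) auto
    finally show ?thesis using \<epsilon>(3) by simp
  qed
  have "\<forall>p\<in>{p \<in> Y \<times> Y. fst p \<noteq> snd p}. \<exists>g\<in>carrier G. e (fst p) g * cnj (e (snd p) g) = -1"
    using sep Y(2) by auto
  then obtain w where w: "\<And>p. p \<in> Y \<times> Y \<Longrightarrow> fst p \<noteq> snd p \<Longrightarrow> w p \<in> carrier G \<and> e (fst p) (w p) * cnj (e (snd p) (w p)) = -1"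
    by (metis (mono_tags, lifting) mem_Collect_eq)
  obtain ps where ps: "set ps = {p \<in> Y \<times> Y. fst p \<noteq> snd p}" using finite_list[of "{p \<in> Y \<times> Y. fst p \<noteq> snd p}"] Y(1) by auto
  \<comment> \<open>One separating element for each pair of distinct members of Y: the product
    attached to a cross term of |P|^2 then has a vanishing factor.\<close>
  define gs where "gs = map w ps"
  have gs: "set gs \<subseteq> carrier G" using w ps by (auto simp: gs_def)
  let ?e = "\<lambda>p Z. e (fst p) Z * cnj (e (snd p) Z)" and ?k = "\<lambda>p. of_real (c (fst p) * c (snd p)) :: complex"
  have P2: "(cmod (?P Z))\<^sup>2 = Re (\<Sum>p\<in>Y \<times> Y. ?k p * ?e p Z)" for Z
  proof -
    have "of_real ((cmod (?P Z))\<^sup>2) = ?P Z * cnj (?P Z)" by (rule complex_norm_square)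
    also have "\<dots> = (\<Sum>\<xi>\<in>Y. \<Sum>\<eta>\<in>Y. (e \<xi> Z * of_real (c \<xi>)) * cnj (e \<eta> Z * of_real (c \<eta>)))"
      by (simp add: sum_product)
    also have "\<dots> = (\<Sum>p\<in>Y \<times> Y. ?k p * ?e p Z)" by (simp add: sum.cartesian_product case_prod_unfold mult_ac)
    finally show ?thesis by (metis Re_complex_of_real)
  qed
  have avgP: "avg G gs (\<lambda>Z. (cmod (?P Z))\<^sup>2) Z \<le> b" if Z: "Z \<in> carrier G" for Z
  proof -
    have "avg G gs (\<lambda>Z. (cmod (?P Z))\<^sup>2) Z = Re (\<Sum>p\<in>Y \<times> Y. avg G gs (\<lambda>Z. ?k p * ?e p Z) Z)"
      unfolding P2 avg_Re[symmetric] avg_sum ..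
    also have "(\<Sum>p\<in>Y \<times> Y. avg G gs (\<lambda>Z. ?k p * ?e p Z) Z) = (\<Sum>p\<in>Y \<times> Y. if fst p = snd p then ?k p else 0)"
    proof (rule sum.cong[OF refl])
      fix p assume p: "p \<in> Y \<times> Y"
      then have pD: "fst p \<in> D" "snd p \<in> D" using Y(2) by auto
      have ch: "avg G gs (\<lambda>Z. ?k p * ?e p Z) Z = ?k p * (\<Prod>g\<leftarrow>gs. (1 + ?e p g) / 2) * ?e p Z"
        by (rule avg_character[OF G gs Z]) (simp add: hom pD)
      show "avg G gs (\<lambda>Z. ?k p * ?e p Z) Z = (if fst p = snd p then ?k p else 0)"
      proof (cases "fst p = snd p")
        case True
        have one: "?e p g = 1" if "g \<in> carrier G" for g
          using complex_norm_square[of "e (snd p) g"] unit[OF pD(2) that] True by simp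
        have "(\<Prod>g\<leftarrow>gs. (1 + ?e p g) / 2) = (\<Prod>g\<leftarrow>gs. 1)"
          by (intro arg_cong[of _ _ prod_list] map_cong refl) (use gs one in auto)
        then show ?thesis unfolding ch using one[OF Z] True by (simp add: prod_list_replicate map_replicate_const)
      next
        case False
        then have m: "w p \<in> set gs" using p ps by (auto simp: gs_def)
        have "0 = (1 + ?e p (w p)) / 2" using w[OF p False] by simp
        then have "0 \<in> (\<lambda>g. (1 + ?e p g) / 2) ` set gs" using m by (rule image_eqI)
        then have "(\<Prod>g\<leftarrow>gs. (1 + ?e p g) / 2) = 0" by (simp only: prod_list_zero_iff set_map)
        then show ?thesis unfolding ch using False by simp
      qed
    qed
    also have "\<dots> = (\<Sum>\<xi>\<in>Y. \<Sum>\<eta>\<in>Y. if \<xi> = \<eta> then of_real (c \<xi> * c \<eta>) else 0)"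
      by (simp add: sum.cartesian_product case_prod_unfold)
    also have "\<dots> = (\<Sum>\<xi>\<in>Y. of_real ((c \<xi>)\<^sup>2))"
      by (intro sum.cong refl) (use Y(1) in \<open>simp add: power2_eq_square\<close>)
    also have "Re \<dots> = (\<Sum>\<xi>\<in>Y. (c \<xi>)\<^sup>2)" by (simp add: power2_eq_square)
    also have "\<dots> \<le> b" by (rule b[OF Y(1,2)])
    finally show ?thesis .
  qed
  let ?I = "LINT Z|\<mu>. (cmod (?F Z))\<^sup>2"
  show "?I \<le> b + \<delta>"
  proof (cases "integrable \<mu> (\<lambda>Z. (cmod (?F Z))\<^sup>2)")
    \<comment> \<open>Measurability of the series is not established; the integral of a function
      that is not integrable is 0, which is below the bound.\<close>
    case False
    then show ?thesis using b0 \<delta> by (simp add: not_integrable_integral_eq)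
  next
    case True
    have sp: "space \<mu> = carrier G" "emeasure \<mu> (space \<mu>) = 1" using \<mu> by (auto simp: haar_probability_def)
    interpret finite_measure \<mu> by (rule finite_measureI) (simp add: sp(2))
    note av = avg_integral[OF G \<mu> gs True]
    have "?I = integral\<^sup>L \<mu> (avg G gs (\<lambda>Z. (cmod (?F Z))\<^sup>2))" using av by simp
    also have "\<dots> \<le> (LINT Z|\<mu>. b + \<delta>)"
    proof (rule integral_mono)
      fix Z assume "Z \<in> space \<mu>"
      then have Z: "Z \<in> carrier G" by (simp add: sp)
      have "avg G gs (\<lambda>Z. (cmod (?F Z))\<^sup>2) Z \<le> avg G gs (\<lambda>Z. (cmod (?P Z))\<^sup>2 + \<delta>) Z"
        by (rule avg_mono[OF G gs sq Z])
      also have "\<dots> = avg G gs (\<lambda>Z. (cmod (?P Z))\<^sup>2) Z + \<delta>" by (simp add: avg_add avg_const)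
      finally show "avg G gs (\<lambda>Z. (cmod (?F Z))\<^sup>2) Z \<le> b + \<delta>" using avgP[OF Z] by simp
    qed (use av in auto)
    also have "\<dots> = b + \<delta>" using sp(2) by (simp add: measure_def)
    finally show ?thesis .
  qed
qed

section \<open>The quotient of the real space by the lattice\<close>

context lattice_place
begin

lemma ext_add:
  assumes "of_linear \<Lambda> \<xi>" "u \<in> carrier bc.B" "w \<in> carrier bc.B"
  shows "bc.ext \<xi> (u \<oplus>\<^bsub>bc.B\<^esub> w) = bc.ext \<xi> u + bc.ext \<xi> w"
proof -
  obtain s t where "s \<in> bc.T" "t \<in> bc.T" "u = bc.cls s" "w = bc.cls t" using assms by (auto simp: bc.carrier_B)
  then show ?thesis by (simp add: bc.add_B bc.ext_cls[OF assms(1)] bc.efun_simps)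
qed

lemma tau_add: "x \<in> carrier \<Lambda> \<Longrightarrow> y \<in> carrier \<Lambda> \<Longrightarrow>
    to_place_fibre \<Lambda> v (x \<oplus>\<^bsub>\<Lambda>\<^esub> y) = to_place_fibre \<Lambda> v x \<oplus>\<^bsub>bc.B\<^esub> to_place_fibre \<Lambda> v y"
  using bc.cls_rel(1)[of x y 1] bc.K(2) by (simp add: tau bc.add_B bc.T_closed)

lemma extend_pure:
  "of_linear \<Lambda> \<xi> \<Longrightarrow> extend_functional v \<xi> (bc.cls (frag_of (x, a))) = sv (\<xi> x) * a"
  by (simp add: extend_functional_ext bc.ext_cls bc.efun_simps)

end

context hermitian_lattice
begin

lemma comm_group_fibre: "v \<in> infinite_places \<Longrightarrow> comm_group (add_monoid (place_fibre \<Lambda> v))"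
proof -
  assume v: "v \<in> infinite_places"
  interpret lattice_place \<Lambda> h v by (rule lattice_place[OF v])
  show ?thesis unfolding B by (rule abelian_group.a_comm_group[OF bc.abelian_group_B])
qed

lemma carrier_space: "carrier (lattice_space \<Lambda>) = (\<Pi>\<^sub>E v\<in>infinite_places. carrier (place_fibre \<Lambda> v))"
  by (simp add: lattice_space_def)

lemma mult_space: "x \<otimes>\<^bsub>lattice_space \<Lambda>\<^esub> y = (\<lambda>v\<in>infinite_places. x v \<oplus>\<^bsub>place_fibre \<Lambda> v\<^esub> y v)"
  by (simp add: lattice_space_def)

lemma comm_group_space: "comm_group (lattice_space \<Lambda>)"
proof (rule group.group_comm_groupI)
  show "group (lattice_space \<Lambda>)"
    unfolding lattice_space_def by (rule product_group) (rule comm_group.axioms(2)[OF comm_group_fibre])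
  fix x y assume xy: "x \<in> carrier (lattice_space \<Lambda>)" "y \<in> carrier (lattice_space \<Lambda>)"
  have "x v \<oplus>\<^bsub>place_fibre \<Lambda> v\<^esub> y v = y v \<oplus>\<^bsub>place_fibre \<Lambda> v\<^esub> x v" if v: "v \<in> infinite_places" for v
  proof -
    interpret G: comm_group "add_monoid (place_fibre \<Lambda> v)" by (rule comm_group_fibre[OF v])
    show ?thesis using G.m_comm[of "x v" "y v"] xy v by (auto simp: carrier_space)
  qed
  then show "x \<otimes>\<^bsub>lattice_space \<Lambda>\<^esub> y = y \<otimes>\<^bsub>lattice_space \<Lambda>\<^esub> x"
    unfolding mult_space by (intro restrict_ext) auto
qed

abbreviation Gam :: "('f place \<Rightarrow> ('m, complex) tensor) set" where
  "Gam \<equiv> to_lattice_space \<Lambda> ` carrier \<Lambda>"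

lemma tau_space: "x \<in> carrier \<Lambda> \<Longrightarrow> to_lattice_space \<Lambda> x \<in> carrier (lattice_space \<Lambda>)"
proof -
  assume x: "x \<in> carrier \<Lambda>"
  have "to_place_fibre \<Lambda> v x \<in> carrier (place_fibre \<Lambda> v)" if v: "v \<in> infinite_places" for v
  proof -
    interpret lattice_place \<Lambda> h v by (rule lattice_place[OF v])
    show ?thesis unfolding B tau by (rule cls_mem[OF x bc.K(2)])
  qed
  then show ?thesis by (simp add: carrier_space to_lattice_space_def)
qed

lemma Gam_subgroup: "subgroup Gam (lattice_space \<Lambda>)"
proof -
  have "to_lattice_space \<Lambda> \<in> hom (add_monoid \<Lambda>) (lattice_space \<Lambda>)"
  proof (rule homI)
    show "to_lattice_space \<Lambda> x \<in> carrier (lattice_space \<Lambda>)" if "x \<in> carrier (add_monoid \<Lambda>)" for x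
      using that tau_space by simp
    fix x y assume "x \<in> carrier (add_monoid \<Lambda>)" "y \<in> carrier (add_monoid \<Lambda>)"
    then have xy: "x \<in> carrier \<Lambda>" "y \<in> carrier \<Lambda>" by simp_all
    have "to_place_fibre \<Lambda> v (x \<oplus>\<^bsub>\<Lambda>\<^esub> y) = to_place_fibre \<Lambda> v x \<oplus>\<^bsub>place_fibre \<Lambda> v\<^esub> to_place_fibre \<Lambda> v y"
      if v: "v \<in> infinite_places" for v
    proof -
      interpret lattice_place \<Lambda> h v by (rule lattice_place[OF v])
      show ?thesis unfolding B by (rule tau_add[OF xy])
    qed
    then show "to_lattice_space \<Lambda> (x \<otimes>\<^bsub>add_monoid \<Lambda>\<^esub> y) =
        to_lattice_space \<Lambda> x \<otimes>\<^bsub>lattice_space \<Lambda>\<^esub> to_lattice_space \<Lambda> y"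
      unfolding mult_space to_lattice_space_def by (auto intro!: restrict_ext)
  qed
  then have "group_hom (add_monoid \<Lambda>) (lattice_space \<Lambda>) (to_lattice_space \<Lambda>)"
    using comm_group.axioms(2)[OF a_comm_group] comm_group.axioms(2)[OF comm_group_space]
    by (simp add: group_hom_def group_hom_axioms_def)
  from group_hom.img_is_subgroup[OF this] show ?thesis by simp
qed

lemma Gam_normal: "Gam \<lhd> lattice_space \<Lambda>"
  by (rule comm_group.subgroup_imp_normal[OF comm_group_space Gam_subgroup])

lemma group_quotient: "group (quotient_space \<Lambda>)"
  unfolding quotient_space_def by (rule normal.factorgroup_is_group[OF Gam_normal])

lemma carrier_quotient:
  "carrier (quotient_space \<Lambda>) = (\<lambda>w. Gam #>\<^bsub>lattice_space \<Lambda>\<^esub> w) ` carrier (lattice_space \<Lambda>)"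
  by (auto simp: quotient_space_def FactGroup_def RCOSETS_def)

lemma mult_quotient:
  "x \<in> carrier (lattice_space \<Lambda>) \<Longrightarrow> y \<in> carrier (lattice_space \<Lambda>) \<Longrightarrow>
    (Gam #>\<^bsub>lattice_space \<Lambda>\<^esub> x) \<otimes>\<^bsub>quotient_space \<Lambda>\<^esub> (Gam #>\<^bsub>lattice_space \<Lambda>\<^esub> y) =
    Gam #>\<^bsub>lattice_space \<Lambda>\<^esub> (x \<otimes>\<^bsub>lattice_space \<Lambda>\<^esub> y)"
  using normal.rcos_sum[OF Gam_normal] by (simp add: quotient_space_def FactGroup_def)

text \<open>The exponent of \<open>pairing\<close> without the factor 2 \<pi> i, as a function on V
  rather than on cosets.\<close>

definition phase :: "('m \<Rightarrow> 'f) \<Rightarrow> ('f place \<Rightarrow> ('m, complex) tensor) \<Rightarrow> real" where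
  "phase \<xi> z = (\<Sum>v\<in>infinite_places. local_trace v (extend_functional v \<xi> (z v)))"

lemma local_trace_add: "local_trace v (a + b) = local_trace v a + local_trace v b"
  by (simp add: local_trace_def)

lemma phase_add:
  assumes \<xi>: "of_linear \<Lambda> \<xi>" and xy: "x \<in> carrier (lattice_space \<Lambda>)" "y \<in> carrier (lattice_space \<Lambda>)"
  shows "phase \<xi> (x \<otimes>\<^bsub>lattice_space \<Lambda>\<^esub> y) = phase \<xi> x + phase \<xi> y"
  unfolding phase_def sum.distrib[symmetric]
proof (rule sum.cong[OF refl])
  fix v :: "'f place" assume v: "v \<in> infinite_places"
  interpret lattice_place \<Lambda> h v by (rule lattice_place[OF v])
  have "x v \<in> carrier bc.B" "y v \<in> carrier bc.B" using xy v unfolding carrier_space B[symmetric] by auto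
  then show "local_trace v (extend_functional v \<xi> ((x \<otimes>\<^bsub>lattice_space \<Lambda>\<^esub> y) v)) =
      local_trace v (extend_functional v \<xi> (x v)) + local_trace v (extend_functional v \<xi> (y v))"
    using v by (simp add: mult_space B extend_functional_ext ext_add[OF \<xi>] local_trace_add)
qed

text \<open>On lattice vectors the phase is the trace of \<xi> x, an integer because \<xi> x lies in
  \<omega>. Hence \<open>pairing\<close> does not depend on the representative chosen in a
  coset.\<close>

lemma phase_lattice:
  assumes \<xi>: "\<xi> \<in> dual_lattice \<Lambda>" and x: "x \<in> carrier \<Lambda>"
  shows "phase \<xi> (to_lattice_space \<Lambda> x) \<in> \<int>"
proof -
  have "phase \<xi> (to_lattice_space \<Lambda> x) = (\<Sum>v\<in>infinite_places. local_trace v (place_embedding v (\<xi> x)))"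
    unfolding phase_def
  proof (rule sum.cong[OF refl])
    fix v :: "'f place" assume v: "v \<in> infinite_places"
    interpret lattice_place \<Lambda> h v by (rule lattice_place[OF v])
    show "local_trace v (extend_functional v \<xi> (to_lattice_space \<Lambda> x v)) = local_trace v (sv (\<xi> x))"
      using v by (simp add: to_lattice_space_def tau extend_pure[OF dual_latticeD(1)[OF \<xi>]])
  qed
  also have "\<dots> = real_of_rat (field_trace (\<xi> x))" by (rule sum_local_trace)
  finally have eq: "phase \<xi> (to_lattice_space \<Lambda> x) = real_of_rat (field_trace (\<xi> x))" .
  have "field_trace (\<xi> x * 1) \<in> \<int>"
    using dual_latticeD(2)[OF \<xi>] x int_elems_closed(2) by (auto simp: inverse_different_def carrier_ring_of_integers simp del: mult_1_right)
  then obtain k where "field_trace (\<xi> x) = of_int k" by (auto elim: Ints_cases)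
  then show ?thesis unfolding eq by simp
qed

lemma pairing_coset:
  assumes \<xi>: "\<xi> \<in> dual_lattice \<Lambda>" and w: "w \<in> carrier (lattice_space \<Lambda>)"
  shows "pairing (Gam #>\<^bsub>lattice_space \<Lambda>\<^esub> w) \<xi> = cis (2 * pi * phase \<xi> w)"
proof -
  let ?V = "lattice_space \<Lambda>" and ?z = "SOME z. z \<in> Gam #>\<^bsub>lattice_space \<Lambda>\<^esub> w"
  interpret V: comm_group ?V by (rule comm_group_space)
  have "?z \<in> Gam #>\<^bsub>?V\<^esub> w" by (rule someI[of _ w]) (rule V.rcos_self[OF w Gam_subgroup])
  then obtain x where x: "x \<in> carrier \<Lambda>" "?z = to_lattice_space \<Lambda> x \<otimes>\<^bsub>?V\<^esub> w" by (auto simp: r_coset_def)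
  have "phase \<xi> ?z = phase \<xi> (to_lattice_space \<Lambda> x) + phase \<xi> w"
    unfolding x(2) by (rule phase_add[OF dual_latticeD(1)[OF \<xi>] tau_space[OF x(1)] w])
  then have "cis (2 * pi * phase \<xi> ?z) = cis (2 * pi * phase \<xi> (to_lattice_space \<Lambda> x)) * cis (2 * pi * phase \<xi> w)"
    by (simp add: cis_mult distrib_left)
  also have "cis (2 * pi * phase \<xi> (to_lattice_space \<Lambda> x)) = 1"
    by (rule cis_multiple_2pi[OF phase_lattice[OF \<xi> x(1)]])
  finally have "cis (2 * pi * phase \<xi> ?z) = cis (2 * pi * phase \<xi> w)" by simp
  moreover have "pairing (Gam #>\<^bsub>?V\<^esub> w) \<xi> = cis (2 * pi * phase \<xi> ?z)"
    by (simp add: pairing_def Let_def phase_def cis_conv_exp mult_ac)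
  ultimately show ?thesis by simp
qed

text \<open>The separating point has components \<open>x \<otimes> a\<^sub>v\<close> with \<open>a\<^sub>v = 1 / (2 d \<sigma>\<^sub>v(\<xi>(x) - \<eta>(x)))\<close>, so that the
  two phases differ by \<open>1/2\<close>.\<close>

lemma dual_separates:
  assumes \<xi>: "\<xi> \<in> dual_lattice \<Lambda>" and \<eta>: "\<eta> \<in> dual_lattice \<Lambda>" and ne: "\<xi> \<noteq> \<eta>"
  shows "\<exists>w\<in>carrier (lattice_space \<Lambda>). phase \<xi> w - phase \<eta> w = 1 / 2"
proof -
  obtain x where x: "x \<in> carrier \<Lambda>" "\<xi> x \<noteq> \<eta> x" using dual_nonzero[OF \<xi> \<eta> ne] by blast
  let ?d = "real (field_degree TYPE('f))"
  define a where "a = (\<lambda>v. of_real (1 / (2 * ?d)) / place_embedding v (\<xi> x - \<eta> x))"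
  define w where "w = (\<lambda>v\<in>infinite_places. pure_tensor ring_of_integers (completion_ring v) (place_embedding v) \<Lambda> x (a v))"
  have d: "?d > 0" using field_degree_pos[where 'f='f] by simp
  have wv: "w v \<in> carrier (place_fibre \<Lambda> v) \<and> local_trace v (extend_functional v \<xi> (w v)) =
      local_degree v * (1 / (2 * ?d)) + local_trace v (extend_functional v \<eta> (w v))" if v: "v \<in> infinite_places" for v
  proof -
    interpret lattice_place \<Lambda> h v by (rule lattice_place[OF v])
    have aK: "a v \<in> Kv"
    proof (cases "Kv = \<real>")
      case True
      have "sv (\<xi> x - \<eta> x) \<in> \<real>" using sv_Kv unfolding True .
      then show ?thesis unfolding True a_def by (rule Reals_divide[OF Reals_of_real])
    next
      case False
      with Kv have "Kv = UNIV" by blast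
      then show ?thesis by (simp only: UNIV_I)
    qed
    have w: "w v = bc.cls (frag_of (x, a v))" using v by (simp add: w_def bc.pure_tensor_cls[symmetric] S)
    have "sv (\<xi> x - \<eta> x) \<noteq> 0" using svD(10)[of "\<xi> x - \<eta> x"] x(2) by simp
    then have "(sv (\<xi> x) - sv (\<eta> x)) * a v = of_real (1 / (2 * ?d))" by (simp add: a_def svD(6))
    then have eq: "sv (\<xi> x) * a v = of_real (1 / (2 * ?d)) + sv (\<eta> x) * a v" by (simp add: algebra_simps)
    have real: "local_trace v (of_real r) = local_degree v * r" for r by (simp add: local_trace_def local_degree_def)
    have "local_trace v (extend_functional v \<xi> (w v)) =
        local_degree v * (1 / (2 * ?d)) + local_trace v (extend_functional v \<eta> (w v))"
      unfolding w extend_pure[OF dual_latticeD(1)[OF \<xi>]] extend_pure[OF dual_latticeD(1)[OF \<eta>]] eq local_trace_add real ..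
    then show ?thesis unfolding B w using cls_mem[OF x(1) aK] by simp
  qed
  have mem: "w \<in> carrier (lattice_space \<Lambda>)" unfolding carrier_space
  proof (rule PiE_I)
    show "w v = undefined" if "v \<notin> infinite_places" for v using that by (simp add: w_def)
  qed (use wv in blast)
  have "phase \<xi> w - phase \<eta> w = (\<Sum>v\<in>(infinite_places :: 'f place set). local_degree v * (1 / (2 * ?d)))"
    unfolding phase_def sum_subtractf[symmetric]
  proof (rule sum.cong[OF refl])
    fix v :: "'f place" assume "v \<in> infinite_places"
    from wv[OF this, THEN conjunct2]
    show "local_trace v (extend_functional v \<xi> (w v)) - local_trace v (extend_functional v \<eta> (w v)) =
        local_degree v * (1 / (2 * ?d))" by linarith
  qed
  also have "\<dots> = 1 / 2" unfolding sum_distrib_right[symmetric] sum_local_degree using d by simp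
  finally show ?thesis using mem by blast
qed

text \<open>In \<open>parseval_bound\<close> the characters are the inverse pairings and the
  coefficients are the Gaussian factors, whose squares have exponent pi. The integral is then at
  most \<open>1 + ?B pi\<close>, the 1 being the term of \<xi> = 0.\<close>

lemma h1_bound:
  assumes l: "l > 0" "real (rank (carrier \<Lambda>) * field_degree TYPE('f)) \<le> l"
    and min: "\<And>\<xi>. \<xi> \<in> dual_lattice \<Lambda> \<Longrightarrow> \<exists>x\<in>carrier \<Lambda>. \<xi> x \<noteq> 0 \<Longrightarrow> l \<le> dual_norm_sq \<Lambda> h \<xi>"
    and haar: "haar_probability (quotient_space \<Lambda>) T dz"
  shows "h1 \<Lambda> h dz \<le> 3 ^ (rank (carrier \<Lambda>) * field_degree TYPE('f)) * exp (- pi * l) * (pi / (pi - 1 / 2))"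
proof -
  let ?D = "dual_lattice \<Lambda>" and ?Q = "quotient_space \<Lambda>" and ?z = "restrict (\<lambda>x. 0) (carrier \<Lambda>) :: 'm \<Rightarrow> 'f"
  let ?B = "\<lambda>t. 3 ^ (rank (carrier \<Lambda>) * field_degree TYPE('f)) * exp (- t * l) * (t / (t - 1 / 2))"
  let ?e = "\<lambda>\<xi> Z. inverse (pairing Z \<xi>)" and ?c = "\<lambda>\<xi>. exp (- (pi / 2) * dual_norm_sq \<Lambda> h \<xi>)"
  have z0: "dual_norm_sq \<Lambda> h ?z = 0" by (rule dual_sum_bound(2)[OF l min, of 1]) simp_all
  have sums: "finite Y \<Longrightarrow> Y \<subseteq> ?D \<Longrightarrow> (\<Sum>\<xi>\<in>Y. exp (- t * dual_norm_sq \<Lambda> h \<xi>)) \<le> 1 + ?B t"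
    "(\<lambda>\<xi>. exp (- t * dual_norm_sq \<Lambda> h \<xi>)) summable_on ?D" if t: "t > 1 / 2" for t Y
    by (rule infsum_one_plus_bound(1,2)[of ?D "\<lambda>\<xi>. exp (- t * dual_norm_sq \<Lambda> h \<xi>)" ?z "?B t", OF _ zero_dual _ dual_sum_bound(1)[OF l min t]];
        simp add: z0)+
  have pairing: "?e \<xi> (Gam #>\<^bsub>lattice_space \<Lambda>\<^esub> w) = cis (- (2 * pi * phase \<xi> w))"
    if "\<xi> \<in> ?D" "w \<in> carrier (lattice_space \<Lambda>)" for \<xi> w
    unfolding pairing_coset[OF that] by simp
  let ?I = "LINT Z|dz. (cmod (\<Sum>\<^sub>\<infinity>\<xi>\<in>?D. ?e \<xi> Z * of_real (?c \<xi>)))\<^sup>2"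
  have I: "?I \<le> 1 + ?B pi"
  proof (rule parseval_bound[OF group_quotient haar])
    fix \<xi> g Z assume \<xi>: "\<xi> \<in> ?D" and "g \<in> carrier ?Q" "Z \<in> carrier ?Q"
    then obtain u w where uw: "u \<in> carrier (lattice_space \<Lambda>)" "w \<in> carrier (lattice_space \<Lambda>)"
      "g = Gam #>\<^bsub>lattice_space \<Lambda>\<^esub> u" "Z = Gam #>\<^bsub>lattice_space \<Lambda>\<^esub> w" by (auto simp: carrier_quotient)
    interpret V: comm_group "lattice_space \<Lambda>" by (rule comm_group_space)
    show "?e \<xi> (g \<otimes>\<^bsub>?Q\<^esub> Z) = ?e \<xi> g * ?e \<xi> Z"
      unfolding uw(3,4) mult_quotient[OF uw(1,2)] pairing[OF \<xi> V.m_closed[OF uw(1,2)]] pairing[OF \<xi> uw(1)] pairing[OF \<xi> uw(2)]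
        phase_add[OF dual_latticeD(1)[OF \<xi>] uw(1,2)] by (simp add: cis_mult algebra_simps)
  next
    fix \<xi> Z assume \<xi>: "\<xi> \<in> ?D" and "Z \<in> carrier ?Q"
    then obtain w where w: "w \<in> carrier (lattice_space \<Lambda>)" "Z = Gam #>\<^bsub>lattice_space \<Lambda>\<^esub> w" by (auto simp: carrier_quotient)
    show "cmod (?e \<xi> Z) = 1" unfolding w(2) pairing[OF \<xi> w(1)] by simp
  next
    fix \<xi> \<eta> assume xe: "\<xi> \<in> ?D" "\<eta> \<in> ?D" "\<xi> \<noteq> \<eta>"
    obtain w where w: "w \<in> carrier (lattice_space \<Lambda>)" "phase \<xi> w - phase \<eta> w = 1 / 2" using dual_separates[OF xe] by blast
    let ?g = "Gam #>\<^bsub>lattice_space \<Lambda>\<^esub> w"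
    have "?e \<xi> ?g * cnj (?e \<eta> ?g) = cis (- (2 * pi * (phase \<xi> w - phase \<eta> w)))"
      unfolding pairing[OF xe(1) w(1)] pairing[OF xe(2) w(1)] cis_cnj by (simp add: cis_mult algebra_simps)
    also have "\<dots> = -1" unfolding w(2) by (simp add: complex_eq_iff)
    finally show "\<exists>g\<in>carrier ?Q. ?e \<xi> g * cnj (?e \<eta> g) = -1" using w(1) by (auto simp: carrier_quotient)
  next
    show "?c summable_on ?D" by (rule sums(2)) (use pi_gt3 in simp)
    fix Y assume Y: "finite Y" "Y \<subseteq> ?D"
    have "(\<Sum>\<xi>\<in>Y. (?c \<xi>)\<^sup>2) = (\<Sum>\<xi>\<in>Y. exp (- pi * dual_norm_sq \<Lambda> h \<xi>))"
      by (intro sum.cong refl) (simp add: power2_eq_square flip: exp_add)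
    then show "(\<Sum>\<xi>\<in>Y. (?c \<xi>)\<^sup>2) \<le> 1 + ?B pi" using sums(1)[OF _ Y, of pi] pi_gt3 by simp
  qed simp
  have I0: "?I \<ge> 0" by (rule integral_nonneg_AE) simp
  have B0: "?B pi \<ge> 0" using pi_gt3 by simp
  \<comment> \<open>The integral is known only to be nonnegative, since it would be 0 for a
    non-integrable integrand; the case y = 0 relies on ln 0 = 0.\<close>
  have "ln y \<le> B" if "y \<le> 1 + B" "0 \<le> y" "0 \<le> B" for y B :: real
    using ln_le_minus_one[of y] that by (cases "y = 0") auto
  from this[OF I I0 B0] have "ln ?I \<le> ?B pi" .
  then show ?thesis by (simp add: h1_def)
qed

end

text \<open>The inequality ln y \<le> y - 1 at y = 1/3 gives ln 3 \<ge> 2/3 > 1/2, and at y = 3 it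
  gives ln 3 \<le> 2 < \<pi>; so replacing 1/2 by ln 3 decreases a denominator that stays
  positive.\<close>

lemma bound_constant: "pi / (pi - 1 / 2) \<le> 1 / (1 - ln 3 / pi)"
proof -
  have "ln (1 / 3 :: real) \<le> 1 / 3 - 1" by (rule ln_le_minus_one) simp
  then have l: "ln (3 :: real) \<ge> 1 / 2" by (simp add: ln_div)
  have u: "ln (3 :: real) < pi" using ln_le_minus_one[of "3 :: real"] pi_gt3 by simp
  have "1 / (1 - ln 3 / pi) = pi / (pi - ln 3)" using u by (simp add: field_simps)
  moreover have "pi / (pi - 1 / 2) \<le> pi / (pi - ln 3)" using l u pi_gt3 by (intro divide_left_mono) auto
  ultimately show ?thesis by simp
qed

theorem theorem6:
  fixes \<Lambda> :: "('f::number_field, 'm) module"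
    and h :: "('f, 'm) metrics"
    and n :: nat
  assumes "is_lattice \<Lambda> h"
    and "lattice_rank \<Lambda> (carrier \<Lambda>) = n"
    and "semistable \<Lambda> h"
  shows
    "(let d = real (field_degree TYPE('f));
          \<Delta> = abs_discriminant TYPE('f);
          deg = lattice_degree \<Lambda> h (carrier \<Lambda>)
      in
        (deg \<le> - d * (real n * ln (real n) / 2) \<longrightarrow>
          h0 \<Lambda> h \<le> 3 powr (real n * d) / (1 - ln 3 / pi) *
            exp (- pi * d * exp (- (2 * deg / (real n * d))))) \<and>
        (deg \<ge> d * (real n * ln (real n) / 2) + real n * ln \<Delta> \<longrightarrow>
          (\<forall>dz. haar_probability (quotient_space \<Lambda>) (quotient_topology \<Lambda> h) dz \<longrightarrow>
            h1 \<Lambda> h dz \<le> 3 powr (real n * d) / (1 - ln 3 / pi) *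
              exp (- pi * d * \<Delta> powr (- (2 / d)) * exp (2 * deg / (real n * d))))))"
proof -
  interpret hermitian_lattice \<Lambda> h by (rule hermitian_lattice.intro) fact
  define d where "d = real (field_degree TYPE('f))"
  define D where "D = abs_discriminant TYPE('f)"
  define deg where "deg = lattice_degree \<Lambda> h (carrier \<Lambda>)"
  have d: "d > 0" using field_degree_pos[where 'f='f] by (simp add: d_def)
  have D: "D > 0" unfolding D_def by (rule abs_discriminant_pos)
  have nd: "real (rank (carrier \<Lambda>) * field_degree TYPE('f)) = real n * d" by (simp add: assms(2) d_def)
  have bound: "3 ^ (rank (carrier \<Lambda>) * field_degree TYPE('f)) * exp (- pi * l) * (pi / (pi - 1 / 2)) \<le>
      3 powr (real n * d) / (1 - ln 3 / pi) * exp (- pi * l)" for l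
  proof -
    have "(3 :: real) ^ (rank (carrier \<Lambda>) * field_degree TYPE('f)) = 3 powr (real n * d)"
      unfolding nd[symmetric] by (rule powr_realpow[symmetric]) simp
    then show ?thesis
      using mult_left_mono[OF bound_constant, of "3 powr (real n * d) * exp (- pi * l)"] by (simp add: mult_ac)
  qed
  \<comment> \<open>The hypotheses on the degree amount to ln n \<le> s, where d exp s is the lower
    bound for the squared minimum; so they make that bound at least n d. For n = 0 the claim is 0
    \<le> d exp s.\<close>
  have large: "real n * d \<le> d * exp s" if "n > 0 \<Longrightarrow> ln (real n) \<le> s" for s
  proof (cases "n = 0")
    case False
    then have "real n \<le> exp s" using that ln_le_cancel_iff[of "real n" "exp s"] by simp
    then show ?thesis using d by (simp add: mult.commute)
  qed (use d in simp)
  have i: "h0 \<Lambda> h \<le> 3 powr (real n * d) / (1 - ln 3 / pi) * exp (- pi * d * exp (- (2 * deg / (real n * d))))"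
    if le: "deg \<le> - d * (real n * ln (real n) / 2)"
  proof -
    let ?l = "d * exp (- (2 * deg / (real n * d)))"
    have s: "ln (real n) \<le> - (2 * deg / (real n * d))" if "n > 0" using le that d by (simp add: field_simps)
    have "h0 \<Lambda> h \<le> 3 ^ (rank (carrier \<Lambda>) * field_degree TYPE('f)) * exp (- pi * ?l) * (pi / (pi - 1 / 2))"
    proof (rule h0_bound)
      show "?l \<le> norm_sq h (to_lattice_space \<Lambda> x)" if "x \<in> carrier \<Lambda>" "x \<noteq> \<zero>\<^bsub>\<Lambda>\<^esub>" for x
        using min_norm[OF assms(3) that] by (simp add: deg_def d_def assms(2))
    qed (use d nd large[OF s] in auto)
    also note bound[of ?l]
    finally show ?thesis by (simp add: mult.assoc)
  qed
  have ii: "h1 \<Lambda> h dz \<le> 3 powr (real n * d) / (1 - ln 3 / pi) *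
      exp (- pi * d * D powr (- (2 / d)) * exp (2 * deg / (real n * d)))"
    if ge: "deg \<ge> d * (real n * ln (real n) / 2) + real n * ln D"
      and haar: "haar_probability (quotient_space \<Lambda>) (quotient_topology \<Lambda> h) dz" for dz
  proof -
    \<comment> \<open>Writing the power of \<Delta> as an exponential brings the bound into the form
      d exp s; the term n ln \<Delta> of the hypothesis compensates for - (2/d) ln \<Delta> in
      s.\<close>
    let ?s = "- (2 / d) * ln D + 2 * deg / (real n * d)"
    let ?l = "d * (D powr (- (2 / d)) * exp (2 * deg / (real n * d)))"
    have l: "?l = d * exp ?s" using D by (simp only: exp_add powr_def) simp
    have s: "ln (real n) \<le> ?s" if "n > 0"
    proof -
      have "real n * d * ln (real n) \<le> 2 * deg - 2 * (real n * ln D)" using ge by (simp add: algebra_simps)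
      also have "\<dots> = real n * d * ?s" using that d by (simp add: field_simps)
      finally show ?thesis using that d by simp
    qed
    have "h1 \<Lambda> h dz \<le> 3 ^ (rank (carrier \<Lambda>) * field_degree TYPE('f)) * exp (- pi * ?l) * (pi / (pi - 1 / 2))"
    proof (rule h1_bound[OF _ _ _ haar])
      show "?l \<le> dual_norm_sq \<Lambda> h \<xi>" if xi: "\<xi> \<in> dual_lattice \<Lambda>" "\<exists>x\<in>carrier \<Lambda>. \<xi> x \<noteq> 0" for \<xi>
        using min_dual_norm[OF assms(3) dual_latticeD(1,2)[OF xi(1)]] xi(2) by (auto simp: deg_def d_def D_def assms(2))
      show "?l > 0" using d D by simp
      show "real (rank (carrier \<Lambda>) * field_degree TYPE('f)) \<le> ?l" unfolding l nd by (rule large[OF s])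
    qed
    also note bound[of ?l]
    finally show ?thesis by (simp add: mult.assoc)
  qed
  show ?thesis unfolding Let_def d_def[symmetric] D_def[symmetric] deg_def[symmetric] using i ii by blast
qed

end
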